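(* Let $K, D, F$ be smooth functions of one real variable with $K$ not identically zero, and consider the system for $u=u(t,x)$, $v=v(t,x)$ $$u_t=-[K(u)v_x]_x+[D(u)u_x]_x+F(u),\qquad 0=u_{xx}-v. \qquad ( * )$$ All possible maximal algebras of invariance of system $( * )$ (MAI), for any fixed triplet $(K,D,F)$ for which the MAI is non-trivial, i.e. larger than the algebra $\langle \partial_t,\partial_x\rangle$ (up to equivalent representations generated by transformations of the form $( ** )$ below), are presented in the following list. In every case the second equation of the system is $u_{xx}-v=0$; only the first equation, the restrictions on the parameters, and basic operators of the MAI are given. Write $P_t=\partial_t$, $P_x=\partial_x$, $I=u\partial_u+v\partial_v$, $D_1=4t\partial_t+x\partial_x-2v\partial_v$, $$D_2=2(\gamma-2\mu)t\partial_t+(\gamma-\mu)x\partial_x+2\big(\partial_u-(\gamma-\mu)v\partial_v\big),$$ $$D_3=2(\gamma-2\mu)t\partial_t+(\gamma-\mu)x\partial_x+2\big(u\partial_u+(\mu-\gamma+1)v\partial_v\big).$$ 1. $u_t=-[K(u)v_x]_x$ ($K$ arbitrary): $P_t,\ P_x,\ D_1$. 2. $u_t=-[e^{\gamma u}v_x]_x+d[e^{\mu u}u_x]_x+\lambda e^{(2\mu-\gamma)u}$, with $\gamma^2+\mu^2\neq0$, $d^2+\lambda^2\neq0$: $P_t,\ P_x,\ D_2$. 3. $u_t=-[u^{\gamma}v_x]_x+d[u^{\mu}u_x]_x+\lambda u^{2\mu-\gamma+1}$, with $\gamma^2+\mu^2\neq0$, $d^2+\lambda^2\neq0$: $P_t,\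 P_x,\ D_3$. 4. $u_t=-v_{xx}+d\,u_{xx}+\lambda u\ln u$, with $\lambda\neq0$: $P_t,\ P_x,\ Q_1=e^{\lambda t}(u\partial_u+v\partial_v)$. 5. $u_t=-[e^{\gamma u}v_x]_x$, with $\gamma\neq0$: $P_t,\ P_x,\ D_1$, and $D_2$ with $\mu=\gamma$. 6. $u_t=-[u^{\gamma}v_x]_x$, with $\gamma\neq0$: $P_t,\ P_x,\ D_1$, and $D_3$ with $\mu=\gamma$. 7. $u_t=-v_{xx}+d\,u_{xx}$, with $d\neq0$: $P_t,\ P_x,\ I$, and $X^\infty=P(t,x)\partial_u+P_{xx}(t,x)\partial_v$, where $P$ is an arbitrary solution of $P_t+P_{xxxx}-dP_{xx}=0$. 8. $u_t=-v_{xx}$: $P_t,\ P_x,\ I,\ D_1$, and $X^\infty=P(t,x)\partial_u+P_{xx}(t,x)\partial_v$, where $P$ is an arbitrary solution of $P_t+P_{xxxx}=0$. Here $\gamma,\mu,d,\lambda$ are real constants. Any other system of the form $( * )$ with non-trivial Lie symmetry is reduced to one of those listed in 1--8 by a local substitution of the form $$t\to C_0t+C_1e^{C_2t},\quad x\to C_3x,\quad u\to C_4+C_5t+C_6e^{C_7t}u,\quad v\to C_8+C_9e^{C_{10}t}v, \qquad ( ** )$$ where the constants $C_0,\dots,C_{10}$ are determined by the form of the system in question (some of them necessarily being zero in all particular cases).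
   Context: Subscripts $t,x$ denote partial derivatives. System $( * )$ is the system form, via $v=u_{xx}$, of the fourth-order equation $u_t=-[K(u)u_{xxx}]_x+[D(u)u_x]_x+F(u)$. The maximal algebra of invariance (MAI) of system $( * )$ for a given triplet $(K,D,F)$ is the Lie algebra of all infinitesimal generators of Lie point symmetries $$X=\xi^0(t,x,u,v)\partial_t+\xi^1(t,x,u,v)\partial_x+\eta^1(t,x,u,v)\partial_u+\eta^2(t,x,u,v)\partial_v$$ with smooth coefficients. Here $X$ is a Lie point symmetry generator if its second prolongation $X^{2}$ satisfies $X^2S_1=0$ and $X^2S_2=0$ on the manifold $S_1=S_2=0$, where $S_1=-u_t-[K(u)v_x]_x+[D(u)u_x]_x+F(u)$ and $S_2=u_{xx}-v$ are regarded as functions on the second-order jet space. For every $(K,D,F)$ the MAI contains the two-dimensional algebra with basis $P_t=\partial_t$, $P_x=\partial_x$, called the trivial Lie algebra. A system has non-trivial Lie symmetry if its MAI is strictly larger than this algebra. "Basic operators of MAI" means that the listed operators span the MAI as a real vector space (in cases 7 and 8, together with all operators $X^\infty$, with $P$ ranging over all smooth solutions of the indicated linear equation). The usual convention of group classification is in force: a case containing arbitrary functions or parameters describes generic values of them; those special values for which the system coincides with, or is reducible by a substitution $( ** )$ to, a system of another listed case having a larger algebra (for example $K(u)=e^{\gamma u}$ in case 1, which is case 5) are governed by that other case. Powers $u^{\gamma}$ and $\ln u$ are considered on a domain where they are smooth (e.g. $u>0$). Form $( ** )$ is a form of invertible change of variables between the given system, in variables $(t,x,u,v)$, and the listed system,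 in variables $(t^*,x^*,u^*,v^* )$. The new independent variables are $t^*=C_0t+C_1e^{C_2t}$, $x^*=C_3x$. The dependent variables are related by an expression of the indicated form in either direction (starred in terms of unstarred or unstarred in terms of starred), with coefficients depending on the original $t$. For example, $t^*=\frac{1}{ac}e^{act}$, $x^*=x$, $u^*=(u+b)e^{-at}$ (equivalently $u=-b+e^{at}u^*$), $v^*=ve^{-at}$ with constants $a,b,c$, $ac\neq0$, is of this form. *)

theory Defs
  imports "HOL-Analysis.Analysis"
begin

primrec Ck_on :: "nat \<Rightarrow> 'a::real_normed_vector set \<Rightarrow> ('a \<Rightarrow> 'b::real_normed_vector) \<Rightarrow> bool" where
  "Ck_on 0 U f \<longleftrightarrow> continuous_on U f"
| "Ck_on (Suc k) U f \<longleftrightarrow> (\<forall>x\<in>U. f differentiable (at x)) \<and>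
     (\<forall>w. Ck_on k U (\<lambda>x. frechet_derivative f (at x) w))"

definition smooth_on :: "'a::real_normed_vector set \<Rightarrow> ('a \<Rightarrow> 'b::real_normed_vector) \<Rightarrow> bool" where
  "smooth_on U f \<longleftrightarrow> (\<forall>k. Ck_on k U f)"

definition pd_t :: "(real \<times> real \<Rightarrow> real) \<Rightarrow> real \<times> real \<Rightarrow> real" where
  "pd_t f p = frechet_derivative f (at p) (1, 0)"

definition pd_x :: "(real \<times> real \<Rightarrow> real) \<Rightarrow> real \<times> real \<Rightarrow> real" where
  "pd_x f p = frechet_derivative f (at p) (0, 1)"

text \<open>The coefficient functions live on a nonempty open interval \<open>uvals\<close> of values of \<open>u\<close> (possibly
  all of the real line), so that real powers and logarithms are covered. Their values outside
  \<open>uvals\<close> are irrelevant.\<close>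

record rd_system =
  uvals :: "real set"
  coefK :: "real \<Rightarrow> real"
  coefD :: "real \<Rightarrow> real"
  coefF :: "real \<Rightarrow> real"

definition valid_system :: "rd_system \<Rightarrow> bool" where
  "valid_system S \<longleftrightarrow> open (uvals S) \<and> is_interval (uvals S) \<and> uvals S \<noteq> {} \<and>
     smooth_on (uvals S) (coefK S) \<and> smooth_on (uvals S) (coefD S) \<and> smooth_on (uvals S) (coefF S) \<and>
     (\<exists>u\<in>uvals S. coefK S u \<noteq> 0)"

definition system_holds_at ::
  "rd_system \<Rightarrow> (real \<times> real \<Rightarrow> real) \<Rightarrow> (real \<times> real \<Rightarrow> real) \<Rightarrow> real \<times> real \<Rightarrow> bool" where
  "system_holds_at S u v p \<longleftrightarrow>
     pd_t u p = - pd_x (\<lambda>q. coefK S (u q) * pd_x v q) p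
                + pd_x (\<lambda>q. coefD S (u q) * pd_x u q) p + coefF S (u p) \<and>
     0 = pd_x (pd_x u) p - v p"

text \<open>Coordinates: \<open>(t, x, u, v)\<close>; then \<open>(u\<^sub>t, u\<^sub>x, v\<^sub>t, v\<^sub>x)\<close>;
  then \<open>(u\<^sub>t\<^sub>t, u\<^sub>t\<^sub>x, u\<^sub>x\<^sub>x, v\<^sub>t\<^sub>t, v\<^sub>t\<^sub>x, v\<^sub>x\<^sub>x)\<close>.\<close>

type_synonym jet0 = "real \<times> real \<times> real \<times> real"
type_synonym jet1 = "jet0 \<times> (real \<times> real \<times> real \<times> real)"
type_synonym jet2 = "jet1 \<times> (real \<times> real \<times> real \<times> real \<times> real \<times> real)"

text \<open>A vector field \<open>(\<xi>\<^sup>0, \<xi>\<^sup>1, \<eta>\<^sup>1, \<eta>\<^sup>2)\<close> on the space of \<open>(t, x, u, v)\<close>.\<close>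

type_synonym vfield = "jet0 \<Rightarrow> jet0"

fun Dt0 :: "(jet0 \<Rightarrow> real) \<Rightarrow> jet1 \<Rightarrow> real" where
  "Dt0 f (z, (ut, ux, vt, vx)) = frechet_derivative f (at z) (1, 0, ut, vt)"

fun Dx0 :: "(jet0 \<Rightarrow> real) \<Rightarrow> jet1 \<Rightarrow> real" where
  "Dx0 f (z, (ut, ux, vt, vx)) = frechet_derivative f (at z) (0, 1, ux, vx)"

fun Dt1 :: "(jet1 \<Rightarrow> real) \<Rightarrow> jet2 \<Rightarrow> real" where
  "Dt1 f ((z, (ut, ux, vt, vx)), (utt, utx, uxx, vtt, vtx, vxx)) =
     frechet_derivative f (at (z, (ut, ux, vt, vx))) ((1, 0, ut, vt), (utt, utx, vtt, vtx))"

fun Dx1 :: "(jet1 \<Rightarrow> real) \<Rightarrow> jet2 \<Rightarrow> real" where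
  "Dx1 f ((z, (ut, ux, vt, vx)), (utt, utx, uxx, vtt, vtx, vxx)) =
     frechet_derivative f (at (z, (ut, ux, vt, vx))) ((0, 1, ux, vx), (utx, uxx, vtx, vxx))"

definition xi0 :: "vfield \<Rightarrow> jet0 \<Rightarrow> real" where "xi0 X z = (case X z of (a, b, c, d) \<Rightarrow> a)"
definition xi1 :: "vfield \<Rightarrow> jet0 \<Rightarrow> real" where "xi1 X z = (case X z of (a, b, c, d) \<Rightarrow> b)"
definition eta1 :: "vfield \<Rightarrow> jet0 \<Rightarrow> real" where "eta1 X z = (case X z of (a, b, c, d) \<Rightarrow> c)"
definition eta2 :: "vfield \<Rightarrow> jet0 \<Rightarrow> real" where "eta2 X z = (case X z of (a, b, c, d) \<Rightarrow> d)"

text \<open>First-order prolongation coefficients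
  \<open>\<zeta>\<^sup>w\<^sub>i = D\<^sub>i \<eta> - w\<^sub>t D\<^sub>i \<xi>\<^sup>0 - w\<^sub>x D\<^sub>i \<xi>\<^sup>1\<close>.\<close>

fun zeta_ut :: "vfield \<Rightarrow> jet1 \<Rightarrow> real" where
  "zeta_ut X (z, (ut, ux, vt, vx)) = (let j = (z, (ut, ux, vt, vx)) in
     Dt0 (eta1 X) j - ut * Dt0 (xi0 X) j - ux * Dt0 (xi1 X) j)"

fun zeta_ux :: "vfield \<Rightarrow> jet1 \<Rightarrow> real" where
  "zeta_ux X (z, (ut, ux, vt, vx)) = (let j = (z, (ut, ux, vt, vx)) in
     Dx0 (eta1 X) j - ut * Dx0 (xi0 X) j - ux * Dx0 (xi1 X) j)"

fun zeta_vt :: "vfield \<Rightarrow> jet1 \<Rightarrow> real" where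
  "zeta_vt X (z, (ut, ux, vt, vx)) = (let j = (z, (ut, ux, vt, vx)) in
     Dt0 (eta2 X) j - vt * Dt0 (xi0 X) j - vx * Dt0 (xi1 X) j)"

fun zeta_vx :: "vfield \<Rightarrow> jet1 \<Rightarrow> real" where
  "zeta_vx X (z, (ut, ux, vt, vx)) = (let j = (z, (ut, ux, vt, vx)) in
     Dx0 (eta2 X) j - vt * Dx0 (xi0 X) j - vx * Dx0 (xi1 X) j)"

text \<open>The second prolongation, with second-order coefficients
  \<open>\<zeta>\<^sup>w\<^sub>i\<^sub>j = D\<^sub>j \<zeta>\<^sup>w\<^sub>i - w\<^sub>i\<^sub>t D\<^sub>j \<xi>\<^sup>0 - w\<^sub>i\<^sub>x D\<^sub>j \<xi>\<^sup>1\<close>.\<close>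

fun prolong2 :: "vfield \<Rightarrow> jet2 \<Rightarrow> jet2" where
  "prolong2 X ((z, (ut, ux, vt, vx)), (utt, utx, uxx, vtt, vtx, vxx)) =
    (let j1 = (z, (ut, ux, vt, vx)); j2 = (j1, (utt, utx, uxx, vtt, vtx, vxx)) in
     ((X z, (zeta_ut X j1, zeta_ux X j1, zeta_vt X j1, zeta_vx X j1)),
      (Dt1 (zeta_ut X) j2 - utt * Dt0 (xi0 X) j1 - utx * Dt0 (xi1 X) j1,
       Dx1 (zeta_ut X) j2 - utt * Dx0 (xi0 X) j1 - utx * Dx0 (xi1 X) j1,
       Dx1 (zeta_ux X) j2 - utx * Dx0 (xi0 X) j1 - uxx * Dx0 (xi1 X) j1,
       Dt1 (zeta_vt X) j2 - vtt * Dt0 (xi0 X) j1 - vtx * Dt0 (xi1 X) j1,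
       Dx1 (zeta_vt X) j2 - vtt * Dx0 (xi0 X) j1 - vtx * Dx0 (xi1 X) j1,
       Dx1 (zeta_vx X) j2 - vtx * Dx0 (xi0 X) j1 - vxx * Dx0 (xi1 X) j1)))"

fun S1 :: "rd_system \<Rightarrow> jet2 \<Rightarrow> real" where
  "S1 S (((t, x, u, v), (ut, ux, vt, vx)), (utt, utx, uxx, vtt, vtx, vxx)) =
    (let j = (((t, x, u, v), (ut, ux, vt, vx)), (utt, utx, uxx, vtt, vtx, vxx)) in
     - ut - Dx1 (\<lambda>((t, x, u, v), (ut, ux, vt, vx)). coefK S u * vx) j
          + Dx1 (\<lambda>((t, x, u, v), (ut, ux, vt, vx)). coefD S u * ux) j + coefF S u)"

fun S2 :: "jet2 \<Rightarrow> real" where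
  "S2 (((t, x, u, v), (ut, ux, vt, vx)), (utt, utx, uxx, vtt, vtx, vxx)) = uxx - v"

definition base_dom :: "rd_system \<Rightarrow> jet0 set" where
  "base_dom S = {(t, x, u, v). u \<in> uvals S}"

definition is_symmetry :: "rd_system \<Rightarrow> vfield \<Rightarrow> bool" where
  "is_symmetry S X \<longleftrightarrow> smooth_on (base_dom S) X \<and>
     (\<forall>j. fst (fst j) \<in> base_dom S \<and> S1 S j = 0 \<and> S2 j = 0 \<longrightarrow>
        frechet_derivative (S1 S) (at j) (prolong2 X j) = 0 \<and>
        frechet_derivative S2 (at j) (prolong2 X j) = 0)"

definition MAI :: "rd_system \<Rightarrow> vfield set" where
  "MAI S = {X. is_symmetry S X}"

text \<open>All functions that agree on \<open>U\<close> with a (finite) real linear combination of members of \<open>B\<close>.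
  Membership in \<open>MAI S\<close> likewise only depends on the values on \<open>base_dom S\<close>.\<close>

definition span_on :: "jet0 set \<Rightarrow> vfield set \<Rightarrow> vfield set" where
  "span_on U B = {X. \<exists>A c. finite A \<and> A \<subseteq> B \<and> (\<forall>z\<in>U. X z = (\<Sum>Y\<in>A. c Y *\<^sub>R Y z))}"

definition independent_on :: "jet0 set \<Rightarrow> vfield set \<Rightarrow> bool" where
  "independent_on U A \<longleftrightarrow> (\<forall>c. (\<forall>z\<in>U. (\<Sum>Y\<in>A. c Y *\<^sub>R Y z) = 0) \<longrightarrow> (\<forall>Y\<in>A. c Y = 0))"

text \<open>Dimension of \<open>span_on U B\<close> modulo equality on \<open>U\<close>.\<close>

definition dim_on :: "jet0 set \<Rightarrow> vfield set \<Rightarrow> enat" where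
  "dim_on U B = (SUP A\<in>{A. finite A \<and> A \<subseteq> B \<and> independent_on U A}. enat (card A))"

definition op_Pt :: vfield where "op_Pt = (\<lambda>(t, x, u, v). (1, 0, 0, 0))"
definition op_Px :: vfield where "op_Px = (\<lambda>(t, x, u, v). (0, 1, 0, 0))"
definition op_I :: vfield where "op_I = (\<lambda>(t, x, u, v). (0, 0, u, v))"
definition op_D1 :: vfield where "op_D1 = (\<lambda>(t, x, u, v). (4 * t, x, 0, - 2 * v))"
definition op_D2 :: "real \<Rightarrow> real \<Rightarrow> vfield" where
  "op_D2 \<gamma> \<mu> = (\<lambda>(t, x, u, v).
     (2 * (\<gamma> - 2 * \<mu>) * t, (\<gamma> - \<mu>) * x, 2, - 2 * (\<gamma> - \<mu>) * v))"
definition op_D3 :: "real \<Rightarrow> real \<Rightarrow> vfield" where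
  "op_D3 \<gamma> \<mu> = (\<lambda>(t, x, u, v).
     (2 * (\<gamma> - 2 * \<mu>) * t, (\<gamma> - \<mu>) * x, 2 * u, 2 * (\<mu> - \<gamma> + 1) * v))"
definition op_Q1 :: "real \<Rightarrow> vfield" where
  "op_Q1 l = (\<lambda>(t, x, u, v). (0, 0, exp (l * t) * u, exp (l * t) * v))"
definition op_Xinf :: "(real \<times> real \<Rightarrow> real) \<Rightarrow> vfield" where
  "op_Xinf P = (\<lambda>(t, x, u, v). (0, 0, P (t, x), pd_x (pd_x P) (t, x)))"

definition linear_solutions :: "real \<Rightarrow> (real \<times> real \<Rightarrow> real) set" where
  "linear_solutions d = {P. smooth_on UNIV P \<and>
     (\<forall>p. pd_t P p + pd_x (pd_x (pd_x (pd_x P))) p - d * pd_x (pd_x P) p = 0)}"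

text \<open>Parameters are given in the order \<open>\<gamma>, \<mu>, d, \<lambda>\<close>, as far as they occur.\<close>

datatype listed_case =
    Case1
  | Case2 real real real real
  | Case3 real real real real
  | Case4 real real
  | Case5 real
  | Case6 real
  | Case7 real
  | Case8

fun basic_ops :: "listed_case \<Rightarrow> vfield set" where
  "basic_ops Case1 = {op_Pt, op_Px, op_D1}"
| "basic_ops (Case2 \<gamma> \<mu> d l) = {op_Pt, op_Px, op_D2 \<gamma> \<mu>}"
| "basic_ops (Case3 \<gamma> \<mu> d l) = {op_Pt, op_Px, op_D3 \<gamma> \<mu>}"
| "basic_ops (Case4 d l) = {op_Pt, op_Px, op_Q1 l}"
| "basic_ops (Case5 \<gamma>) = {op_Pt, op_Px, op_D1, op_D2 \<gamma> \<gamma>}"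
| "basic_ops (Case6 \<gamma>) = {op_Pt, op_Px, op_D1, op_D3 \<gamma> \<gamma>}"
| "basic_ops (Case7 d) = {op_Pt, op_Px, op_I} \<union> op_Xinf ` linear_solutions d"
| "basic_ops Case8 = {op_Pt, op_Px, op_I, op_D1} \<union> op_Xinf ` linear_solutions 0"

text \<open>\<open>f u = c u\<^sup>\<gamma>\<close> on \<open>J\<close>: for real exponents on positive values of \<open>u\<close>, for integer exponents on any
  \<open>J\<close>. A negative exponent together with \<open>0 \<in> J\<close> is excluded by the smoothness required in
  \<open>valid_system\<close>. If \<open>c = 0\<close> the term is absent and the exponent places no restriction on \<open>J\<close>.\<close>

definition power_term :: "real set \<Rightarrow> (real \<Rightarrow> real) \<Rightarrow> real \<Rightarrow> real \<Rightarrow> bool" where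
  "power_term J f c \<gamma> \<longleftrightarrow>
     (J \<subseteq> {0<..} \<and> (\<forall>u\<in>J. f u = c * u powr \<gamma>)) \<or>
     (\<exists>n::int. \<gamma> = of_int n \<and> (\<forall>u\<in>J. f u = c * u powi n)) \<or>
     (c = 0 \<and> (\<forall>u\<in>J. f u = 0))"

fun listed_form :: "listed_case \<Rightarrow> rd_system \<Rightarrow> bool" where
  "listed_form Case1 S \<longleftrightarrow> (\<forall>u\<in>uvals S. coefD S u = 0 \<and> coefF S u = 0)"
| "listed_form (Case2 \<gamma> \<mu> d l) S \<longleftrightarrow> \<gamma>\<^sup>2 + \<mu>\<^sup>2 \<noteq> 0 \<and> d\<^sup>2 + l\<^sup>2 \<noteq> 0 \<and>
     (\<forall>u\<in>uvals S. coefK S u = exp (\<gamma> * u) \<and> coefD S u = d * exp (\<mu> * u) \<and>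
        coefF S u = l * exp ((2 * \<mu> - \<gamma>) * u))"
| "listed_form (Case3 \<gamma> \<mu> d l) S \<longleftrightarrow> \<gamma>\<^sup>2 + \<mu>\<^sup>2 \<noteq> 0 \<and> d\<^sup>2 + l\<^sup>2 \<noteq> 0 \<and>
     power_term (uvals S) (coefK S) 1 \<gamma> \<and> power_term (uvals S) (coefD S) d \<mu> \<and>
     power_term (uvals S) (coefF S) l (2 * \<mu> - \<gamma> + 1)"
| "listed_form (Case4 d l) S \<longleftrightarrow> l \<noteq> 0 \<and> uvals S \<subseteq> {0<..} \<and>
     (\<forall>u\<in>uvals S. coefK S u = 1 \<and> coefD S u = d \<and> coefF S u = l * u * ln u)"
| "listed_form (Case5 \<gamma>) S \<longleftrightarrow> \<gamma> \<noteq> 0 \<and>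
     (\<forall>u\<in>uvals S. coefK S u = exp (\<gamma> * u) \<and> coefD S u = 0 \<and> coefF S u = 0)"
| "listed_form (Case6 \<gamma>) S \<longleftrightarrow> \<gamma> \<noteq> 0 \<and> power_term (uvals S) (coefK S) 1 \<gamma> \<and>
     (\<forall>u\<in>uvals S. coefD S u = 0 \<and> coefF S u = 0)"
| "listed_form (Case7 d) S \<longleftrightarrow> d \<noteq> 0 \<and>
     (\<forall>u\<in>uvals S. coefK S u = 1 \<and> coefD S u = d \<and> coefF S u = 0)"
| "listed_form Case8 S \<longleftrightarrow>
     (\<forall>u\<in>uvals S. coefK S u = 1 \<and> coefD S u = 0 \<and> coefF S u = 0)"

definition listed :: "listed_case \<Rightarrow> rd_system \<Rightarrow> bool" where
  "listed k S \<longleftrightarrow> valid_system S \<and> listed_form k S"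

text \<open>The constants \<open>C\<^sub>0, \<dots>, C\<^sub>1\<^sub>0\<close> are the values \<open>C 0, \<dots>, C 10\<close>.
  The flag of \<open>dep_subst\<close> tells whether the expression \<open>p + q t + r exp (s t) \<cdot>\<close> gives the new dependent
  variable in terms of the old one (\<open>True\<close>) or the old one in terms of the new one (\<open>False\<close>); in both
  cases the function maps the old value \<open>w\<close> to the new one, and \<open>t\<close> is the old time.\<close>

definition dep_subst :: "bool \<Rightarrow> real \<Rightarrow> real \<Rightarrow> real \<Rightarrow> real \<Rightarrow> real \<Rightarrow> real \<Rightarrow> real" where
  "dep_subst fwd p q r s t w =
     (if fwd then p + q * t + r * exp (s * t) * w else (w - (p + q * t)) / (r * exp (s * t)))"

definition base_subst :: "(nat \<Rightarrow> real) \<Rightarrow> real \<times> real \<Rightarrow> real \<times> real" where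
  "base_subst C = (\<lambda>(t, x). (C 0 * t + C 1 * exp (C 2 * t), C 3 * x))"

definition subst_map :: "(nat \<Rightarrow> real) \<Rightarrow> bool \<Rightarrow> bool \<Rightarrow> jet0 \<Rightarrow> jet0" where
  "subst_map C du dv = (\<lambda>(t, x, u, v).
     (C 0 * t + C 1 * exp (C 2 * t), C 3 * x,
      dep_subst du (C 4) (C 5) (C 6) (C 7) t u, dep_subst dv (C 8) 0 (C 9) (C 10) t v))"

text \<open>The first conjunct says that the new time has nowhere vanishing derivative with respect to the
  old one. Altogether, \<open>subst_map\<close> is a diffeomorphism onto its image.\<close>

definition invertible_subst :: "(nat \<Rightarrow> real) \<Rightarrow> bool" where
  "invertible_subst C \<longleftrightarrow>
     (\<forall>t. C 0 + C 1 * C 2 * exp (C 2 * t) \<noteq> 0) \<and> C 3 \<noteq> 0 \<and> C 6 \<noteq> 0 \<and> C 9 \<noteq> 0"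

definition graph_point ::
  "(real \<times> real \<Rightarrow> real) \<Rightarrow> (real \<times> real \<Rightarrow> real) \<Rightarrow> real \<times> real \<Rightarrow> jet0" where
  "graph_point u v = (\<lambda>(t, x). (t, x, u (t, x), v (t, x)))"

text \<open>The substitution turns system \<open>S\<close> into system \<open>S'\<close>: whenever it carries the graph of \<open>(u, v)\<close> to
  the graph of \<open>(u', v')\<close>, the equations of \<open>S\<close> for \<open>(u, v)\<close> and those of \<open>S'\<close> for \<open>(u', v')\<close> are
  equivalent at corresponding points. The range of values of \<open>u\<close> of \<open>S\<close> only has to be mapped into
  that of \<open>S'\<close>, because its image may depend on \<open>t\<close>.\<close>

definition reduces_by :: "(nat \<Rightarrow> real) \<Rightarrow> bool \<Rightarrow> bool \<Rightarrow> rd_system \<Rightarrow> rd_system \<Rightarrow> bool" where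
  "reduces_by C du dv S S' \<longleftrightarrow>
     invertible_subst C \<and> subst_map C du dv ` base_dom S \<subseteq> base_dom S' \<and>
     (\<forall>\<Omega> u v u' v'. open \<Omega> \<and> smooth_on \<Omega> u \<and> smooth_on \<Omega> v \<and> u ` \<Omega> \<subseteq> uvals S \<and>
        (\<forall>p\<in>\<Omega>. graph_point u' v' (base_subst C p) = subst_map C du dv (graph_point u v p)) \<longrightarrow>
        (\<forall>p\<in>\<Omega>. system_holds_at S u v p \<longleftrightarrow> system_holds_at S' u' v' (base_subst C p)))"

definition transported :: "(nat \<Rightarrow> real) \<Rightarrow> bool \<Rightarrow> bool \<Rightarrow> rd_system \<Rightarrow> vfield set \<Rightarrow> vfield set" where
  "transported C du dv S A = {X. \<exists>Y\<in>A. \<forall>z\<in>base_dom S.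
     frechet_derivative (subst_map C du dv) (at z) (X z) = Y (subst_map C du dv z)}"

text \<open>The usual convention of group classification: a member of a case is generic unless it coincides
  with, or is reducible to, a listed system with a larger algebra. A coincidence is a reduction by
  the identity. The dimension only depends on the case, so \<open>k'\<close> is automatically another case.\<close>

definition generic_in_case :: "listed_case \<Rightarrow> rd_system \<Rightarrow> bool" where
  "generic_in_case k S \<longleftrightarrow> \<not> (\<exists>k' S' C du dv. listed k' S' \<and> reduces_by C du dv S S' \<and>
     dim_on (base_dom S) (basic_ops k) < dim_on (base_dom S') (basic_ops k'))"

definition nontrivial_symmetry :: "rd_system \<Rightarrow> bool" where
  "nontrivial_symmetry S \<longleftrightarrow> span_on (base_dom S) {op_Pt, op_Px} \<subset> MAI S"

end

theory Submission
  imports Defs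
begin

text \<open>Comparing coefficients of the jet variables shows that a symmetry has the components \<open>a(t)\<close>,
  \<open>p x + q\<close>, \<open>A(t) u + B(t, x)\<close> and \<open>B\<^sub>x\<^sub>x + (A - 2 p) v\<close>, where \<open>K' (A u + B) = K (4 p - a')\<close>,
  \<open>D' (A u + B) = D (2 p - a')\<close> and a third such equation holds for \<open>F\<close>. If \<open>A u + B\<close> is nonzero for
  some \<open>(t, x)\<close>, it is proportional there to \<open>e u + b\<close> with \<open>e = 0\<close>, \<open>b = 1\<close> or \<open>e = 1\<close>, so that \<open>K\<close> and
  \<open>D\<close> solve Euler equations \<open>f' (e u + b) = \<sigma> f\<close> and are exponentials (\<open>e = 0\<close>) or powers (\<open>e = 1\<close>).
  Varying \<open>t\<close> then shows that \<open>F\<close> is of the same type up to a multiple of \<open>e u + b\<close>, which the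
  substitution absorbs, or, for constant \<open>K\<close> and \<open>D\<close>, affine or logarithmic. If \<open>A u + B\<close> vanishes for
  every symmetry, a non-trivial one has \<open>p \<noteq> 0\<close>, which forces \<open>D = F = 0\<close>. Since the symmetries of the
  listed systems are found from the same equations, and the degenerate members of cases 1--3 reduce to
  cases 5--8, whose algebras have dimension at least 4, the generic members have the listed algebras.\<close>

section \<open>Smooth functions\<close>

text \<open>The delicate point is the equality \<open>MAI S = transported ...\<close>. A
  substitution with exponential time reaches only a half-line of new times, and the image of
  \<open>uvals S\<close> moves with the old time, so a symmetry of the given system cannot simply be
  pushed forward to a symmetry of the target. Instead the determining equations are rewritten in the
  new variables but over the old time (\<open>hat_eqs\<close>, on the moving sets
  \<open>Y t\<close>) and are solved there; every solution turns out to come from one that is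
  defined for all new times. Solutions of a linear equation need not extend in this way, so cases 7
  and 8 are reached with proportional time, and so is case 4; exponential time serves to absorb a
  multiple of e u + b in the source of the scaling cases. The second obstacle is an interval
  \<open>uvals S\<close> that contains the singular point - b of an Euler equation: smoothness
  leaves only natural exponents there, and it rules out a logarithmic source.\<close>

lemma Ck_on_cong_aux:
  assumes "open U"
  shows "(\<And>x. x \<in> U \<Longrightarrow> f x = g x) \<Longrightarrow> Ck_on k U f \<Longrightarrow> Ck_on k U g"
proof (induction k arbitrary: f g)
  case 0
  then show ?case using continuous_on_cong by fastforce
next
  case (Suc k)
  have d: "f differentiable at x" if "x \<in> U" for x
    using Suc.prems that by simp
  have eq: "frechet_derivative f (at x) = frechet_derivative g (at x)" if "x \<in> U" for x
    using frechet_derivative_transform_within_open[OF d[OF that] assms that] Suc.prems by blast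
  have "g differentiable at x" if "x \<in> U" for x
    using d[OF that] has_derivative_transform_within_open[OF _ assms that, of f _ UNIV g] Suc.prems(1)
    unfolding differentiable_def by blast
  moreover have "Ck_on k U (\<lambda>x. frechet_derivative g (at x) w)" for w
    by (rule Suc.IH[of "\<lambda>x. frechet_derivative f (at x) w"]) (use eq Suc.prems in auto)
  ultimately show ?case by simp
qed

lemma smooth_on_cong:
  assumes "open U" "\<And>x. x \<in> U \<Longrightarrow> f x = g x"
  shows "smooth_on U f \<longleftrightarrow> smooth_on U g"
  unfolding smooth_on_def using Ck_on_cong_aux[OF assms(1)] assms(2) by metis

lemma Ck_on_Suc_D: "Ck_on (Suc k) U f \<Longrightarrow> Ck_on k U f"
proof (induction k arbitrary: f)
  case 0
  then show ?case
    by (auto intro!: continuous_at_imp_continuous_on differentiable_imp_continuous_within)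
next
  case (Suc k)
  then show ?case by auto
qed

lemma Ck_on_subset: "V \<subseteq> U \<Longrightarrow> Ck_on k U f \<Longrightarrow> Ck_on k V f"
  by (induction k arbitrary: f) (auto intro: continuous_on_subset)


lemma smooth_on_differentiable: "smooth_on U f \<Longrightarrow> x \<in> U \<Longrightarrow> f differentiable (at x)"
  unfolding smooth_on_def by (metis Ck_on.simps(2))

lemma smooth_on_frechet: "smooth_on U f \<Longrightarrow> smooth_on U (\<lambda>x. frechet_derivative f (at x) w)"
  unfolding smooth_on_def by (metis Ck_on.simps(2))

lemma smooth_on_has_derivative:
  "smooth_on U f \<Longrightarrow> x \<in> U \<Longrightarrow> (f has_derivative frechet_derivative f (at x)) (at x)"
  using smooth_on_differentiable frechet_derivative_works by blast

lemma smooth_on_continuous: "smooth_on U f \<Longrightarrow> continuous_on U f"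
  unfolding smooth_on_def by (metis Ck_on.simps(1))

lemma Ck_on_SucI:
  assumes "open U" "\<And>x. x \<in> U \<Longrightarrow> (f has_derivative f' x) (at x)" "\<And>w. Ck_on k U (\<lambda>x. f' x w)"
  shows "Ck_on (Suc k) U f"
proof -
  have "frechet_derivative f (at x) = f' x" if "x \<in> U" for x
    using frechet_derivative_at assms(2)[OF that] by metis
  then have "Ck_on k U (\<lambda>x. frechet_derivative f (at x) w)" for w
    by (intro Ck_on_cong_aux[OF assms(1) _ assms(3)[of w]]) simp
  then show ?thesis
    using assms(2) unfolding Ck_on.simps differentiable_def by blast
qed

text \<open>Induction on the order for all members of \<open>\<F>\<close> at once: closure under
  directional derivatives reduces order k + 1 of one member to order k of another. With families
  such as all \<open>c * x powr s\<close>, no higher derivative has to be computed.\<close>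

lemma smooth_on_family:
  assumes "open U"
    and "\<And>f x. f \<in> \<F> \<Longrightarrow> x \<in> U \<Longrightarrow> f differentiable (at x)"
    and "\<And>f w. f \<in> \<F> \<Longrightarrow> \<exists>g\<in>\<F>. \<forall>x\<in>U. frechet_derivative f (at x) w = g x"
    and "f \<in> \<F>"
  shows "smooth_on U f"
proof -
  have "\<forall>f\<in>\<F>. Ck_on k U f" for k
  proof (induction k)
    case 0
    then show ?case
      by (auto intro!: continuous_at_imp_continuous_on differentiable_imp_continuous_within assms(2))
  next
    case (Suc k)
    show ?case
    proof
      fix f assume f: "f \<in> \<F>"
      have "Ck_on k U (\<lambda>x. frechet_derivative f (at x) w)" for w
      proof -
        obtain g where "g \<in> \<F>" "\<forall>x\<in>U. frechet_derivative f (at x) w = g x"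
          using assms(3)[OF f] by blast
        then have "\<And>x. x \<in> U \<Longrightarrow> g x = frechet_derivative f (at x) w" and "Ck_on k U g"
          using Suc by simp_all
        then show ?thesis by (rule Ck_on_cong_aux[OF assms(1)])
      qed
      then show "Ck_on (Suc k) U f" using assms(2)[OF f] by simp
    qed
  qed
  then show ?thesis using assms(4) unfolding smooth_on_def by blast
qed

lemma smooth_on_bounded_linear:
  assumes "open U" "bounded_linear f" shows "smooth_on U (\<lambda>x. c + f x)"
proof (rule smooth_on_family[where \<F> = "{h. \<exists>c. h = (\<lambda>x. c + f x)} \<union> {h. \<exists>c. h = (\<lambda>x. c)}"])
  have d: "((\<lambda>x. c + f x) has_derivative f) (at x)" for c x
    by (auto intro!: derivative_eq_intros bounded_linear_imp_has_derivative assms)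
  have fd: "frechet_derivative (\<lambda>x. c + f x) (at x) = f" for c x
    using frechet_derivative_at[OF d] by metis
  show "\<exists>g\<in>{h. \<exists>c. h = (\<lambda>x. c + f x)} \<union> {h. \<exists>c. h = (\<lambda>x. c)}.
          \<forall>x\<in>U. frechet_derivative h (at x) w = g x"
    if "h \<in> {h. \<exists>c. h = (\<lambda>x. c + f x)} \<union> {h. \<exists>c. h = (\<lambda>x. c)}" for h w
    using that fd by fastforce
  show "h differentiable at x" if "h \<in> {h. \<exists>c. h = (\<lambda>x. c + f x)} \<union> {h. \<exists>c. h = (\<lambda>x. c)}" for h x
    using that d has_derivative_const unfolding differentiable_def by blast
qed (use assms in auto)

lemma smooth_on_linear: "open U \<Longrightarrow> bounded_linear f \<Longrightarrow> smooth_on U f"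
  using smooth_on_bounded_linear[of U f 0] by simp

lemma smooth_on_const: "open U \<Longrightarrow> smooth_on U (\<lambda>x. c)"
  by (rule smooth_on_family[where \<F> = "{h. \<exists>c. h = (\<lambda>x. c)}"]) auto

lemma Ck_on_add:
  assumes "open U"
  shows "Ck_on k U f \<Longrightarrow> Ck_on k U g \<Longrightarrow> Ck_on k U (\<lambda>x. f x + g x)"
proof (induction k arbitrary: f g)
  case 0
  then show ?case by (auto intro: continuous_intros)
next
  case (Suc k)
  show ?case
  proof (rule Ck_on_SucI[OF assms])
    show "((\<lambda>x. f x + g x) has_derivative
        (\<lambda>w. frechet_derivative f (at x) w + frechet_derivative g (at x) w)) (at x)" if "x \<in> U" for x
      using Suc.prems that by (auto intro!: has_derivative_add simp: frechet_derivative_works)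
  qed (use Suc in auto)
qed

lemma Ck_on_mult:
  fixes f g :: "'a::real_normed_vector \<Rightarrow> real"
  assumes "open U"
  shows "Ck_on k U f \<Longrightarrow> Ck_on k U g \<Longrightarrow> Ck_on k U (\<lambda>x. f x * g x)"
proof (induction k arbitrary: f g)
  case 0
  then show ?case by (auto intro: continuous_intros)
next
  case (Suc k)
  show ?case
  proof (rule Ck_on_SucI[OF assms])
    show "((\<lambda>x. f x * g x) has_derivative
        (\<lambda>w. f x * frechet_derivative g (at x) w + frechet_derivative f (at x) w * g x)) (at x)"
      if "x \<in> U" for x
      using Suc.prems that by (auto intro!: has_derivative_mult simp: frechet_derivative_works)
  next
    fix w
    have "Ck_on k U f" "Ck_on k U g" using Suc.prems Ck_on_Suc_D by blast+
    then show "Ck_on k U (\<lambda>x. f x * frechet_derivative g (at x) w + frechet_derivative f (at x) w * g x)"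
      using Suc by (intro Ck_on_add[OF assms] Suc.IH) auto
  qed
qed

lemma Ck_on_Pair:
  assumes "open U"
  shows "Ck_on k U f \<Longrightarrow> Ck_on k U g \<Longrightarrow> Ck_on k U (\<lambda>x. (f x, g x))"
proof (induction k arbitrary: f g)
  case 0
  then show ?case by (auto intro: continuous_intros)
next
  case (Suc k)
  show ?case
  proof (rule Ck_on_SucI[OF assms])
    show "((\<lambda>x. (f x, g x)) has_derivative
        (\<lambda>w. (frechet_derivative f (at x) w, frechet_derivative g (at x) w))) (at x)"
      if "x \<in> U" for x
      using Suc.prems that by (auto intro!: has_derivative_Pair simp: frechet_derivative_works)
  qed (use Suc in auto)
qed

lemma Ck_on_bounded_linear_comp:
  assumes "open U" "bounded_linear h"
  shows "Ck_on k U f \<Longrightarrow> Ck_on k U (\<lambda>x. h (f x))"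
proof (induction k arbitrary: f)
  case 0
  then show ?case using assms by (auto intro: bounded_linear.continuous_on)
next
  case (Suc k)
  show ?case
  proof (rule Ck_on_SucI[OF assms(1)])
    show "((\<lambda>x. h (f x)) has_derivative (\<lambda>w. h (frechet_derivative f (at x) w))) (at x)"
      if "x \<in> U" for x
      using Suc.prems that
      by (auto intro!: bounded_linear.has_derivative[OF assms(2)] simp: frechet_derivative_works)
  qed (use Suc in auto)
qed

lemma smooth_on_add:
  "open U \<Longrightarrow> smooth_on U f \<Longrightarrow> smooth_on U g \<Longrightarrow> smooth_on U (\<lambda>x. f x + g x)"
  by (simp add: smooth_on_def Ck_on_add)

lemma smooth_on_mult:
  fixes f g :: "'a::real_normed_vector \<Rightarrow> real"
  shows "open U \<Longrightarrow> smooth_on U f \<Longrightarrow> smooth_on U g \<Longrightarrow> smooth_on U (\<lambda>x. f x * g x)"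
  by (simp add: smooth_on_def Ck_on_mult)

lemma smooth_on_Pair:
  "open U \<Longrightarrow> smooth_on U f \<Longrightarrow> smooth_on U g \<Longrightarrow> smooth_on U (\<lambda>x. (f x, g x))"
  by (simp add: smooth_on_def Ck_on_Pair)

lemma smooth_on_bounded_linear_comp:
  "open U \<Longrightarrow> bounded_linear h \<Longrightarrow> smooth_on U f \<Longrightarrow> smooth_on U (\<lambda>x. h (f x))"
  by (simp add: smooth_on_def Ck_on_bounded_linear_comp)

lemma smooth_on_uminus: "open U \<Longrightarrow> smooth_on U f \<Longrightarrow> smooth_on U (\<lambda>x. - f x)"
  by (rule smooth_on_bounded_linear_comp[OF _ bounded_linear_minus[OF bounded_linear_ident]])

lemma smooth_on_diff:
  "open U \<Longrightarrow> smooth_on U f \<Longrightarrow> smooth_on U g \<Longrightarrow> smooth_on U (\<lambda>x. f x - g x)"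
  using smooth_on_add[OF _ _ smooth_on_uminus] by fastforce

lemma linear_pair:
  fixes L :: "real \<times> real \<Rightarrow> real"
  assumes "linear L" shows "L (a, b) = a * L (1, 0) + b * L (0, 1)"
proof -
  have "L (a *\<^sub>R (1, 0) + b *\<^sub>R (0, 1)) = a *\<^sub>R L (1, 0) + b *\<^sub>R L (0, 1)"
    by (subst linear_add[OF assms]) (simp only: linear_scale[OF assms])
  then show ?thesis by simp
qed

text \<open>By the chain rule a directional derivative of the composite is a sum of products:
  derivatives of \<open>g\<close> and \<open>h\<close> times partial derivatives of \<open>F\<close>
  composed with the same inner functions. So \<open>g\<close> and \<open>h\<close> stay fixed and
  smooth while the induction varies \<open>F\<close> only.\<close>

lemma Ck_on_comp2:
  fixes F :: "real \<times> real \<Rightarrow> real" and g h :: "'a::real_normed_vector \<Rightarrow> real"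
  assumes "open U" and im: "\<And>x. x \<in> U \<Longrightarrow> (g x, h x) \<in> V"
    and g: "smooth_on U g" and h: "smooth_on U h"
  shows "Ck_on k V F \<Longrightarrow> Ck_on k U (\<lambda>x. F (g x, h x))"
proof (induction k arbitrary: F)
  case 0
  have "continuous_on U (\<lambda>x. (g x, h x))"
    using smooth_on_continuous g h by (auto intro: continuous_intros)
  moreover have "(\<lambda>x. (g x, h x)) ` U \<subseteq> V" using im by auto
  ultimately show ?case
    using 0 continuous_on_compose2[of V F U "\<lambda>x. (g x, h x)"] by auto
next
  case (Suc k)
  show ?case
  proof (rule Ck_on_SucI[OF assms(1)])
    fix x assume x: "x \<in> U"
    let ?G = "frechet_derivative g (at x)" and ?H = "frechet_derivative h (at x)"
      and ?F = "frechet_derivative F (at (g x, h x))"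
    have F: "(F has_derivative ?F) (at (g x, h x))"
      using Suc.prems im[OF x] by (simp add: frechet_derivative_works)
    have gh: "((\<lambda>x. (g x, h x)) has_derivative (\<lambda>w. (?G w, ?H w))) (at x)"
      using smooth_on_has_derivative[OF g x] smooth_on_has_derivative[OF h x] by (rule has_derivative_Pair)
    have "((\<lambda>x. F (g x, h x)) has_derivative (\<lambda>w. ?F (?G w, ?H w))) (at x)"
      using diff_chain_at[OF gh F] by (simp only: o_def)
    moreover have "(\<lambda>w. ?F (?G w, ?H w)) = (\<lambda>w. ?G w * ?F (1, 0) + ?H w * ?F (0, 1))"
      by (rule ext) (rule linear_pair[OF has_derivative_linear[OF F]])
    ultimately show "((\<lambda>x. F (g x, h x)) has_derivative
        (\<lambda>w. ?G w * ?F (1, 0) + ?H w * ?F (0, 1))) (at x)" by simp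
  next
    fix w
    have "Ck_on k U (\<lambda>x. frechet_derivative g (at x) w)" "Ck_on k U (\<lambda>x. frechet_derivative h (at x) w)"
      using smooth_on_frechet g h unfolding smooth_on_def by blast+
    moreover have "Ck_on k U (\<lambda>x. frechet_derivative F (at (g x, h x)) v)" for v
      by (rule Suc.IH[of "\<lambda>y. frechet_derivative F (at y) v"])
        (use Suc.prems[unfolded Ck_on.simps] in blast)
    ultimately show "Ck_on k U (\<lambda>x. frechet_derivative g (at x) w * frechet_derivative F (at (g x, h x)) (1, 0)
        + frechet_derivative h (at x) w * frechet_derivative F (at (g x, h x)) (0, 1))"
      by (intro Ck_on_add Ck_on_mult assms)
  qed
qed

lemma smooth_on_comp2:
  fixes F :: "real \<times> real \<Rightarrow> real" and g h :: "'a::real_normed_vector \<Rightarrow> real"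
  assumes "open U" "smooth_on V F" "smooth_on U g" "smooth_on U h"
    "\<And>x. x \<in> U \<Longrightarrow> (g x, h x) \<in> V"
  shows "smooth_on U (\<lambda>x. F (g x, h x))"
  using Ck_on_comp2[of U g h V _ F] assms unfolding smooth_on_def by blast

text \<open>Regards a function of one variable as a function of a pair, so that composition with it
  becomes an instance of \<open>smooth_on_comp2\<close>.\<close>

lemma Ck_on_fst: "open V \<Longrightarrow> Ck_on k V f \<Longrightarrow> Ck_on k (V \<times> (UNIV :: real set)) (\<lambda>p. f (fst p))"
proof (induction k arbitrary: f)
  case 0
  then show ?case
    by (auto intro!: continuous_on_compose2[OF _ continuous_on_fst] continuous_intros)
next
  case (Suc k)
  show ?case
  proof (rule Ck_on_SucI)
    show "open (V \<times> (UNIV :: real set))" using Suc by (simp add: open_Times)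
    show "((\<lambda>p. f (fst p)) has_derivative (\<lambda>w. frechet_derivative f (at (fst p)) (fst w))) (at p)"
      if "p \<in> V \<times> (UNIV :: real set)" for p
    proof -
      have "(f has_derivative frechet_derivative f (at (fst p))) (at (fst p))"
        using Suc.prems that by (auto simp: frechet_derivative_works)
      from diff_chain_at[OF has_derivative_fst[OF has_derivative_ident] this] show ?thesis
        by (simp add: o_def)
    qed
  qed (use Suc in auto)
qed

lemma smooth_on_comp:
  fixes f :: "real \<Rightarrow> real" and g :: "'a::real_normed_vector \<Rightarrow> real"
  assumes "open U" "open V" "smooth_on V f" "smooth_on U g" "\<And>x. x \<in> U \<Longrightarrow> g x \<in> V"
  shows "smooth_on U (\<lambda>x. f (g x))"
proof -
  have "smooth_on (V \<times> (UNIV :: real set)) (\<lambda>p. f (fst p))"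
    using Ck_on_fst assms unfolding smooth_on_def by blast
  from smooth_on_comp2[OF assms(1) this assms(4) smooth_on_const[OF assms(1), of 0]] assms(5)
  show ?thesis by simp
qed

lemma smooth_on_real_deriv:
  fixes f :: "real \<Rightarrow> real"
  assumes "smooth_on U f" "x \<in> U"
  shows "(f has_real_derivative deriv f x) (at x)"
proof -
  have "f differentiable (at x)" using smooth_on_differentiable[OF assms] .
  then show ?thesis using DERIV_deriv_iff_real_differentiable by blast
qed

lemma frechet_derivative_real:
  fixes f :: "real \<Rightarrow> real"
  assumes "(f has_real_derivative d) (at x)"
  shows "frechet_derivative f (at x) w = d * w"
  using frechet_derivative_at[of f "(*) d" x] assms unfolding has_field_derivative_def by metis

lemma smooth_on_deriv:
  fixes f :: "real \<Rightarrow> real"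
  assumes "open U" "smooth_on U f"
  shows "smooth_on U (deriv f)"
  using smooth_on_cong[OF assms(1), of "\<lambda>x. frechet_derivative f (at x) 1" "deriv f"]
    smooth_on_frechet[OF assms(2), of 1] frechet_derivative_real[OF smooth_on_real_deriv[OF assms(2)]]
  by simp

lemma smooth_on_real_family:
  fixes f :: "real \<Rightarrow> real"
  assumes "open U"
    and d: "\<And>f x. f \<in> \<F> \<Longrightarrow> x \<in> U \<Longrightarrow> (f has_real_derivative f' f x) (at x)"
    and c: "\<And>f c. f \<in> \<F> \<Longrightarrow> \<exists>g\<in>\<F>. \<forall>x\<in>U. f' f x * c = g x"
    and "f \<in> \<F>"
  shows "smooth_on U f"
proof (rule smooth_on_family[OF assms(1)])
  show "f differentiable at x" if "f \<in> \<F>" "x \<in> U" for f x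
    using d[OF that] by (auto simp: has_field_derivative_def differentiable_def)
  show "\<exists>g\<in>\<F>. \<forall>x\<in>U. frechet_derivative f (at x) w = g x" if "f \<in> \<F>" for f w
    using c[OF that, of w] frechet_derivative_real[OF d[OF that]] by metis
qed (use assms in auto)

lemma smooth_on_exp: "open U \<Longrightarrow> smooth_on U (\<lambda>x::real. exp (s * x))"
proof (rule smooth_on_real_family[where \<F> = "{h. \<exists>c. h = (\<lambda>x. c * exp (s * x))}"
      and f' = "\<lambda>f x. s * f x"])
  show "\<exists>g\<in>{h. \<exists>c. h = (\<lambda>x. c * exp (s * x))}. \<forall>x\<in>U. s * f x * c = g x"
    if "f \<in> {h. \<exists>c. h = (\<lambda>x. c * exp (s * x))}" for f c
    using that by (auto intro!: exI[of _ "s * c * _"])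
qed (auto intro!: derivative_eq_intros exI[of _ 1])

text \<open>The family ranges over all exponents at once because differentiation lowers the exponent
  by one.\<close>

lemma smooth_on_powr: "smooth_on {0<..} (\<lambda>x::real. x powr s)"
proof (rule smooth_on_family[where \<F> = "{h. \<exists>c s. h = (\<lambda>x. c * x powr s)}"])
  have d: "((\<lambda>x. c * x powr s) has_real_derivative c * (s * x powr (s - 1))) (at x)"
    if "x > 0" for x c s :: real
    using that by (auto intro!: derivative_eq_intros has_real_derivative_powr)
  show "f differentiable at x" if "f \<in> {h. \<exists>c s. h = (\<lambda>x. c * x powr s)}" "x \<in> {0<..}"
    for f and x :: real
    using that d unfolding has_field_derivative_def differentiable_def by fastforce
  show "\<exists>g\<in>{h. \<exists>c s. h = (\<lambda>x. c * x powr s)}. \<forall>x\<in>{0<..}. frechet_derivative f (at x) w = g x"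
    if "f \<in> {h. \<exists>c s. h = (\<lambda>x. c * x powr s)}" for f and w :: real
  proof -
    obtain c s where f: "f = (\<lambda>x. c * x powr s)" using \<open>f \<in> _\<close> by blast
    have "frechet_derivative f (at x) w = (c * s * w) * x powr (s - 1)" if "x > 0" for x
      unfolding f frechet_derivative_real[OF d[OF that]] by simp
    then show ?thesis by (intro bexI[of _ "\<lambda>x. (c * s * w) * x powr (s - 1)"]) auto
  qed
  show "(\<lambda>x. x powr s) \<in> {h. \<exists>c s. h = (\<lambda>x. c * x powr s)}"
    by (rule CollectI, rule exI[of _ 1], rule exI[of _ s]) simp
qed auto

text \<open>From the first derivative on, this is the power with exponent -1.\<close>

lemma smooth_on_ln: "smooth_on {0<..} (ln :: real \<Rightarrow> real)"
proof -
  have "Ck_on (Suc k) {0<..} (ln :: real \<Rightarrow> real)" for k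
  proof (rule Ck_on_SucI)
    show "(ln has_derivative (\<lambda>w. x powr (- 1) * w)) (at x)" if "x \<in> {0<..}" for x :: real
    proof -
      have "(ln has_real_derivative x powr (- 1)) (at x)"
        using DERIV_ln[of x] that by (simp add: powr_minus)
      then show ?thesis unfolding has_field_derivative_def .
    qed
    show "Ck_on k {0<..} (\<lambda>x::real. x powr (- 1) * w)" for w
      using smooth_on_mult[OF open_greaterThan smooth_on_powr[of "- 1"] smooth_on_const[OF open_greaterThan]]
      unfolding smooth_on_def by blast
  qed auto
  then show ?thesis unfolding smooth_on_def using Ck_on_Suc_D by blast
qed

lemma smooth_on_power:
  fixes f :: "'a::real_normed_vector \<Rightarrow> real"
  assumes "open U" "smooth_on U f" shows "smooth_on U (\<lambda>x. f x ^ n)"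
  by (induction n) (auto intro: smooth_on_mult smooth_on_const assms)

subsection \<open>Functions of time and space\<close>

lemma pd_eq:
  assumes "(f has_derivative L) (at p)"
  shows "pd_t f p = L (1, 0)" "pd_x f p = L (0, 1)"
  using frechet_derivative_at[OF assms] by (simp_all add: pd_t_def pd_x_def)

lemma has_derivative_pd:
  assumes "f differentiable (at p)"
  shows "(f has_derivative (\<lambda>w. fst w * pd_t f p + snd w * pd_x f p)) (at p)"
proof -
  let ?F = "frechet_derivative f (at p)"
  have F: "(f has_derivative ?F) (at p)" using assms frechet_derivative_works by blast
  have "?F = (\<lambda>w. fst w * pd_t f p + snd w * pd_x f p)"
  proof
    show "?F w = fst w * pd_t f p + snd w * pd_x f p" for w
      using linear_pair[OF has_derivative_linear[OF F], of "fst w" "snd w"]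
      by (simp add: pd_t_def pd_x_def)
  qed
  then show ?thesis using F by simp
qed

lemma smooth_pd:
  assumes "smooth_on U f" shows "smooth_on U (pd_t f)" "smooth_on U (pd_x f)"
  using smooth_on_frechet[OF assms, of "(1,0)"] smooth_on_frechet[OF assms, of "(0,1)"]
  by (simp_all add: pd_t_def[abs_def] pd_x_def[abs_def])

lemma smooth_on_UNIV_pd:
  assumes "smooth_on UNIV f"
  shows "(f has_derivative (\<lambda>w. fst w * pd_t f p + snd w * pd_x f p)) (at p)"
  using has_derivative_pd smooth_on_differentiable[OF assms] by blast


lemma smooth_on_fst_arg:
  fixes c :: "real \<Rightarrow> real"
  assumes "smooth_on UNIV c" shows "smooth_on UNIV (\<lambda>p::real \<times> real. c (fst p))"
  by (rule smooth_on_comp[OF _ open_UNIV assms smooth_on_linear[OF _ bounded_linear_fst]]) auto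

lemma smooth_on_slice:
  assumes "smooth_on UNIV (f :: real \<times> real \<Rightarrow> real)" shows "smooth_on UNIV (\<lambda>t. f (t, x0))"
  by (rule smooth_on_comp2[OF _ assms smooth_on_linear[OF _ bounded_linear_ident] smooth_on_const]) auto

section \<open>Prolongation\<close>

text \<open>True for functions that are not differentiable as well: the choice in
  \<open>frechet_derivative\<close> ranges over the same candidates for \<open>f\<close> and
  \<open>g\<close>, since having a given derivative is a local property.\<close>

lemma frechet_derivative_cong_open:
  assumes "open U" "x \<in> U" "\<And>y. y \<in> U \<Longrightarrow> f y = g y"
  shows "frechet_derivative f (at x) = frechet_derivative g (at x)"
proof -
  have "(f has_derivative D) (at x) \<longleftrightarrow> (g has_derivative D) (at x)" for D
    using has_derivative_transform_within_open[of f D x UNIV U g]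
      has_derivative_transform_within_open[of g D x UNIV U f] assms by metis
  then show ?thesis unfolding frechet_derivative_def by simp
qed

lemma frechet_derivative_eqI:
  "(f has_derivative D) (at x) \<Longrightarrow> frechet_derivative f (at x) = D"
  using frechet_derivative_at by metis

definition d1 where "d1 f z = frechet_derivative f (at z) (1::real, 0::real, 0::real, 0::real)"
definition d2 where "d2 f z = frechet_derivative f (at z) (0::real, 1::real, 0::real, 0::real)"
definition d3 where "d3 f z = frechet_derivative f (at z) (0::real, 0::real, 1::real, 0::real)"
definition d4 where "d4 f z = frechet_derivative f (at z) (0::real, 0::real, 0::real, 1::real)"

lemma linear_quad:
  fixes L :: "jet0 \<Rightarrow> real"
  assumes "linear L"
  shows "L (a, b, c, d) = a * L (1, 0, 0, 0) + b * L (0, 1, 0, 0) + c * L (0, 0, 1, 0) + d * L (0, 0, 0, 1)"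
proof -
  have "(a, b, c, d) = a *\<^sub>R (1, 0, 0, 0) + (b *\<^sub>R (0, 1, 0, 0) + (c *\<^sub>R (0, 0, 1, 0) + d *\<^sub>R (0, 0, 0, 1)))"
    by simp
  then have "L (a, b, c, d) = L (a *\<^sub>R (1, 0, 0, 0) + (b *\<^sub>R (0, 1, 0, 0) + (c *\<^sub>R (0, 0, 1, 0) + d *\<^sub>R (0, 0, 0, 1))))"
    by (simp only:)
  also have "\<dots> = a *\<^sub>R L (1, 0, 0, 0) + (b *\<^sub>R L (0, 1, 0, 0) + (c *\<^sub>R L (0, 0, 1, 0) + d *\<^sub>R L (0, 0, 0, 1)))"
    by (simp only: linear_add[OF assms] linear_scale[OF assms])
  finally show ?thesis by (simp only: real_scaleR_def add.assoc)
qed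

lemma frechet_quad:
  assumes "(f :: jet0 \<Rightarrow> real) differentiable (at z)"
  shows "frechet_derivative f (at z) (a, b, c, d) = a * d1 f z + b * d2 f z + c * d3 f z + d * d4 f z"
  unfolding d1_def d2_def d3_def d4_def
  using assms frechet_derivative_works has_derivative_linear by (intro linear_quad) blast

lemma smooth_on_ds:
  assumes "smooth_on U (f :: jet0 \<Rightarrow> real)"
  shows "smooth_on U (d1 f)" "smooth_on U (d2 f)" "smooth_on U (d3 f)" "smooth_on U (d4 f)"
  unfolding d1_def[abs_def] d2_def[abs_def] d3_def[abs_def] d4_def[abs_def]
  by (rule smooth_on_frechet[OF assms])+

lemma open_base_dom: "open (uvals S) \<Longrightarrow> open (base_dom S)"
proof -
  assume "open (uvals S)"
  moreover have "base_dom S = UNIV \<times> UNIV \<times> uvals S \<times> UNIV" by (auto simp: base_dom_def)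
  ultimately show ?thesis by (simp add: open_Times)
qed

lemma xi_smooth:
  assumes "open U" "smooth_on U X"
  shows "smooth_on U (xi0 X)" "smooth_on U (xi1 X)" "smooth_on U (eta1 X)" "smooth_on U (eta2 X)"
proof -
  note bl = bounded_linear_fst bounded_linear_snd
    bounded_linear_compose[OF bounded_linear_fst bounded_linear_snd]
    bounded_linear_compose[OF bounded_linear_fst bounded_linear_compose[OF bounded_linear_snd bounded_linear_snd]]
    bounded_linear_compose[OF bounded_linear_snd bounded_linear_compose[OF bounded_linear_snd bounded_linear_snd]]
  have eq: "xi0 X = (\<lambda>z. fst (X z))" "xi1 X = (\<lambda>z. fst (snd (X z)))"
    "eta1 X = (\<lambda>z. fst (snd (snd (X z))))" "eta2 X = (\<lambda>z. snd (snd (snd (X z))))"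
    by (auto simp: xi0_def xi1_def eta1_def eta2_def split: prod.split)
  show "smooth_on U (xi0 X)" "smooth_on U (xi1 X)" "smooth_on U (eta1 X)" "smooth_on U (eta2 X)"
    unfolding eq by (rule smooth_on_bounded_linear_comp[OF assms(1) bl(1) assms(2)]
        smooth_on_bounded_linear_comp[OF assms(1) bl(3) assms(2)]
        smooth_on_bounded_linear_comp[OF assms(1) bl(4) assms(2)]
        smooth_on_bounded_linear_comp[OF assms(1) bl(5) assms(2)])+
qed

lemma has_derivative_jet1:
  fixes f :: "jet0 \<Rightarrow> real"
  assumes "f differentiable (at z)"
  shows "((\<lambda>j::jet1. f (fst j)) has_derivative (\<lambda>w. frechet_derivative f (at z) (fst w))) (at (z, q))"
proof -
  have "(f has_derivative frechet_derivative f (at z)) (at (fst (z, q)))"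
    using assms unfolding frechet_derivative_works fst_conv .
  from diff_chain_at[OF has_derivative_fst[OF has_derivative_ident] this] show ?thesis
    by (simp add: o_def)
qed

lemma zeta_ux_quad:
  assumes "eta1 X differentiable (at z)" "xi0 X differentiable (at z)" "xi1 X differentiable (at z)"
  shows "zeta_ux X (z, (ut, ux, vt, vx)) =
     (d2 (eta1 X) z + ux * d3 (eta1 X) z + vx * d4 (eta1 X) z)
     - ut * (d2 (xi0 X) z + ux * d3 (xi0 X) z + vx * d4 (xi0 X) z)
     - ux * (d2 (xi1 X) z + ux * d3 (xi1 X) z + vx * d4 (xi1 X) z)"
  using assms by (simp add: frechet_quad)

text \<open>\<open>T\<close> is the total derivative in x of a function of the base variables; the
  other terms arise where it meets the factors \<open>ux\<close>, \<open>vx\<close> and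
  \<open>ut\<close>. The field is an arbitrary smooth one, because this coefficient, inserted into
  the second equation, has to reveal the shape of a symmetry.\<close>

lemma Dx1_zeta_ux:
  fixes ux vx :: real
  assumes U: "open U" and z: "z \<in> U" and X: "smooth_on U X"
  defines "T \<equiv> (\<lambda>g. frechet_derivative g (at z) (0, 1, ux, vx))"
  shows "Dx1 (zeta_ux X) ((z, (ut, ux, vt, vx)), (utt, utx, uxx, vtt, vtx, vxx)) =
     T (d2 (eta1 X)) + ux * T (d3 (eta1 X)) + vx * T (d4 (eta1 X))
       + uxx * d3 (eta1 X) z + vxx * d4 (eta1 X) z
     - utx * (d2 (xi0 X) z + ux * d3 (xi0 X) z + vx * d4 (xi0 X) z)
     - ut * (T (d2 (xi0 X)) + ux * T (d3 (xi0 X)) + vx * T (d4 (xi0 X))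
       + uxx * d3 (xi0 X) z + vxx * d4 (xi0 X) z)
     - uxx * (d2 (xi1 X) z + ux * d3 (xi1 X) z + vx * d4 (xi1 X) z)
     - ux * (T (d2 (xi1 X)) + ux * T (d3 (xi1 X)) + vx * T (d4 (xi1 X))
       + uxx * d3 (xi1 X) z + vxx * d4 (xi1 X) z)"
proof -
  let ?j = "(z, (ut, ux, vt, vx)) :: jet1"
  let ?P = "\<lambda>f. \<lambda>j::jet1. d2 f (fst j) + fst (snd (snd j)) * d3 f (fst j) + snd (snd (snd (snd j))) * d4 f (fst j)"
  \<comment> \<open>The closed formula for \<open>zeta_ux X\<close> holds only over
    \<open>U\<close>; agreement on the open set \<open>U \<times> UNIV\<close> is enough for equal
    derivatives.\<close>
  define g where "g = (\<lambda>j::jet1. ?P (eta1 X) j - fst (snd j) * ?P (xi0 X) j - fst (snd (snd j)) * ?P (xi1 X) j)"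
  note s = xi_smooth[OF U X]
  note ds = smooth_on_ds[OF s(1)] smooth_on_ds[OF s(2)] smooth_on_ds[OF s(3)]
  have dif: "f differentiable (at z)" if "smooth_on U f" for f :: "jet0 \<Rightarrow> real"
    using smooth_on_differentiable[OF that z] .
  have eq: "zeta_ux X j = g j" if "j \<in> U \<times> UNIV" for j
  proof -
    obtain z' a b c d where j: "j = (z', (a, b, c, d))" by (cases j) auto
    have "z' \<in> U" using that j by auto
    then show ?thesis
      unfolding j g_def using smooth_on_differentiable[OF s(1)] smooth_on_differentiable[OF s(2)]
        smooth_on_differentiable[OF s(3)] by (subst zeta_ux_quad) auto
  qed
  have "frechet_derivative (zeta_ux X) (at ?j) = frechet_derivative g (at ?j)"
    by (rule frechet_derivative_cong_open[OF open_Times[OF U open_UNIV] _ eq]) (simp_all add: z)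
  moreover have dd: "((\<lambda>j::jet1. f (fst j)) has_derivative (\<lambda>w. frechet_derivative f (at z) (fst w))) (at ?j)"
    if "smooth_on U f" for f :: "jet0 \<Rightarrow> real"
    using has_derivative_jet1[OF dif[OF that]] .
  have "(g has_derivative (\<lambda>w.
     (let T = (\<lambda>g. frechet_derivative g (at z) (fst w)); a = fst (snd w); b = fst (snd (snd w)); c = snd (snd (snd (snd w))) in
     T (d2 (eta1 X)) + ux * T (d3 (eta1 X)) + vx * T (d4 (eta1 X))
       + b * d3 (eta1 X) z + c * d4 (eta1 X) z
     - a * (d2 (xi0 X) z + ux * d3 (xi0 X) z + vx * d4 (xi0 X) z)
     - ut * (T (d2 (xi0 X)) + ux * T (d3 (xi0 X)) + vx * T (d4 (xi0 X))
       + b * d3 (xi0 X) z + c * d4 (xi0 X) z)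
     - b * (d2 (xi1 X) z + ux * d3 (xi1 X) z + vx * d4 (xi1 X) z)
     - ux * (T (d2 (xi1 X)) + ux * T (d3 (xi1 X)) + vx * T (d4 (xi1 X))
       + b * d3 (xi1 X) z + c * d4 (xi1 X) z)))) (at ?j)"
    unfolding g_def Let_def
    by (rule derivative_eq_intros dd[OF ds(2)] dd[OF ds(3)] dd[OF ds(4)] dd[OF ds(6)] dd[OF ds(7)]
        dd[OF ds(8)] dd[OF ds(10)] dd[OF ds(11)] dd[OF ds(12)] refl)+
      (simp add: fun_eq_iff algebra_simps)
  from frechet_derivative_eqI[OF this] show ?thesis
    using calculation by (simp add: Let_def T_def)
qed

lemma frechet_S2: "frechet_derivative S2 (at j) w = fst (snd (snd (snd w))) - snd (snd (snd (fst (fst w))))"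
proof -
  have e: "S2 = (\<lambda>j. fst (snd (snd (snd j))) - snd (snd (snd (fst (fst j)))))"
    by (auto simp: fun_eq_iff)
  have "((\<lambda>j::jet2. fst (snd (snd (snd j))) - snd (snd (snd (fst (fst j))))) has_derivative
     (\<lambda>w. fst (snd (snd (snd w))) - snd (snd (snd (fst (fst w)))))) (at j)"
    by (intro derivative_intros)
  from frechet_derivative_eqI[OF this] show ?thesis unfolding e by (rule fun_cong)
qed

section \<open>The first equation and its differential on the second-order jet space\<close>

context
  fixes S :: rd_system and K D F :: "real \<Rightarrow> real" and J :: "real set"
  defines "K \<equiv> coefK S" and "D \<equiv> coefD S" and "F \<equiv> coefF S" and "J \<equiv> uvals S"
  assumes S: "valid_system S"
begin

lemma open_J: "open J" and J_interval: "is_interval J" and J_ne: "J \<noteq> {}"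
  and smooth_K: "smooth_on J K" and smooth_D: "smooth_on J D" and smooth_F: "smooth_on J F"
  using S by (auto simp: valid_system_def K_def D_def F_def J_def)

lemma S1_eq:
  assumes "u \<in> J"
  shows "S1 S (((t, x, u, v), (ut, ux, vt, vx)), (utt, utx, uxx, vtt, vtx, vxx)) =
    - ut - (deriv K u * ux * vx + K u * vxx) + (deriv D u * ux * ux + D u * uxx) + F u"
proof -
  let ?j = "((t, x, u, v), (ut, ux, vt, vx)) :: jet1"
  have c: "((\<lambda>j::jet1. c (fst (snd (snd (fst j))))) has_derivative (\<lambda>w. deriv c u * fst (snd (snd (fst w))))) (at ?j)"
    if "smooth_on J c" for c
  proof -
    have c: "(c has_derivative (*) (deriv c u)) (at (fst (snd (snd (fst ?j)))))"
      using smooth_on_real_deriv[OF that assms] by (simp add: has_field_derivative_def)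
    have p: "((\<lambda>j::jet1. fst (snd (snd (fst j)))) has_derivative (\<lambda>w. fst (snd (snd (fst w))))) (at ?j)"
      by (intro derivative_intros)
    show ?thesis using diff_chain_at[OF p c] by (simp only: o_def)
  qed
  have 1: "((\<lambda>((t, x, u, v), (ut, ux, vt, vx)). K u * vx) has_derivative
     (\<lambda>w. deriv K u * fst (snd (snd (fst w))) * vx + K u * snd (snd (snd (snd w))))) (at ?j)"
  proof -
    have e: "(\<lambda>((t, x, u, v), (ut, ux, vt, vx)). K u * vx) = (\<lambda>j::jet1. K (fst (snd (snd (fst j)))) * snd (snd (snd (snd j))))"
      by auto
    show ?thesis unfolding e by (rule derivative_eq_intros c[OF smooth_K] refl)+ (simp add: fun_eq_iff)
  qed
  have 2: "((\<lambda>((t, x, u, v), (ut, ux, vt, vx)). D u * ux) has_derivative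
     (\<lambda>w. deriv D u * fst (snd (snd (fst w))) * ux + D u * fst (snd (snd w)))) (at ?j)"
  proof -
    have e: "(\<lambda>((t, x, u, v), (ut, ux, vt, vx)). D u * ux) = (\<lambda>j::jet1. D (fst (snd (snd (fst j)))) * fst (snd (snd j)))"
      by auto
    show ?thesis unfolding e by (rule derivative_eq_intros c[OF smooth_D] refl)+ (simp add: fun_eq_iff)
  qed
  show ?thesis
    unfolding S1.simps Let_def Dx1.simps K_def[symmetric] D_def[symmetric] F_def[symmetric]
      frechet_derivative_eqI[OF 1] frechet_derivative_eqI[OF 2]
    by (simp add: algebra_simps)
qed

text \<open>Only the slots for \<open>u\<close>, \<open>ut\<close>, \<open>ux\<close>,
  \<open>vx\<close>, \<open>uxx\<close> and \<open>vxx\<close> of the tangent vector enter. Second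
  derivatives of \<open>K\<close> and \<open>D\<close> appear because \<open>S1\<close> already
  contains the first ones.\<close>

lemma frechet_S1:
  assumes u: "u \<in> J"
  shows "frechet_derivative (S1 S) (at (((t, x, u, v), (ut, ux, vt, vx)), (utt, utx, uxx, vtt, vtx, vxx)))
     (((wt', wx', wu, wv), (wut, wux, wvt, wvx)), (wutt, wutx, wuxx, wvtt, wvtx, wvxx)) =
    - wut - (deriv (deriv K) u * wu * ux * vx + deriv K u * wux * vx + deriv K u * ux * wvx
        + deriv K u * wu * vxx + K u * wvxx)
      + (deriv (deriv D) u * wu * ux * ux + 2 * deriv D u * ux * wux + deriv D u * wu * uxx + D u * wuxx)
      + deriv F u * wu"
    (is "frechet_derivative _ (at ?j) ?w = _")
proof -
  let ?U = "(((UNIV \<times> UNIV \<times> J \<times> UNIV) \<times> UNIV) \<times> UNIV) :: jet2 set"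
  let ?pu = "\<lambda>j::jet2. fst (snd (snd (fst (fst j))))" and ?pux = "\<lambda>j::jet2. fst (snd (snd (fst j)))"
    and ?pvx = "\<lambda>j::jet2. snd (snd (snd (snd (fst j))))" and ?put = "\<lambda>j::jet2. fst (snd (fst j))"
    and ?puxx = "\<lambda>j::jet2. fst (snd (snd (snd j)))" and ?pvxx = "\<lambda>j::jet2. snd (snd (snd (snd (snd (snd j)))))"
  define g where "g = (\<lambda>j::jet2. - ?put j - (deriv K (?pu j) * ?pux j * ?pvx j + K (?pu j) * ?pvxx j)
     + (deriv D (?pu j) * ?pux j * ?pux j + D (?pu j) * ?puxx j) + F (?pu j))"
  have eq: "frechet_derivative (S1 S) (at ?j) = frechet_derivative g (at ?j)"
  proof (rule frechet_derivative_cong_open[of ?U])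
    show "open ?U" using open_J by (intro open_Times) auto
    show "?j \<in> ?U" using u by simp
    show "S1 S y = g y" if "y \<in> ?U" for y
    proof -
      obtain t x u v ut ux vt vx utt utx uxx vtt vtx vxx
        where y: "y = (((t, x, u, v), (ut, ux, vt, vx)), (utt, utx, uxx, vtt, vtx, vxx))"
        by (metis prod.exhaust)
      then have "u \<in> J" using that by simp
      then show ?thesis unfolding y by (subst S1_eq) (simp_all add: g_def)
    qed
  qed
  have c: "((\<lambda>j. c (?pu j)) has_derivative (\<lambda>w. deriv c u * ?pu w)) (at ?j)"
    if "smooth_on J c" for c
  proof -
    have c: "(c has_derivative (*) (deriv c u)) (at (?pu ?j))"
      using smooth_on_real_deriv[OF that u] by (simp add: has_field_derivative_def)
    have p: "(?pu has_derivative ?pu) (at ?j)"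
      by (intro derivative_intros)
    show ?thesis using diff_chain_at[OF p c] by (simp only: o_def)
  qed
  have "(g has_derivative (\<lambda>w. - ?put w - (deriv (deriv K) u * ?pu w * ux * vx + deriv K u * ?pux w * vx + deriv K u * ux * ?pvx w
        + deriv K u * ?pu w * vxx + K u * ?pvxx w)
      + (deriv (deriv D) u * ?pu w * ux * ux + 2 * deriv D u * ux * ?pux w + deriv D u * ?pu w * uxx + D u * ?puxx w)
      + deriv F u * ?pu w)) (at ?j)"
    unfolding g_def
    by (rule derivative_eq_intros c[OF smooth_K] c[OF smooth_D] c[OF smooth_F]
        c[OF smooth_on_deriv[OF open_J smooth_K]] c[OF smooth_on_deriv[OF open_J smooth_D]] refl)+
      (simp add: fun_eq_iff algebra_simps)
  from frechet_derivative_eqI[OF this] show ?thesis unfolding eq by simp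
qed

end

text \<open>The shape to which the condition on \<open>S2\<close> restricts a symmetry. Its
  coefficients are kept independent of each other here, so that one computation of the prolongation
  serves both the necessity and the sufficiency of the determining equations.\<close>

definition vform :: "(real \<Rightarrow> real) \<Rightarrow> (real \<times> real \<Rightarrow> real) \<Rightarrow> (real \<times> real \<Rightarrow> real) \<Rightarrow>
    (real \<times> real \<Rightarrow> real) \<Rightarrow> (real \<times> real \<Rightarrow> real) \<Rightarrow> (real \<times> real \<Rightarrow> real) \<Rightarrow>
    (real \<times> real \<Rightarrow> real) \<Rightarrow> vfield" where
  "vform a \<xi> A B E0 E1 G = (\<lambda>(t, x, u, v).
     (a t, \<xi> (t, x), A (t, x) * u + B (t, x), E0 (t, x) + E1 (t, x) * u + G (t, x) * v))"

lemma has_derivative_lift0: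
  assumes "f differentiable (at (t, x))"
  shows "((\<lambda>z::jet0. f (fst z, fst (snd z))) has_derivative
     (\<lambda>w. fst w * pd_t f (t, x) + fst (snd w) * pd_x f (t, x))) (at (t, x, u, v))"
proof -
  have p: "((\<lambda>z::jet0. (fst z, fst (snd z))) has_derivative (\<lambda>w. (fst w, fst (snd w)))) (at (t, x, u, v))"
    by (intro derivative_intros)
  have f: "(f has_derivative (\<lambda>w. fst w * pd_t f (t, x) + snd w * pd_x f (t, x)))
     (at ((\<lambda>z::jet0. (fst z, fst (snd z))) (t, x, u, v)))"
    using has_derivative_pd[OF assms] by simp
  from diff_chain_at[OF p f] show ?thesis by (simp add: o_def)
qed

lemma has_derivative_lift1:
  assumes "f differentiable (at (t, x))"
  shows "((\<lambda>j::jet1. f (fst (fst j), fst (snd (fst j)))) has_derivative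
     (\<lambda>w. fst (fst w) * pd_t f (t, x) + fst (snd (fst w)) * pd_x f (t, x))) (at ((t, x, u, v), q))"
proof -
  have p: "((\<lambda>j::jet1. (fst (fst j), fst (snd (fst j)))) has_derivative
      (\<lambda>w. (fst (fst w), fst (snd (fst w))))) (at ((t, x, u, v), q))"
    by (intro derivative_intros)
  have f: "(f has_derivative (\<lambda>w. fst w * pd_t f (t, x) + snd w * pd_x f (t, x)))
     (at ((\<lambda>j::jet1. (fst (fst j), fst (snd (fst j)))) ((t, x, u, v), q)))"
    using has_derivative_pd[OF assms] by simp
  from diff_chain_at[OF p f] show ?thesis by (simp add: o_def)
qed

lemma has_derivative_time0:
  assumes "smooth_on UNIV a"
  shows "((\<lambda>z::jet0. a (fst z)) has_derivative (\<lambda>w. fst w * deriv a t)) (at (t, x, u, v))"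
proof -
  have p: "((\<lambda>z::jet0. fst z) has_derivative (\<lambda>w. fst w)) (at (t, x, u, v))"
    by (intro derivative_intros)
  have "(*) (deriv a t) = (\<lambda>w. w * deriv a t)" by (simp add: fun_eq_iff)
  then have f: "(a has_derivative (\<lambda>w. w * deriv a t)) (at (fst (t, x, u, v)))"
    using smooth_on_real_deriv[OF assms, of t] unfolding has_field_derivative_def by simp
  from diff_chain_at[OF p f] show ?thesis by (simp add: o_def)
qed

section \<open>Prolongation of fields that are affine in the dependent variables\<close>

context
  fixes a :: "real \<Rightarrow> real" and \<xi> A B E0 E1 G :: "real \<times> real \<Rightarrow> real"
  assumes sm: "smooth_on UNIV a" "smooth_on UNIV \<xi>" "smooth_on UNIV A" "smooth_on UNIV B"
    "smooth_on UNIV E0" "smooth_on UNIV E1" "smooth_on UNIV G"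
begin

abbreviation (input) \<Xi> where "\<Xi> \<equiv> vform a \<xi> A B E0 E1 G"

lemma dif: "smooth_on UNIV f \<Longrightarrow> f differentiable (at q)"
  using smooth_on_differentiable by blast

lemma frechet_vform:
  "frechet_derivative (xi0 \<Xi>) (at (t, x, u, v)) (w1, w2, w3, w4) = w1 * deriv a t"
  "frechet_derivative (xi1 \<Xi>) (at (t, x, u, v)) (w1, w2, w3, w4) = w1 * pd_t \<xi> (t, x) + w2 * pd_x \<xi> (t, x)"
  "frechet_derivative (eta1 \<Xi>) (at (t, x, u, v)) (w1, w2, w3, w4) =
     (w1 * pd_t A (t, x) + w2 * pd_x A (t, x)) * u + A (t, x) * w3 + (w1 * pd_t B (t, x) + w2 * pd_x B (t, x))"
  "frechet_derivative (eta2 \<Xi>) (at (t, x, u, v)) (w1, w2, w3, w4) =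
     (w1 * pd_t E0 (t, x) + w2 * pd_x E0 (t, x)) + (w1 * pd_t E1 (t, x) + w2 * pd_x E1 (t, x)) * u + E1 (t, x) * w3
     + (w1 * pd_t G (t, x) + w2 * pd_x G (t, x)) * v + G (t, x) * w4"
proof -
  have e: "xi0 \<Xi> = (\<lambda>z. a (fst z))" "xi1 \<Xi> = (\<lambda>z. \<xi> (fst z, fst (snd z)))"
    "eta1 \<Xi> = (\<lambda>z. A (fst z, fst (snd z)) * fst (snd (snd z)) + B (fst z, fst (snd z)))"
    "eta2 \<Xi> = (\<lambda>z. E0 (fst z, fst (snd z)) + E1 (fst z, fst (snd z)) * fst (snd (snd z))
       + G (fst z, fst (snd z)) * snd (snd (snd z)))"
    by (auto simp: xi0_def xi1_def eta1_def eta2_def vform_def split: prod.split)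
  note l = has_derivative_lift0[OF dif[OF sm(2)]] has_derivative_lift0[OF dif[OF sm(3)]]
    has_derivative_lift0[OF dif[OF sm(4)]] has_derivative_lift0[OF dif[OF sm(5)]]
    has_derivative_lift0[OF dif[OF sm(6)]] has_derivative_lift0[OF dif[OF sm(7)]]
  show "frechet_derivative (xi0 \<Xi>) (at (t, x, u, v)) (w1, w2, w3, w4) = w1 * deriv a t"
    unfolding e frechet_derivative_eqI[OF has_derivative_time0[OF sm(1)]] by simp
  show "frechet_derivative (xi1 \<Xi>) (at (t, x, u, v)) (w1, w2, w3, w4) = w1 * pd_t \<xi> (t, x) + w2 * pd_x \<xi> (t, x)"
    unfolding e frechet_derivative_eqI[OF l(1)] by simp
  have "((\<lambda>z. A (fst z, fst (snd z)) * fst (snd (snd z)) + B (fst z, fst (snd z))) has_derivative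
     (\<lambda>w. (fst w * pd_t A (t, x) + fst (snd w) * pd_x A (t, x)) * u + A (t, x) * fst (snd (snd w))
        + (fst w * pd_t B (t, x) + fst (snd w) * pd_x B (t, x)))) (at (t, x, u, v))"
    by (rule derivative_eq_intros l refl)+ (simp add: fun_eq_iff)
  from frechet_derivative_eqI[OF this]
  show "frechet_derivative (eta1 \<Xi>) (at (t, x, u, v)) (w1, w2, w3, w4) =
     (w1 * pd_t A (t, x) + w2 * pd_x A (t, x)) * u + A (t, x) * w3 + (w1 * pd_t B (t, x) + w2 * pd_x B (t, x))"
    unfolding e by simp
  have "((\<lambda>z. E0 (fst z, fst (snd z)) + E1 (fst z, fst (snd z)) * fst (snd (snd z))
       + G (fst z, fst (snd z)) * snd (snd (snd z))) has_derivative
     (\<lambda>w. (fst w * pd_t E0 (t, x) + fst (snd w) * pd_x E0 (t, x)) + (fst w * pd_t E1 (t, x) + fst (snd w) * pd_x E1 (t, x)) * u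
       + E1 (t, x) * fst (snd (snd w)) + (fst w * pd_t G (t, x) + fst (snd w) * pd_x G (t, x)) * v
       + G (t, x) * snd (snd (snd w)))) (at (t, x, u, v))"
    by (rule derivative_eq_intros l refl)+ (simp add: fun_eq_iff algebra_simps)
  from frechet_derivative_eqI[OF this]
  show "frechet_derivative (eta2 \<Xi>) (at (t, x, u, v)) (w1, w2, w3, w4) =
     (w1 * pd_t E0 (t, x) + w2 * pd_x E0 (t, x)) + (w1 * pd_t E1 (t, x) + w2 * pd_x E1 (t, x)) * u + E1 (t, x) * w3
     + (w1 * pd_t G (t, x) + w2 * pd_x G (t, x)) * v + G (t, x) * w4"
    unfolding e by simp
qed

lemma zeta_vform:
  "zeta_ut \<Xi> ((t, x, u, v), (ut, ux, vt, vx)) =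
     pd_t A (t, x) * u + pd_t B (t, x) + (A (t, x) - deriv a t) * ut - ux * pd_t \<xi> (t, x)"
  "zeta_ux \<Xi> ((t, x, u, v), (ut, ux, vt, vx)) =
     pd_x A (t, x) * u + pd_x B (t, x) + A (t, x) * ux - ux * pd_x \<xi> (t, x)"
  "zeta_vx \<Xi> ((t, x, u, v), (ut, ux, vt, vx)) =
     pd_x E0 (t, x) + pd_x E1 (t, x) * u + E1 (t, x) * ux + pd_x G (t, x) * v + G (t, x) * vx - vx * pd_x \<xi> (t, x)"
  by (simp_all add: frechet_vform algebra_simps)

lemma Dx1_zeta_vform:
  "Dx1 (zeta_ux \<Xi>) (((t, x, u, v), (ut, ux, vt, vx)), (utt, utx, uxx, vtt, vtx, vxx)) =
     pd_x (pd_x A) (t, x) * u + pd_x (pd_x B) (t, x) + 2 * pd_x A (t, x) * ux + A (t, x) * uxx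
     - uxx * pd_x \<xi> (t, x) - ux * pd_x (pd_x \<xi>) (t, x)"
  "Dx1 (zeta_vx \<Xi>) (((t, x, u, v), (ut, ux, vt, vx)), (utt, utx, uxx, vtt, vtx, vxx)) =
     pd_x (pd_x E0) (t, x) + pd_x (pd_x E1) (t, x) * u + 2 * pd_x E1 (t, x) * ux + E1 (t, x) * uxx
     + pd_x (pd_x G) (t, x) * v + 2 * pd_x G (t, x) * vx + G (t, x) * vxx
     - vxx * pd_x \<xi> (t, x) - vx * pd_x (pd_x \<xi>) (t, x)"
proof -
  let ?p = "\<lambda>j::jet1. (fst (fst j), fst (snd (fst j)))"
    and ?u = "\<lambda>j::jet1. fst (snd (snd (fst j)))" and ?v = "\<lambda>j::jet1. snd (snd (snd (fst j)))"
    and ?ux = "\<lambda>j::jet1. fst (snd (snd j))" and ?vx = "\<lambda>j::jet1. snd (snd (snd (snd j)))"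
  let ?j = "((t, x, u, v), (ut, ux, vt, vx)) :: jet1"
  have e1: "zeta_ux \<Xi> = (\<lambda>j. pd_x A (?p j) * ?u j + pd_x B (?p j) + A (?p j) * ?ux j - ?ux j * pd_x \<xi> (?p j))"
  proof
    fix j :: jet1
    obtain t x u v ut ux vt vx where j: "j = ((t, x, u, v), (ut, ux, vt, vx))" by (metis prod.exhaust)
    show "zeta_ux \<Xi> j = pd_x A (?p j) * ?u j + pd_x B (?p j) + A (?p j) * ?ux j - ?ux j * pd_x \<xi> (?p j)"
      unfolding j zeta_vform by simp
  qed
  have e2: "zeta_vx \<Xi> = (\<lambda>j. pd_x E0 (?p j) + pd_x E1 (?p j) * ?u j + E1 (?p j) * ?ux j + pd_x G (?p j) * ?v j
      + G (?p j) * ?vx j - ?vx j * pd_x \<xi> (?p j))"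
  proof
    fix j :: jet1
    obtain t x u v ut ux vt vx where j: "j = ((t, x, u, v), (ut, ux, vt, vx))" by (metis prod.exhaust)
    show "zeta_vx \<Xi> j = pd_x E0 (?p j) + pd_x E1 (?p j) * ?u j + E1 (?p j) * ?ux j + pd_x G (?p j) * ?v j
      + G (?p j) * ?vx j - ?vx j * pd_x \<xi> (?p j)"
      unfolding j zeta_vform by simp
  qed
  note l = has_derivative_lift1[OF dif[OF sm(3)]] has_derivative_lift1[OF dif[OF smooth_pd(2)[OF sm(3)]]]
    has_derivative_lift1[OF dif[OF smooth_pd(2)[OF sm(4)]]] has_derivative_lift1[OF dif[OF smooth_pd(2)[OF sm(2)]]]
  have "((\<lambda>j. pd_x A (?p j) * ?u j + pd_x B (?p j) + A (?p j) * ?ux j - ?ux j * pd_x \<xi> (?p j)) has_derivative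
     (\<lambda>w. (fst (fst w) * pd_t (pd_x A) (t, x) + fst (snd (fst w)) * pd_x (pd_x A) (t, x)) * u + pd_x A (t, x) * ?u w
        + (fst (fst w) * pd_t (pd_x B) (t, x) + fst (snd (fst w)) * pd_x (pd_x B) (t, x))
        + (fst (fst w) * pd_t A (t, x) + fst (snd (fst w)) * pd_x A (t, x)) * ux + A (t, x) * ?ux w
        - (?ux w * pd_x \<xi> (t, x) + ux * (fst (fst w) * pd_t (pd_x \<xi>) (t, x) + fst (snd (fst w)) * pd_x (pd_x \<xi>) (t, x))))) (at ?j)"
    by (rule derivative_eq_intros l refl)+ (simp add: fun_eq_iff algebra_simps)
  from frechet_derivative_eqI[OF this]
  show "Dx1 (zeta_ux \<Xi>) (((t, x, u, v), (ut, ux, vt, vx)), (utt, utx, uxx, vtt, vtx, vxx)) =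
     pd_x (pd_x A) (t, x) * u + pd_x (pd_x B) (t, x) + 2 * pd_x A (t, x) * ux + A (t, x) * uxx
     - uxx * pd_x \<xi> (t, x) - ux * pd_x (pd_x \<xi>) (t, x)"
    unfolding Dx1.simps e1 by simp
  note l = has_derivative_lift1[OF dif[OF sm(6)]] has_derivative_lift1[OF dif[OF sm(7)]]
    has_derivative_lift1[OF dif[OF smooth_pd(2)[OF sm(5)]]] has_derivative_lift1[OF dif[OF smooth_pd(2)[OF sm(6)]]]
    has_derivative_lift1[OF dif[OF smooth_pd(2)[OF sm(7)]]] has_derivative_lift1[OF dif[OF smooth_pd(2)[OF sm(2)]]]
  have "((\<lambda>j. pd_x E0 (?p j) + pd_x E1 (?p j) * ?u j + E1 (?p j) * ?ux j + pd_x G (?p j) * ?v j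
      + G (?p j) * ?vx j - ?vx j * pd_x \<xi> (?p j)) has_derivative
     (\<lambda>w. (fst (fst w) * pd_t (pd_x E0) (t, x) + fst (snd (fst w)) * pd_x (pd_x E0) (t, x))
        + (fst (fst w) * pd_t (pd_x E1) (t, x) + fst (snd (fst w)) * pd_x (pd_x E1) (t, x)) * u + pd_x E1 (t, x) * ?u w
        + (fst (fst w) * pd_t E1 (t, x) + fst (snd (fst w)) * pd_x E1 (t, x)) * ux + E1 (t, x) * ?ux w
        + (fst (fst w) * pd_t (pd_x G) (t, x) + fst (snd (fst w)) * pd_x (pd_x G) (t, x)) * v + pd_x G (t, x) * ?v w
        + (fst (fst w) * pd_t G (t, x) + fst (snd (fst w)) * pd_x G (t, x)) * vx + G (t, x) * ?vx w
        - (?vx w * pd_x \<xi> (t, x) + vx * (fst (fst w) * pd_t (pd_x \<xi>) (t, x) + fst (snd (fst w)) * pd_x (pd_x \<xi>) (t, x))))) (at ?j)"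
    by (rule derivative_eq_intros l refl)+ (simp add: fun_eq_iff algebra_simps)
  from frechet_derivative_eqI[OF this]
  show "Dx1 (zeta_vx \<Xi>) (((t, x, u, v), (ut, ux, vt, vx)), (utt, utx, uxx, vtt, vtx, vxx)) =
     pd_x (pd_x E0) (t, x) + pd_x (pd_x E1) (t, x) * u + 2 * pd_x E1 (t, x) * ux + E1 (t, x) * uxx
     + pd_x (pd_x G) (t, x) * v + 2 * pd_x G (t, x) * vx + G (t, x) * vxx
     - vxx * pd_x \<xi> (t, x) - vx * pd_x (pd_x \<xi>) (t, x)"
    unfolding Dx1.simps e2 by simp
qed

text \<open>The witnesses \<open>b1\<close> to \<open>b5\<close> are the components along
  \<open>vt\<close>, \<open>utt\<close>, \<open>utx\<close>, \<open>vtt\<close> and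
  \<open>vtx\<close>. Neither \<open>S1\<close> nor \<open>S2\<close> depends on these coordinates,
  so they are hidden instead of computed.\<close>

lemma prolong_vform:
  defines "uxx' \<equiv> (\<lambda>t x u ux uxx. pd_x (pd_x A) (t, x) * u + pd_x (pd_x B) (t, x) + 2 * pd_x A (t, x) * ux
      + A (t, x) * uxx - 2 * uxx * pd_x \<xi> (t, x) - ux * pd_x (pd_x \<xi>) (t, x))"
    and "vxx' \<equiv> (\<lambda>t x u v ux vx uxx vxx. pd_x (pd_x E0) (t, x) + pd_x (pd_x E1) (t, x) * u
      + 2 * pd_x E1 (t, x) * ux + E1 (t, x) * uxx
      + pd_x (pd_x G) (t, x) * v + 2 * pd_x G (t, x) * vx + G (t, x) * vxx
      - 2 * vxx * pd_x \<xi> (t, x) - vx * pd_x (pd_x \<xi>) (t, x))"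
  shows "\<exists>b1 b2 b3 b4 b5. prolong2 \<Xi> (((t, x, u, v), (ut, ux, vt, vx)), (utt, utx, uxx, vtt, vtx, vxx)) =
    (((a t, \<xi> (t, x), A (t, x) * u + B (t, x), E0 (t, x) + E1 (t, x) * u + G (t, x) * v),
      (zeta_ut \<Xi> ((t, x, u, v), (ut, ux, vt, vx)), zeta_ux \<Xi> ((t, x, u, v), (ut, ux, vt, vx)), b1,
       zeta_vx \<Xi> ((t, x, u, v), (ut, ux, vt, vx)))),
     (b2, b3, uxx' t x u ux uxx, b4, b5, vxx' t x u v ux vx uxx vxx))"
  unfolding prolong2.simps Let_def Dx1_zeta_vform uxx'_def vxx'_def Dx0.simps frechet_vform
  by (intro exI) (simp add: vform_def)

end

text \<open>The prolongation at a point depends only on the germ of the field. A field known on the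
  base domain may therefore be replaced by one that is given everywhere by a formula.\<close>

lemma prolong2_cong:
  assumes U: "open U" and eq: "\<And>z. z \<in> U \<Longrightarrow> X z = Y z" and z: "z \<in> U"
  shows "prolong2 X ((z, q), r) = prolong2 Y ((z, q), r)"
proof -
  have c: "xi0 X z = xi0 Y z" "xi1 X z = xi1 Y z" "eta1 X z = eta1 Y z" "eta2 X z = eta2 Y z" if "z \<in> U" for z
    using eq[OF that] by (simp_all add: xi0_def xi1_def eta1_def eta2_def)
  have f: "frechet_derivative (xi0 X) (at z) = frechet_derivative (xi0 Y) (at z)"
    "frechet_derivative (xi1 X) (at z) = frechet_derivative (xi1 Y) (at z)"
    "frechet_derivative (eta1 X) (at z) = frechet_derivative (eta1 Y) (at z)"
    "frechet_derivative (eta2 X) (at z) = frechet_derivative (eta2 Y) (at z)" if "z \<in> U" for z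
    using c frechet_derivative_cong_open[OF U that] by blast+
  have zt: "zeta_ut X (z, w) = zeta_ut Y (z, w)" "zeta_ux X (z, w) = zeta_ux Y (z, w)"
    "zeta_vt X (z, w) = zeta_vt Y (z, w)" "zeta_vx X (z, w) = zeta_vx Y (z, w)" if "z \<in> U" for z w
    by (cases w, simp add: f[OF that])+
  have fz: "frechet_derivative (zeta_ut X) (at (z, w)) = frechet_derivative (zeta_ut Y) (at (z, w))"
    "frechet_derivative (zeta_ux X) (at (z, w)) = frechet_derivative (zeta_ux Y) (at (z, w))"
    "frechet_derivative (zeta_vt X) (at (z, w)) = frechet_derivative (zeta_vt Y) (at (z, w))"
    "frechet_derivative (zeta_vx X) (at (z, w)) = frechet_derivative (zeta_vx Y) (at (z, w))" for w
    using z by (auto intro!: frechet_derivative_cong_open[OF open_Times[OF U open_UNIV]] simp: zt simp del: zeta_ut.simps zeta_ux.simps zeta_vt.simps zeta_vx.simps)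
  obtain ut ux vt vx where q: "q = (ut, ux, vt, vx)" by (metis prod.exhaust)
  obtain utt utx uxx vtt vtx vxx where r: "r = (utt, utx, uxx, vtt, vtx, vxx)" by (metis prod.exhaust)
  show ?thesis
    unfolding q r prolong2.simps Let_def Dx1.simps Dt1.simps Dx0.simps Dt0.simps fz f[OF z] zt[OF z] eq[OF z] ..
qed

section \<open>Determining equations\<close>

text \<open>The derivative has to vanish only in the direction \<open>w\<close> and only along the
  segment; the restriction of \<open>f\<close> to the segment then has derivative zero.\<close>

lemma constant_along:
  fixes f :: "'a::real_normed_vector \<Rightarrow> real"
  assumes "\<And>s. 0 \<le> s \<Longrightarrow> s \<le> 1 \<Longrightarrow> f differentiable (at (z + s *\<^sub>R w))"
    and "\<And>s. 0 \<le> s \<Longrightarrow> s \<le> 1 \<Longrightarrow> frechet_derivative f (at (z + s *\<^sub>R w)) w = 0"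
  shows "f (z + w) = f z"
proof -
  define g where "g = (\<lambda>s. f (z + s *\<^sub>R w))"
  have "(g has_field_derivative 0) (at s within {0..1})" if "s \<in> {0..1}" for s
  proof -
    have f: "(f has_derivative frechet_derivative f (at (z + s *\<^sub>R w))) (at (z + s *\<^sub>R w))"
      using assms(1)[of s] that unfolding frechet_derivative_works by simp
    have l: "((\<lambda>s. z + s *\<^sub>R w) has_derivative (\<lambda>h. h *\<^sub>R w)) (at s)"
      by (auto intro!: derivative_eq_intros)
    have "(g has_derivative (\<lambda>h. frechet_derivative f (at (z + s *\<^sub>R w)) (h *\<^sub>R w))) (at s)"
      using diff_chain_at[OF l f] by (simp add: g_def o_def)
    moreover have "(\<lambda>h. frechet_derivative f (at (z + s *\<^sub>R w)) (h *\<^sub>R w)) = (\<lambda>h. h * 0)"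
      using linear_scale[OF has_derivative_linear[OF f]] assms(2)[of s] that by auto
    ultimately have "(g has_derivative (\<lambda>h. h * 0)) (at s)" by metis
    moreover have "(\<lambda>h. h * 0) = (*) (0::real)" by (simp add: fun_eq_iff)
    ultimately show ?thesis unfolding has_field_derivative_def by (simp only: has_derivative_at_withinI)
  qed
  then obtain c where "\<forall>s\<in>{0..1}. g s = c"
    using has_field_derivative_zero_constant[of "{0..1}" g] by auto
  then have "g 1 = g 0" by simp
  then show ?thesis by (simp add: g_def)
qed

lemma frechet_derivative_zero_open:
  fixes f :: "'a::real_normed_vector \<Rightarrow> real"
  assumes "open U" "z \<in> U" "\<And>y. y \<in> U \<Longrightarrow> f y = 0"
  shows "frechet_derivative f (at z) w = 0"
  using frechet_derivative_cong_open[OF assms(1,2), of f "\<lambda>_. 0"] assms(3) by simp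

text \<open>Invariance under a translation passes to the derivative. Applied to translations in
  \<open>v\<close>, it shows that derivatives in x and \<open>u\<close> do not depend on
  \<open>v\<close> without exchanging mixed derivatives.\<close>

lemma frechet_derivative_translate:
  fixes f :: "'a::real_normed_vector \<Rightarrow> real"
  assumes U: "open U" and z: "z \<in> U" and inv: "\<And>y. y \<in> U \<Longrightarrow> f (y + w) = f y"
    and d: "f differentiable (at (z + w))"
  shows "frechet_derivative f (at (z + w)) = frechet_derivative f (at z)"
proof -
  have l: "((\<lambda>y. y + w) has_derivative (\<lambda>h. h)) (at z)" by (auto intro!: derivative_eq_intros)
  have "(f has_derivative frechet_derivative f (at (z + w))) (at (z + w))"
    using d unfolding frechet_derivative_works .
  from diff_chain_at[OF l this] have "((\<lambda>y. f (y + w)) has_derivative frechet_derivative f (at (z + w))) (at z)"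
    by (simp only: o_def)
  from has_derivative_transform_within_open[OF this U z inv] show ?thesis
    using frechet_derivative_eqI by metis
qed

lemma pd_x_zero_iff:
  assumes "smooth_on UNIV f"
  shows "(\<forall>x. pd_x f (t, x) = 0) \<longleftrightarrow> (\<forall>x. f (t, x) = f (t, 0))"
proof -
  have d: "((\<lambda>x. f (t, x)) has_real_derivative pd_x f (t, x)) (at x)" for x
  proof -
    have l: "((\<lambda>x. (t, x)) has_derivative (\<lambda>h. (0, h))) (at x)" by (auto intro!: derivative_eq_intros)
    have "((\<lambda>x. f (t, x)) has_derivative (\<lambda>h. h * pd_x f (t, x))) (at x)"
      using diff_chain_at[OF l smooth_on_UNIV_pd[OF assms, of "(t, x)"]] by (simp add: o_def)
    moreover have "(\<lambda>h. h * pd_x f (t, x)) = (*) (pd_x f (t, x))" by (simp add: fun_eq_iff)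
    ultimately show ?thesis unfolding has_field_derivative_def by simp
  qed
  show ?thesis
  proof
    assume "\<forall>x. pd_x f (t, x) = 0"
    then have "\<exists>c. \<forall>x\<in>UNIV. f (t, x) = c" using d
      by (intro has_field_derivative_zero_constant) (auto intro!: convex_UNIV)
    then show "\<forall>x. f (t, x) = f (t, 0)" by auto
  next
    assume "\<forall>x. f (t, x) = f (t, 0)"
    then have "(\<lambda>x. f (t, x)) = (\<lambda>x. f (t, 0))" by (simp add: fun_eq_iff)
    then have "((\<lambda>x. f (t, x)) has_real_derivative 0) (at x)" for x by simp
    then show "\<forall>x. pd_x f (t, x) = 0" using d DERIV_unique by blast
  qed
qed

lemma pd_t_zero:
  assumes "smooth_on UNIV f" "\<And>t. pd_t f (t, x) = 0"
  shows "f (t, x) = f (0, x)"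
proof -
  have d: "((\<lambda>t. f (t, x)) has_real_derivative 0) (at t)" for t
  proof -
    have l: "((\<lambda>t. (t, x)) has_derivative (\<lambda>h. (h, 0))) (at t)" by (auto intro!: derivative_eq_intros)
    have "((\<lambda>t. f (t, x)) has_derivative (\<lambda>h. h * pd_t f (t, x))) (at t)"
      using diff_chain_at[OF l smooth_on_UNIV_pd[OF assms(1), of "(t, x)"]] by (simp add: o_def)
    moreover have "(\<lambda>h. h * pd_t f (t, x)) = (*) 0" using assms(2) by (simp add: fun_eq_iff)
    ultimately show ?thesis unfolding has_field_derivative_def by simp
  qed
  then have "\<exists>c. \<forall>t\<in>UNIV. f (t, x) = c"
    by (intro has_field_derivative_zero_constant) auto
  then show ?thesis by auto
qed

text \<open>The values at 0, 1, -1 and 2 are four independent linear conditions on the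
  coefficients.\<close>

lemma cubic_zero:
  fixes a b c d :: real
  assumes "\<And>y. a + b * y + c * y\<^sup>2 + d * y ^ 3 = 0"
  shows "a = 0" "b = 0" "c = 0" "d = 0"
  using assms[of 0] assms[of 1] assms[of "-1"] assms[of 2] by (simp_all add: power2_eq_square power3_eq_cube)

text \<open>Only the condition on \<open>S2\<close> is exploited. It says that the prolonged
  \<open>uxx\<close> component equals \<open>eta2 X\<close> on the manifold, where
  \<open>utx\<close>, \<open>vxx\<close>, \<open>vx\<close> and \<open>ux\<close> are free jet
  coordinates, so that their powers can be split off one after the other.\<close>

lemma symmetry_stage1:
  assumes S: "valid_system S" and X: "is_symmetry S X"
  shows "\<exists>a \<xi> A B. smooth_on UNIV a \<and> smooth_on UNIV \<xi> \<and> smooth_on UNIV A \<and> smooth_on UNIV B \<and>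
    (\<forall>t x. 2 * pd_x A (t, x) = pd_x (pd_x \<xi>) (t, x)) \<and>
    (\<forall>z\<in>base_dom S. X z = vform a \<xi> A B (pd_x (pd_x B)) (pd_x (pd_x A)) (\<lambda>p. A p - 2 * pd_x \<xi> p) z)"
proof -
  define U where "U = base_dom S"
  define J where "J = uvals S"
  have oJ: "open J" and iJ: "is_interval J" and nJ: "J \<noteq> {}" using S by (auto simp: valid_system_def J_def)
  have U: "open U" using open_base_dom oJ by (simp add: U_def J_def)
  have inU: "(t, x, u, v) \<in> U \<longleftrightarrow> u \<in> J" for t x u v by (simp add: U_def base_dom_def J_def)
  have sX: "smooth_on U X" using X by (simp add: is_symmetry_def U_def)
  define f0 where "f0 = xi0 X"
  define f1 where "f1 = xi1 X"
  define h where "h = eta1 X"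
  define h2 where "h2 = eta2 X"
  have sm: "smooth_on U f0" "smooth_on U f1" "smooth_on U h" "smooth_on U h2"
    using xi_smooth[OF U sX] by (simp_all add: f0_def f1_def h_def h2_def)
  have dif: "f differentiable (at z)" if "smooth_on U f" "z \<in> U" for f :: "jet0 \<Rightarrow> real" and z
    using smooth_on_differentiable that by blast
  define T where "T = (\<lambda>g::jet0 \<Rightarrow> real. \<lambda>z ux vx. frechet_derivative g (at z) (0, 1, ux, vx))"
  have Teq: "T g z ux vx = d2 g z + ux * d3 g z + vx * d4 g z" if "smooth_on U g" "z \<in> U" for g z ux vx
    unfolding T_def frechet_quad[OF dif[OF that]] by simp
  have T0: "T g z ux vx = 0" if "\<And>z. z \<in> U \<Longrightarrow> g z = 0" "z \<in> U" for g z ux vx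
    unfolding T_def using frechet_derivative_zero_open[OF U that(2), of g] that(1) by blast
  \<comment> \<open>The value that \<open>S1 = 0\<close> prescribes for \<open>ut\<close> once
    \<open>uxx = v\<close>.\<close>
  define UT where "UT = (\<lambda>u v ux vx vxx. - (deriv (coefK S) u * ux * vx + coefK S u * vxx) + (deriv (coefD S) u * ux * ux + coefD S u * v) + coefF S u)"
  have main: "T (d2 h) (t,x,u,v) ux vx + ux * T (d3 h) (t,x,u,v) ux vx + vx * T (d4 h) (t,x,u,v) ux vx
       + v * d3 h (t,x,u,v) + vxx * d4 h (t,x,u,v)
     - 2 * utx * (d2 f0 (t,x,u,v) + ux * d3 f0 (t,x,u,v) + vx * d4 f0 (t,x,u,v))
     - UT u v ux vx vxx * (T (d2 f0) (t,x,u,v) ux vx + ux * T (d3 f0) (t,x,u,v) ux vx + vx * T (d4 f0) (t,x,u,v) ux vx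
       + v * d3 f0 (t,x,u,v) + vxx * d4 f0 (t,x,u,v))
     - 2 * v * (d2 f1 (t,x,u,v) + ux * d3 f1 (t,x,u,v) + vx * d4 f1 (t,x,u,v))
     - ux * (T (d2 f1) (t,x,u,v) ux vx + ux * T (d3 f1) (t,x,u,v) ux vx + vx * T (d4 f1) (t,x,u,v) ux vx
       + v * d3 f1 (t,x,u,v) + vxx * d4 f1 (t,x,u,v)) = h2 (t,x,u,v)"
    if u: "u \<in> J" for t x u v ux vx vxx utx
  proof -
    define ut where "ut = UT u v ux vx vxx"
    define z where "z = (t, x, u, v)"
    define j :: jet2 where "j = (((t, x, u, v), (ut, ux, 0, vx)), (0, utx, v, 0, 0, vxx))"
    have z: "z \<in> U" using u inU by (simp add: z_def)
    have "S1 S j = 0" unfolding j_def using u S1_eq[OF S, of u] by (simp add: J_def ut_def UT_def del: S1.simps)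
    moreover have "S2 j = 0" by (simp add: j_def)
    moreover have "fst (fst j) \<in> base_dom S" using z by (simp add: j_def U_def z_def)
    ultimately have "frechet_derivative S2 (at j) (prolong2 X j) = 0" using X unfolding is_symmetry_def by blast
    then have "fst (snd (snd (snd (prolong2 X j)))) = snd (snd (snd (fst (fst (prolong2 X j)))))"
      unfolding frechet_S2 by simp
    then have "Dx1 (zeta_ux X) ((z, (ut, ux, 0, vx)), (0, utx, v, 0, 0, vxx))
        - utx * Dx0 f0 (z, (ut, ux, 0, vx)) - v * Dx0 f1 (z, (ut, ux, 0, vx)) = h2 z"
      unfolding j_def prolong2.simps Let_def
      by (simp add: z_def f0_def f1_def h2_def eta2_def case_prod_beta del: Dx1.simps Dx0.simps)
    then have "T (d2 h) z ux vx + ux * T (d3 h) z ux vx + vx * T (d4 h) z ux vx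
       + v * d3 h z + vxx * d4 h z
     - 2 * utx * (d2 f0 z + ux * d3 f0 z + vx * d4 f0 z)
     - ut * (T (d2 f0) z ux vx + ux * T (d3 f0) z ux vx + vx * T (d4 f0) z ux vx
       + v * d3 f0 z + vxx * d4 f0 z)
     - 2 * v * (d2 f1 z + ux * d3 f1 z + vx * d4 f1 z)
     - ux * (T (d2 f1) z ux vx + ux * T (d3 f1) z ux vx + vx * T (d4 f1) z ux vx
       + v * d3 f1 z + vxx * d4 f1 z) = h2 z"
      unfolding Dx1_zeta_ux[OF U z sX] Dx0.simps frechet_quad[OF dif[OF sm(1) z]] frechet_quad[OF dif[OF sm(2) z]]
        f0_def[symmetric] f1_def[symmetric] h_def[symmetric] T_def
      by (simp add: algebra_simps)
    then show ?thesis unfolding z_def ut_def .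
  qed
  \<comment> \<open>\<open>utx\<close> enters affinely; comparing its values 1 and 0 isolates the
    coefficient.\<close>
  have f0z: "d2 f0 z = 0" "d3 f0 z = 0" "d4 f0 z = 0" if z: "z \<in> U" for z
  proof -
    obtain t x u v where zz: "z = (t, x, u, v)" by (metis prod.exhaust)
    have u: "u \<in> J" using z inU zz by simp
    have e: "d2 f0 z + ux * d3 f0 z + vx * d4 f0 z = 0" for ux vx
      using main[OF u, where t=t and x=x and v=v and ux=ux and vx=vx and vxx=0 and utx=1]
        main[OF u, where t=t and x=x and v=v and ux=ux and vx=vx and vxx=0 and utx=0]
      unfolding zz by (simp add: algebra_simps)
    show "d2 f0 z = 0" "d3 f0 z = 0" "d4 f0 z = 0" using e[of 0 0] e[of 1 0] e[of 0 1] by simp_all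
  qed
  have T0f: "T (d2 f0) z ux vx = 0" "T (d3 f0) z ux vx = 0" "T (d4 f0) z ux vx = 0" if z: "z \<in> U" for z ux vx
    using T0[OF f0z(1) z] T0[OF f0z(2) z] T0[OF f0z(3) z] by auto
  have main2: "T (d2 h) z ux vx + ux * T (d3 h) z ux vx + vx * T (d4 h) z ux vx
       + v * d3 h z + vxx * d4 h z
     - 2 * v * (d2 f1 z + ux * d3 f1 z + vx * d4 f1 z)
     - ux * (T (d2 f1) z ux vx + ux * T (d3 f1) z ux vx + vx * T (d4 f1) z ux vx
       + v * d3 f1 z + vxx * d4 f1 z) = h2 z"
    if "u \<in> J" "z = (t, x, u, v)" for z t x u v ux vx vxx
  proof -
    have "z \<in> U" using that inU by simp
    then show ?thesis
      using main[OF that(1), where t=t and x=x and v=v and ux=ux and vx=vx and vxx=vxx and utx=0] f0z[of z] T0f[of z]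
      unfolding that(2) by simp
  qed
  \<comment> \<open>Likewise the coefficient of \<open>vxx\<close>, which is itself affine in
    \<open>ux\<close>, has to vanish.\<close>
  have v0: "d4 h z = 0" "d4 f1 z = 0" if z: "z \<in> U" for z
  proof -
    obtain t x u v where zz: "z = (t, x, u, v)" by (metis prod.exhaust)
    have u: "u \<in> J" using z inU zz by simp
    have e: "d4 h z - ux * d4 f1 z = 0" for ux
      using main2[OF u zz, where ux=ux and vx=0 and vxx=0] main2[OF u zz, where ux=ux and vx=0 and vxx=1]
      by (simp add: algebra_simps)
    show "d4 h z = 0" "d4 f1 z = 0" using e[of 0] e[of 1] by simp_all
  qed
  have T4: "T (d4 h) z ux vx = 0" "T (d4 f1) z ux vx = 0" if z: "z \<in> U" for z ux vx
    using T0[OF v0(1) z] T0[OF v0(2) z] by auto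
  \<comment> \<open>With \<open>vx = vxx = 0\<close> the condition is a cubic polynomial in
    \<open>ux\<close>; these are its four coefficients.\<close>
  have quad: "d2 (d2 h) z + v * d3 h z - 2 * v * d2 f1 z - h2 z = 0"
    "d3 (d2 h) z + d2 (d3 h) z - 3 * v * d3 f1 z - d2 (d2 f1) z = 0"
    "d3 (d3 h) z - d3 (d2 f1) z - d2 (d3 f1) z = 0"
    "d3 (d3 f1) z = 0"
    if u: "u \<in> J" and zz: "z = (t, x, u, v)" for z t x u v
  proof -
    have z: "z \<in> U" using that inU by simp
    have "(d2 (d2 h) z + v * d3 h z - 2 * v * d2 f1 z - h2 z)
      + (d3 (d2 h) z + d2 (d3 h) z - 3 * v * d3 f1 z - d2 (d2 f1) z) * y
      + (d3 (d3 h) z - d3 (d2 f1) z - d2 (d3 f1) z) * y\<^sup>2 + (- d3 (d3 f1) z) * y ^ 3 = 0" for y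
      using main2[OF u zz, where ux=y and vx=0 and vxx=0] v0[OF z] T4[OF z]
      unfolding Teq[OF smooth_on_ds(2)[OF sm(3)] z] Teq[OF smooth_on_ds(3)[OF sm(3)] z]
        Teq[OF smooth_on_ds(2)[OF sm(2)] z] Teq[OF smooth_on_ds(3)[OF sm(2)] z]
      by (simp add: algebra_simps power2_eq_square power3_eq_cube)
    from cubic_zero[OF this] show "d2 (d2 h) z + v * d3 h z - 2 * v * d2 f1 z - h2 z = 0"
    "d3 (d2 h) z + d2 (d3 h) z - 3 * v * d3 f1 z - d2 (d2 f1) z = 0"
    "d3 (d3 h) z - d3 (d2 f1) z - d2 (d3 f1) z = 0"
    "d3 (d3 f1) z = 0" by simp_all
  qed
  have moveU: "(t, x, u, v) + s *\<^sub>R (0, x' - x, u' - u, v' - v) \<in> U"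
    if "u \<in> J" "u' \<in> J" "0 \<le> s" "s \<le> 1" for t x u v x' u' v' s
  proof -
    have "convex J" using iJ is_interval_convex by blast
    then have "(1 - s) *\<^sub>R u + s *\<^sub>R u' \<in> J" using that by (auto simp: convex_alt)
    then show ?thesis by (simp add: inU algebra_simps)
  qed
  \<comment> \<open>Points over the same time are joined by a segment inside \<open>U\<close>,
    because the interval \<open>J\<close> is convex.\<close>
  have move: "f (t, x', u', v') = f (t, x, u, v)"
    if "u \<in> J" "u' \<in> J" "smooth_on U f"
      "\<And>s. 0 \<le> s \<Longrightarrow> s \<le> 1 \<Longrightarrow> (let z = (t, x, u, v) + s *\<^sub>R (0, x' - x, u' - u, v' - v) in
         (x' - x) * d2 f z + (u' - u) * d3 f z + (v' - v) * d4 f z = 0)" for f t x u v x' u' v'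
  proof -
    have "f ((t, x, u, v) + (0, x' - x, u' - u, v' - v)) = f (t, x, u, v)"
    proof (rule constant_along)
      fix s :: real assume s: "0 \<le> s" "s \<le> 1"
      show "f differentiable at ((t, x, u, v) + s *\<^sub>R (0, x' - x, u' - u, v' - v))"
        using dif[OF that(3) moveU[OF that(1,2) s]] .
      show "frechet_derivative f (at ((t, x, u, v) + s *\<^sub>R (0, x' - x, u' - u, v' - v))) (0, x' - x, u' - u, v' - v) = 0"
        unfolding frechet_quad[OF dif[OF that(3) moveU[OF that(1,2) s]]] using that(4)[OF s] by (simp only: Let_def)
    qed
    then show ?thesis by simp
  qed
  have hv: "h (z + (0, 0, 0, s)) = h z" if z: "z \<in> U" for z s
  proof -
    obtain t x u v where zz: "z = (t, x, u, v)" by (metis prod.exhaust)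
    have u: "u \<in> J" using z inU zz by simp
    have "h (t, x, u, v + s) = h (t, x, u, v)"
      using moveU[OF u u, where x=x and x'=x and t=t] by (intro move[OF u u sm(3)]) (auto simp: Let_def inU intro!: v0)
    then show ?thesis by (simp add: zz)
  qed
  have trU: "z + (0, 0, 0, s) \<in> U" if "z \<in> U" for z s
    using that by (cases z) (auto simp: inU)
  have tr: "d2 g (z + (0, 0, 0, s)) = d2 g z" "d3 g (z + (0, 0, 0, s)) = d3 g z"
    if "z \<in> U" "smooth_on U g" "\<And>z. z \<in> U \<Longrightarrow> g (z + (0, 0, 0, s)) = g z" for g :: "jet0 \<Rightarrow> real" and z s
    unfolding d2_def d3_def using frechet_derivative_translate[OF U that(1,3) dif[OF that(2) trU[OF that(1)]]] by auto
  have hvd: "d3 (d2 h) (z + (0, 0, 0, s)) = d3 (d2 h) z" "d2 (d3 h) (z + (0, 0, 0, s)) = d2 (d3 h) z"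
    if "z \<in> U" for z s
    using tr[OF that smooth_on_ds(2)[OF sm(3)] tr(1)[OF _ sm(3) hv]]
      tr[OF that smooth_on_ds(3)[OF sm(3)] tr(2)[OF _ sm(3) hv]] by auto
  have f1v: "f1 (z + (0, 0, 0, s)) = f1 z" if z: "z \<in> U" for z s
  proof -
    obtain t x u v where zz: "z = (t, x, u, v)" by (metis prod.exhaust)
    have u: "u \<in> J" using z inU zz by simp
    have "f1 (t, x, u, v + s) = f1 (t, x, u, v)"
      using moveU[OF u u, where x=x and x'=x and t=t] by (intro move[OF u u sm(2)]) (auto simp: Let_def inU intro!: v0)
    then show ?thesis by (simp add: zz)
  qed
  have f1vd: "d2 (d2 f1) (z + (0, 0, 0, s)) = d2 (d2 f1) z" "d3 f1 (z + (0, 0, 0, s)) = d3 f1 z" if "z \<in> U" for z s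
    using tr[OF that smooth_on_ds(2)[OF sm(2)] tr(1)[OF _ sm(2) f1v]] tr(2)[OF that sm(2) f1v] by auto
  \<comment> \<open>In the coefficient of \<open>ux\<close>, every factor except the explicit
    \<open>v\<close> is invariant under shifts of \<open>v\<close>. Comparing \<open>v\<close> with
    \<open>v + 1\<close> leaves three times the u-derivative of \<open>f1\<close>.\<close>
  have f1u: "d3 f1 z = 0" if z: "z \<in> U" for z
  proof -
    obtain t x u v where zz: "z = (t, x, u, v)" by (metis prod.exhaust)
    have u: "u \<in> J" using z inU zz by simp
    have z1: "z + (0, 0, 0, 1) = (t, x, u, v + 1)" by (simp add: zz)
    have "d3 (d2 h) z + d2 (d3 h) z - 3 * v * d3 f1 z - d2 (d2 f1) z = 0"
      "d3 (d2 h) z + d2 (d3 h) z - 3 * (v + 1) * d3 f1 z - d2 (d2 f1) z = 0"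
      using quad(2)[OF u zz] quad(2)[OF u z1] hvd[OF z, of 1] f1vd[OF z, of 1] by simp_all
    then show ?thesis by (simp add: algebra_simps)
  qed
  obtain u0 where u0: "u0 \<in> J" using nJ by blast
  define a where "a = (\<lambda>t. f0 (t, 0, u0, 0))"
  define \<xi> where "\<xi> = (\<lambda>p::real \<times> real. f1 (fst p, snd p, u0, 0))"
  \<comment> \<open>\<open>h\<close> will turn out to be affine in \<open>u\<close> and free of
    \<open>v\<close>, so its slope and its value over the fixed \<open>u0\<close> with
    \<open>v = 0\<close> determine it.\<close>
  define A where "A = (\<lambda>p::real \<times> real. d3 h (fst p, snd p, u0, 0))"
  define B where "B = (\<lambda>p::real \<times> real. h (fst p, snd p, u0, 0) - A p * u0)"
  have emb: "smooth_on UNIV (\<lambda>p::real \<times> real. f (fst p, snd p, u0, 0))" if f: "smooth_on U f" for f :: "jet0 \<Rightarrow> real"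
  proof -
    have "Ck_on k U f \<Longrightarrow> Ck_on k UNIV (\<lambda>p::real \<times> real. f (fst p, snd p, u0, 0))" for k and f :: "jet0 \<Rightarrow> real"
    proof (induction k arbitrary: f)
      case 0
      then show ?case
        by (auto intro!: continuous_on_compose2[of U f] continuous_intros simp: inU u0)
    next
      case (Suc k)
      show ?case
      proof (rule Ck_on_SucI[OF open_UNIV])
        fix p :: "real \<times> real"
        have l: "((\<lambda>p. (fst p, snd p, u0, 0)) has_derivative (\<lambda>w. (fst w, snd w, 0, 0))) (at p)"
          by (intro derivative_intros)
        have "(f has_derivative frechet_derivative f (at (fst p, snd p, u0, 0))) (at (fst p, snd p, u0, 0))"
          using Suc.prems inU u0 unfolding frechet_derivative_works[symmetric] by simp
        from diff_chain_at[OF l this] show "((\<lambda>p. f (fst p, snd p, u0, 0)) has_derivative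
          (\<lambda>w. frechet_derivative f (at (fst p, snd p, u0, 0)) (fst w, snd w, 0, 0))) (at p)"
          by (simp only: o_def)
      next
        show "Ck_on k UNIV (\<lambda>p. frechet_derivative f (at (fst p, snd p, u0, 0)) (fst w, snd w, 0, 0))" for w :: "real \<times> real"
          using Suc.IH[of "\<lambda>z. frechet_derivative f (at z) (fst w, snd w, 0, 0)"] Suc.prems[unfolded Ck_on.simps] by blast
      qed
    qed
    then show ?thesis using f unfolding smooth_on_def by blast
  qed
  have s\<xi>: "smooth_on UNIV \<xi>" unfolding \<xi>_def by (rule emb[OF sm(2)])
  have sA: "smooth_on UNIV A" unfolding A_def by (rule emb[OF smooth_on_ds(3)[OF sm(3)]])
  have sB: "smooth_on UNIV B" unfolding B_def
    by (intro smooth_on_diff smooth_on_mult emb[OF sm(3)] sA smooth_on_const) auto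
  have sa: "smooth_on UNIV a"
    using smooth_on_slice[OF emb[OF sm(1)], of 0] by (simp add: a_def)
  have fa: "f0 (t, x, u, v) = a t" if u: "u \<in> J" for t x u v
    unfolding a_def using moveU[OF u0 u] by (intro move[OF u0 u sm(1)]) (simp add: Let_def inU f0z)
  have f\<xi>: "f1 (t, x, u, v) = \<xi> (t, x)" if u: "u \<in> J" for t x u v
    unfolding \<xi>_def fst_conv snd_conv using moveU[OF u0 u] by (intro move[OF u0 u sm(2)]) (simp add: Let_def inU f1u v0)
  have lift: "d1 g (t, x, u, v) = pd_t k (t, x)" "d2 g (t, x, u, v) = pd_x k (t, x)" "d3 g (t, x, u, v) = 0"
    if "u \<in> J" "smooth_on UNIV k" "\<And>t x u v. u \<in> J \<Longrightarrow> g (t, x, u, v) = k (t, x)" for g :: "jet0 \<Rightarrow> real" and k t x u v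
  proof -
    have kd: "((\<lambda>z::jet0. k (fst z, fst (snd z))) has_derivative
       (\<lambda>w. fst w * pd_t k (t, x) + fst (snd w) * pd_x k (t, x))) (at (t, x, u, v))"
      using has_derivative_lift0[of k t x u v] smooth_on_differentiable[OF that(2)] by blast
    have ke: "frechet_derivative g (at (t, x, u, v)) = frechet_derivative (\<lambda>z. k (fst z, fst (snd z))) (at (t, x, u, v))"
      by (rule frechet_derivative_cong_open[OF U]) (use that inU in auto)
    have "frechet_derivative g (at (t, x, u, v)) = (\<lambda>w. fst w * pd_t k (t, x) + fst (snd w) * pd_x k (t, x))"
      by (simp only: ke frechet_derivative_eqI[OF kd])
    then show "d1 g (t, x, u, v) = pd_t k (t, x)" "d2 g (t, x, u, v) = pd_x k (t, x)" "d3 g (t, x, u, v) = 0"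
      by (simp_all add: d1_def d2_def d3_def)
  qed
  have d2f1: "d2 f1 (t, x, u, v) = pd_x \<xi> (t, x)" if "u \<in> J" for t x u v
    using lift(2)[OF that s\<xi> f\<xi>] .
  have d22f1: "d2 (d2 f1) (t, x, u, v) = pd_x (pd_x \<xi>) (t, x)" "d3 (d2 f1) (t, x, u, v) = 0" if "u \<in> J" for t x u v
    using lift(2,3)[OF that smooth_pd(2)[OF s\<xi>] d2f1] by auto
  have d33h: "d3 (d3 h) (t, x, u, v) = 0" if u: "u \<in> J" for t x u v
  proof -
    have "d2 (d3 f1) (t, x, u, v) = 0"
      unfolding d2_def using frechet_derivative_zero_open[OF U _ f1u] inU u by simp
    then show ?thesis using quad(3)[OF u refl, of t x v] d22f1(2)[OF u, of t x v] by simp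
  qed
  have d3h: "d3 h (t, x, u, 0) = A (t, x)" if u: "u \<in> J" for t x u
    unfolding A_def fst_conv snd_conv using moveU[OF u0 u, where x=x and x'=x and t=t and v=0 and v'=0]
    by (intro move[OF u0 u smooth_on_ds(3)[OF sm(3)]]) (auto simp: Let_def inU d33h)
  have hform: "h (t, x, u, v) = A (t, x) * u + B (t, x)" if u: "u \<in> J" for t x u v
  proof -
    define g where "g = (\<lambda>z. h z - A (t, x) * fst (snd (snd z)))"
    have gd: "(g has_derivative (\<lambda>w. frechet_derivative h (at z) w - A (t, x) * fst (snd (snd w)))) (at z)" if "z \<in> U" for z
      unfolding g_def by (auto intro!: derivative_eq_intros smooth_on_has_derivative[OF sm(3) that])
    have "g ((t, x, u0, 0) + (0, 0, u - u0, 0)) = g (t, x, u0, 0)"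
    proof (rule constant_along)
      fix s :: real assume s: "0 \<le> s" "s \<le> 1"
      have w: "(t, x, u0, 0) + s *\<^sub>R (0, 0, u - u0, 0) \<in> U"
        using moveU[OF u0 u s, of t x 0 x 0] by simp
      show "g differentiable at ((t, x, u0, 0) + s *\<^sub>R (0, 0, u - u0, 0))"
        using gd[OF w] unfolding differentiable_def by blast
      have "u0 + s * (u - u0) \<in> J" using w by (simp add: inU)
      from d3h[OF this, of t x] frechet_quad[OF dif[OF sm(3) w], of 0 0 "u - u0" 0]
      show "frechet_derivative g (at ((t, x, u0, 0) + s *\<^sub>R (0, 0, u - u0, 0))) (0, 0, u - u0, 0) = 0"
        unfolding frechet_derivative_eqI[OF gd[OF w]] by simp
    qed
    then have "h (t, x, u, 0) = A (t, x) * u + B (t, x)" by (simp add: g_def B_def algebra_simps)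
    moreover have "h (t, x, u, v) = h (t, x, u, 0)" using hv[of "(t, x, u, 0)" v] u inU by simp
    ultimately show ?thesis by simp
  qed
  have hd: "frechet_derivative h (at (t, x, u, v)) (w1, w2, w3, w4) =
     (w1 * pd_t A (t, x) + w2 * pd_x A (t, x)) * u + A (t, x) * w3 + (w1 * pd_t B (t, x) + w2 * pd_x B (t, x))"
    if "u \<in> J" for t x u v w1 w2 w3 w4
  proof -
    \<comment> \<open>The last arguments of \<open>vform\<close> are placeholders; only the u
      component is compared.\<close>
    have "frechet_derivative h (at (t, x, u, v)) = frechet_derivative (eta1 (vform a \<xi> A B B B B)) (at (t, x, u, v))"
      by (rule frechet_derivative_cong_open[OF U]) (use that inU hform in \<open>auto simp: eta1_def vform_def\<close>)
    then show ?thesis using frechet_vform(3)[OF sa s\<xi> sA sB sB sB sB] by simp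
  qed
  have d2h: "d2 h (t, x, u, v) = pd_x A (t, x) * u + pd_x B (t, x)" "d3 h (t, x, u, v) = A (t, x)" if "u \<in> J" for t x u v
    using hd[OF that] by (simp_all add: d2_def d3_def)
  have d22h: "d2 (d2 h) (t, x, u, v) = pd_x (pd_x A) (t, x) * u + pd_x (pd_x B) (t, x)" "d3 (d2 h) (t, x, u, v) = pd_x A (t, x)"
    if "u \<in> J" for t x u v
  proof -
    have "frechet_derivative (d2 h) (at (t, x, u, v)) = frechet_derivative (eta1 (vform a \<xi> (pd_x A) (pd_x B) B B B)) (at (t, x, u, v))"
      by (rule frechet_derivative_cong_open[OF U]) (use that inU d2h in \<open>auto simp: eta1_def vform_def\<close>)
    then show "d2 (d2 h) (t, x, u, v) = pd_x (pd_x A) (t, x) * u + pd_x (pd_x B) (t, x)" "d3 (d2 h) (t, x, u, v) = pd_x A (t, x)"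
      using frechet_vform(3)[OF sa s\<xi> smooth_pd(2)[OF sA] smooth_pd(2)[OF sB] sB sB sB] by (simp_all add: d2_def[of "d2 h"] d3_def[of "d2 h"])
  qed
  have d23h: "d2 (d3 h) (t, x, u, v) = pd_x A (t, x)" if "u \<in> J" for t x u v
    using lift(2)[OF that sA d2h(2)] .
  have "2 * pd_x A (t, x) = pd_x (pd_x \<xi>) (t, x)" for t x
    using quad(2)[OF u0 refl, of t x 0] d22h(2)[OF u0, of t x 0] d23h[OF u0, of t x 0] d22f1(1)[OF u0, of t x 0] by simp
  moreover have "X z = vform a \<xi> A B (pd_x (pd_x B)) (pd_x (pd_x A)) (\<lambda>p. A p - 2 * pd_x \<xi> p) z" if z: "z \<in> U" for z
  proof -
    obtain t x u v where zz: "z = (t, x, u, v)" by (metis prod.exhaust)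
    have u: "u \<in> J" using z inU zz by simp
    have "h2 z = pd_x (pd_x B) (t, x) + pd_x (pd_x A) (t, x) * u + (A (t, x) - 2 * pd_x \<xi> (t, x)) * v"
      using quad(1)[OF u zz] d22h(1)[OF u, of t x v] d2h(2)[OF u, of t x v] d2f1[OF u, of t x v] by (simp add: zz algebra_simps)
    moreover have "X z = (f0 z, f1 z, h z, h2 z)"
      by (simp add: f0_def f1_def h_def h2_def xi0_def xi1_def eta1_def eta2_def split: prod.split)
    ultimately show ?thesis using fa[OF u] f\<xi>[OF u] hform[OF u] by (simp add: zz vform_def)
  qed
  ultimately show ?thesis using sa s\<xi> sA sB U_def by blast
qed

text \<open>The three equations are the coefficient of \<open>vxx\<close>, the coefficient of
  \<open>v\<close> (that is, of \<open>uxx\<close>) and the free term in the condition on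
  \<open>S1\<close>. The x component is p x + q; translations in x are always symmetries, so q does
  not occur.\<close>

definition determining :: "rd_system \<Rightarrow> (real \<Rightarrow> real) \<Rightarrow> (real \<Rightarrow> real) \<Rightarrow> (real \<times> real \<Rightarrow> real) \<Rightarrow> real \<Rightarrow> bool" where
  "determining S a A B p \<longleftrightarrow> smooth_on UNIV a \<and> smooth_on UNIV A \<and> smooth_on UNIV B \<and>
    (\<forall>t x. \<forall>u\<in>uvals S.
       deriv (coefK S) u * (A t * u + B (t, x)) = coefK S u * (4 * p - deriv a t) \<and>
       deriv (coefD S) u * (A t * u + B (t, x)) = coefD S u * (2 * p - deriv a t) \<and>
       deriv (coefF S) u * (A t * u + B (t, x)) = (A t - deriv a t) * coefF S u + deriv A t * u + pd_t B (t, x)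
         + coefK S u * pd_x (pd_x (pd_x (pd_x B))) (t, x) - coefD S u * pd_x (pd_x B) (t, x))"

text \<open>The v component follows from the u component through v = u_xx: two x-derivatives of a
  quantity, with x scaled at rate \<open>p\<close>, contribute \<open>- 2 * p\<close>.\<close>

definition field_of :: "(real \<Rightarrow> real) \<Rightarrow> (real \<Rightarrow> real) \<Rightarrow> (real \<times> real \<Rightarrow> real) \<Rightarrow> real \<Rightarrow> real \<Rightarrow> vfield" where
  "field_of a A B p q = (\<lambda>(t, x, u, v).
     (a t, p * x + q, A t * u + B (t, x), pd_x (pd_x B) (t, x) + (A t - 2 * p) * v))"

text \<open>\<open>h\<close>, \<open>hx\<close>, \<open>gx\<close>, \<open>hxx\<close> and
  \<open>gxx\<close> are the components of the prolonged field along \<open>u\<close>,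
  \<open>ux\<close>, \<open>vx\<close>, \<open>uxx\<close> and \<open>vxx\<close>. The jet point is
  not yet restricted to the manifold.\<close>

lemma frechet_S_vform:
  fixes t x u v ut ux vt vx utt utx uxx vtt vtx vxx :: real
  assumes S: "valid_system S" and u: "u \<in> uvals S"
    and sm: "smooth_on UNIV a" "smooth_on UNIV \<xi>" "smooth_on UNIV A" "smooth_on UNIV B"
    "smooth_on UNIV E0" "smooth_on UNIV E1" "smooth_on UNIV G"
  defines "j \<equiv> (((t, x, u, v), (ut, ux, vt, vx)), (utt, utx, uxx, vtt, vtx, vxx))"
    and "h \<equiv> A (t, x) * u + B (t, x)"
    and "hx \<equiv> pd_x A (t, x) * u + pd_x B (t, x) + (A (t, x) - pd_x \<xi> (t, x)) * ux"
    and "gx \<equiv> pd_x E0 (t, x) + pd_x E1 (t, x) * u + E1 (t, x) * ux + pd_x G (t, x) * v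
       + (G (t, x) - pd_x \<xi> (t, x)) * vx"
    and "hxx \<equiv> pd_x (pd_x A) (t, x) * u + pd_x (pd_x B) (t, x) + 2 * pd_x A (t, x) * ux
      + A (t, x) * uxx - 2 * uxx * pd_x \<xi> (t, x) - ux * pd_x (pd_x \<xi>) (t, x)"
    and "gxx \<equiv> pd_x (pd_x E0) (t, x) + pd_x (pd_x E1) (t, x) * u + 2 * pd_x E1 (t, x) * ux + E1 (t, x) * uxx
      + pd_x (pd_x G) (t, x) * v + 2 * pd_x G (t, x) * vx + G (t, x) * vxx
      - 2 * vxx * pd_x \<xi> (t, x) - vx * pd_x (pd_x \<xi>) (t, x)"
  shows "frechet_derivative (S1 S) (at j) (prolong2 (vform a \<xi> A B E0 E1 G) j) =
     - (pd_t A (t, x) * u + pd_t B (t, x) + (A (t, x) - deriv a t) * ut - ux * pd_t \<xi> (t, x))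
     - (deriv (deriv (coefK S)) u * h * ux * vx + deriv (coefK S) u * hx * vx
        + deriv (coefK S) u * ux * gx + deriv (coefK S) u * h * vxx + coefK S u * gxx)
     + (deriv (deriv (coefD S)) u * h * ux * ux + 2 * deriv (coefD S) u * ux * hx
        + deriv (coefD S) u * h * uxx + coefD S u * hxx)
     + deriv (coefF S) u * h" (is ?S1)
    and "frechet_derivative S2 (at j) (prolong2 (vform a \<xi> A B E0 E1 G) j)
     = hxx - (E0 (t, x) + E1 (t, x) * u + G (t, x) * v)" (is ?S2)
proof -
  obtain b1 b2 b3 b4 b5 where e: "prolong2 (vform a \<xi> A B E0 E1 G) j =
    (((a t, \<xi> (t, x), h, E0 (t, x) + E1 (t, x) * u + G (t, x) * v),
      (pd_t A (t, x) * u + pd_t B (t, x) + (A (t, x) - deriv a t) * ut - ux * pd_t \<xi> (t, x), hx, b1, gx)),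
     (b2, b3, hxx, b4, b5, gxx))"
    using prolong_vform[OF sm, of t x u v ut ux vt vx utt utx uxx vtt vtx vxx]
    unfolding zeta_vform[OF sm] j_def h_def hxx_def gxx_def hx_def gx_def
    by (auto simp: algebra_simps)
  show ?S1 unfolding e unfolding j_def using frechet_S1[OF S u] by simp
  show ?S2 unfolding e frechet_S2 by simp
qed

text \<open>The coefficient equation differentiated once in \<open>u\<close>. For \<open>K\<close>
  and \<open>D\<close> this is the condition that belongs to the monomials \<open>ux * vx\<close>
  and \<open>ux * ux\<close>.\<close>

lemma deriv_eq_on_open:
  fixes f :: "real \<Rightarrow> real"
  assumes J: "open J" and u: "u \<in> J" and f: "smooth_on J f"
    and e: "\<And>u. u \<in> J \<Longrightarrow> deriv f u * (\<alpha> * u + \<beta>) = f u * \<sigma>"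
  shows "deriv (deriv f) u * (\<alpha> * u + \<beta>) + deriv f u * \<alpha> = deriv f u * \<sigma>"
proof -
  note d = smooth_on_real_deriv[OF f u] smooth_on_real_deriv[OF smooth_on_deriv[OF J f] u]
  have "((\<lambda>u. deriv f u * (\<alpha> * u + \<beta>)) has_real_derivative deriv (deriv f) u * (\<alpha> * u + \<beta>) + deriv f u * \<alpha>) (at u)"
    using d by (auto intro!: derivative_eq_intros)
  moreover have "((\<lambda>u. f u * \<sigma>) has_real_derivative deriv f u * \<sigma>) (at u)"
    using d by (auto intro!: derivative_eq_intros)
  moreover have "((\<lambda>u. deriv f u * (\<alpha> * u + \<beta>)) has_real_derivative deriv f u * \<sigma>) (at u)"
    using has_field_derivative_transform_within_open[OF calculation(2) J u, of "\<lambda>u. deriv f u * (\<alpha> * u + \<beta>)"] e by simp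
  ultimately show ?thesis using DERIV_unique by blast
qed

lemma deriv_zero_const:
  assumes S: "open J" "is_interval J" and f: "smooth_on J (f :: real \<Rightarrow> real)"
    and z: "\<And>u. u \<in> J \<Longrightarrow> deriv f u = 0"
  shows "\<exists>c. \<forall>u\<in>J. f u = c"
proof (rule has_field_derivative_zero_constant)
  show "convex J" using S is_interval_convex by blast
  show "(f has_real_derivative 0) (at u within J)" if "u \<in> J" for u
    using smooth_on_real_deriv[OF f that] z[OF that] by (simp add: has_field_derivative_at_within)
qed

lemma pd_x_zero_fun: "pd_x (\<lambda>_. 0) = (\<lambda>_. 0)"
  by (simp add: fun_eq_iff pd_x_def)

lemma pd_t_zero_fun: "pd_t (\<lambda>_. c) = (\<lambda>_. 0)" "pd_x (\<lambda>_. c) = (\<lambda>_. 0)"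
  by (simp_all add: fun_eq_iff pd_x_def pd_t_def)

lemma pd_time_fun:
  assumes "smooth_on UNIV A"
  shows "pd_t (\<lambda>p. A (fst p)) = (\<lambda>p. deriv A (fst p))" "pd_x (\<lambda>p. A (fst p)) = (\<lambda>_. 0)"
proof -
  have "((\<lambda>p. A (fst p)) has_derivative (\<lambda>w. deriv A (fst p) * fst w)) (at p)" for p :: "real \<times> real"
  proof -
    have f: "(A has_derivative (*) (deriv A (fst p))) (at (fst p))"
      using smooth_on_real_deriv[OF assms, of "fst p"] unfolding has_field_derivative_def by simp
    show ?thesis using diff_chain_at[OF has_derivative_fst[OF has_derivative_ident] f] by (simp add: o_def)
  qed
  from pd_eq[OF this]
  show "pd_t (\<lambda>p. A (fst p)) = (\<lambda>p. deriv A (fst p))" "pd_x (\<lambda>p. A (fst p)) = (\<lambda>_. 0)"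
    by (auto simp: fun_eq_iff)
qed

text \<open>Besides the determining equations and their u-derivatives, the terms linear in
  \<open>ux\<close> and \<open>vx\<close> leave K' B_x, K' B_xxx and D' B_x. These vanish because
  \<open>B\<close> can vary with x only if \<open>K\<close> and \<open>D\<close> are
  constant.\<close>

lemma determining_sufficient:
  assumes S: "valid_system S" and det: "determining S a A B p"
    and X: "\<And>z. z \<in> base_dom S \<Longrightarrow> X z = field_of a A B p q z"
  shows "X \<in> MAI S"
proof -
  define J where "J = uvals S"
  have oJ: "open J" and iJ: "is_interval J" and nJ: "J \<noteq> {}" and sK: "smooth_on J (coefK S)"
    and sD: "smooth_on J (coefD S)"
    using S by (auto simp: valid_system_def J_def)
  have sa: "smooth_on UNIV a" and sA: "smooth_on UNIV A" and sB: "smooth_on UNIV B" using det by (auto simp: determining_def)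
  define \<xi> where "\<xi> = (\<lambda>q'::real \<times> real. q + p * snd q')"
  define A2 where "A2 = (\<lambda>q::real \<times> real. A (fst q))"
  define G where "G = (\<lambda>q::real \<times> real. A (fst q) - 2 * p)"
  have s\<xi>: "smooth_on UNIV \<xi>" unfolding \<xi>_def
    by (rule smooth_on_bounded_linear[OF open_UNIV bounded_linear_compose[OF bounded_linear_mult_right bounded_linear_snd]])
  have sA2: "smooth_on UNIV A2" unfolding A2_def by (rule smooth_on_fst_arg[OF sA])
  have sG: "smooth_on UNIV G" unfolding G_def
    by (intro smooth_on_diff smooth_on_fst_arg[OF sA] smooth_on_const) auto
  have s0: "smooth_on UNIV (\<lambda>_::real \<times> real. 0::real)" by (rule smooth_on_const) simp
  have sBx: "smooth_on UNIV (pd_x (pd_x B))" using smooth_pd sB by blast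
  have f\<xi>: "(\<xi> has_derivative (\<lambda>w. p * snd w)) (at q')" for q'
    unfolding \<xi>_def by (auto intro!: derivative_eq_intros)
  have p\<xi>: "pd_t \<xi> = (\<lambda>_. 0)" "pd_x \<xi> = (\<lambda>_. p)" "pd_x (pd_x \<xi>) = (\<lambda>_. 0)"
  proof -
    show "pd_t \<xi> = (\<lambda>_. 0)" "pd_x \<xi> = (\<lambda>_. p)" using pd_eq[OF f\<xi>] by auto
    then show "pd_x (pd_x \<xi>) = (\<lambda>_. 0)" by (simp add: pd_t_zero_fun)
  qed
  have pA: "pd_t A2 = (\<lambda>q. deriv A (fst q))" "pd_x A2 = (\<lambda>_. 0)"
    unfolding A2_def using pd_time_fun[OF sA] .
  have pG: "pd_x G = (\<lambda>_. 0)"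
  proof -
    have "smooth_on UNIV (\<lambda>t. A t - 2 * p)" by (intro smooth_on_diff sA smooth_on_const) auto
    from pd_time_fun(2)[OF this] show ?thesis unfolding G_def .
  qed
  have vA2: "A2 (t, x) = A t" and vG: "G (t, x) = A t - 2 * p" for t x by (simp_all add: A2_def G_def)
  define V where "V = vform a \<xi> A2 B (pd_x (pd_x B)) (\<lambda>_. 0) G"
  have XV: "X z = V z" if "z \<in> base_dom S" for z
    using X[OF that] by (cases z) (simp add: V_def vform_def field_of_def \<xi>_def A2_def G_def add.commute)
  have U: "open (base_dom S)" using open_base_dom oJ by (simp add: J_def)
  have eq: "deriv (coefK S) u * (A t * u + B (t, x)) = coefK S u * (4 * p - deriv a t)"
    "deriv (coefD S) u * (A t * u + B (t, x)) = coefD S u * (2 * p - deriv a t)"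
    "deriv (coefF S) u * (A t * u + B (t, x)) = (A t - deriv a t) * coefF S u + deriv A t * u + pd_t B (t, x)
         + coefK S u * pd_x (pd_x (pd_x (pd_x B))) (t, x) - coefD S u * pd_x (pd_x B) (t, x)"
    if "u \<in> J" for t x u
    using det that unfolding determining_def J_def by blast+
  have eq': "deriv (deriv (coefK S)) u * (A t * u + B (t, x)) + deriv (coefK S) u * A t = deriv (coefK S) u * (4 * p - deriv a t)"
    "deriv (deriv (coefD S)) u * (A t * u + B (t, x)) + deriv (coefD S) u * A t = deriv (coefD S) u * (2 * p - deriv a t)"
    if u: "u \<in> J" for t x u
    by (rule deriv_eq_on_open[OF oJ u sK eq(1)], assumption, rule deriv_eq_on_open[OF oJ u sD eq(2)])
  \<comment> \<open>If K' or D' is nonzero at some \<open>u\<close>, the corresponding equation at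
    this \<open>u\<close> determines \<open>B (t, x)\<close> by data that depend on \<open>t\<close>
    only.\<close>
  have Bx: "pd_x B = (\<lambda>_. 0) \<or> (\<forall>u\<in>J. deriv (coefK S) u = 0 \<and> deriv (coefD S) u = 0)"
  proof (rule ccontr)
    assume "\<not> ?thesis"
    then obtain u where u: "u \<in> J" "deriv (coefK S) u \<noteq> 0 \<or> deriv (coefD S) u \<noteq> 0" and ne: "pd_x B \<noteq> (\<lambda>_. 0)" by blast
    have "B (t, x) = B (t, 0)" for t x
    proof -
      have "deriv (coefK S) u * (A t * u + B (t, x)) = deriv (coefK S) u * (A t * u + B (t, 0))"
        "deriv (coefD S) u * (A t * u + B (t, x)) = deriv (coefD S) u * (A t * u + B (t, 0))"
        using eq[OF u(1)] by metis+
      then show ?thesis using u(2) by auto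
    qed
    then have "\<forall>t x. pd_x B (t, x) = 0" using pd_x_zero_iff[OF sB] by metis
    then show False using ne by (auto simp: fun_eq_iff)
  qed
  have Bx0: "deriv (coefK S) u * pd_x B (t, x) = 0" "deriv (coefD S) u * pd_x B (t, x) = 0"
    "deriv (coefK S) u * pd_x (pd_x (pd_x B)) (t, x) = 0" if "u \<in> J" for u t x
    using Bx that by (auto simp: pd_x_zero_fun)
  have "is_symmetry S X" unfolding is_symmetry_def
  proof (intro conjI allI impI)
    have "smooth_on (base_dom S) V"
    proof -
      let ?U = "base_dom S"
      have ln: "smooth_on ?U fst" "smooth_on ?U (\<lambda>z. fst (snd z))" "smooth_on ?U (\<lambda>z. fst (snd (snd z)))"
        "smooth_on ?U (\<lambda>z. snd (snd (snd z)))"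
        by (intro smooth_on_linear[OF U] bounded_linear_intros)+
      have c1: "smooth_on ?U (\<lambda>z. c (fst z))" if "smooth_on UNIV c" for c :: "real \<Rightarrow> real"
        by (rule smooth_on_comp[OF U open_UNIV that ln(1)]) simp
      have c2: "smooth_on ?U (\<lambda>z. c (fst z, fst (snd z)))" if "smooth_on UNIV c" for c :: "real \<times> real \<Rightarrow> real"
        by (rule smooth_on_comp2[OF U that ln(1,2)]) simp
      have eV: "V = (\<lambda>z. (a (fst z), \<xi> (fst z, fst (snd z)), A2 (fst z, fst (snd z)) * fst (snd (snd z)) + B (fst z, fst (snd z)),
          pd_x (pd_x B) (fst z, fst (snd z)) + 0 * fst (snd (snd z)) + G (fst z, fst (snd z)) * snd (snd (snd z))))"
        by (auto simp: V_def vform_def)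
      show ?thesis unfolding eV
        by (intro smooth_on_Pair smooth_on_add smooth_on_mult U c1[OF sa] c2[OF s\<xi>] c2[OF sA2] c2[OF sB] c2[OF sBx]
            c2[OF sG] ln smooth_on_const)
    qed
    then show "smooth_on (base_dom S) X" using smooth_on_cong[OF U XV] by simp
  next
    fix j assume j: "fst (fst j) \<in> base_dom S \<and> S1 S j = 0 \<and> S2 j = 0"
    obtain t x u v ut ux vt vx utt utx uxx vtt vtx vxx
      where jj: "j = (((t, x, u, v), (ut, ux, vt, vx)), (utt, utx, uxx, vtt, vtx, vxx))"
      by (metis prod.exhaust)
    have u: "u \<in> uvals S" and uJ: "u \<in> J" using j by (simp_all add: jj base_dom_def J_def)
    have uxx: "uxx = v" using j by (simp add: jj)
    have ut: "ut = - (deriv (coefK S) u * ux * vx + coefK S u * vxx) + (deriv (coefD S) u * ux * ux + coefD S u * v) + coefF S u"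
    proof -
      have "S1 S j = 0" using j by blast
      then show ?thesis unfolding jj uxx S1_eq[OF S u] by linarith
    qed
    have pr: "prolong2 X j = prolong2 V j"
      unfolding jj by (rule prolong2_cong[OF U XV]) (use j jj in auto)
    note fr = frechet_S_vform[OF S u sa s\<xi> sA2 sB sBx s0 sG]
    show "frechet_derivative S2 (at j) (prolong2 X j) = 0"
      unfolding pr unfolding jj V_def fr(2) by (simp add: pA p\<xi> pd_t_zero_fun uxx vG vA2 algebra_simps)
    have "frechet_derivative (S1 S) (at j) (prolong2 X j) =
       - (deriv A t * u + pd_t B (t, x) + (A t - deriv a t) * ut)
     - (deriv (deriv (coefK S)) u * (A t * u + B (t, x)) * ux * vx
        + deriv (coefK S) u * (pd_x B (t, x) + (A t - p) * ux) * vx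
        + deriv (coefK S) u * ux * (pd_x (pd_x (pd_x B)) (t, x) + (A t - 3 * p) * vx)
        + deriv (coefK S) u * (A t * u + B (t, x)) * vxx
        + coefK S u * (pd_x (pd_x (pd_x (pd_x B))) (t, x) + (A t - 4 * p) * vxx))
     + (deriv (deriv (coefD S)) u * (A t * u + B (t, x)) * ux * ux
        + 2 * deriv (coefD S) u * ux * (pd_x B (t, x) + (A t - p) * ux)
        + deriv (coefD S) u * (A t * u + B (t, x)) * v
        + coefD S u * (pd_x (pd_x B) (t, x) + A t * v - 2 * v * p))
     + deriv (coefF S) u * (A t * u + B (t, x))"
      unfolding pr unfolding jj V_def fr(1) by (simp add: pA p\<xi> pG pd_t_zero_fun uxx vG vA2 algebra_simps)
    also have "\<dots> = 0"
    proof -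
      define K0 K1 K2 D0 D1 D2 F0 F1 Bv Bt B1 B2 B3 B4 s where
        "K0 = coefK S u" "K1 = deriv (coefK S) u" "K2 = deriv (deriv (coefK S)) u"
        "D0 = coefD S u" "D1 = deriv (coefD S) u" "D2 = deriv (deriv (coefD S)) u"
        "F0 = coefF S u" "F1 = deriv (coefF S) u" "Bv = B (t, x)" "Bt = pd_t B (t, x)" "B1 = pd_x B (t, x)"
        "B2 = pd_x (pd_x B) (t, x)" "B3 = pd_x (pd_x (pd_x B)) (t, x)" "B4 = pd_x (pd_x (pd_x (pd_x B))) (t, x)"
        "s = deriv a t"
      note df = this
      note E = eq[OF uJ, of t x] eq'[OF uJ, of t x] Bx0[OF uJ, of t x]
      note E' = E[folded df]
      show ?thesis unfolding ut df[symmetric]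
      proof -
        let ?A = "A t" let ?h = "?A * u + Bv"
        let ?e = "- (deriv A t * u + Bt + (?A - s) * (- (K1 * ux * vx + K0 * vxx) + (D1 * ux * ux + D0 * v) + F0))
         - (K2 * ?h * ux * vx + K1 * (B1 + (?A - p) * ux) * vx + K1 * ux * (B3 + (?A - 3 * p) * vx)
            + K1 * ?h * vxx + K0 * (B4 + (?A - 4 * p) * vxx))
         + (D2 * ?h * ux * ux + 2 * D1 * ux * (B1 + (?A - p) * ux) + D1 * ?h * v + D0 * (B2 + ?A * v - 2 * v * p))
         + F1 * ?h"
        have "?e = vxx * (K0 * (4 * p - s) - K1 * ?h) - ux * vx * (K2 * ?h + K1 * ?A - K1 * (4 * p - s))
          - vx * (K1 * B1) - ux * (K1 * B3) + v * (D1 * ?h - D0 * (2 * p - s))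
          + ux * ux * (D2 * ?h + D1 * ?A - D1 * (2 * p - s)) + 2 * ux * (D1 * B1)
          + (F1 * ?h - ((?A - s) * F0 + deriv A t * u + Bt + K0 * B4 - D0 * B2))"
          by (simp add: algebra_simps)
        also have "\<dots> = 0" unfolding E' by simp
        finally show "?e = 0" .
      qed
    qed
    finally show "frechet_derivative (S1 S) (at j) (prolong2 X j) = 0" .
  qed
  then show ?thesis by (simp add: MAI_def)
qed

text \<open>Once the shape of the field is known, the condition on \<open>S1\<close> is polynomial
  in \<open>v\<close>, \<open>ux\<close>, \<open>vx\<close>, \<open>vxx\<close> on the manifold.
  Some coefficients force \<xi>_xx = 0 and \<xi>_t = 0; what is left are the determining
  equations.\<close>

lemma determining_necessary:
  assumes S: "valid_system S" and X: "X \<in> MAI S"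
  shows "\<exists>a A B p q. determining S a A B p \<and> (\<forall>z\<in>base_dom S. X z = field_of a A B p q z)"
proof -
  define J where "J = uvals S"
  have oJ: "open J" and iJ: "is_interval J" and nJ: "J \<noteq> {}" and sK: "smooth_on J (coefK S)"
    and sD: "smooth_on J (coefD S)"
    using S by (auto simp: valid_system_def J_def)
  obtain uK where uK: "uK \<in> J" "coefK S uK \<noteq> 0" using S by (auto simp: valid_system_def J_def)
  have sym: "is_symmetry S X" using X by (simp add: MAI_def)
  obtain a \<xi> A B where sa: "smooth_on UNIV a" and s\<xi>: "smooth_on UNIV \<xi>" and sA: "smooth_on UNIV A"
    and sB: "smooth_on UNIV B" and A\<xi>: "\<And>t x. 2 * pd_x A (t, x) = pd_x (pd_x \<xi>) (t, x)"
    and XV: "\<And>z. z \<in> base_dom S \<Longrightarrow> X z = vform a \<xi> A B (pd_x (pd_x B)) (pd_x (pd_x A)) (\<lambda>p. A p - 2 * pd_x \<xi> p) z"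
    using symmetry_stage1[OF S sym] by blast
  define G where "G = (\<lambda>p. A p - 2 * pd_x \<xi> p)"
  define V where "V = vform a \<xi> A B (pd_x (pd_x B)) (pd_x (pd_x A)) G"
  have s\<xi>x: "smooth_on UNIV (pd_x \<xi>)" using smooth_pd(2)[OF s\<xi>] .
  have sG: "smooth_on UNIV G" unfolding G_def
    by (intro smooth_on_diff sA smooth_on_mult s\<xi>x smooth_on_const) auto
  have sBx: "smooth_on UNIV (pd_x (pd_x B))" and sAx: "smooth_on UNIV (pd_x (pd_x A))" using smooth_pd sA sB by blast+
  have U: "open (base_dom S)" using open_base_dom oJ by (simp add: J_def)
  have Gx: "pd_x G (t, x) = pd_x A (t, x) - 2 * pd_x (pd_x \<xi>) (t, x)" for t x
  proof -
    have "(G has_derivative (\<lambda>w. (fst w * pd_t A (t, x) + snd w * pd_x A (t, x))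
       - 2 * (fst w * pd_t (pd_x \<xi>) (t, x) + snd w * pd_x (pd_x \<xi>) (t, x)))) (at (t, x))"
      unfolding G_def
      by (intro has_derivative_diff has_derivative_mult_right smooth_on_UNIV_pd sA s\<xi>x)
    from pd_eq(2)[OF this] show ?thesis by simp
  qed
  have Gv: "G (t, x) = A (t, x) - 2 * pd_x \<xi> (t, x)" for t x by (simp add: G_def)
  \<comment> \<open>The condition on \<open>S1\<close> with \<open>uxx = v\<close> inserted and
    \<open>ut\<close> eliminated by \<open>S1 = 0\<close>.\<close>
  define P where "P = (\<lambda>t x u v ux vx vxx.
     - (pd_t A (t, x) * u + pd_t B (t, x) + (A (t, x) - deriv a t) * (- (deriv (coefK S) u * ux * vx + coefK S u * vxx)
        + (deriv (coefD S) u * ux * ux + coefD S u * v) + coefF S u) - ux * pd_t \<xi> (t, x))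
     - (deriv (deriv (coefK S)) u * (A (t, x) * u + B (t, x)) * ux * vx
        + deriv (coefK S) u * (pd_x A (t, x) * u + pd_x B (t, x) + (A (t, x) - pd_x \<xi> (t, x)) * ux) * vx
        + deriv (coefK S) u * ux * (pd_x (pd_x (pd_x B)) (t, x) + pd_x (pd_x (pd_x A)) (t, x) * u + pd_x (pd_x A) (t, x) * ux
          + pd_x G (t, x) * v + (G (t, x) - pd_x \<xi> (t, x)) * vx)
        + deriv (coefK S) u * (A (t, x) * u + B (t, x)) * vxx
        + coefK S u * (pd_x (pd_x (pd_x (pd_x B))) (t, x) + pd_x (pd_x (pd_x (pd_x A))) (t, x) * u + 2 * pd_x (pd_x (pd_x A)) (t, x) * ux
          + pd_x (pd_x A) (t, x) * v + pd_x (pd_x G) (t, x) * v + 2 * pd_x G (t, x) * vx + G (t, x) * vxx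
          - 2 * vxx * pd_x \<xi> (t, x) - vx * pd_x (pd_x \<xi>) (t, x)))
     + (deriv (deriv (coefD S)) u * (A (t, x) * u + B (t, x)) * ux * ux
        + 2 * deriv (coefD S) u * ux * (pd_x A (t, x) * u + pd_x B (t, x) + (A (t, x) - pd_x \<xi> (t, x)) * ux)
        + deriv (coefD S) u * (A (t, x) * u + B (t, x)) * v
        + coefD S u * (pd_x (pd_x A) (t, x) * u + pd_x (pd_x B) (t, x) + 2 * pd_x A (t, x) * ux
          + A (t, x) * v - 2 * v * pd_x \<xi> (t, x) - ux * pd_x (pd_x \<xi>) (t, x)))
     + deriv (coefF S) u * (A (t, x) * u + B (t, x)))"
  have P0: "P t x u v ux vx vxx = 0" if u: "u \<in> J" for t x u v ux vx vxx
  proof -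
    have u': "u \<in> uvals S" using u by (simp add: J_def)
    define ut where "ut = - (deriv (coefK S) u * ux * vx + coefK S u * vxx) + (deriv (coefD S) u * ux * ux + coefD S u * v) + coefF S u"
    define j :: jet2 where "j = (((t, x, u, v), (ut, ux, 0, vx)), (0, 0, v, 0, 0, vxx))"
    have "S1 S j = 0" unfolding j_def S1_eq[OF S u'] by (simp add: ut_def)
    moreover have "S2 j = 0" by (simp add: j_def)
    moreover have "fst (fst j) \<in> base_dom S" using u' by (simp add: j_def base_dom_def)
    ultimately have z: "frechet_derivative (S1 S) (at j) (prolong2 X j) = 0" using sym unfolding is_symmetry_def by blast
    have pr: "prolong2 X j = prolong2 V j"
      unfolding j_def by (rule prolong2_cong[OF U]) (use XV u' in \<open>auto simp: V_def G_def base_dom_def\<close>)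
    show ?thesis
      using z unfolding pr unfolding j_def V_def frechet_S_vform(1)[OF S u' sa s\<xi> sA sB sBx sAx sG] P_def ut_def .
  qed
  have cK: "deriv (coefK S) u * (A (t, x) * u + B (t, x)) = coefK S u * (4 * pd_x \<xi> (t, x) - deriv a t)"
    if u: "u \<in> J" for t x u
    using P0[OF u, of t x 0 0 0 1] P0[OF u, of t x 0 0 0 0] by (simp add: P_def G_def algebra_simps)
  \<comment> \<open>The mixed second difference in \<open>v\<close> and \<open>ux\<close> isolates
    the coefficient of \<open>v * ux\<close>.\<close>
  have cG: "deriv (coefK S) u * pd_x G (t, x) = 0" if u: "u \<in> J" for t x u
  proof -
    have "P t x u 1 1 0 0 - P t x u 0 1 0 0 - P t x u 1 0 0 0 + P t x u 0 0 0 0 = - (deriv (coefK S) u * pd_x G (t, x))"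
      by (simp add: P_def algebra_simps)
    then show ?thesis by (simp add: P0[OF u])
  qed
  \<comment> \<open>If K' is nonzero somewhere, then G_x = A_x - 2 \<xi>_xx vanishes, and with 2 A_x
    = \<xi>_xx so does \<xi>_xx. Otherwise the first equation at a point where \<open>K\<close> is
    nonzero gives 4 \<xi>_x = a', which is free of x.\<close>
  have x2: "pd_x (pd_x \<xi>) (t, x) = 0" for t x
  proof (cases "\<exists>u\<in>J. deriv (coefK S) u \<noteq> 0")
    case True
    then obtain u where "u \<in> J" "deriv (coefK S) u \<noteq> 0" by blast
    then have "pd_x G (t, x) = 0" using cG[of u t x] by simp
    then show ?thesis using A\<xi>[of t x] Gx[of t x] by linarith
  next
    case False
    then have "coefK S uK * (4 * pd_x \<xi> (t, x) - deriv a t) = 0" for x using cK[OF uK(1), of t x] uK(1) by auto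
    then have "4 * pd_x \<xi> (t, x) - deriv a t = 0" for x using uK(2) mult_eq_0_iff by blast
    then have "pd_x \<xi> (t, x) = deriv a t / 4" for x by (simp add: field_simps)
    then have "\<forall>x. pd_x \<xi> (t, x) = pd_x \<xi> (t, 0)" by metis
    then show ?thesis using pd_x_zero_iff[OF s\<xi>x, of t] by blast
  qed
  have Ax: "pd_x A (t, x) = 0" for t x using A\<xi>[of t x] x2 by simp
  have fx2: "pd_x (pd_x \<xi>) = (\<lambda>_. 0)" and fAx: "pd_x A = (\<lambda>_. 0)" using x2 Ax by (auto simp: fun_eq_iff)
  have fGx: "pd_x G = (\<lambda>_. 0)" using Gx x2 Ax by (auto simp: fun_eq_iff)
  have A0: "A (t, x) = A (t, 0)" for t x using pd_x_zero_iff[OF sA, of t] Ax by blast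
  have \<xi>0: "pd_x \<xi> (t, x) = pd_x \<xi> (t, 0)" for t x using pd_x_zero_iff[OF s\<xi>x, of t] x2 by blast
  have cD: "deriv (coefD S) u * (A (t, x) * u + B (t, x)) = coefD S u * (2 * pd_x \<xi> (t, x) - deriv a t)"
    if u: "u \<in> J" for t x u
    using P0[OF u, of t x 1 0 0 0] P0[OF u, of t x 0 0 0 0] by (simp add: P_def fx2 fAx fGx pd_x_zero_fun Gv algebra_simps)
  \<comment> \<open>The odd part in \<open>ux\<close>, from its values 1 and -1.\<close>
  have cX: "pd_t \<xi> (t, x) - deriv (coefK S) u * pd_x (pd_x (pd_x B)) (t, x) + 2 * deriv (coefD S) u * pd_x B (t, x) = 0"
    if u: "u \<in> J" for t x u
    using P0[OF u, of t x 0 1 0 0] P0[OF u, of t x 0 "-1" 0 0] by (simp add: P_def fx2 fAx fGx pd_x_zero_fun algebra_simps)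
  have cF: "deriv (coefF S) u * (A (t, x) * u + B (t, x)) = (A (t, x) - deriv a t) * coefF S u + pd_t A (t, x) * u + pd_t B (t, x)
         + coefK S u * pd_x (pd_x (pd_x (pd_x B))) (t, x) - coefD S u * pd_x (pd_x B) (t, x)" if u: "u \<in> J" for t x u
    using P0[OF u, of t x 0 0 0 0] by (simp add: P_def fx2 fAx fGx pd_x_zero_fun algebra_simps)
  \<comment> \<open>If \<open>K\<close> or \<open>D\<close> varies, \<open>B\<close> is free of x
    and only \<xi>_t survives in \<open>cX\<close>; otherwise the factors K' and D' vanish.\<close>
  have xt: "pd_t \<xi> (t, x) = 0" for t x
  proof (cases "\<exists>u\<in>J. deriv (coefK S) u \<noteq> 0 \<or> deriv (coefD S) u \<noteq> 0")
    case True
    then obtain u where u: "u \<in> J" "deriv (coefK S) u \<noteq> 0 \<or> deriv (coefD S) u \<noteq> 0" by blast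
    have "B (t, x) = B (t, 0)" for t x
    proof -
      have "deriv (coefK S) u * (A (t, 0) * u + B (t, x)) = deriv (coefK S) u * (A (t, 0) * u + B (t, 0))"
        "deriv (coefD S) u * (A (t, 0) * u + B (t, x)) = deriv (coefD S) u * (A (t, 0) * u + B (t, 0))"
        using cK[OF u(1), of t] cD[OF u(1), of t] A0[of t x] \<xi>0[of t x] by metis+
      then show ?thesis using u(2) by auto
    qed
    then have "\<forall>t x. pd_x B (t, x) = 0" using pd_x_zero_iff[OF sB] by metis
    then have "pd_x B = (\<lambda>_. 0)" by (auto simp: fun_eq_iff)
    then show ?thesis using cX[OF u(1), of t x] by (simp add: pd_x_zero_fun)
  next
    case False
    then show ?thesis using cX[OF uK(1), of t x] uK(1) by simp
  qed
  have \<xi>t: "\<xi> (t, x) = \<xi> (0, x)" for t x using pd_t_zero[OF s\<xi>, of x] xt by blast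
  define p where "p = pd_x \<xi> (0, 0)"
  define \<xi>' where "\<xi>' = (\<lambda>q::real \<times> real. \<xi> (0, snd q))"
  have "\<xi> = \<xi>'" unfolding \<xi>'_def using \<xi>t by (auto simp: fun_eq_iff)
  moreover have "pd_x \<xi>' (t, x) = pd_x \<xi> (0, x)" for t x
  proof -
    have l: "((\<lambda>q::real \<times> real. (0::real, snd q)) has_derivative (\<lambda>w. (0, snd w))) (at (t, x))"
      by (intro derivative_intros)
    have "(\<xi>' has_derivative (\<lambda>w. snd w * pd_x \<xi> (0, x))) (at (t, x))"
      unfolding \<xi>'_def using diff_chain_at[OF l, of \<xi>] smooth_on_UNIV_pd[OF s\<xi>, of "(0, x)"] by (fastforce simp: o_def)
    from pd_eq(2)[OF this] show ?thesis by simp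
  qed
  ultimately have px: "pd_x \<xi> (t, x) = p" for t x using \<xi>0[of 0 x] unfolding p_def by metis
  define q where "q = \<xi> (0, 0)"
  have \<xi>pq: "\<xi> (t, x) = p * x + q" for t x
  proof -
    define g where "g = (\<lambda>w::real \<times> real. \<xi> w - p * snd w)"
    have sg: "smooth_on UNIV g" unfolding g_def
      by (intro smooth_on_diff s\<xi> smooth_on_mult smooth_on_const smooth_on_linear bounded_linear_snd) auto
    have "(g has_derivative (\<lambda>w. (fst w * pd_t \<xi> (t, x) + snd w * pd_x \<xi> (t, x)) - p * snd w)) (at (t, x))" for t x
      unfolding g_def by (intro has_derivative_diff smooth_on_UNIV_pd s\<xi> has_derivative_mult_right has_derivative_snd has_derivative_ident)
    from pd_eq(2)[OF this] have "pd_x g (t, x) = 0" for t x by (simp add: px)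
    then have "g (0, x) = g (0, 0)" using pd_x_zero_iff[OF sg, of 0] by blast
    then show ?thesis using \<xi>t[of t x] by (simp add: g_def q_def)
  qed
  define A' where "A' = (\<lambda>t. A (t, 0))"
  have sA': "smooth_on UNIV A'" unfolding A'_def by (rule smooth_on_slice[OF sA])
  have AA: "A = (\<lambda>w. A' (fst w))" unfolding A'_def using A0 by (auto simp: fun_eq_iff)
  have At: "pd_t A (t, x) = deriv A' t" for t x unfolding AA pd_time_fun[OF sA'] by simp
  have "determining S a A' B p"
    unfolding determining_def using sa sA' sB cK cD cF px At AA J_def by simp
  moreover have "\<forall>z\<in>base_dom S. X z = field_of a A' B p q z"
  proof -
    have A0': "A (t, x) = A' t" for t x using A0[of t x] by (simp add: A'_def)
    show ?thesis using XV by (auto simp: vform_def field_of_def \<xi>pq A0' px fAx pd_x_zero_fun)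
  qed
  ultimately show ?thesis by blast
qed

lemma MAI_iff:
  assumes "valid_system S"
  shows "X \<in> MAI S \<longleftrightarrow> (\<exists>a A B p q. determining S a A B p \<and> (\<forall>z\<in>base_dom S. X z = field_of a A B p q z))"
  using determining_necessary[OF assms] determining_sufficient[OF assms] by blast

section \<open>Substitutions\<close>

lemma inj_of_deriv_nonzero:
  fixes f :: "real \<Rightarrow> real"
  assumes d: "\<And>x. (f has_real_derivative f' x) (at x)" and nz: "\<And>x. f' x \<noteq> 0"
  shows "inj f"
proof -
  have "f x \<noteq> f y" if "x < y" for x y
  proof
    assume "f x = f y"
    have "\<exists>z>x. z < y \<and> (\<lambda>h. f' z * h) = (\<lambda>v. 0)"
    proof (rule Rolle_deriv[OF that \<open>f x = f y\<close>])
      show "continuous_on {x..y} f"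
        using DERIV_isCont[OF d] by (intro continuous_at_imp_continuous_on) blast
      show "(f has_derivative (\<lambda>h. f' z * h)) (at z)" for z
        using d[of z] by (simp add: has_field_derivative_def)
    qed
    then obtain z where "(\<lambda>h. f' z * h) = (\<lambda>v. 0)" by blast
    from fun_cong[OF this, of 1] show False using nz by simp
  qed
  then show ?thesis by (metis injI linorder_neqE)
qed

text \<open>The values of \<open>f\<close> are known only on the image of \<open>\<Omega>\<close>,
  so this image has to be open: Rolle's theorem makes the new time injective, and invariance of
  domain applies. The differentiable inverse then allows the chain rule.\<close>

lemma base_change:
  fixes g :: "real \<times> real \<Rightarrow> real"
  assumes C: "invertible_subst C" and \<Omega>: "open \<Omega>" and p: "p \<in> \<Omega>" and g: "g differentiable (at p)"
    and eq: "\<And>q. q \<in> \<Omega> \<Longrightarrow> f (base_subst C q) = g q"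
  shows "pd_t f (base_subst C p) = pd_t g p / (C 0 + C 1 * C 2 * exp (C 2 * fst p))"
    and "pd_x f (base_subst C p) = pd_x g p / C 3"
proof -
  define \<tau> where "\<tau> = (\<lambda>t. C 0 * t + C 1 * exp (C 2 * t))"
  define \<theta> where "\<theta> = (\<lambda>t. C 0 + C 1 * C 2 * exp (C 2 * t))"
  have C3: "C 3 \<noteq> 0" and \<theta>: "\<theta> t \<noteq> 0" for t using C by (auto simp: invertible_subst_def \<theta>_def)
  have d\<tau>: "(\<tau> has_real_derivative \<theta> t) (at t)" for t
    unfolding \<tau>_def \<theta>_def by (auto intro!: derivative_eq_intros)
  have b: "base_subst C = (\<lambda>q. (\<tau> (fst q), C 3 * snd q))"
    by (auto simp: base_subst_def \<tau>_def)
  have "inj \<tau>" using inj_of_deriv_nonzero[OF d\<tau> \<theta>] .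
  then have inj_b: "inj (base_subst C)" unfolding b using C3 by (auto simp: inj_def)
  have cont: "continuous_on UNIV (base_subst C)" unfolding b \<tau>_def by (intro continuous_intros)
  have op_img: "open (base_subst C ` \<Omega>)"
    using invariance_of_domain[OF continuous_on_subset[OF cont] \<Omega> inj_on_subset[OF inj_b]] by auto
  have db: "(base_subst C has_derivative (\<lambda>w. (\<theta> (fst p) * fst w, C 3 * snd w))) (at p)"
  proof -
    have "(\<tau> has_derivative (\<lambda>h. \<theta> (fst p) * h)) (at (fst p))"
      using d\<tau>[of "fst p"] by (simp add: has_field_derivative_def)
    from diff_chain_at[OF has_derivative_fst[OF has_derivative_ident] this]
    have "((\<lambda>q. \<tau> (fst q)) has_derivative (\<lambda>w. \<theta> (fst p) * fst w)) (at p)" by (simp add: o_def)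
    then show ?thesis unfolding b by (intro derivative_intros)
  qed
  define i where "i = inv (base_subst C)"
  have ii: "i (base_subst C q) = q" for q unfolding i_def using inj_b by simp
  have di: "(i has_derivative (\<lambda>w. (fst w / \<theta> (fst p), snd w / C 3))) (at (base_subst C p))"
    by (rule has_derivative_inverse_strong[OF open_UNIV UNIV_I cont ii db])
      (use \<theta> C3 in \<open>auto simp: fun_eq_iff\<close>)
  have dg: "(g has_derivative (\<lambda>w. fst w * pd_t g p + snd w * pd_x g p)) (at (i (base_subst C p)))"
    using has_derivative_pd[OF g] by (simp add: ii)
  have "((\<lambda>q. g (i q)) has_derivative (\<lambda>w. fst w / \<theta> (fst p) * pd_t g p + snd w / C 3 * pd_x g p)) (at (base_subst C p))"
    using diff_chain_at[OF di dg] by (simp add: o_def)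
  then have "(f has_derivative (\<lambda>w. fst w / \<theta> (fst p) * pd_t g p + snd w / C 3 * pd_x g p)) (at (base_subst C p))"
    by (rule has_derivative_transform_within_open[OF _ op_img]) (use p eq ii in auto)
  from pd_eq[OF this] show "pd_t f (base_subst C p) = pd_t g p / (C 0 + C 1 * C 2 * exp (C 2 * fst p))"
    and "pd_x f (base_subst C p) = pd_x g p / C 3" by (simp_all add: \<theta>_def)
qed

lemma differentiable_time_mult:
  assumes "(m has_real_derivative m') (at (fst p))" and g: "g differentiable (at p)"
  shows "(\<lambda>q. m (fst q) * g q) differentiable (at p)"
    and "pd_x (\<lambda>q. m (fst q) * g q) p = m (fst p) * pd_x g p"
    and "pd_t (\<lambda>q. m (fst q) * g q) p = m' * g p + m (fst p) * pd_t g p"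
proof -
  have "(m has_derivative (\<lambda>h. m' * h)) (at (fst p))" using assms(1) by (simp add: has_field_derivative_def)
  from diff_chain_at[OF has_derivative_fst[OF has_derivative_ident] this]
  have m: "((\<lambda>q. m (fst q)) has_derivative (\<lambda>w. m' * fst w)) (at p)" by (simp add: o_def)
  have "((\<lambda>q. m (fst q) * g q) has_derivative (\<lambda>w. m (fst p) * (fst w * pd_t g p + snd w * pd_x g p) + m' * fst w * g p)) (at p)"
    by (rule has_derivative_mult[OF m has_derivative_pd[OF g]])
  from pd_eq[OF this] this show "(\<lambda>q. m (fst q) * g q) differentiable (at p)"
    and "pd_x (\<lambda>q. m (fst q) * g q) p = m (fst p) * pd_x g p"
    and "pd_t (\<lambda>q. m (fst q) * g q) p = m' * g p + m (fst p) * pd_t g p"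
    by (auto simp: differentiable_def)
qed

text \<open>The members of the substitution family that suffice for all reductions: x is kept, and
  \<open>v\<close> has no shift and is scaled by the same factor as \<open>u\<close>, so that v =
  u_xx is preserved.\<close>

definition subst_const :: "real \<Rightarrow> real \<Rightarrow> real \<Rightarrow> real \<Rightarrow> real \<Rightarrow> real \<Rightarrow> real \<Rightarrow> nat \<Rightarrow> real" where
  "subst_const c0 c1 c2 c4 c5 c6 c7 =
     (\<lambda>i. 0)(0 := c0, 1 := c1, 2 := c2, 3 := 1, 4 := c4, 5 := c5, 6 := c6, 7 := c7, 9 := c6, 10 := c7)"

text \<open>The determining equations of a target system, with the unknowns written as functions of
  the old time \<open>t\<close>: \<open>\<theta>\<close> is the derivative of the new time, and
  every time derivative is divided by it. \<open>Y t\<close> is the set of new values of u that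
  occur at old time \<open>t\<close>, possibly a proper part of \<open>uvals S\<close>.\<close>

definition hat_eqs :: "rd_system \<Rightarrow> (real \<Rightarrow> real) \<Rightarrow> (real \<Rightarrow> real set) \<Rightarrow> (real \<Rightarrow> real) \<Rightarrow> (real \<Rightarrow> real) \<Rightarrow>
    (real \<times> real \<Rightarrow> real) \<Rightarrow> real \<Rightarrow> bool" where
  "hat_eqs S \<theta> Y a A B p \<longleftrightarrow> smooth_on UNIV a \<and> smooth_on UNIV A \<and> smooth_on UNIV B \<and>
    (\<forall>t x. \<forall>u\<in>Y t.
       deriv (coefK S) u * (A t * u + B (t, x)) = coefK S u * (4 * p - deriv a t / \<theta> t) \<and>
       deriv (coefD S) u * (A t * u + B (t, x)) = coefD S u * (2 * p - deriv a t / \<theta> t) \<and>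
       deriv (coefF S) u * (A t * u + B (t, x)) = (A t - deriv a t / \<theta> t) * coefF S u
         + (deriv A t * u + pd_t B (t, x)) / \<theta> t
         + coefK S u * pd_x (pd_x (pd_x (pd_x B))) (t, x) - coefD S u * pd_x (pd_x B) (t, x))"

text \<open>The members of \<open>V\<close> are functions on the whole line of new times, whereas
  \<open>\<tau>\<close> need not be onto. The content is that every solution over the old time
  extends.\<close>

definition solves :: "rd_system \<Rightarrow> ((real \<Rightarrow> real) \<times> (real \<Rightarrow> real) \<times> (real \<times> real \<Rightarrow> real) \<times> real) set \<Rightarrow>
    (real \<Rightarrow> real) \<Rightarrow> (real \<Rightarrow> real) \<Rightarrow> (real \<Rightarrow> real set) \<Rightarrow> bool" where
  "solves S V \<tau> \<theta> Y \<longleftrightarrow> (\<forall>a A B p. hat_eqs S \<theta> Y a A B p \<longrightarrow>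
     (\<exists>a' A' B'. (a', A', B', p) \<in> V \<and> a = (\<lambda>t. a' (\<tau> t)) \<and> A = (\<lambda>t. A' (\<tau> t)) \<and>
        B = (\<lambda>q. B' (\<tau> (fst q), snd q))))"

definition fields :: "jet0 set \<Rightarrow> ((real \<Rightarrow> real) \<times> (real \<Rightarrow> real) \<times> (real \<times> real \<Rightarrow> real) \<times> real) set \<Rightarrow> vfield set" where
  "fields U V = {Y. \<exists>a A B p q. (a, A, B, p) \<in> V \<and> (\<forall>z\<in>U. Y z = field_of a A B p q z)}"

lemma determining_hat: "determining S = hat_eqs S (\<lambda>_. 1) (\<lambda>_. uvals S)"
  by (simp add: fun_eq_iff determining_def hat_eqs_def add.assoc)

lemma MAI_eq_fields:
  assumes S: "valid_system S" and V: "\<And>a A B p. (a, A, B, p) \<in> V \<Longrightarrow> determining S a A B p"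
    and sol: "solves S V (\<lambda>t. t) (\<lambda>_. 1) (\<lambda>_. uvals S)"
  shows "MAI S = fields (base_dom S) V"
proof -
  have "(\<exists>a A B p q. determining S a A B p \<and> (\<forall>z\<in>base_dom S. X z = field_of a A B p q z)) \<longleftrightarrow>
     (\<exists>a A B p q. (a, A, B, p) \<in> V \<and> (\<forall>z\<in>base_dom S. X z = field_of a A B p q z))" for X
  proof -
    have "(a, A, B, p) \<in> V" if "determining S a A B p" for a A B p
      using sol[unfolded solves_def determining_hat[symmetric], rule_format, OF that] by auto
    then show ?thesis using V by blast
  qed
  then show ?thesis unfolding fields_def by (intro set_eqI) (simp only: MAI_iff[OF S] mem_Collect_eq)
qed

text \<open>Inserting u = \<alpha> + r y with \<alpha>' = c5 and r' = c7 r gives u_t = c5 + c7 r y +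
  r \<theta> y', where y' is the derivative in the new time. This explains the relation between the
  two sources; the factor \<theta> in the other relations comes from dividing by r \<theta>. The
  alternative for \<open>c1 * c2\<close> and \<open>c0\<close> makes \<theta> a constant or a pure
  exponential, so that its reciprocal is visibly smooth.\<close>

locale reduction =
  fixes S S' :: rd_system and c0 c1 c2 c4 c5 c6 c7 :: real
  assumes S: "valid_system S" and S': "valid_system S'" and c6: "c6 \<noteq> 0"
    and c01: "c1 * c2 = 0 \<or> c0 = 0"
    and \<theta>_nz: "\<And>t. c0 + c1 * c2 * exp (c2 * t) \<noteq> 0"
    and coef: "\<And>t u y. u \<in> uvals S \<Longrightarrow> y = (u - (c4 + c5 * t)) / (c6 * exp (c7 * t)) \<Longrightarrow>
       y \<in> uvals S' \<and> coefK S u = (c0 + c1 * c2 * exp (c2 * t)) * coefK S' y \<and>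
       coefD S u = (c0 + c1 * c2 * exp (c2 * t)) * coefD S' y \<and>
       coefF S u = (c0 + c1 * c2 * exp (c2 * t)) * (c6 * exp (c7 * t)) * coefF S' y
          + c5 + c7 * (c6 * exp (c7 * t)) * y"
begin

definition "C = subst_const c0 c1 c2 c4 c5 c6 c7"
definition "\<tau> t = c0 * t + c1 * exp (c2 * t)"
definition "\<theta> t = c0 + c1 * c2 * exp (c2 * t)"
definition "\<alpha> t = c4 + c5 * t"
definition "r t = c6 * exp (c7 * t)"
definition "Y t = (\<lambda>u. (u - \<alpha> t) / r t) ` uvals S"

lemma C_simps: "C 0 = c0" "C (Suc 0) = c1" "C 1 = c1" "C 2 = c2" "C 3 = 1" "C 4 = c4" "C 5 = c5" "C 6 = c6" "C 7 = c7"
  "C 8 = 0" "C 9 = c6" "C 10 = c7"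
  by (simp_all add: C_def subst_const_def)

lemma r_nz: "r t \<noteq> 0" and theta_nz: "\<theta> t \<noteq> 0"
  using c6 \<theta>_nz by (auto simp: r_def \<theta>_def)

lemma coefs:
  assumes "u \<in> uvals S" "y = (u - \<alpha> t) / r t"
  shows "y \<in> uvals S'" "coefK S u = \<theta> t * coefK S' y" "coefD S u = \<theta> t * coefD S' y"
    "coefF S u = \<theta> t * r t * coefF S' y + c5 + c7 * r t * y"
  using coef[OF assms[unfolded \<alpha>_def r_def]] by (simp_all add: \<theta>_def r_def)

lemma invertible: "invertible_subst C"
  using \<theta>_nz c6 by (simp add: invertible_subst_def C_simps)

lemma base_eq: "base_subst C (t, x) = (\<tau> t, x)"
  by (simp add: base_subst_def C_simps \<tau>_def)

lemma map_eq: "subst_map C False False (t, x, u, v) = (\<tau> t, x, (u - \<alpha> t) / r t, v / r t)"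
  by (simp add: subst_map_def C_simps \<tau>_def dep_subst_def \<alpha>_def r_def)

lemma derivs:
  "(\<tau> has_real_derivative \<theta> t) (at t)" "(\<alpha> has_real_derivative c5) (at t)"
  "(r has_real_derivative c7 * r t) (at t)" "(\<theta> has_real_derivative c2 * (\<theta> t - c0)) (at t)"
  "((\<lambda>t. 1 / r t) has_real_derivative - c7 / r t) (at t)"
proof -
  show "(\<tau> has_real_derivative \<theta> t) (at t)" "(\<alpha> has_real_derivative c5) (at t)"
    "(r has_real_derivative c7 * r t) (at t)" "(\<theta> has_real_derivative c2 * (\<theta> t - c0)) (at t)"
    unfolding \<tau>_def[abs_def] \<theta>_def[abs_def] \<alpha>_def[abs_def] r_def[abs_def] by (auto intro!: derivative_eq_intros)
  then show "((\<lambda>t. 1 / r t) has_real_derivative - c7 / r t) (at t)"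
    using r_nz by (auto intro!: derivative_eq_intros simp: power2_eq_square)
qed

lemma smooths: "smooth_on UNIV \<tau>" "smooth_on UNIV \<theta>" "smooth_on UNIV \<alpha>" "smooth_on UNIV r"
  "smooth_on UNIV (\<lambda>t. 1 / r t)" "smooth_on UNIV (\<lambda>t. 1 / \<theta> t)"
proof -
  have e: "smooth_on UNIV (\<lambda>t. exp (c * t))" for c :: real by (rule smooth_on_exp) simp
  have i: "smooth_on UNIV (\<lambda>t::real. t)" by (rule smooth_on_linear) (auto intro: bounded_linear_ident)
  have k: "smooth_on UNIV (\<lambda>t::real. c)" for c :: real by (rule smooth_on_const) simp
  show "smooth_on UNIV \<tau>" "smooth_on UNIV \<theta>" "smooth_on UNIV \<alpha>" "smooth_on UNIV r"
    unfolding \<tau>_def[abs_def] \<theta>_def[abs_def] \<alpha>_def[abs_def] r_def[abs_def]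
    by (intro smooth_on_add smooth_on_mult e i k open_UNIV)+
  have "(\<lambda>t. 1 / r t) = (\<lambda>t. 1 / c6 * exp (- c7 * t))" by (simp add: r_def fun_eq_iff exp_minus field_simps)
  then show "smooth_on UNIV (\<lambda>t. 1 / r t)" by (simp only: smooth_on_mult[OF open_UNIV k e])
  show "smooth_on UNIV (\<lambda>t. 1 / \<theta> t)"
  proof (cases "c1 * c2 = 0")
    case True
    then have "(\<lambda>t. 1 / \<theta> t) = (\<lambda>t. 1 / c0)" by (auto simp: \<theta>_def fun_eq_iff)
    then show ?thesis by (simp only: k)
  next
    case False
    then have "(\<lambda>t. 1 / \<theta> t) = (\<lambda>t. 1 / (c1 * c2) * exp (- c2 * t))"
      using c01 unfolding \<theta>_def by (simp add: fun_eq_iff exp_minus field_simps)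
    then show ?thesis by (simp only: smooth_on_mult[OF open_UNIV k e])
  qed
qed

text \<open>Every term of the target equation is 1 / (r \<theta>) times a term of the original one,
  up to the part c5 + c7 (u - \<alpha>) by which u_t and the source are diminished alike.\<close>

lemma reduces: "reduces_by C False False S S'"
  unfolding reduces_by_def
proof (intro conjI allI impI ballI)
  show "invertible_subst C" by (rule invertible)
  show "subst_map C False False ` base_dom S \<subseteq> base_dom S'"
    using coefs(1) by (auto simp: base_dom_def map_eq)
next
  fix \<Omega> u v u' v' p
  assume H: "open \<Omega> \<and> smooth_on \<Omega> u \<and> smooth_on \<Omega> v \<and> u ` \<Omega> \<subseteq> uvals S \<and>
    (\<forall>p\<in>\<Omega>. graph_point u' v' (base_subst C p) = subst_map C False False (graph_point u v p))"
    and p: "p \<in> \<Omega>"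
  have \<Omega>: "open \<Omega>" and su: "smooth_on \<Omega> u" and sv: "smooth_on \<Omega> v" and uS: "\<And>q. q \<in> \<Omega> \<Longrightarrow> u q \<in> uvals S"
    using H by auto
  have gr: "u' (base_subst C q) = (u q - \<alpha> (fst q)) / r (fst q)" "v' (base_subst C q) = v q / r (fst q)"
    if "q \<in> \<Omega>" for q
  proof -
    have "graph_point u' v' (base_subst C q) = subst_map C False False (graph_point u v q)" using H that by blast
    then show "u' (base_subst C q) = (u q - \<alpha> (fst q)) / r (fst q)" "v' (base_subst C q) = v q / r (fst q)"
      by (cases q; simp add: graph_point_def base_eq map_eq)+
  qed
  have dif: "g differentiable (at q)" if "smooth_on \<Omega> g" "q \<in> \<Omega>" for g :: "real \<times> real \<Rightarrow> real" and q
    using smooth_on_differentiable that by blast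
  note bx = base_change(2)[OF invertible \<Omega>, unfolded C_simps]
  note bt = base_change(1)[OF invertible \<Omega>, unfolded C_simps]
  have mx: "pd_x f (base_subst C q) = m (fst q) * pd_x g q"
    if "q \<in> \<Omega>" "g differentiable (at q)" "\<And>q. q \<in> \<Omega> \<Longrightarrow> f (base_subst C q) = m (fst q) * g q" "smooth_on UNIV m" for f g m q
  proof -
    note dm = differentiable_time_mult[OF smooth_on_real_deriv[OF that(4) UNIV_I] that(2)]
    show ?thesis using bx[OF that(1) dm(1) that(3)] dm(2) by simp
  qed
  have dgu: "((\<lambda>q. (u q - \<alpha> (fst q)) / r (fst q)) has_derivative
     (\<lambda>w. (1 / r (fst q)) * (fst w * pd_t u q + snd w * pd_x u q - c5 * fst w) + (- c7 / r (fst q)) * fst w * (u q - \<alpha> (fst q)))) (at q)"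
    if q: "q \<in> \<Omega>" for q
  proof -
    have c: "((\<lambda>q. c (fst q)) has_derivative (\<lambda>w. d * fst w)) (at q)" if "(c has_real_derivative d) (at (fst q))" for c d
      using diff_chain_at[OF has_derivative_fst[OF has_derivative_ident], of c "(*) d" q] that
      by (simp add: o_def has_field_derivative_def)
    have "((\<lambda>q. (1 / r (fst q)) * (u q - \<alpha> (fst q))) has_derivative
     (\<lambda>w. (1 / r (fst q)) * (fst w * pd_t u q + snd w * pd_x u q - c5 * fst w) + (- c7 / r (fst q)) * fst w * (u q - \<alpha> (fst q)))) (at q)"
      by (rule has_derivative_mult[OF c[OF derivs(5)] has_derivative_diff[OF has_derivative_pd[OF dif[OF su q]] c[OF derivs(2)]]])
    then show ?thesis by simp
  qed
  have ut: "pd_t u' (base_subst C p) = (pd_t u p - c5 - c7 * (u p - \<alpha> (fst p))) / r (fst p) / \<theta> (fst p)"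
  proof -
    have d: "(\<lambda>q. (u q - \<alpha> (fst q)) / r (fst q)) differentiable at p" using dgu[OF p] differentiable_def by blast
    have "(1 / r (fst p)) * (fst (1, 0) * pd_t u p + snd (1, 0) * pd_x u p - c5 * fst (1, 0))
        + (- c7 / r (fst p)) * fst (1, 0) * (u p - \<alpha> (fst p)) = (pd_t u p - c5 - c7 * (u p - \<alpha> (fst p))) / r (fst p)"
      using r_nz by (simp add: field_simps)
    then show ?thesis using bt[OF p d gr(1)] unfolding pd_eq(1)[OF dgu[OF p]] \<theta>_def by simp
  qed
  have ux: "pd_x u' (base_subst C q) = 1 / r (fst q) * pd_x u q" if q: "q \<in> \<Omega>" for q
  proof -
    have d: "(\<lambda>q. (u q - \<alpha> (fst q)) / r (fst q)) differentiable at q" using dgu[OF q] differentiable_def by blast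
    show ?thesis using bx[OF q d gr(1)] pd_eq(2)[OF dgu[OF q]] by simp
  qed
  have uxx: "pd_x (pd_x u') (base_subst C q) = 1 / r (fst q) * pd_x (pd_x u) q" if q: "q \<in> \<Omega>" for q
    using mx[OF q dif[OF smooth_pd(2)[OF su] q] ux smooths(5)] by blast
  have vx: "pd_x v' (base_subst C q) = 1 / r (fst q) * pd_x v q" if q: "q \<in> \<Omega>" for q
    using mx[OF q dif[OF sv q] _ smooths(5)] gr(2) by simp
  have oS: "open (uvals S)" and sK: "smooth_on (uvals S) (coefK S)" and sD: "smooth_on (uvals S) (coefD S)"
    using S by (auto simp: valid_system_def)
  have sm: "smooth_on UNIV (\<lambda>t. 1 / \<theta> t * (1 / r t))" by (rule smooth_on_mult[OF open_UNIV smooths(6,5)])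
  have dK: "(\<lambda>q. coefK S (u q) * pd_x v q) differentiable (at p)"
    by (rule dif[OF smooth_on_mult[OF \<Omega> smooth_on_comp[OF \<Omega> oS sK su uS] smooth_pd(2)[OF sv]] p])
  have dD: "(\<lambda>q. coefD S (u q) * pd_x u q) differentiable (at p)"
    by (rule dif[OF smooth_on_mult[OF \<Omega> smooth_on_comp[OF \<Omega> oS sD su uS] smooth_pd(2)[OF su]] p])
  have eK: "pd_x (\<lambda>q. coefK S' (u' q) * pd_x v' q) (base_subst C p) = 1 / \<theta> (fst p) * (1 / r (fst p)) * pd_x (\<lambda>q. coefK S (u q) * pd_x v q) p"
    by (rule mx[OF p dK _ sm]) (use coefs(2)[OF uS gr(1)] vx theta_nz in simp)
  have eD: "pd_x (\<lambda>q. coefD S' (u' q) * pd_x u' q) (base_subst C p) = 1 / \<theta> (fst p) * (1 / r (fst p)) * pd_x (\<lambda>q. coefD S (u q) * pd_x u q) p"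
    by (rule mx[OF p dD _ sm]) (use coefs(3)[OF uS gr(1)] ux theta_nz in simp)
  have eF: "coefF S' (u' (base_subst C p)) = (coefF S (u p) - c5 - c7 * (u p - \<alpha> (fst p))) / r (fst p) / \<theta> (fst p)"
  proof -
    have e: "u p - \<alpha> (fst p) = r (fst p) * u' (base_subst C p)" using gr(1)[OF p] r_nz by simp
    show ?thesis unfolding e coefs(4)[OF uS[OF p] gr(1)[OF p]] using theta_nz r_nz by simp
  qed
  have "system_holds_at S' u' v' (base_subst C p) \<longleftrightarrow>
     (pd_t u p - c5 - c7 * (u p - \<alpha> (fst p))) / r (fst p) / \<theta> (fst p) =
       - (1 / \<theta> (fst p) * (1 / r (fst p)) * pd_x (\<lambda>q. coefK S (u q) * pd_x v q) p)
       + 1 / \<theta> (fst p) * (1 / r (fst p)) * pd_x (\<lambda>q. coefD S (u q) * pd_x u q) p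
       + (coefF S (u p) - c5 - c7 * (u p - \<alpha> (fst p))) / r (fst p) / \<theta> (fst p) \<and>
     0 = 1 / r (fst p) * pd_x (pd_x u) p - v p / r (fst p)"
    unfolding system_holds_at_def ut eK eD eF uxx[OF p] gr(2)[OF p] ..
  also have "\<dots> \<longleftrightarrow> system_holds_at S u v p"
  proof -
    have "(x / r (fst p) / \<theta> (fst p) = - (1 / \<theta> (fst p) * (1 / r (fst p)) * k) + 1 / \<theta> (fst p) * (1 / r (fst p)) * d + f / r (fst p) / \<theta> (fst p))
      \<longleftrightarrow> x = - k + d + f" for x k d f
    proof -
      have "x / r (fst p) / \<theta> (fst p) - (- (1 / \<theta> (fst p) * (1 / r (fst p)) * k) + 1 / \<theta> (fst p) * (1 / r (fst p)) * d + f / r (fst p) / \<theta> (fst p))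
        = (x - (- k + d + f)) / (r (fst p) * \<theta> (fst p))"
        by (simp add: diff_divide_distrib add_divide_distrib field_simps)
      then show ?thesis using r_nz[of "fst p"] theta_nz[of "fst p"]
        by (metis (no_types, opaque_lifting) divide_eq_0_iff eq_iff_diff_eq_0 mult_eq_0_iff)
    qed
    moreover have "(0 = 1 / r (fst p) * b - c / r (fst p)) \<longleftrightarrow> 0 = b - c" for b c
      using r_nz[of "fst p"] by (simp add: field_simps)
    ultimately show ?thesis unfolding system_holds_at_def by (auto simp: algebra_simps)
  qed
  finally show "system_holds_at S u v p = system_holds_at S' u' v' (base_subst C p)" by simp
qed

end

section \<open>The determining equations under a substitution\<close>

context reduction
begin

text \<open>The push-forward of the field, still over the old time. Applied to y = (u - \<alpha>) /
  r, the field gives (A u + B - a (c5 + c7 (u - \<alpha>))) / r; sorting by powers of y yields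
  \<open>hA\<close> and \<open>hB\<close>.\<close>

definition "ha a = (\<lambda>t. \<theta> t * a t)"
definition "hA a A = (\<lambda>t. A t - c7 * a t)"
definition hB :: "(real \<Rightarrow> real) \<Rightarrow> (real \<Rightarrow> real) \<Rightarrow> (real \<times> real \<Rightarrow> real) \<Rightarrow> real \<times> real \<Rightarrow> real" where
  "hB a A B = (\<lambda>q. 1 / r (fst q) * (A (fst q) * \<alpha> (fst q) + B q - c5 * a (fst q)))"

lemma y_deriv:
  assumes "y = (u - \<alpha> t) / r t"
  shows "((\<lambda>s. (u - \<alpha> s) / r s) has_real_derivative - (c5 + c7 * r t * y) / r t) (at t)"
  using r_nz[of t] derivs(2,3)[of t]
  by (auto intro!: derivative_eq_intros simp: assms field_simps power2_eq_square)

text \<open>The relation is differentiated in \<open>u\<close>, and in \<open>t\<close> at fixed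
  \<open>u\<close>. In the second case the left side is constant, which gives an infinitesimal
  scaling law for \<open>g\<close>. The switch \<open>e\<close> is 0 for \<open>K\<close> and
  \<open>D\<close>, and 1 for \<open>F\<close>, whose relation contains the extra affine
  part.\<close>

lemma coef_derivs:
  assumes u: "u \<in> uvals S" and y: "y = (u - \<alpha> t) / r t"
    and sf: "smooth_on (uvals S) f" and sg: "smooth_on (uvals S') g"
    and eq: "\<And>u t. u \<in> uvals S \<Longrightarrow> f u = m t * g ((u - \<alpha> t) / r t) + c5 * e + c7 * e * (u - \<alpha> t)"
    and m: "(m has_real_derivative m') (at t)"
  shows "deriv f u = m t * deriv g y / r t + c7 * e"
    and "m' * g y = m t * deriv g y * (c5 + c7 * r t * y) / r t + c7 * e * c5"
proof -
  have yS: "y \<in> uvals S'" using coefs(1)[OF u y] .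
  have oS: "open (uvals S)" using S by (simp add: valid_system_def)
  have dg: "(g has_real_derivative deriv g y) (at y)" using smooth_on_real_deriv[OF sg yS] .
  have i1: "((\<lambda>u. g ((u - \<alpha> t) / r t)) has_real_derivative deriv g y * (1 / r t)) (at u)"
    by (rule DERIV_chain2[where g = "\<lambda>u. (u - \<alpha> t) / r t", OF dg[unfolded y], folded y])
      (use r_nz[of t] in \<open>auto intro!: derivative_eq_intros\<close>)
  have i2: "((\<lambda>s. g ((u - \<alpha> s) / r s)) has_real_derivative deriv g y * (- (c5 + c7 * r t * y) / r t)) (at t)"
    by (rule DERIV_chain2[where g = "\<lambda>s. (u - \<alpha> s) / r s", OF dg[unfolded y] y_deriv[OF refl], folded y])
  have "((\<lambda>u. m t * g ((u - \<alpha> t) / r t) + c5 * e + c7 * e * (u - \<alpha> t)) has_real_derivative m t * (deriv g y * (1 / r t)) + c7 * e) (at u)"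
    using r_nz[of t] by (auto intro!: derivative_eq_intros i1)
  from has_field_derivative_transform_within_open[OF this oS u, of f]
  have "(f has_real_derivative m t * (deriv g y * (1 / r t)) + c7 * e) (at u)" using eq by metis
  then show "deriv f u = m t * deriv g y / r t + c7 * e" by (simp add: DERIV_imp_deriv)
  have "((\<lambda>s. m s * g ((u - \<alpha> s) / r s) + c5 * e + c7 * e * (u - \<alpha> s)) has_real_derivative
     m' * g y + m t * (deriv g y * (- (c5 + c7 * r t * y) / r t)) - c7 * e * c5) (at t)"
    using derivs(2)[of t]
    by (auto intro!: derivative_eq_intros m i2 simp: y)
  moreover have "(\<lambda>s. m s * g ((u - \<alpha> s) / r s) + c5 * e + c7 * e * (u - \<alpha> s)) = (\<lambda>s. f u)"
    using eq[OF u] by metis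
  ultimately have "((\<lambda>s. f u) has_real_derivative
     m' * g y + m t * (deriv g y * (- (c5 + c7 * r t * y) / r t)) - c7 * e * c5) (at t)" by simp
  from DERIV_unique[OF this DERIV_const] r_nz[of t]
  show "m' * g y = m t * deriv g y * (c5 + c7 * r t * y) / r t + c7 * e * c5" by (simp add: field_simps)
qed

lemma smooth_t:
  assumes "smooth_on UNIV a" "smooth_on UNIV A" "smooth_on UNIV B"
  shows "smooth_on UNIV (ha a)" "smooth_on UNIV (hA a A)" "smooth_on UNIV (hB a A B)"
  unfolding ha_def hA_def hB_def
  by (intro smooth_on_mult smooth_on_add smooth_on_diff open_UNIV smooths assms smooth_on_const
      smooth_on_fst_arg[OF smooths(5)] smooth_on_fst_arg[OF smooths(3)]
      smooth_on_fst_arg[OF assms(1)] smooth_on_fst_arg[OF assms(2)])+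

lemma derivs_t:
  assumes a: "smooth_on UNIV a" and A: "smooth_on UNIV A" and B: "smooth_on UNIV B"
  shows "deriv (ha a) t = c2 * (\<theta> t - c0) * a t + \<theta> t * deriv a t"
    and "deriv (hA a A) t = deriv A t - c7 * deriv a t"
    and "pd_t (hB a A B) (t, x) = - c7 * hB a A B (t, x)
       + (deriv A t * \<alpha> t + c5 * A t + pd_t B (t, x) - c5 * deriv a t) / r t"
    and "pd_x (hB a A B) = (\<lambda>q. 1 / r (fst q) * pd_x B q)"
proof -
  note d = smooth_on_real_deriv[OF a UNIV_I] smooth_on_real_deriv[OF A UNIV_I]
  show "deriv (ha a) t = c2 * (\<theta> t - c0) * a t + \<theta> t * deriv a t"
    unfolding ha_def by (rule DERIV_imp_deriv) (auto intro!: derivative_eq_intros derivs d)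
  show "deriv (hA a A) t = deriv A t - c7 * deriv a t"
    unfolding hA_def by (rule DERIV_imp_deriv) (auto intro!: derivative_eq_intros d)
  have c: "((\<lambda>q. c (fst q)) has_derivative (\<lambda>w. d * fst w)) (at q)" if "(c has_real_derivative d) (at (fst q))"
    for c d and q :: "real \<times> real"
    using diff_chain_at[OF has_derivative_fst[OF has_derivative_ident], of c "(*) d" q] that
    by (simp add: o_def has_field_derivative_def)
  have g: "((\<lambda>q. A (fst q) * \<alpha> (fst q) + B q - c5 * a (fst q)) has_derivative
     (\<lambda>w. (A (fst q) * (c5 * fst w) + deriv A (fst q) * fst w * \<alpha> (fst q)) + (fst w * pd_t B q + snd w * pd_x B q)
        - c5 * (deriv a (fst q) * fst w))) (at q)" for q
    by (intro has_derivative_diff has_derivative_add has_derivative_mult has_derivative_mult_right c d derivs smooth_on_UNIV_pd B)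
  have gd: "(\<lambda>q. A (fst q) * \<alpha> (fst q) + B q - c5 * a (fst q)) differentiable (at q)" for q
    using g differentiable_def by blast
  note dm = differentiable_time_mult[OF derivs(5) gd]
  show "pd_t (hB a A B) (t, x) = - c7 * hB a A B (t, x)
       + (deriv A t * \<alpha> t + c5 * A t + pd_t B (t, x) - c5 * deriv a t) / r t"
    unfolding hB_def dm(3) pd_eq(1)[OF g] using r_nz by (simp add: field_simps)
  show "pd_x (hB a A B) = (\<lambda>q. 1 / r (fst q) * pd_x B q)"
    unfolding hB_def by (rule ext) (simp only: dm(2) pd_eq(2)[OF g], simp)
qed

lemma pd_x_scaled:
  assumes "smooth_on UNIV g"
  shows "pd_x (\<lambda>q. 1 / r (fst q) * g q) = (\<lambda>q. 1 / r (fst q) * pd_x g q)"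
  using differentiable_time_mult(2)[OF derivs(5) smooth_on_differentiable[OF assms UNIV_I]] by blast

lemma Bt_xs:
  assumes a: "smooth_on UNIV a" and A: "smooth_on UNIV A" and B: "smooth_on UNIV B"
  shows "pd_x (pd_x (hB a A B)) (t, x) = pd_x (pd_x B) (t, x) / r t"
    "pd_x (pd_x (pd_x (pd_x (hB a A B)))) (t, x) = pd_x (pd_x (pd_x (pd_x B))) (t, x) / r t"
proof -
  note s1 = smooth_pd(2)[OF B] note s2 = smooth_pd(2)[OF s1] note s3 = smooth_pd(2)[OF s2]
  show "pd_x (pd_x (hB a A B)) (t, x) = pd_x (pd_x B) (t, x) / r t"
    "pd_x (pd_x (pd_x (pd_x (hB a A B)))) (t, x) = pd_x (pd_x (pd_x (pd_x B))) (t, x) / r t"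
    unfolding derivs_t(4)[OF assms] pd_x_scaled[OF s1] pd_x_scaled[OF s2] pd_x_scaled[OF s3] by simp_all
qed

text \<open>The substitution depends on time, so rewriting the equations produces terms proportional
  to \<open>a t\<close>; the scaling laws from \<open>coef_derivs\<close> cancel them.\<close>

lemma determining_pointwise:
  assumes u: "u \<in> uvals S" and y: "y = (u - \<alpha> t) / r t"
    and a: "smooth_on UNIV a" and A: "smooth_on UNIV A" and B: "smooth_on UNIV B"
  shows "deriv (coefK S) u * (A t * u + B (t, x)) = coefK S u * (4 * p - deriv a t) \<longleftrightarrow>
      deriv (coefK S') y * (hA a A t * y + hB a A B (t, x)) = coefK S' y * (4 * p - deriv (ha a) t / \<theta> t)" (is ?K)
    and "deriv (coefD S) u * (A t * u + B (t, x)) = coefD S u * (2 * p - deriv a t) \<longleftrightarrow>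
      deriv (coefD S') y * (hA a A t * y + hB a A B (t, x)) = coefD S' y * (2 * p - deriv (ha a) t / \<theta> t)" (is ?D)
    and "deriv (coefF S) u * (A t * u + B (t, x)) = (A t - deriv a t) * coefF S u + deriv A t * u + pd_t B (t, x)
         + coefK S u * pd_x (pd_x (pd_x (pd_x B))) (t, x) - coefD S u * pd_x (pd_x B) (t, x) \<longleftrightarrow>
      deriv (coefF S') y * (hA a A t * y + hB a A B (t, x)) = (hA a A t - deriv (ha a) t / \<theta> t) * coefF S' y
         + (deriv (hA a A) t * y + pd_t (hB a A B) (t, x)) / \<theta> t
         + coefK S' y * pd_x (pd_x (pd_x (pd_x (hB a A B)))) (t, x) - coefD S' y * pd_x (pd_x (hB a A B)) (t, x)" (is ?F)
proof -
  have sm: "smooth_on (uvals S) (coefK S)" "smooth_on (uvals S) (coefD S)" "smooth_on (uvals S) (coefF S)"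
    "smooth_on (uvals S') (coefK S')" "smooth_on (uvals S') (coefD S')" "smooth_on (uvals S') (coefF S')"
    using S S' by (auto simp: valid_system_def)
  define th1 where "th1 = c2 * (\<theta> t - c0)"
  define k0 k1 d0 d1 f0 f1 where df: "k0 = coefK S' y" "k1 = deriv (coefK S') y" "d0 = coefD S' y" "d1 = deriv (coefD S') y"
    "f0 = coefF S' y" "f1 = deriv (coefF S') y"
  define T R AL a0 a1 A0 A1 B0 where dg: "T = \<theta> t" "R = r t" "AL = \<alpha> t" "a0 = a t" "a1 = deriv a t" "A0 = A t"
    "A1 = deriv A t" "B0 = B (t, x)"
  define Bv where "Bv = hB a A B (t, x)"
  have T: "T \<noteq> 0" and R: "R \<noteq> 0" using theta_nz r_nz by (simp_all add: dg)
  have ut: "u = AL + R * y" using y R by (simp add: dg)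
  note K0 = coefs(2)[OF u y, folded df dg] note D0 = coefs(3)[OF u y, folded df dg]
  note F0 = coefs(4)[OF u y, folded df dg]
  have B0: "B0 = R * Bv - A0 * AL + c5 * a0"
    using R by (simp add: Bv_def hB_def dg)
  have ms: "(\<theta> has_real_derivative th1) (at t)" unfolding th1_def by (rule derivs(4))
  have mr: "((\<lambda>t. \<theta> t * r t) has_real_derivative th1 * r t + c7 * r t * \<theta> t) (at t)"
    by (rule DERIV_mult[OF ms derivs(3)])
  have K: "deriv (coefK S) u = T * k1 / R" "th1 * k0 = T * k1 * (c5 + c7 * R * y) / R"
    using coef_derivs[OF u y sm(1,4) _ ms, of 0] coefs(2)[OF _ refl] by (simp_all add: df dg)
  have D: "deriv (coefD S) u = T * d1 / R" "th1 * d0 = T * d1 * (c5 + c7 * R * y) / R"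
    using coef_derivs[OF u y sm(2,5) _ ms, of 0] coefs(3)[OF _ refl] by (simp_all add: df dg)
  have eF: "coefF S v = \<theta> s * r s * coefF S' ((v - \<alpha> s) / r s) + c5 * 1 + c7 * 1 * (v - \<alpha> s)" if "v \<in> uvals S" for v s
    using coefs(4)[OF that refl, of s] r_nz[of s] by simp
  have F: "deriv (coefF S) u = T * f1 + c7"
    "(th1 * R + c7 * R * T) * f0 = T * f1 * (c5 + c7 * R * y) + c7 * c5"
    using coef_derivs[OF u y sm(3,6) eF mr] R by (simp_all add: df dg)
  note dt = derivs_t[OF a A B] note xs = Bt_xs[OF a A B]
  have Ae: "hA a A t = A0 - c7 * a0" by (simp add: hA_def dg)
  \<comment> \<open>The old u component is r times the new component plus \<open>a\<close> times the
    velocity c5 + c7 r y of u at fixed y.\<close>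
  have eta: "A0 * u + B0 = R * ((A0 - c7 * a0) * y + Bv) + a0 * (c5 + c7 * R * y)"
    unfolding ut B0 by (simp add: algebra_simps)
  have iff: "(l1 = r1) = (l2 = r2)" if "l1 - r1 = c * (l2 - r2)" "c \<noteq> 0" for l1 r1 l2 r2 c :: real
    using that by (metis eq_iff_diff_eq_0 mult_eq_0_iff)
  have da: "deriv (ha a) t / T = th1 * a0 / T + a1" unfolding dt(1) dg[symmetric] using T by (simp add: th1_def dg field_simps)
  show ?K unfolding Ae da K(1) K0 df(1,2)[symmetric] dg[symmetric] Bv_def[symmetric] eta
  proof (rule iff[OF _ T])
    have "T * k1 / R * (R * ((A0 - c7 * a0) * y + Bv) + a0 * (c5 + c7 * R * y)) - T * k0 * (4 * p - a1)
      = T * (k1 * ((A0 - c7 * a0) * y + Bv) - k0 * (4 * p - a1)) + a0 * (T * k1 * (c5 + c7 * R * y) / R)"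
      using R by (simp add: field_simps)
    also have "\<dots> = T * (k1 * ((A0 - c7 * a0) * y + Bv) - k0 * (4 * p - (th1 * a0 / T + a1)))"
      unfolding K(2)[symmetric] using T by (simp add: field_simps)
    finally show "T * k1 / R * (R * ((A0 - c7 * a0) * y + Bv) + a0 * (c5 + c7 * R * y)) - T * k0 * (4 * p - a1)
      = T * (k1 * ((A0 - c7 * a0) * y + Bv) - k0 * (4 * p - (th1 * a0 / T + a1)))" .
  qed
  show ?D unfolding Ae da D(1) D0 df(3,4)[symmetric] dg[symmetric] Bv_def[symmetric] eta
  proof (rule iff[OF _ T])
    have "T * d1 / R * (R * ((A0 - c7 * a0) * y + Bv) + a0 * (c5 + c7 * R * y)) - T * d0 * (2 * p - a1)
      = T * (d1 * ((A0 - c7 * a0) * y + Bv) - d0 * (2 * p - a1)) + a0 * (T * d1 * (c5 + c7 * R * y) / R)"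
      using R by (simp add: field_simps)
    also have "\<dots> = T * (d1 * ((A0 - c7 * a0) * y + Bv) - d0 * (2 * p - (th1 * a0 / T + a1)))"
      unfolding D(2)[symmetric] using T by (simp add: field_simps)
    finally show "T * d1 / R * (R * ((A0 - c7 * a0) * y + Bv) + a0 * (c5 + c7 * R * y)) - T * d0 * (2 * p - a1)
      = T * (d1 * ((A0 - c7 * a0) * y + Bv) - d0 * (2 * p - (th1 * a0 / T + a1)))" .
  qed
  define b4 where "b4 = pd_x (pd_x (pd_x (pd_x B))) (t, x)"
  define b2 where "b2 = pd_x (pd_x B) (t, x)"
  define bt where "bt = pd_t B (t, x)"
  have Bte: "pd_t (hB a A B) (t, x) = - c7 * Bv + (A1 * AL + c5 * A0 + bt - c5 * a1) / R"
    unfolding dt(3) by (simp add: Bv_def dg bt_def)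
  have A1e: "deriv (hA a A) t = A1 - c7 * a1" unfolding dt(2) by (simp add: dg)
  show ?F unfolding Ae da F(1) F0 K0 D0 df[symmetric] dg[symmetric] Bv_def[symmetric] eta xs Bte A1e b4_def[symmetric]
      b2_def[symmetric] bt_def[symmetric]
  proof (rule iff)
    show "T * R \<noteq> 0" using T R by simp
    have "(T * f1 + c7) * (R * ((A0 - c7 * a0) * y + Bv) + a0 * (c5 + c7 * R * y)) -
      ((A0 - a1) * (T * R * f0 + c5 + c7 * R * y) + A1 * u + bt + T * k0 * b4 - T * d0 * b2)
      = T * R * f1 * ((A0 - c7 * a0) * y + Bv) + c7 * (R * ((A0 - c7 * a0) * y + Bv)) + a0 * c7 * (c5 + c7 * R * y)
        + a0 * (T * f1 * (c5 + c7 * R * y)) -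
      ((A0 - a1) * (T * R * f0 + c5 + c7 * R * y) + A1 * u + bt + T * k0 * b4 - T * d0 * b2)"
      by (simp add: algebra_simps)
    also have "T * f1 * (c5 + c7 * R * y) = (th1 * R + c7 * R * T) * f0 - c7 * c5" using F(2) by simp
    also have "T * R * f1 * ((A0 - c7 * a0) * y + Bv) + c7 * (R * ((A0 - c7 * a0) * y + Bv)) + a0 * c7 * (c5 + c7 * R * y)
        + a0 * ((th1 * R + c7 * R * T) * f0 - c7 * c5) -
      ((A0 - a1) * (T * R * f0 + c5 + c7 * R * y) + A1 * u + bt + T * k0 * b4 - T * d0 * b2)
      = T * R * (f1 * ((A0 - c7 * a0) * y + Bv) - ((A0 - c7 * a0 - (th1 * a0 / T + a1)) * f0
         + ((A1 - c7 * a1) * y + (- c7 * Bv + (A1 * AL + c5 * A0 + bt - c5 * a1) / R)) / T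
         + k0 * (b4 / R) - d0 * (b2 / R)))"
      unfolding ut using T R by (simp add: field_simps)
    finally show "(T * f1 + c7) * (R * ((A0 - c7 * a0) * y + Bv) + a0 * (c5 + c7 * R * y)) -
      ((A0 - a1) * (T * R * f0 + c5 + c7 * R * y) + A1 * u + bt + T * k0 * b4 - T * d0 * b2)
      = T * R * (f1 * ((A0 - c7 * a0) * y + Bv) - ((A0 - c7 * a0 - (th1 * a0 / T + a1)) * f0
         + ((A1 - c7 * a1) * y + (- c7 * Bv + (A1 * AL + c5 * A0 + bt - c5 * a1) / R)) / T
         + k0 * (b4 / R) - d0 * (b2 / R)))" .
  qed
qed

lemma determining_iff_hat:
  assumes a: "smooth_on UNIV a" and A: "smooth_on UNIV A" and B: "smooth_on UNIV B"
  shows "determining S a A B p \<longleftrightarrow> hat_eqs S' \<theta> Y (ha a) (hA a A) (hB a A B) p"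
proof -
  have "(\<forall>y\<in>Y t. P y) \<longleftrightarrow> (\<forall>u\<in>uvals S. P ((u - \<alpha> t) / r t))" for P t by (auto simp: Y_def)
  then show ?thesis
    unfolding determining_def hat_eqs_def using a A B smooth_t[OF a A B] determining_pointwise[OF _ refl a A B]
    by (auto 0 3)
qed

end

section \<open>Transport of the whole algebra\<close>

context reduction
begin

lemma frechet_map:
  "frechet_derivative (subst_map C False False) (at (t, x, u, v)) (w1, w2, w3, w4) =
    (\<theta> t * w1, w2, (w3 - (c5 + c7 * (u - \<alpha> t)) * w1) / r t, (w4 - c7 * v * w1) / r t)"
proof -
  let ?z = "(t, x, u, v)"
  have c: "((\<lambda>z::jet0. c (fst z)) has_derivative (\<lambda>w. d * fst w)) (at ?z)" if "(c has_real_derivative d) (at t)" for c d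
    using diff_chain_at[OF has_derivative_fst[OF has_derivative_ident], of c "(*) d" ?z] that
    by (simp add: o_def has_field_derivative_def)
  have e: "subst_map C False False = (\<lambda>z. (\<tau> (fst z), fst (snd z), 1 / r (fst z) * (fst (snd (snd z)) - \<alpha> (fst z)),
     1 / r (fst z) * snd (snd (snd z))))"
  proof
    fix z show "subst_map C False False z = (\<tau> (fst z), fst (snd z), 1 / r (fst z) * (fst (snd (snd z)) - \<alpha> (fst z)),
     1 / r (fst z) * snd (snd (snd z)))"
      by (cases z) (simp add: map_eq)
  qed
  have "((\<lambda>z. (\<tau> (fst z), fst (snd z), 1 / r (fst z) * (fst (snd (snd z)) - \<alpha> (fst z)),
     1 / r (fst z) * snd (snd (snd z)))) has_derivative
    (\<lambda>w. (\<theta> t * fst w, fst (snd w),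
       1 / r (fst ?z) * (fst (snd (snd w)) - c5 * fst w) + (- c7 / r t * fst w) * (fst (snd (snd ?z)) - \<alpha> (fst ?z)),
       1 / r (fst ?z) * snd (snd (snd w)) + (- c7 / r t * fst w) * snd (snd (snd ?z))))) (at ?z)"
    by (intro has_derivative_Pair has_derivative_mult has_derivative_diff has_derivative_fst has_derivative_snd
        has_derivative_ident c derivs)
  from frechet_derivative_eqI[OF this] show ?thesis
    unfolding e using r_nz[of t] by (simp add: field_simps)
qed

lemma comp_derivative:
  assumes "smooth_on UNIV B"
  shows "pd_t (\<lambda>q. B (\<tau> (fst q), snd q)) (t, x) = \<theta> t * pd_t B (\<tau> t, x)"
    and "pd_x (\<lambda>q. B (\<tau> (fst q), snd q)) = (\<lambda>q. pd_x B (\<tau> (fst q), snd q))"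
    and "smooth_on UNIV (\<lambda>q. B (\<tau> (fst q), snd q))"
proof -
  have l: "((\<lambda>q::real \<times> real. (\<tau> (fst q), snd q)) has_derivative (\<lambda>w. (\<theta> (fst q) * fst w, snd w))) (at q)" for q
  proof -
    have "((\<lambda>q::real \<times> real. \<tau> (fst q)) has_derivative (\<lambda>w. \<theta> (fst q) * fst w)) (at q)"
      using diff_chain_at[OF has_derivative_fst[OF has_derivative_ident], of \<tau> "(*) (\<theta> (fst q))" q] derivs(1)
      by (simp add: o_def has_field_derivative_def)
    then show ?thesis by (intro derivative_intros)
  qed
  have "((\<lambda>q. B (\<tau> (fst q), snd q)) has_derivative (\<lambda>w. \<theta> (fst q) * fst w * pd_t B (\<tau> (fst q), snd q)
      + snd w * pd_x B (\<tau> (fst q), snd q))) (at q)" for q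
    using diff_chain_at[OF l smooth_on_UNIV_pd[OF assms]] by (simp add: o_def)
  from pd_eq[OF this] show "pd_t (\<lambda>q. B (\<tau> (fst q), snd q)) (t, x) = \<theta> t * pd_t B (\<tau> t, x)"
    and "pd_x (\<lambda>q. B (\<tau> (fst q), snd q)) = (\<lambda>q. pd_x B (\<tau> (fst q), snd q))"
    by (simp_all add: fun_eq_iff)
  show "smooth_on UNIV (\<lambda>q. B (\<tau> (fst q), snd q))"
    by (rule smooth_on_comp2[OF open_UNIV assms smooth_on_fst_arg[OF smooths(1)] smooth_on_linear[OF open_UNIV bounded_linear_snd]]) simp
qed

text \<open>Pulling a solution back along \<tau> multiplies time derivatives by \<theta>, which the
  divisions in \<open>hat_eqs\<close> undo.\<close>

lemma hat_of_determining:
  assumes d: "determining S' a A B p"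
  shows "hat_eqs S' \<theta> Y (\<lambda>t. a (\<tau> t)) (\<lambda>t. A (\<tau> t)) (\<lambda>q. B (\<tau> (fst q), snd q)) p"
proof -
  have a: "smooth_on UNIV a" and A: "smooth_on UNIV A" and B: "smooth_on UNIV B"
    using d by (auto simp: determining_def)
  have cm: "smooth_on UNIV (\<lambda>t. f (\<tau> t))" if "smooth_on UNIV f" for f :: "real \<Rightarrow> real"
    by (rule smooth_on_comp[OF open_UNIV open_UNIV that smooths(1)]) simp
  have dv: "deriv (\<lambda>t. f (\<tau> t)) t = deriv f (\<tau> t) * \<theta> t" if "smooth_on UNIV f" for f t
    by (rule DERIV_imp_deriv[OF DERIV_chain2[OF smooth_on_real_deriv[OF that UNIV_I] derivs(1)]])
  note s1 = smooth_pd(2)[OF B] note s2 = smooth_pd(2)[OF s1] note s3 = smooth_pd(2)[OF s2]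
  have YS: "y \<in> uvals S'" if "y \<in> Y t" for y t
    using that coefs(1)[OF _ refl] by (auto simp: Y_def)
  show ?thesis
    unfolding hat_eqs_def comp_derivative(1)[OF B] comp_derivative(2)[OF B] comp_derivative(2)[OF s1]
      comp_derivative(2)[OF s2] comp_derivative(2)[OF s3] dv[OF a] dv[OF A] fst_conv snd_conv
  proof (intro conjI allI ballI cm a A comp_derivative(3) B)
    fix t x y assume "y \<in> Y t"
    then have y: "y \<in> uvals S'" by (rule YS)
    note D = d[unfolded determining_def, THEN conjunct2, THEN conjunct2, THEN conjunct2, rule_format, OF y, of "\<tau> t" x]
    show "deriv (coefK S') y * (A (\<tau> t) * y + B (\<tau> t, x)) = coefK S' y * (4 * p - deriv a (\<tau> t) * \<theta> t / \<theta> t)"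
      "deriv (coefD S') y * (A (\<tau> t) * y + B (\<tau> t, x)) = coefD S' y * (2 * p - deriv a (\<tau> t) * \<theta> t / \<theta> t)"
      using D theta_nz[of t] by simp_all
    have "(deriv A (\<tau> t) * \<theta> t * y + \<theta> t * pd_t B (\<tau> t, x)) / \<theta> t = deriv A (\<tau> t) * y + pd_t B (\<tau> t, x)"
      using theta_nz[of t] by (simp add: field_simps)
    then show "deriv (coefF S') y * (A (\<tau> t) * y + B (\<tau> t, x)) =
       (A (\<tau> t) - deriv a (\<tau> t) * \<theta> t / \<theta> t) * coefF S' y +
       (deriv A (\<tau> t) * \<theta> t * y + \<theta> t * pd_t B (\<tau> t, x)) / \<theta> t +
       coefK S' y * pd_x (pd_x (pd_x (pd_x B))) (\<tau> t, x) - coefD S' y * pd_x (pd_x B) (\<tau> t, x)"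
      using D theta_nz[of t] by simp
  qed
qed

text \<open>For one inclusion the pushed-forward coefficients have to extend to all new times, which
  is what \<open>solves\<close> provides. For the other a globally defined field is pulled back; the
  differential of the substitution is invertible at each point, so the field is determined by its
  image.\<close>

lemma transport:
  assumes V1: "\<And>a A B p. (a, A, B, p) \<in> V \<Longrightarrow> determining S' a A B p"
    and V2: "solves S' V \<tau> \<theta> Y"
  shows "MAI S = transported C False False S (fields (base_dom S') V)"
proof (intro set_eqI iffI)
  fix X assume "X \<in> MAI S"
  then obtain a A B p q where d: "determining S a A B p" and X: "\<forall>z\<in>base_dom S. X z = field_of a A B p q z"
    using MAI_iff[OF S] by blast
  have a: "smooth_on UNIV a" and A: "smooth_on UNIV A" and B: "smooth_on UNIV B"
    using d by (auto simp: determining_def)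
  obtain a' A' B' where V: "(a', A', B', p) \<in> V" and e: "ha a = (\<lambda>t. a' (\<tau> t))" "hA a A = (\<lambda>t. A' (\<tau> t))"
    "hB a A B = (\<lambda>q. B' (\<tau> (fst q), snd q))"
    using V2 d determining_iff_hat[OF a A B] unfolding solves_def by blast
  have B': "smooth_on UNIV B'" using V1[OF V] by (simp add: determining_def)
  have bx: "pd_x (pd_x B') (\<tau> t, x) = pd_x (pd_x B) (t, x) / r t" for t x
    using Bt_xs(1)[OF a A B, of t x] unfolding e(3) comp_derivative(2)[OF B'] comp_derivative(2)[OF smooth_pd(2)[OF B']]
    by simp
  have "frechet_derivative (subst_map C False False) (at z) (X z) = field_of a' A' B' p q (subst_map C False False z)"
    if z: "z \<in> base_dom S" for z
  proof -
    obtain t x u v where zz: "z = (t, x, u, v)" by (metis prod.exhaust)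
    have 1: "a' (\<tau> t) = \<theta> t * a t" "A' (\<tau> t) = A t - c7 * a t"
      "B' (\<tau> t, x) = (A t * \<alpha> t + B (t, x) - c5 * a t) / r t"
      using fun_cong[OF e(1), of t] fun_cong[OF e(2), of t] fun_cong[OF e(3), of "(t, x)"]
      by (simp_all add: ha_def hA_def hB_def)
    have Xz: "X z = field_of a A B p q z" using X z by blast
    show ?thesis unfolding Xz unfolding zz field_of_def prod.case frechet_map map_eq 1 bx
      using r_nz[of t] by (simp add: field_simps)
  qed
  moreover have "field_of a' A' B' p q \<in> fields (base_dom S') V"
    unfolding fields_def by (intro CollectI exI conjI) (rule V, blast)
  ultimately show "X \<in> transported C False False S (fields (base_dom S') V)"
    unfolding transported_def by blast
next
  fix X assume "X \<in> transported C False False S (fields (base_dom S') V)"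
  then obtain W where W: "W \<in> fields (base_dom S') V"
    and X: "\<And>z. z \<in> base_dom S \<Longrightarrow> frechet_derivative (subst_map C False False) (at z) (X z) = W (subst_map C False False z)"
    unfolding transported_def by blast
  obtain a' A' B' p q where V: "(a', A', B', p) \<in> V" and Wf: "\<forall>z\<in>base_dom S'. W z = field_of a' A' B' p q z"
    using W unfolding fields_def by blast
  have d': "determining S' a' A' B' p" using V1[OF V] .
  have a': "smooth_on UNIV a'" and A': "smooth_on UNIV A'" and B': "smooth_on UNIV B'"
    using d' by (auto simp: determining_def)
  have cm: "smooth_on UNIV (\<lambda>t. f (\<tau> t))" if "smooth_on UNIV f" for f :: "real \<Rightarrow> real"
    by (rule smooth_on_comp[OF open_UNIV open_UNIV that smooths(1)]) simp
  \<comment> \<open>The formulas \<open>ha\<close>, \<open>hA\<close>, \<open>hB\<close> solved for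
    the old coefficients.\<close>
  define a where "a = (\<lambda>t. 1 / \<theta> t * a' (\<tau> t))"
  define A where "A = (\<lambda>t. A' (\<tau> t) + c7 * a t)"
  define B where "B = (\<lambda>q. r (fst q) * B' (\<tau> (fst q), snd q) - A (fst q) * \<alpha> (fst q) + c5 * a (fst q))"
  have a: "smooth_on UNIV a" unfolding a_def by (intro smooth_on_mult open_UNIV smooths cm a')
  have A: "smooth_on UNIV A" unfolding A_def by (intro smooth_on_add smooth_on_mult smooth_on_const open_UNIV cm A' a)
  have B: "smooth_on UNIV B" unfolding B_def
    by (intro smooth_on_add smooth_on_diff smooth_on_mult smooth_on_const open_UNIV comp_derivative(3) B'
        smooth_on_fst_arg[OF smooths(3)] smooth_on_fst_arg[OF smooths(4)] smooth_on_fst_arg[OF a] smooth_on_fst_arg[OF A])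
  have e: "ha a = (\<lambda>t. a' (\<tau> t))" "hA a A = (\<lambda>t. A' (\<tau> t))" "hB a A B = (\<lambda>q. B' (\<tau> (fst q), snd q))"
    using theta_nz r_nz by (simp_all add: ha_def hA_def hB_def a_def A_def B_def fun_eq_iff)
  have d: "determining S a A B p"
    unfolding determining_iff_hat[OF a A B] e by (rule hat_of_determining[OF d'])
  have bx: "pd_x (pd_x B) (t, x) = r t * pd_x (pd_x B') (\<tau> t, x)" for t x
    using Bt_xs(1)[OF a A B, of t x] r_nz[of t]
    unfolding e(3) comp_derivative(2)[OF B'] comp_derivative(2)[OF smooth_pd(2)[OF B']]
    by simp
  have "X z = field_of a A B p q z" if z: "z \<in> base_dom S" for z
  proof -
    obtain t x u v where zz: "z = (t, x, u, v)" by (metis prod.exhaust)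
    obtain w1 w2 w3 w4 where Xz: "X z = (w1, w2, w3, w4)" by (metis prod.exhaust)
    have u: "u \<in> uvals S" using z zz by (simp add: base_dom_def)
    have "subst_map C False False z \<in> base_dom S'" using coefs(1)[OF u refl, of t] by (simp add: zz map_eq base_dom_def)
    then have "frechet_derivative (subst_map C False False) (at z) (X z) = field_of a' A' B' p q (subst_map C False False z)"
      using X[OF z] Wf by simp
    then have "frechet_derivative (subst_map C False False) (at (t, x, u, v)) (w1, w2, w3, w4)
        = field_of a' A' B' p q (subst_map C False False (t, x, u, v))" using Xz zz by simp
    then have "\<theta> t * w1 = a' (\<tau> t)" "w2 = p * x + q"
      "(w3 - (c5 + c7 * (u - \<alpha> t)) * w1) / r t = A' (\<tau> t) * ((u - \<alpha> t) / r t) + B' (\<tau> t, x)"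
      "(w4 - c7 * v * w1) / r t = pd_x (pd_x B') (\<tau> t, x) + (A' (\<tau> t) - 2 * p) * (v / r t)"
      unfolding frechet_map map_eq field_of_def by simp_all
    then have w: "w1 = a t" "w2 = p * x + q"
      "w3 = (c5 + c7 * (u - \<alpha> t)) * w1 + A' (\<tau> t) * (u - \<alpha> t) + r t * B' (\<tau> t, x)"
      "w4 = c7 * v * w1 + r t * pd_x (pd_x B') (\<tau> t, x) + (A' (\<tau> t) - 2 * p) * v"
      using theta_nz[of t] r_nz[of t] by (simp_all add: a_def field_simps)
    show ?thesis unfolding Xz unfolding zz field_of_def prod.case w(1,2) w(3)[unfolded w(1)] w(4)[unfolded w(1)] bx
      by (simp add: A_def B_def algebra_simps)
  qed
  then show "X \<in> MAI S" using MAI_iff[OF S] d by blast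
qed

end

section \<open>Solving the determining equations\<close>

text \<open>Two points outside \<open>E\<close> decide. A finite exceptional set is allowed because
  the zero of \<open>e * u + b\<close> has to be left out in the applications.\<close>

lemma affine_zero:
  fixes a b :: real
  assumes "open I" "I \<noteq> {}" "finite E" "\<And>u. u \<in> I \<Longrightarrow> u \<notin> E \<Longrightarrow> a * u + b = 0"
  shows "a = 0" "b = 0"
proof -
  obtain u0 where "u0 \<in> I" using assms(2) by blast
  then have "infinite I" using assms(1) by (metis finite_imp_not_open empty_iff)
  then have "infinite (I - E)" using assms(3) by simp
  then obtain u where u: "u \<in> I - E" by (metis finite.emptyI ex_in_conv)
  have "infinite (I - E - {u})" using \<open>infinite (I - E)\<close> by simp
  then obtain w where w: "w \<in> I - E - {u}" by (metis finite.emptyI ex_in_conv)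
  have ab: "a * u + b = 0 \<and> a * w + b = 0" using assms(4) u w by auto
  have "a * (u - w) = (a * u + b) - (a * w + b)" by (simp add: algebra_simps)
  then have "a * (u - w) = 0" using ab by simp
  then show "a = 0" using w by auto
  then show "b = 0" using ab by simp
qed

text \<open>For \<open>e = 0\<close>, \<open>b = 1\<close> the solutions are multiples of exp
  (\<sigma> u), for \<open>e = 1\<close> powers of u + b with exponent \<sigma>. One equation for
  both lets the exponential and the power cases share their proofs; \<sigma> is called the weight of
  \<open>f\<close> below.\<close>

definition euler :: "real set \<Rightarrow> real \<Rightarrow> real \<Rightarrow> (real \<Rightarrow> real) \<Rightarrow> real \<Rightarrow> bool" where
  "euler J e b f \<sigma> \<longleftrightarrow> (\<forall>u\<in>J. deriv f u * (e * u + b) = \<sigma> * f u)"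

text \<open>The zero of \<open>e * u + b\<close> is exempt because a power with positive exponent
  vanishes there.\<close>

definition nowhere_zero :: "real set \<Rightarrow> real \<Rightarrow> real \<Rightarrow> (real \<Rightarrow> real) \<Rightarrow> bool" where
  "nowhere_zero J e b f \<longleftrightarrow> (\<forall>u\<in>J. e * u + b \<noteq> 0 \<longrightarrow> f u \<noteq> 0)"

definition vanishes :: "real set \<Rightarrow> (real \<Rightarrow> real) \<Rightarrow> bool" where
  "vanishes J f \<longleftrightarrow> (\<forall>u\<in>J. f u = 0)"

lemma deriv_vanishes: "open J \<Longrightarrow> vanishes J f \<Longrightarrow> u \<in> J \<Longrightarrow> deriv f u = 0"
  using DERIV_imp_deriv[OF has_field_derivative_transform_within_open[OF DERIV_const[of 0], of J u f]]
  by (simp add: vanishes_def)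

text \<open>The target side of a substitution. That \<open>Y t\<close> is open and nonempty is
  enough to compare coefficients in \<open>u\<close> and to differentiate in \<open>u\<close> at
  each fixed time.\<close>

locale solving =
  fixes S :: rd_system and \<tau> \<theta> :: "real \<Rightarrow> real" and Y :: "real \<Rightarrow> real set"
  assumes S: "valid_system S" and \<tau>: "\<And>t. (\<tau> has_real_derivative \<theta> t) (at t)" and \<theta>: "\<And>t. \<theta> t \<noteq> 0"
    and Yo: "\<And>t. open (Y t)" and Yn: "\<And>t. Y t \<noteq> {}" and YS: "\<And>t. Y t \<subseteq> uvals S"
begin

lemma sm: "smooth_on (uvals S) (coefK S)" "smooth_on (uvals S) (coefD S)" "smooth_on (uvals S) (coefF S)"
  and oS: "open (uvals S)"
  using S by (auto simp: valid_system_def)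

lemma hatD:
  assumes "hat_eqs S \<theta> Y a A B p" "u \<in> Y t"
  shows "deriv (coefK S) u * (A t * u + B (t, x)) = coefK S u * (4 * p - deriv a t / \<theta> t)"
    "deriv (coefD S) u * (A t * u + B (t, x)) = coefD S u * (2 * p - deriv a t / \<theta> t)"
    "deriv (coefF S) u * (A t * u + B (t, x)) = (A t - deriv a t / \<theta> t) * coefF S u
         + (deriv A t * u + pd_t B (t, x)) / \<theta> t
         + coefK S u * pd_x (pd_x (pd_x (pd_x B))) (t, x) - coefD S u * pd_x (pd_x B) (t, x)"
  using assms unfolding hat_eqs_def by blast+

lemma hat_smooth:
  assumes "hat_eqs S \<theta> Y a A B p"
  shows "smooth_on UNIV a" "smooth_on UNIV A" "smooth_on UNIV B"
  using assms unfolding hat_eqs_def by blast+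

lemma integrate_a:
  assumes "smooth_on UNIV a" "\<And>t. deriv a t / \<theta> t = m"
  shows "\<exists>k. a = (\<lambda>t. m * \<tau> t + k)"
proof -
  have "((\<lambda>t. a t - m * \<tau> t) has_real_derivative 0) (at t)" for t
  proof -
    have "deriv a t - m * \<theta> t = 0" using assms(2)[of t] \<theta>[of t] by (simp add: field_simps)
    then show ?thesis using smooth_on_real_deriv[OF assms(1) UNIV_I, of t] \<tau>[of t]
      by (auto intro!: derivative_eq_intros)
  qed
  then have "\<exists>k. \<forall>t\<in>UNIV. a t - m * \<tau> t = k"
    by (intro has_field_derivative_zero_constant) auto
  then obtain k where "\<forall>t. a t - m * \<tau> t = k" by auto
  then have "a t = m * \<tau> t + k" for t by (metis add.commute diff_add_cancel)
  then show ?thesis by blast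
qed

lemma zero_deriv_const:
  assumes "smooth_on UNIV (f :: real \<Rightarrow> real)" "\<And>t. deriv f t = 0"
  shows "\<exists>c. f = (\<lambda>_. c)"
  using deriv_zero_const[OF open_UNIV _ assms(1)] assms(2) by (auto simp: fun_eq_iff)

text \<open>If A u + B = C(t) (e u + b), the x-derivatives of \<open>B\<close> drop out of the
  source equation. \<open>C\<close> inherits its smoothness from \<open>B\<close> if
  \<open>e = 0\<close> and from \<open>A\<close> if \<open>e = 1\<close>.\<close>

lemma homothety:
  assumes eb: "(e = 0 \<and> b = 1) \<or> e = 1"
    and A: "\<And>t. A t = e * C t" and B: "\<And>t x. B (t, x) = b * C t"
    and sA: "smooth_on UNIV A" and sB: "smooth_on UNIV B"
  shows "smooth_on UNIV C" "pd_x (pd_x B) = (\<lambda>_. 0)" "pd_x (pd_x (pd_x (pd_x B))) = (\<lambda>_. 0)"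
    "deriv A t = e * deriv C t" "pd_t B (t, x) = b * deriv C t"
proof -
  show C: "smooth_on UNIV C"
  proof (cases "e = 0")
    case True
    then have "C = (\<lambda>t. B (t, 0))" using B eb by auto
    then show ?thesis using smooth_on_slice[OF sB, of 0] by simp
  next
    case False
    then have "C = A" using A eb by auto
    then show ?thesis using sA by simp
  qed
  have bC: "smooth_on UNIV (\<lambda>t. b * C t)" by (intro smooth_on_mult smooth_on_const open_UNIV C)
  have Be: "B = (\<lambda>q. b * C (fst q))" using B by (auto simp: fun_eq_iff)
  have "A = (\<lambda>t. e * C t)" using A by auto
  then show "deriv A t = e * deriv C t"
    by (auto intro!: DERIV_imp_deriv derivative_eq_intros smooth_on_real_deriv[OF C])
  have "deriv (\<lambda>t. b * C t) t = b * deriv C t"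
    by (auto intro!: DERIV_imp_deriv derivative_eq_intros smooth_on_real_deriv[OF C])
  then show "pd_t B (t, x) = b * deriv C t"
    unfolding Be using pd_time_fun(1)[OF bC] by simp
  show "pd_x (pd_x B) = (\<lambda>_. 0)" "pd_x (pd_x (pd_x (pd_x B))) = (\<lambda>_. 0)"
    unfolding Be pd_time_fun(2)[OF bC] by (simp_all add: pd_t_zero_fun)
qed

lemma fin: "(e = 0 \<and> b = 1) \<or> e = 1 \<Longrightarrow> finite {u::real. e * u + b = 0}"
proof -
  assume "(e = 0 \<and> b = 1) \<or> e = 1"
  then have "{u::real. e * u + b = 0} \<subseteq> {- b}" by (auto simp: add_eq_0_iff)
  then show ?thesis by (rule finite_subset) simp
qed

lemma open_Y': "(e = 0 \<and> b = 1) \<or> e = 1 \<Longrightarrow> open (Y t - {u. e * u + b = 0})"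
  using Yo fin finite_imp_closed by (metis open_Diff)

lemma ex_Y':
  assumes eb: "(e = 0 \<and> b = 1) \<or> e = 1"
  obtains u where "u \<in> Y t" "u \<in> uvals S" "e * u + b \<noteq> 0"
proof -
  have "\<exists>u\<in>Y t. e * u + b \<noteq> 0"
    using affine_zero[OF Yo Yn finite.emptyI, of t e b] eb by force
  then show ?thesis using that YS by blast
qed

text \<open>Comparison of the coefficients of two affine functions of \<open>u\<close> that agree
  off one point of an open set.\<close>

lemma proportional:
  assumes eb: "(e = 0 \<and> b = 1) \<or> e = 1" and g: "g \<noteq> 0"
    and eq: "\<And>u. u \<in> Y t \<Longrightarrow> e * u + b \<noteq> 0 \<Longrightarrow> g * (A * u + B) = (e * u + b) * h"
  shows "A = e * (h / g)" "B = b * (h / g)"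
proof -
  have "(g * A - e * h) * u + (g * B - b * h) = 0" if "u \<in> Y t" "u \<notin> {u. e * u + b = 0}" for u
    using eq[of u] that by (simp add: algebra_simps)
  from affine_zero[OF Yo Yn fin[OF eb] this] have "g * A - e * h = 0" "g * B - b * h = 0" by blast+
  then show "A = e * (h / g)" "B = b * (h / g)" using g by (simp_all add: field_simps)
qed

lemma deriv_eq_on:
  assumes "open I" "u \<in> I" "\<And>y. y \<in> I \<Longrightarrow> f y = g y" "(f has_real_derivative f') (at u)" "(g has_real_derivative g') (at u)"
  shows "f' = g'"
  using DERIV_unique[OF has_field_derivative_transform_within_open[OF assms(5,1,2)] assms(4)] assms(3) by simp

text \<open>\<open>e * u + b\<close> itself has weight \<open>e\<close>, and functions of different
  weights are independent: differentiating the relation and inserting the Euler equation compares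
  \<nu> with \<open>e\<close>.\<close>

lemma no_relation:
  assumes eb: "(e = 0 \<and> b = 1) \<or> e = 1"
    and F: "smooth_on (uvals S) f" "euler (uvals S) e b f \<nu>" "nowhere_zero (uvals S) e b f" and \<nu>: "\<nu> \<noteq> e"
    and eq: "\<And>u. u \<in> Y t \<Longrightarrow> \<kappa> * f u = \<eta> * (e * u + b)"
  shows "\<kappa> = 0" "\<eta> = 0"
proof -
  obtain u where u: "u \<in> Y t" "u \<in> uvals S" "e * u + b \<noteq> 0" by (rule ex_Y'[OF eb])
  have fu: "f u \<noteq> 0" using F(3) u by (simp add: nowhere_zero_def)
  have d: "(f has_real_derivative deriv f u) (at u)" using smooth_on_real_deriv[OF F(1) u(2)] .
  have "\<kappa> * deriv f u = \<eta> * e"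
  proof (rule deriv_eq_on[OF Yo u(1) eq])
    show "((\<lambda>u. \<kappa> * f u) has_real_derivative \<kappa> * deriv f u) (at u)" using d by (auto intro!: derivative_eq_intros)
    show "((\<lambda>u. \<eta> * (e * u + b)) has_real_derivative \<eta> * e) (at u)" by (auto intro!: derivative_eq_intros)
  qed
  then have "\<kappa> * (deriv f u * (e * u + b)) = e * (\<eta> * (e * u + b))"
    unfolding mult.assoc[symmetric] by (simp only: mult.commute)
  moreover have "deriv f u * (e * u + b) = \<nu> * f u" using F(2) u by (simp add: euler_def)
  ultimately have "\<kappa> * (\<nu> * f u) = e * (\<kappa> * f u)" using eq[OF u(1)] by metis
  then have "\<kappa> * (\<nu> - e) * f u = 0" by (simp add: algebra_simps)
  then show "\<kappa> = 0" using fu \<nu> by simp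
  then show "\<eta> = 0" using eq[OF u(1)] u(3) by simp
qed

text \<open>The Euler equation removes the derivative of \<open>F\<close>, so the source equation
  becomes a linear relation between \<open>F\<close> and e u + b with coefficients that depend on
  \<open>t\<close>.\<close>

lemma hat_F_homothety:
  assumes eb: "(e = 0 \<and> b = 1) \<or> e = 1"
    and H: "hat_eqs S \<theta> Y a A B p"
    and A: "\<And>t. A t = e * C t" and B: "\<And>t x. B (t, x) = b * C t"
    and F: "euler (uvals S) e b (coefF S) \<nu>" and u: "u \<in> Y t"
  shows "(\<nu> * C t - e * C t + deriv a t / \<theta> t) * coefF S u = deriv C t / \<theta> t * (e * u + b)"
proof -
  note h = homothety[OF eb A B hat_smooth(2,3)[OF H]]
  have "deriv (coefF S) u * (e * u + b) = \<nu> * coefF S u" using F u YS by (auto simp: euler_def)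
  moreover have "deriv (coefF S) u * (A t * u + B (t, 0)) = C t * (deriv (coefF S) u * (e * u + b))"
    unfolding A B by (simp add: algebra_simps)
  ultimately have "deriv (coefF S) u * (A t * u + B (t, 0)) = C t * (\<nu> * coefF S u)" by simp
  moreover have "(deriv A t * u + pd_t B (t, 0)) / \<theta> t = deriv C t / \<theta> t * (e * u + b)"
    unfolding h(4,5) by (simp add: algebra_simps)
  ultimately have "C t * (\<nu> * coefF S u) = (A t - deriv a t / \<theta> t) * coefF S u + deriv C t / \<theta> t * (e * u + b)"
    using hatD(3)[OF H u, of 0] fun_cong[OF h(2), of "(t, 0)"] fun_cong[OF h(3), of "(t, 0)"] by simp
  then show ?thesis unfolding A[of t] by (simp add: left_diff_distrib distrib_right mult.assoc mult.left_commute)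
qed

text \<open>Multiplying the equation for \<open>K\<close> by e u + b and cancelling \<open>K\<close>
  compares A u + B with e u + b; the nonzero weight makes the comparison solvable for A u +
  B.\<close>

lemma hat_K_homothety:
  assumes eb: "(e = 0 \<and> b = 1) \<or> e = 1"
    and H: "hat_eqs S \<theta> Y a A B p"
    and K: "euler (uvals S) e b (coefK S) \<gamma>" "nowhere_zero (uvals S) e b (coefK S)" and \<gamma>: "\<gamma> \<noteq> 0"
  shows "A t = e * ((4 * p - deriv a t / \<theta> t) / \<gamma>)" "B (t, x) = b * ((4 * p - deriv a t / \<theta> t) / \<gamma>)"
proof -
  have "\<gamma> * (A t * u + B (t, x)) = (e * u + b) * (4 * p - deriv a t / \<theta> t)" if u: "u \<in> Y t" "e * u + b \<noteq> 0" for u x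
  proof -
    have uS: "u \<in> uvals S" using u YS by blast
    have "deriv (coefK S) u * (e * u + b) = \<gamma> * coefK S u" using K(1) uS by (simp add: euler_def)
    then have "\<gamma> * coefK S u * (A t * u + B (t, x)) = (e * u + b) * (deriv (coefK S) u * (A t * u + B (t, x)))"
      by (metis mult.assoc mult.commute)
    also have "\<dots> = (e * u + b) * (coefK S u * (4 * p - deriv a t / \<theta> t))"
      using hatD(1)[OF H u(1), of x] by simp
    finally have "coefK S u * (\<gamma> * (A t * u + B (t, x)) - (e * u + b) * (4 * p - deriv a t / \<theta> t)) = 0"
      by (simp add: algebra_simps)
    then show ?thesis using K(2) uS u(2) by (simp add: nowhere_zero_def)
  qed
  from proportional[OF eb \<gamma> this] show "A t = e * ((4 * p - deriv a t / \<theta> t) / \<gamma>)"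
    "B (t, x) = b * ((4 * p - deriv a t / \<theta> t) / \<gamma>)" by blast+
qed

lemma hat_D_homothety:
  assumes H: "hat_eqs S \<theta> Y a A B p"
    and D: "euler (uvals S) e b (coefD S) \<mu>" "nowhere_zero (uvals S) e b (coefD S)"
    and u: "u \<in> Y t" "e * u + b \<noteq> 0"
  shows "\<mu> * (A t * u + B (t, x)) = (e * u + b) * (2 * p - deriv a t / \<theta> t)"
proof -
  have uS: "u \<in> uvals S" using u YS by blast
  have "deriv (coefD S) u * (e * u + b) = \<mu> * coefD S u" using D(1) uS by (simp add: euler_def)
  then have "\<mu> * coefD S u * (A t * u + B (t, x)) = (e * u + b) * (deriv (coefD S) u * (A t * u + B (t, x)))"
    by (metis mult.assoc mult.commute)
  also have "\<dots> = (e * u + b) * (coefD S u * (2 * p - deriv a t / \<theta> t))"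
    using hatD(2)[OF H u(1), of x] by simp
  finally have "coefD S u * (\<mu> * (A t * u + B (t, x)) - (e * u + b) * (2 * p - deriv a t / \<theta> t)) = 0"
    by (simp add: algebra_simps)
  then show ?thesis using D(2) uS u(2) by (simp add: nowhere_zero_def)
qed

lemma hat_K_constant:
  assumes eb: "(e = 0 \<and> b = 1) \<or> e = 1"
    and H: "hat_eqs S \<theta> Y a A B p"
    and K: "euler (uvals S) e b (coefK S) 0" "nowhere_zero (uvals S) e b (coefK S)"
  shows "deriv a t / \<theta> t = 4 * p"
proof -
  obtain u where u: "u \<in> Y t" "u \<in> uvals S" "e * u + b \<noteq> 0" by (rule ex_Y'[OF eb])
  have "deriv (coefK S) u = 0" "coefK S u \<noteq> 0" using K u by (auto simp: euler_def nowhere_zero_def)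
  then show ?thesis using hatD(1)[OF H u(1), of 0] by simp
qed

text \<open>With \<open>K\<close> constant and \<open>D\<close> zero, the source equation is
  differentiated in \<open>u\<close> to lose the inhomogeneity in \<open>B\<close>; the Euler
  equation of \<open>F\<close> turns the result into a relation between \<open>F\<close> and
  polynomials in \<open>u\<close>. A second differentiation eliminates the unknown A'.\<close>

lemma hat_F_only:
  assumes eb: "(e = 0 \<and> b = 1) \<or> e = 1"
    and H: "hat_eqs S \<theta> Y a A B p"
    and K: "euler (uvals S) e b (coefK S) 0" "nowhere_zero (uvals S) e b (coefK S)"
    and D: "vanishes (uvals S) (coefD S)"
    and F: "euler (uvals S) e b (coefF S) \<nu>" "nowhere_zero (uvals S) e b (coefF S)" and \<nu>: "\<nu> \<noteq> 0" "\<nu> \<noteq> e"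
  shows "A t = e * (- 4 * p / (\<nu> - e))" "B (t, x) = b * (- 4 * p / (\<nu> - e))"
proof -
  have s: "deriv a t / \<theta> t = 4 * p" for t by (rule hat_K_constant[OF eb H K])
  define \<eta> where "\<eta> = (\<lambda>t. deriv A t / \<theta> t)"
  \<comment> \<open>\<open>l1\<close> and \<open>l0\<close> are the coefficients of (\<nu> - e) (A u
    + B) + 4 p (e u + b), which has to be shown to vanish.\<close>
  define l1 where "l1 = (\<lambda>t. (\<nu> - e) * A t + 4 * p * e)"
  define l0 where "l0 = (\<lambda>t x. (\<nu> - e) * B (t, x) + 4 * p * b)"
  have E1: "\<nu> * coefF S u * (l1 t * u + l0 t x) = \<eta> t * (e * u + b)\<^sup>2" if u: "u \<in> Y t" "e * u + b \<noteq> 0" for t x u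
  proof -
    have uS: "u \<in> uvals S" using u YS by blast
    note dF = smooth_on_real_deriv[OF sm(3) uS] smooth_on_real_deriv[OF smooth_on_deriv[OF oS sm(3)] uS]
      smooth_on_real_deriv[OF sm(1) uS]
    let ?f = "coefF S" let ?b4 = "pd_x (pd_x (pd_x (pd_x B))) (t, x)"
    have K0: "deriv (coefK S) u = 0" using K(1) uS u(2) by (auto simp: euler_def)
    have "deriv (deriv ?f) u * (A t * u + B (t, x)) + deriv ?f u * A t =
       (A t - 4 * p) * deriv ?f u + deriv A t / \<theta> t + deriv (coefK S) u * ?b4"
    proof (rule deriv_eq_on[OF Yo u(1)])
      show "deriv ?f y * (A t * y + B (t, x)) = (A t - 4 * p) * ?f y + (deriv A t * y + pd_t B (t, x)) / \<theta> t + coefK S y * ?b4"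
        if "y \<in> Y t" for y
        using hatD(3)[OF H that, of x] D that YS unfolding s vanishes_def by (auto simp: subset_iff)
      show "((\<lambda>y. deriv ?f y * (A t * y + B (t, x))) has_real_derivative
          deriv (deriv ?f) u * (A t * u + B (t, x)) + deriv ?f u * A t) (at u)"
        using dF by (auto intro!: derivative_eq_intros)
      show "((\<lambda>y. (A t - 4 * p) * ?f y + (deriv A t * y + pd_t B (t, x)) / \<theta> t + coefK S y * ?b4) has_real_derivative
          (A t - 4 * p) * deriv ?f u + deriv A t / \<theta> t + deriv (coefK S) u * ?b4) (at u)"
        using dF \<theta>[of t] by (auto intro!: derivative_eq_intros)
    qed
    then have 1: "deriv (deriv ?f) u * (A t * u + B (t, x)) + 4 * p * deriv ?f u = \<eta> t"
      by (simp add: K0 \<eta>_def algebra_simps)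
    have 2: "deriv (deriv ?f) u * (e * u + b) + deriv ?f u * e = deriv ?f u * \<nu>"
      by (rule deriv_eq_on_open[OF oS uS sm(3)]) (use F(1) in \<open>auto simp: euler_def algebra_simps\<close>)
    have 3: "deriv ?f u * (e * u + b) = \<nu> * ?f u" using F(1) uS by (simp add: euler_def)
    have "\<eta> t * (e * u + b)\<^sup>2 = (deriv (deriv ?f) u * (e * u + b)) * (e * u + b) * (A t * u + B (t, x))
        + 4 * p * (deriv ?f u * (e * u + b)) * (e * u + b)"
      unfolding 1[symmetric] by (simp add: algebra_simps power2_eq_square)
    also have "deriv (deriv ?f) u * (e * u + b) = (\<nu> - e) * deriv ?f u" using 2 by (simp add: algebra_simps)
    also have "(\<nu> - e) * deriv ?f u * (e * u + b) = (\<nu> - e) * (\<nu> * ?f u)" using 3 by (simp add: algebra_simps)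
    finally show ?thesis unfolding 3 by (simp add: l1_def l0_def algebra_simps)
  qed
  \<comment> \<open>Differentiate \<open>E1\<close>, multiply by e u + b and insert
    \<open>E1\<close> on the right; cancelling \<nu> F leaves an affine function of
    \<open>u\<close>.\<close>
  have E2: "(\<nu> - 2 * e) * l1 t + e * l1 t = 0" "(\<nu> - 2 * e) * l0 t x + b * l1 t = 0" for t x
  proof -
    have "((\<nu> - 2 * e) * l1 t + e * l1 t) * u + ((\<nu> - 2 * e) * l0 t x + b * l1 t) = 0"
      if u: "u \<in> Y t" "u \<notin> {u. e * u + b = 0}" for u
    proof -
      have uS: "u \<in> uvals S" using u YS by blast
      have om: "e * u + b \<noteq> 0" using u by simp
      note dF = smooth_on_real_deriv[OF sm(3) uS]
      let ?f = "coefF S"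
      have f0: "?f u \<noteq> 0" using F(2) uS om by (simp add: nowhere_zero_def)
      have "\<nu> * (deriv ?f u * (l1 t * u + l0 t x) + ?f u * l1 t) = \<eta> t * (2 * (e * u + b) * e)"
      proof (rule deriv_eq_on[OF open_Y'[OF eb, of t]])
        show "u \<in> Y t - {u. e * u + b = 0}" using u by simp
        show "\<nu> * ?f y * (l1 t * y + l0 t x) = \<eta> t * (e * y + b)\<^sup>2" if "y \<in> Y t - {u. e * u + b = 0}" for y
          using E1[of y t x] that by simp
        show "((\<lambda>y. \<nu> * ?f y * (l1 t * y + l0 t x)) has_real_derivative
            \<nu> * (deriv ?f u * (l1 t * u + l0 t x) + ?f u * l1 t)) (at u)"
          using dF by (auto intro!: derivative_eq_intros simp: algebra_simps)
        show "((\<lambda>y. \<eta> t * (e * y + b)\<^sup>2) has_real_derivative \<eta> t * (2 * (e * u + b) * e)) (at u)"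
          by (auto intro!: derivative_eq_intros)
      qed
      note dd = this
      have "\<nu> * ((deriv ?f u * (e * u + b)) * (l1 t * u + l0 t x) + ?f u * l1 t * (e * u + b)) =
          \<nu> * (deriv ?f u * (l1 t * u + l0 t x) + ?f u * l1 t) * (e * u + b)" by (simp add: algebra_simps)
      also have "\<dots> = 2 * e * (\<eta> t * (e * u + b)\<^sup>2)" unfolding dd by (simp add: power2_eq_square)
      also have "\<eta> t * (e * u + b)\<^sup>2 = \<nu> * ?f u * (l1 t * u + l0 t x)" using E1[OF u(1) om, of x] by simp
      also have "deriv ?f u * (e * u + b) = \<nu> * ?f u" using F(1) uS by (simp add: euler_def)
      finally have "\<nu> * ?f u * (((\<nu> - 2 * e) * l1 t + e * l1 t) * u + ((\<nu> - 2 * e) * l0 t x + b * l1 t)) = 0"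
        by (simp add: algebra_simps)
      then show ?thesis using f0 \<nu>(1) by simp
    qed
    from affine_zero[OF Yo Yn fin[OF eb] this]
    show "(\<nu> - 2 * e) * l1 t + e * l1 t = 0" "(\<nu> - 2 * e) * l0 t x + b * l1 t = 0" by blast+
  qed
  have l1: "l1 t = 0" for t
  proof -
    have "(\<nu> - e) * l1 t = 0" using E2(1)[of t] by (simp add: algebra_simps)
    then show ?thesis using \<nu>(2) by simp
  qed
  have l0: "l0 t x = 0" for t x
  proof (cases "\<nu> = 2 * e")
    case False
    then show ?thesis using E2(2)[of t x] l1 by simp
  next
    \<comment> \<open>The exceptional weight 2 e of a quadratic source: \<open>A\<close> is constant
      by \<open>l1\<close>, hence \<open>\<eta>\<close> is zero and \<open>E1\<close> itself yields
      the claim.\<close>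
    case True
    then have e: "e = 1" using \<nu> eb by auto
    have "A t = - 4 * p" for t using l1[of t] True e by (simp add: l1_def)
    then have "A = (\<lambda>_. - 4 * p)" by auto
    then have \<eta>: "\<eta> t = 0" by (simp add: \<eta>_def)
    obtain u where u: "u \<in> Y t" "u \<in> uvals S" "e * u + b \<noteq> 0" by (rule ex_Y'[OF eb])
    then have "coefF S u \<noteq> 0" using F(2) by (simp add: nowhere_zero_def)
    then show ?thesis using E1[OF u(1,3), of x] \<eta> l1 \<nu>(1) by simp
  qed
  show "A t = e * (- 4 * p / (\<nu> - e))" "B (t, x) = b * (- 4 * p / (\<nu> - e))"
    using l1[of t] l0[of t x] \<nu>(2) by (simp_all add: l1_def l0_def field_simps)
qed

text \<open>The hypothesis \<open>nd\<close> keeps out vanishing \<open>D\<close> together with a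
  source that is a multiple of e u + b, or constant when \<open>K\<close> is constant, and the
  linear systems with \<gamma> = \<mu> = 0: these have larger algebras. \<open>c\<close> is half of
  the factor C(t), to match the normalisation of \<open>op_D2\<close> and
  \<open>op_D3\<close>.\<close>

lemma solve_scaling:
  assumes eb: "(e = 0 \<and> b = 1) \<or> e = 1"
    and K: "euler (uvals S) e b (coefK S) \<gamma>" "nowhere_zero (uvals S) e b (coefK S)"
    and D: "euler (uvals S) e b (coefD S) \<mu>" "vanishes (uvals S) (coefD S) \<or> nowhere_zero (uvals S) e b (coefD S)"
    and F: "euler (uvals S) e b (coefF S) (e + 2 * \<mu> - \<gamma>)"
    and nd: "(\<gamma> \<noteq> 0 \<and> (nowhere_zero (uvals S) e b (coefD S) \<or> (nowhere_zero (uvals S) e b (coefF S) \<and> 2 * \<mu> \<noteq> \<gamma>))) \<or>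
      (\<gamma> = 0 \<and> \<mu> \<noteq> 0 \<and> (nowhere_zero (uvals S) e b (coefD S) \<or> (nowhere_zero (uvals S) e b (coefF S) \<and> e + 2 * \<mu> \<noteq> 0)))"
    and H: "hat_eqs S \<theta> Y a A B p"
  shows "\<exists>c k. p = (\<gamma> - \<mu>) * c \<and> a = (\<lambda>t. 2 * (\<gamma> - 2 * \<mu>) * c * \<tau> t + k) \<and> A = (\<lambda>_. e * (2 * c)) \<and> B = (\<lambda>_. b * (2 * c))"
proof -
  define s where "s = (\<lambda>t. deriv a t / \<theta> t)"
  have "\<exists>c. p = (\<gamma> - \<mu>) * c \<and> (\<forall>t. s t = 2 * (\<gamma> - 2 * \<mu>) * c) \<and> (\<forall>t. A t = e * (2 * c)) \<and> (\<forall>t x. B (t, x) = b * (2 * c))"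
  proof (cases "\<gamma> = 0")
    case False
    define C where "C = (\<lambda>t. (4 * p - s t) / \<gamma>)"
    have A: "A t = e * C t" and B: "B (t, x) = b * C t" for t x
      using hat_K_homothety[OF eb H K False] by (simp_all add: C_def s_def)
    have Cs: "\<gamma> * C t = 4 * p - s t" for t using False by (simp add: C_def)
    note h = homothety[OF eb A B hat_smooth(2,3)[OF H]]
    have Fh: "(\<nu> * C t - e * C t + s t) * coefF S u = deriv C t / \<theta> t * (e * u + b)" if "u \<in> Y t" "\<nu> = e + 2 * \<mu> - \<gamma>" for u t \<nu>
      using hat_F_homothety[OF eb H A B F that(1)] that(2) by (simp add: s_def)
    have const: "\<exists>c. \<forall>t. C t = 2 * c" if C0: "\<And>t. deriv C t = 0"
    proof -
      obtain k where k: "C = (\<lambda>_. k)" using zero_deriv_const[OF h(1) C0] by blast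
      have "\<forall>t. C t = 2 * (k / 2)" unfolding k by simp
      then show ?thesis by blast
    qed
    show ?thesis
    proof (cases "nowhere_zero (uvals S) e b (coefD S)")
      case True
      have Ds: "\<mu> * C t = 2 * p - s t" for t
      proof -
        obtain u where u: "u \<in> Y t" "u \<in> uvals S" "e * u + b \<noteq> 0" by (rule ex_Y'[OF eb])
        have "(e * u + b) * (\<mu> * C t - (2 * p - s t)) = 0"
          using hat_D_homothety[OF H D(1) True u(1,3), of 0] unfolding A B s_def by (simp add: algebra_simps)
        then show ?thesis using u(3) by simp
      qed
      \<comment> \<open>The equations for \<open>K\<close> and \<open>D\<close> are two linear
        conditions on C(t). For \<gamma> \<noteq> \<mu> they make it constant; for \<gamma> = \<mu>
        they give p = 0, and the source equation decides.\<close>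
      have gm: "(\<gamma> - \<mu>) * C t = 2 * p" for t using Cs[of t] Ds[of t] by (simp add: algebra_simps)
      show ?thesis
      proof (cases "\<gamma> = \<mu>")
        case False
        have C: "C t = 2 * (p / (\<gamma> - \<mu>))" for t using gm[of t] False by (simp add: field_simps)
        have "s t = 2 * (\<gamma> - 2 * \<mu>) * (p / (\<gamma> - \<mu>))" for t
          using Cs[of t] False unfolding C by (simp add: field_simps)
        then show ?thesis using A B C False by (intro exI[of _ "p / (\<gamma> - \<mu>)"]) simp
      next
        case True
        then have p: "p = 0" using gm by simp
        have "deriv C t = 0" for t
        proof -
          obtain u where u: "u \<in> Y t" "u \<in> uvals S" "e * u + b \<noteq> 0" by (rule ex_Y'[OF eb])
          have "(e + 2 * \<mu> - \<gamma>) * C t - e * C t + s t = 0" using Cs[of t] True p by (simp add: algebra_simps)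
          then show ?thesis using Fh[OF u(1) refl] u(3) \<theta>[of t] by simp
        qed
        from const[OF this] obtain c where c: "\<forall>t. C t = 2 * c" by blast
        have "s t = 2 * (\<gamma> - 2 * \<mu>) * c" for t using Cs[of t] c True p by simp
        then show ?thesis using A B c True p by (intro exI[of _ c]) simp
      qed
    next
      case nD: False
      then have nF: "nowhere_zero (uvals S) e b (coefF S)" "2 * \<mu> \<noteq> \<gamma>" using nd False by auto
      \<comment> \<open>The weight of \<open>F\<close> differs from that of e u + b, so the relation
        between the two splits.\<close>
      have ne: "e + 2 * \<mu> - \<gamma> \<noteq> e" using nF by simp
      have nr: "(e + 2 * \<mu> - \<gamma>) * C t - e * C t + s t = 0" "deriv C t / \<theta> t = 0" for t
      proof -
        have R: "((e + 2 * \<mu> - \<gamma>) * C t - e * C t + s t) * coefF S u = deriv C t / \<theta> t * (e * u + b)"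
          if "u \<in> Y t" for u by (rule Fh[OF that refl])
        from no_relation[OF eb sm(3) F nF(1) ne R]
        show "(e + 2 * \<mu> - \<gamma>) * C t - e * C t + s t = 0" "deriv C t / \<theta> t = 0" by blast+
      qed
      have "deriv C t = 0" for t using nr(2)[of t] \<theta>[of t] by simp
      from const[OF this] obtain c where c: "\<forall>t. C t = 2 * c" by blast
      have sc: "s t = 2 * (\<gamma> - 2 * \<mu>) * c" for t using nr(1)[of t] c by (simp add: algebra_simps)
      have "p = (\<gamma> - \<mu>) * c" using Cs[of 0] sc[of 0] c by (simp add: algebra_simps)
      then show ?thesis using A B c sc by (intro exI[of _ c]) simp
    qed
  next
    case True
    have s: "s t = 4 * p" for t using hat_K_constant[OF eb H K(1)[unfolded True] K(2)] by (simp add: s_def)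
    have \<mu>: "\<mu> \<noteq> 0" using nd True by simp
    have "A t = e * (2 * (- p / \<mu>)) \<and> B (t, x) = b * (2 * (- p / \<mu>))" for t x
    proof (cases "nowhere_zero (uvals S) e b (coefD S)")
      case nD: True
      have "\<mu> * (A t * u + B (t, x)) = (e * u + b) * (- 2 * p)" if "u \<in> Y t" "e * u + b \<noteq> 0" for u
        using hat_D_homothety[OF H D(1) nD that, of x] s[of t] by (simp add: s_def)
      from proportional[OF eb \<mu> this] show ?thesis by simp
    next
      case nD: False
      then have nF: "nowhere_zero (uvals S) e b (coefF S)" "e + 2 * \<mu> \<noteq> 0" "vanishes (uvals S) (coefD S)" using nd True D by auto
      have "A t = e * (- 4 * p / (2 * \<mu>))" "B (t, x) = b * (- 4 * p / (2 * \<mu>))"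
        using hat_F_only[OF eb H K(1)[unfolded True] K(2) nF(3) F nF(1)] nF(2) \<mu> True by simp_all
      then show ?thesis using \<mu> by (simp add: field_simps)
    qed
    then show ?thesis using s \<mu> True by (intro exI[of _ "- p / \<mu>"]) simp
  qed
  then obtain c where c: "p = (\<gamma> - \<mu>) * c" "\<forall>t. s t = 2 * (\<gamma> - 2 * \<mu>) * c" "\<forall>t. A t = e * (2 * c)" "\<forall>t x. B (t, x) = b * (2 * c)"
    by blast
  obtain k where "a = (\<lambda>t. 2 * (\<gamma> - 2 * \<mu>) * c * \<tau> t + k)"
    using integrate_a[OF hat_smooth(1)[OF H], of "2 * (\<gamma> - 2 * \<mu>) * c"] c(2) by (auto simp: s_def)
  then show ?thesis using c by (intro exI[of _ c] exI[of _ k]) (auto simp: fun_eq_iff)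
qed

text \<open>With \<open>F\<close> zero the source equation only says that C(t) is constant. The
  scaling constant \<open>p\<close> is then independent of \<open>c\<close>, which accounts for the
  fourth operator.\<close>

lemma solve_two_scalings:
  assumes eb: "(e = 0 \<and> b = 1) \<or> e = 1"
    and K: "euler (uvals S) e b (coefK S) \<gamma>" "nowhere_zero (uvals S) e b (coefK S)" and \<gamma>: "\<gamma> \<noteq> 0"
    and F: "vanishes (uvals S) (coefF S)"
    and H: "hat_eqs S \<theta> Y a A B p"
  shows "\<exists>c k. a = (\<lambda>t. (4 * p - 2 * \<gamma> * c) * \<tau> t + k) \<and> A = (\<lambda>_. e * (2 * c)) \<and> B = (\<lambda>_. b * (2 * c))"
proof -
  define s where "s = (\<lambda>t. deriv a t / \<theta> t)"
  define C where "C = (\<lambda>t. (4 * p - s t) / \<gamma>)"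
  have A: "A t = e * C t" and B: "B (t, x) = b * C t" for t x
    using hat_K_homothety[OF eb H K \<gamma>] by (simp_all add: C_def s_def)
  have Cs: "\<gamma> * C t = 4 * p - s t" for t using \<gamma> by (simp add: C_def)
  note h = homothety[OF eb A B hat_smooth(2,3)[OF H]]
  have F0: "euler (uvals S) e b (coefF S) 0"
    using deriv_vanishes[OF oS F] by (auto simp: euler_def)
  have "deriv C t = 0" for t
  proof -
    obtain u where u: "u \<in> Y t" "u \<in> uvals S" "e * u + b \<noteq> 0" by (rule ex_Y'[OF eb])
    then have "coefF S u = 0" using F by (auto simp: vanishes_def)
    then show ?thesis using hat_F_homothety[OF eb H A B F0 u(1)] u(3) \<theta>[of t] by simp
  qed
  from zero_deriv_const[OF h(1) this] obtain k0 where k0: "C = (\<lambda>_. k0)" by blast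
  have "s t = 4 * p - 2 * \<gamma> * (k0 / 2)" for t using Cs[of t] unfolding k0 by simp
  then obtain k where "a = (\<lambda>t. (4 * p - 2 * \<gamma> * (k0 / 2)) * \<tau> t + k)"
    using integrate_a[OF hat_smooth(1)[OF H], of "4 * p - 2 * \<gamma> * (k0 / 2)"] by (auto simp: s_def)
  then show ?thesis using A B k0 by (intro exI[of _ "k0 / 2"] exI[of _ k]) (auto simp: fun_eq_iff)
qed

text \<open>The source equation is differentiated in \<open>u\<close> to lose the terms in
  \<open>B\<close>, and multiplied by \<open>u\<close>; another derivative leaves the logarithm as a
  single additive term, and a third one isolates p / u.\<close>

lemma solve_log:
  assumes K: "\<And>u. u \<in> uvals S \<Longrightarrow> coefK S u = 1" and D: "\<And>u. u \<in> uvals S \<Longrightarrow> coefD S u = d"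
    and F: "\<And>u. u \<in> uvals S \<Longrightarrow> coefF S u = l * u * ln u" and pos: "uvals S \<subseteq> {0<..}" and l: "l \<noteq> 0"
    and \<tau>\<kappa>: "\<And>t. \<tau> t = \<kappa> * t" "\<And>t. \<theta> t = \<kappa>"
    and H: "hat_eqs S \<theta> Y a A B p"
  shows "\<exists>c k. p = 0 \<and> a = (\<lambda>_. k) \<and> A = (\<lambda>t. c * exp (l * \<tau> t)) \<and> B = (\<lambda>_. 0)"
proof -
  have \<kappa>: "\<kappa> \<noteq> 0" using \<theta>[of 0] \<tau>\<kappa> by simp
  have d0: "deriv (coefK S) u = 0" if "u \<in> uvals S" for u
    using DERIV_imp_deriv[OF has_field_derivative_transform_within_open[OF DERIV_const[of 1] oS that, of "coefK S"]] K by simp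
  have s: "deriv a t / \<theta> t = 4 * p" for t
  proof -
    obtain u where u: "u \<in> Y t" "u \<in> uvals S" by (rule ex_Y'[of 0 1 t]) auto
    then show ?thesis using hatD(1)[OF H u(1), of 0] d0 K by simp
  qed
  have dF: "(coefF S has_real_derivative l * ln u + l) (at u)" if u: "u \<in> uvals S" for u
  proof -
    have "((\<lambda>u. l * u * ln u) has_real_derivative l * ln u + l) (at u)"
      using pos u by (auto intro!: derivative_eq_intros)
    then show ?thesis by (rule has_field_derivative_transform_within_open[OF _ oS u]) (simp add: F)
  qed
  have dF': "deriv (coefF S) u = l * ln u + l" if "u \<in> uvals S" for u using DERIV_imp_deriv[OF dF[OF that]] .
  define \<eta> where "\<eta> = (\<lambda>t. deriv A t / \<kappa>)"
  have E1: "l * (A t * u + B (t, x)) + 4 * p * l * (u * (ln u + 1)) = \<eta> t * u" if u: "u \<in> Y t" for t x u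
  proof -
    have uS: "u \<in> uvals S" and u0: "u > 0" using u YS pos by auto
    \<comment> \<open>\<open>K\<close> and \<open>D\<close> are constant, so this part is free of
      \<open>u\<close> and disappears on differentiation.\<close>
    let ?b4 = "pd_x (pd_x (pd_x (pd_x B))) (t, x) - d * pd_x (pd_x B) (t, x)"
    have "l / u * (A t * u + B (t, x)) + (l * ln u + l) * A t = (A t - 4 * p) * (l * ln u + l) + deriv A t / \<theta> t"
    proof (rule deriv_eq_on[OF Yo u])
      show "(l * ln y + l) * (A t * y + B (t, x)) = (A t - 4 * p) * coefF S y + (deriv A t * y + pd_t B (t, x)) / \<theta> t + ?b4"
        if "y \<in> Y t" for y
      proof -
        have "y \<in> uvals S" using that YS by blast
        then show ?thesis using hatD(3)[OF H that, of x] unfolding s by (simp add: dF' K D)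
      qed
      show "((\<lambda>y. (l * ln y + l) * (A t * y + B (t, x))) has_real_derivative
          l / u * (A t * u + B (t, x)) + (l * ln u + l) * A t) (at u)"
        using u0 by (auto intro!: derivative_eq_intros)
      show "((\<lambda>y. (A t - 4 * p) * coefF S y + (deriv A t * y + pd_t B (t, x)) / \<theta> t + ?b4) has_real_derivative
          (A t - 4 * p) * (l * ln u + l) + deriv A t / \<theta> t) (at u)"
        using dF[OF uS] \<theta>[of t] by (auto intro!: derivative_eq_intros)
    qed
    then have "l / u * (A t * u + B (t, x)) + 4 * p * (l * ln u + l) = \<eta> t" by (simp add: \<eta>_def \<tau>\<kappa> algebra_simps)
    then have "(l / u * (A t * u + B (t, x)) + 4 * p * (l * ln u + l)) * u = \<eta> t * u" by simp
    moreover have "(l / u * W + 4 * p * (l * ln u + l)) * u = l * W + 4 * p * l * (u * (ln u + 1))" for W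
      using u0 by (simp add: field_simps)
    ultimately show ?thesis by (simp only:)
  qed
  have E2: "l * A t + 4 * p * l * (ln u + 2) = \<eta> t" if u: "u \<in> Y t" for t u
  proof (rule deriv_eq_on[OF Yo u])
    have u0: "u > 0" using u YS pos by auto
    show "l * (A t * u + B (t, 0)) + 4 * p * l * (u * (ln u + 1)) = \<eta> t * u" if "u \<in> Y t" for u by (rule E1[OF that])
    show "((\<lambda>u. l * (A t * u + B (t, 0)) + 4 * p * l * (u * (ln u + 1))) has_real_derivative l * A t + 4 * p * l * (ln u + 2)) (at u)"
      using u0 by (auto intro!: derivative_eq_intros)
    show "((\<lambda>u. \<eta> t * u) has_real_derivative \<eta> t) (at u)" by (auto intro!: derivative_eq_intros)
  qed
  have p: "p = 0"
  proof -
    obtain u where u: "u \<in> Y 0" "u \<in> uvals S" by (rule ex_Y'[of 0 1 0]) auto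
    have u0: "u > 0" using u pos by auto
    have "4 * p * l * (1 / u) = 0"
    proof (rule deriv_eq_on[OF Yo u(1)])
      show "l * A 0 + 4 * p * l * (ln u + 2) = \<eta> 0" if "u \<in> Y 0" for u by (rule E2[OF that])
      show "((\<lambda>u. l * A 0 + 4 * p * l * (ln u + 2)) has_real_derivative 4 * p * l * (1 / u)) (at u)"
        using u0 by (auto intro!: derivative_eq_intros)
    qed simp
    then show ?thesis using l u0 by simp
  qed
  have E3: "l * A t = \<eta> t" for t
  proof -
    obtain u where u: "u \<in> Y t" "u \<in> uvals S" by (rule ex_Y'[of 0 1 t]) auto
    then show ?thesis using E2[OF u(1)] p by simp
  qed
  have B: "B (t, x) = 0" for t x
  proof -
    obtain u where u: "u \<in> Y t" "u \<in> uvals S" by (rule ex_Y'[of 0 1 t]) auto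
    have "l * B (t, x) = 0" using E1[OF u(1), of x] p unfolding E3[symmetric] by (simp add: algebra_simps)
    then show ?thesis using l by simp
  qed
  \<comment> \<open>Integrating factor for A' = l \<kappa> A.\<close>
  have "((\<lambda>t. A t * exp (- (l * \<kappa>) * t)) has_real_derivative 0) (at t)" for t
  proof -
    have "deriv A t = l * \<kappa> * A t" using E3[of t] \<kappa> by (simp add: \<eta>_def field_simps)
    then show ?thesis using smooth_on_real_deriv[OF hat_smooth(2)[OF H] UNIV_I, of t]
      by (auto intro!: derivative_eq_intros simp: algebra_simps)
  qed
  then have "\<exists>c. \<forall>t\<in>UNIV. A t * exp (- (l * \<kappa>) * t) = c" by (intro has_field_derivative_zero_constant) auto
  then obtain c where c: "\<And>t. A t * exp (- (l * \<kappa>) * t) = c" by auto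
  have "A t = c * exp (l * \<tau> t)" for t
    using c[of t] by (simp add: \<tau>\<kappa> exp_minus field_simps)
  moreover obtain k where "a = (\<lambda>t. 0 * \<tau> t + k)" using integrate_a[OF hat_smooth(1)[OF H], of 0] s p by auto
  ultimately show ?thesis using p B by (intro exI[of _ c] exI[of _ k]) (auto simp: fun_eq_iff)
qed

text \<open>The source equation is affine in \<open>u\<close>; its two coefficients give A' = 0 and
  the linear equation for \<open>B\<close>. Dividing the time argument by \<kappa> expresses
  \<open>B\<close> in the new time, which runs through all of the line because it is proportional to
  the old one.\<close>

lemma solve_linear:
  assumes K: "\<And>u. u \<in> uvals S \<Longrightarrow> coefK S u = 1" and D: "\<And>u. u \<in> uvals S \<Longrightarrow> coefD S u = d"
    and F: "\<And>u. u \<in> uvals S \<Longrightarrow> coefF S u = 0"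
    and \<tau>\<kappa>: "\<And>t. \<tau> t = \<kappa> * t" "\<And>t. \<theta> t = \<kappa>"
    and H: "hat_eqs S \<theta> Y a A B p"
  shows "\<exists>c k. d * p = 0 \<and> a = (\<lambda>t. 4 * p * \<tau> t + k) \<and> A = (\<lambda>_. c) \<and>
    (\<lambda>q. B (fst q / \<kappa>, snd q)) \<in> linear_solutions d"
proof -
  have \<kappa>: "\<kappa> \<noteq> 0" using \<theta>[of 0] \<tau>\<kappa> by simp
  have d0: "deriv (coefK S) u = 0" "deriv (coefD S) u = 0" "deriv (coefF S) u = 0" if "u \<in> uvals S" for u
    using DERIV_imp_deriv[OF has_field_derivative_transform_within_open[OF DERIV_const[of 1] oS that, of "coefK S"]]
     DERIV_imp_deriv[OF has_field_derivative_transform_within_open[OF DERIV_const[of d] oS that, of "coefD S"]]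
     DERIV_imp_deriv[OF has_field_derivative_transform_within_open[OF DERIV_const[of 0] oS that, of "coefF S"]] K D F by simp_all
  have s: "deriv a t / \<theta> t = 4 * p" for t
  proof -
    obtain u where u: "u \<in> Y t" "u \<in> uvals S" by (rule ex_Y'[of 0 1 t]) auto
    then show ?thesis using hatD(1)[OF H u(1), of 0] d0 K by simp
  qed
  have dp: "d * p = 0"
  proof -
    obtain u where u: "u \<in> Y 0" "u \<in> uvals S" by (rule ex_Y'[of 0 1 0]) auto
    then show ?thesis using hatD(2)[OF H u(1), of 0] d0 D s by simp
  qed
  have L: "deriv A t / \<kappa> * u + (pd_t B (t, x) / \<kappa> + pd_x (pd_x (pd_x (pd_x B))) (t, x) - d * pd_x (pd_x B) (t, x)) = 0"
    if u: "u \<in> Y t" for t u x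
  proof -
    have "u \<in> uvals S" using u YS by blast
    then show ?thesis using hatD(3)[OF H u, of x] by (simp add: d0 K D F \<tau>\<kappa> add_divide_distrib)
  qed
  have L0: "deriv A t / \<kappa> = 0" and PB: "pd_t B (t, x) / \<kappa> + pd_x (pd_x (pd_x (pd_x B))) (t, x) - d * pd_x (pd_x B) (t, x) = 0" for t x
    using affine_zero[OF Yo[of t] Yn[of t] finite.emptyI L[of _ t x]] by blast+
  have A0: "deriv A t = 0" for t using L0[of t] \<kappa> by simp
  obtain c where c: "A = (\<lambda>_. c)" using zero_deriv_const[OF hat_smooth(2)[OF H] A0] by blast
  obtain k where k: "a = (\<lambda>t. 4 * p * \<tau> t + k)" using integrate_a[OF hat_smooth(1)[OF H] s] by auto
  have comp: "smooth_on UNIV (\<lambda>q. G (fst q / \<kappa>, snd q)) \<and> pd_x (\<lambda>q. G (fst q / \<kappa>, snd q)) = (\<lambda>q. pd_x G (fst q / \<kappa>, snd q))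
     \<and> pd_t (\<lambda>q. G (fst q / \<kappa>, snd q)) = (\<lambda>q. pd_t G (fst q / \<kappa>, snd q) / \<kappa>)" if G: "smooth_on UNIV G" for G
  proof -
    have l: "((\<lambda>q::real \<times> real. (fst q / \<kappa>, snd q)) has_derivative (\<lambda>w. (fst w / \<kappa>, snd w))) (at q)" for q
      using has_derivative_mult_right[where x = "1 / \<kappa>", OF has_derivative_fst[OF has_derivative_ident]]
      by (intro has_derivative_Pair has_derivative_snd has_derivative_ident) simp
    have "((\<lambda>q. G (fst q / \<kappa>, snd q)) has_derivative (\<lambda>w. fst w / \<kappa> * pd_t G (fst q / \<kappa>, snd q)
        + snd w * pd_x G (fst q / \<kappa>, snd q))) (at q)" for q
      using diff_chain_at[OF l smooth_on_UNIV_pd[OF G]] by (simp add: o_def)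
    note pe = pd_eq[OF this]
    have "smooth_on UNIV (\<lambda>q::real \<times> real. fst q * (1 / \<kappa>))"
      by (intro smooth_on_mult smooth_on_const smooth_on_linear bounded_linear_fst open_UNIV)
    then have "smooth_on UNIV (\<lambda>q. G (fst q / \<kappa>, snd q))"
      using smooth_on_comp2[OF open_UNIV G _ smooth_on_linear[OF open_UNIV bounded_linear_snd], of "\<lambda>q. fst q * (1 / \<kappa>)"] by simp
    then show ?thesis using pe by (auto simp: fun_eq_iff)
  qed
  note B = hat_smooth(3)[OF H]
  note s1 = smooth_pd(2)[OF B] note s2 = smooth_pd(2)[OF s1] note s3 = smooth_pd(2)[OF s2]
  have "(\<lambda>q. B (fst q / \<kappa>, snd q)) \<in> linear_solutions d"
    unfolding linear_solutions_def using comp[OF B] comp[OF s1] comp[OF s2] comp[OF s3] PB by simp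
  then show ?thesis using dp c k by blast
qed

end

section \<open>The listed cases\<close>

lemma span_on_empty: "X \<in> span_on U {} \<longleftrightarrow> (\<forall>z\<in>U. X z = 0)"
  by (auto simp: span_on_def)

lemma span_on_insert:
  "X \<in> span_on U (insert V B) \<longleftrightarrow> (\<exists>c. \<exists>W\<in>span_on U B. \<forall>z\<in>U. X z = c *\<^sub>R V z + W z)"
proof
  assume "X \<in> span_on U (insert V B)"
  then obtain A c where A: "finite A" "A \<subseteq> insert V B" and X: "\<forall>z\<in>U. X z = (\<Sum>W\<in>A. c W *\<^sub>R W z)"
    unfolding span_on_def by blast
  define W where "W = (\<lambda>z. \<Sum>W\<in>A - {V}. c W *\<^sub>R W z)"
  have "W \<in> span_on U B" unfolding span_on_def W_def using A by blast
  moreover have "\<forall>z\<in>U. X z = (if V \<in> A then c V else 0) *\<^sub>R V z + W z"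
    using X A(1) by (auto simp: W_def sum.remove)
  ultimately show "\<exists>c. \<exists>W\<in>span_on U B. \<forall>z\<in>U. X z = c *\<^sub>R V z + W z" by blast
next
  assume "\<exists>c. \<exists>W\<in>span_on U B. \<forall>z\<in>U. X z = c *\<^sub>R V z + W z"
  then obtain c W A d where A: "finite A" "A \<subseteq> B" and W: "\<forall>z\<in>U. W z = (\<Sum>Y\<in>A. d Y *\<^sub>R Y z)"
    and X: "\<forall>z\<in>U. X z = c *\<^sub>R V z + W z" unfolding span_on_def by blast
  show "X \<in> span_on U (insert V B)"
  proof (cases "V \<in> A")
    case True
    \<comment> \<open>\<open>V\<close> may already be among the vectors in use; then its coefficient
      is increased.\<close>
    have "\<forall>z\<in>U. X z = (\<Sum>Y\<in>A. (d(V := d V + c)) Y *\<^sub>R Y z)"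
      using X W A(1) True by (auto simp: sum.remove[OF A(1) True] scaleR_add_left intro!: sum.cong)
    then show ?thesis unfolding span_on_def using A by blast
  next
    case False
    have "\<forall>z\<in>U. X z = (\<Sum>Y\<in>insert V A. (d(V := c)) Y *\<^sub>R Y z)"
      using X W A(1) False by (auto intro!: sum.cong)
    moreover have "finite (insert V A)" "insert V A \<subseteq> insert V B" using A by auto
    ultimately show ?thesis unfolding span_on_def by blast
  qed
qed

lemma linear_solutions_combine:
  assumes P: "P \<in> linear_solutions d" and Q: "Q \<in> linear_solutions d"
  shows "(\<lambda>q. c * P q + Q q) \<in> linear_solutions d"
    "pd_x (pd_x (\<lambda>q. c * P q + Q q)) = (\<lambda>q. c * pd_x (pd_x P) q + pd_x (pd_x Q) q)"
proof -
  have pd: "pd_t (\<lambda>q. c * f q + g q) = (\<lambda>q. c * pd_t f q + pd_t g q)"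
    "pd_x (\<lambda>q. c * f q + g q) = (\<lambda>q. c * pd_x f q + pd_x g q)"
    if "smooth_on UNIV f" "smooth_on UNIV g" for f g
  proof -
    have "((\<lambda>q. c * f q + g q) has_derivative (\<lambda>w. c * (fst w * pd_t f q + snd w * pd_x f q) + (fst w * pd_t g q + snd w * pd_x g q))) (at q)" for q
      by (intro has_derivative_add has_derivative_mult_right smooth_on_UNIV_pd that)
    from pd_eq[OF this] show "pd_t (\<lambda>q. c * f q + g q) = (\<lambda>q. c * pd_t f q + pd_t g q)"
      "pd_x (\<lambda>q. c * f q + g q) = (\<lambda>q. c * pd_x f q + pd_x g q)" by (auto simp: fun_eq_iff)
  qed
  have sP: "smooth_on UNIV P" and sQ: "smooth_on UNIV Q" using P Q by (auto simp: linear_solutions_def)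
  note s1 = smooth_pd(2)[OF sP] smooth_pd(2)[OF sQ]
  note s2 = smooth_pd(2)[OF s1(1)] smooth_pd(2)[OF s1(2)]
  note s3 = smooth_pd(2)[OF s2(1)] smooth_pd(2)[OF s2(2)]
  show "pd_x (pd_x (\<lambda>q. c * P q + Q q)) = (\<lambda>q. c * pd_x (pd_x P) q + pd_x (pd_x Q) q)"
    unfolding pd(2)[OF sP sQ] pd(2)[OF s1] ..
  have "c * pd_t P q + pd_t Q q + (c * pd_x (pd_x (pd_x (pd_x P))) q + pd_x (pd_x (pd_x (pd_x Q))) q)
     - d * (c * pd_x (pd_x P) q + pd_x (pd_x Q) q) =
     c * (pd_t P q + pd_x (pd_x (pd_x (pd_x P))) q - d * pd_x (pd_x P) q)
     + (pd_t Q q + pd_x (pd_x (pd_x (pd_x Q))) q - d * pd_x (pd_x Q) q)" for q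
    by (simp add: algebra_simps)
  then show "(\<lambda>q. c * P q + Q q) \<in> linear_solutions d"
    using P Q unfolding linear_solutions_def mem_Collect_eq pd[OF sP sQ] pd(2)[OF s1] pd(2)[OF s2] pd(2)[OF s3]
    by (auto intro!: smooth_on_add smooth_on_mult smooth_on_const sP sQ)
qed

lemma linear_solutions_zero: "(\<lambda>_. 0) \<in> linear_solutions d" "(\<lambda>_. c) \<in> linear_solutions d"
  by (simp_all add: linear_solutions_def pd_t_zero_fun smooth_on_const)

text \<open>The solution space is closed under linear combinations, so a finite combination of these
  operators is again a single one.\<close>

lemma span_on_Xinf:
  "X \<in> span_on U (op_Xinf ` linear_solutions d) \<longleftrightarrow> (\<exists>P\<in>linear_solutions d. \<forall>z\<in>U. X z = op_Xinf P z)"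
proof
  assume "X \<in> span_on U (op_Xinf ` linear_solutions d)"
  then obtain A c where A: "finite A" "A \<subseteq> op_Xinf ` linear_solutions d" and X: "\<forall>z\<in>U. X z = (\<Sum>W\<in>A. c W *\<^sub>R W z)"
    unfolding span_on_def by blast
  have "\<exists>P\<in>linear_solutions d. \<forall>z. (\<Sum>W\<in>A. c W *\<^sub>R W z) = op_Xinf P z"
    using A
  proof (induction A rule: finite_induct)
    case empty
    show ?case by (rule bexI[OF _ linear_solutions_zero(1)]) (simp add: op_Xinf_def pd_t_zero_fun zero_prod_def split: prod.split)
  next
    case (insert V A)
    then obtain P Q where P: "P \<in> linear_solutions d" "\<forall>z. (\<Sum>W\<in>A. c W *\<^sub>R W z) = op_Xinf P z"
      and Q: "Q \<in> linear_solutions d" "V = op_Xinf Q" by blast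
    have "(\<Sum>W\<in>insert V A. c W *\<^sub>R W z) = op_Xinf (\<lambda>q. c V * Q q + P q) z" for z
      using insert(1,2) P(2) by (cases z) (simp add: Q(2) op_Xinf_def linear_solutions_combine(2)[OF Q(1) P(1)])
    then show ?case using linear_solutions_combine(1)[OF Q(1) P(1)] by blast
  qed
  then show "\<exists>P\<in>linear_solutions d. \<forall>z\<in>U. X z = op_Xinf P z" using X by metis
next
  assume "\<exists>P\<in>linear_solutions d. \<forall>z\<in>U. X z = op_Xinf P z"
  then obtain P where "P \<in> linear_solutions d" "\<forall>z\<in>U. X z = (\<Sum>W\<in>{op_Xinf P}. 1 *\<^sub>R W z)" by auto
  then show "X \<in> span_on U (op_Xinf ` linear_solutions d)" unfolding span_on_def
    by (intro CollectI exI[of _ "{op_Xinf P}"] exI[of _ "\<lambda>_. 1"]) auto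
qed

lemma span_on3: "X \<in> span_on U {V1, V2, V3} \<longleftrightarrow> (\<exists>c1 c2 c3. \<forall>z\<in>U. X z = c1 *\<^sub>R V1 z + (c2 *\<^sub>R V2 z + c3 *\<^sub>R V3 z))"
proof -
  show ?thesis unfolding span_on_insert span_on_empty Bex_def
  proof (intro iffI; elim exE conjE)
    fix c1 W1 c2 W2 c3 W3
    assume "\<forall>z\<in>U. X z = c1 *\<^sub>R V1 z + W1 z" "\<forall>z\<in>U. W1 z = c2 *\<^sub>R V2 z + W2 z" "\<forall>z\<in>U. W2 z = c3 *\<^sub>R V3 z + W3 z"
      "\<forall>z\<in>U. W3 z = 0"
    then have "\<forall>z\<in>U. X z = c1 *\<^sub>R V1 z + (c2 *\<^sub>R V2 z + c3 *\<^sub>R V3 z)" by simp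
    then show "\<exists>c1 c2 c3. \<forall>z\<in>U. X z = c1 *\<^sub>R V1 z + (c2 *\<^sub>R V2 z + c3 *\<^sub>R V3 z)" by blast
  next
    fix c1 c2 c3 assume X: "\<forall>z\<in>U. X z = c1 *\<^sub>R V1 z + (c2 *\<^sub>R V2 z + c3 *\<^sub>R V3 z)"
    show "\<exists>c W. (\<exists>c Wa. (\<exists>c W. (\<forall>z\<in>U. W z = 0) \<and> (\<forall>z\<in>U. Wa z = c *\<^sub>R V3 z + W z)) \<and> (\<forall>z\<in>U. W z = c *\<^sub>R V2 z + Wa z)) \<and>
        (\<forall>z\<in>U. X z = c *\<^sub>R V1 z + W z)"
      by (rule exI[of _ c1], rule exI[of _ "\<lambda>z. c2 *\<^sub>R V2 z + c3 *\<^sub>R V3 z"], intro conjI,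
          rule exI[of _ c2], rule exI[of _ "\<lambda>z. c3 *\<^sub>R V3 z"], intro conjI,
          rule exI[of _ c3], rule exI[of _ "\<lambda>z. 0"]) (use X in auto)
  qed
qed

lemma span_on4: "X \<in> span_on U (insert V0 B) \<longleftrightarrow> (\<exists>c0 W. W \<in> span_on U B \<and> (\<forall>z\<in>U. X z = c0 *\<^sub>R V0 z + W z))"
  unfolding span_on_insert by blast

text \<open>Coefficient data (a, A, B, p) of the fields in the span of the basic operators; the
  x-translation is supplied by the free \<open>q\<close> in \<open>fields\<close>. \<open>k\<close>
  is the coefficient of \<open>op_Pt\<close>, \<open>p\<close> that of \<open>op_D1\<close> where it
  is free, and \<open>c\<close> that of \<open>op_D2\<close>, \<open>op_D3\<close>,
  \<open>op_Q1\<close> or \<open>op_I\<close>.\<close>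

fun sols :: "listed_case \<Rightarrow> ((real \<Rightarrow> real) \<times> (real \<Rightarrow> real) \<times> (real \<times> real \<Rightarrow> real) \<times> real) set" where
  "sols Case1 = {(\<lambda>t. 4 * p * t + k, \<lambda>_. 0, \<lambda>_. 0, p) | p k. True}"
| "sols (Case2 \<gamma> \<mu> d l) = {(\<lambda>t. 2 * (\<gamma> - 2 * \<mu>) * c * t + k, \<lambda>_. 0, \<lambda>_. 2 * c, (\<gamma> - \<mu>) * c) | c k. True}"
| "sols (Case3 \<gamma> \<mu> d l) = {(\<lambda>t. 2 * (\<gamma> - 2 * \<mu>) * c * t + k, \<lambda>_. 2 * c, \<lambda>_. 0, (\<gamma> - \<mu>) * c) | c k. True}"
| "sols (Case4 d l) = {(\<lambda>_. k, \<lambda>t. c * exp (l * t), \<lambda>_. 0, 0) | c k. True}"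
| "sols (Case5 \<gamma>) = {(\<lambda>t. (4 * p - 2 * \<gamma> * c) * t + k, \<lambda>_. 0, \<lambda>_. 2 * c, p) | p c k. True}"
| "sols (Case6 \<gamma>) = {(\<lambda>t. (4 * p - 2 * \<gamma> * c) * t + k, \<lambda>_. 2 * c, \<lambda>_. 0, p) | p c k. True}"
| "sols (Case7 d) = {(\<lambda>_. k, \<lambda>_. c, P, 0) | c k P. P \<in> linear_solutions d}"
| "sols Case8 = {(\<lambda>t. 4 * p * t + k, \<lambda>_. c, P, p) | p c k P. P \<in> linear_solutions 0}"

lemmas op_defs = op_Pt_def op_Px_def op_I_def op_D1_def op_D2_def op_D3_def op_Q1_def op_Xinf_def

lemma fields_span3:
  assumes "\<And>c1 c2 c3. \<exists>a A B p q. (a, A, B, p) \<in> V \<and> field_of a A B p q = (\<lambda>z. c1 *\<^sub>R V1 z + (c2 *\<^sub>R V2 z + c3 *\<^sub>R V3 z))"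
    and "\<And>a A B p q. (a, A, B, p) \<in> V \<Longrightarrow> \<exists>c1 c2 c3. field_of a A B p q = (\<lambda>z. c1 *\<^sub>R V1 z + (c2 *\<^sub>R V2 z + c3 *\<^sub>R V3 z))"
  shows "span_on U {V1, V2, V3} = fields U V"
proof (rule set_eqI)
  fix X
  show "X \<in> span_on U {V1, V2, V3} \<longleftrightarrow> X \<in> fields U V"
    unfolding span_on3 fields_def mem_Collect_eq
  proof
    assume "\<exists>c1 c2 c3. \<forall>z\<in>U. X z = c1 *\<^sub>R V1 z + (c2 *\<^sub>R V2 z + c3 *\<^sub>R V3 z)"
    then obtain c1 c2 c3 where X: "\<forall>z\<in>U. X z = c1 *\<^sub>R V1 z + (c2 *\<^sub>R V2 z + c3 *\<^sub>R V3 z)" by blast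
    obtain a A B p q where V: "(a, A, B, p) \<in> V" and f: "field_of a A B p q = (\<lambda>z. c1 *\<^sub>R V1 z + (c2 *\<^sub>R V2 z + c3 *\<^sub>R V3 z))"
      using assms(1) by blast
    show "\<exists>a A B p q. (a, A, B, p) \<in> V \<and> (\<forall>z\<in>U. X z = field_of a A B p q z)"
      by (rule exI[of _ a], rule exI[of _ A], rule exI[of _ B], rule exI[of _ p], rule exI[of _ q]) (simp add: V f X)
  next
    assume "\<exists>a A B p q. (a, A, B, p) \<in> V \<and> (\<forall>z\<in>U. X z = field_of a A B p q z)"
    then obtain a A B p q where V: "(a, A, B, p) \<in> V" and X: "\<forall>z\<in>U. X z = field_of a A B p q z" by blast
    obtain c1 c2 c3 where "field_of a A B p q = (\<lambda>z. c1 *\<^sub>R V1 z + (c2 *\<^sub>R V2 z + c3 *\<^sub>R V3 z))"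
      using assms(2)[OF V] by blast
    then show "\<exists>c1 c2 c3. \<forall>z\<in>U. X z = c1 *\<^sub>R V1 z + (c2 *\<^sub>R V2 z + c3 *\<^sub>R V3 z)" using X by auto
  qed
qed

text \<open>Splits off one operator. \<open>T\<close> consists of explicit representatives for the
  span of the others, so that the infinite families of cases 7 and 8 fit in.\<close>

lemma fields_span_rest:
  assumes "\<And>a A B p q. (a, A, B, p) \<in> V \<Longrightarrow> \<exists>c0 X. X \<in> T \<and> field_of a A B p q = (\<lambda>z. c0 *\<^sub>R V0 z + X z)"
    and "\<And>c0 X. X \<in> T \<Longrightarrow> \<exists>a A B p q. (a, A, B, p) \<in> V \<and> field_of a A B p q = (\<lambda>z. c0 *\<^sub>R V0 z + X z)"
    and "\<And>X. X \<in> span_on U B \<longleftrightarrow> (\<exists>Z\<in>T. \<forall>z\<in>U. X z = Z z)"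
  shows "span_on U (insert V0 B) = fields U V"
proof (rule set_eqI)
  fix X
  show "X \<in> span_on U (insert V0 B) \<longleftrightarrow> X \<in> fields U V"
    unfolding span_on4 fields_def mem_Collect_eq
  proof
    assume "\<exists>c0 W. W \<in> span_on U B \<and> (\<forall>z\<in>U. X z = c0 *\<^sub>R V0 z + W z)"
    then obtain c0 W Z where Z: "Z \<in> T" "\<forall>z\<in>U. W z = Z z" and X: "\<forall>z\<in>U. X z = c0 *\<^sub>R V0 z + W z" using assms(3) by blast
    obtain a A B p q where V: "(a, A, B, p) \<in> V" and f: "field_of a A B p q = (\<lambda>z. c0 *\<^sub>R V0 z + Z z)"
      using assms(2)[OF Z(1)] by blast
    show "\<exists>a A B p q. (a, A, B, p) \<in> V \<and> (\<forall>z\<in>U. X z = field_of a A B p q z)"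
      by (rule exI[of _ a], rule exI[of _ A], rule exI[of _ B], rule exI[of _ p], rule exI[of _ q]) (simp add: V f X Z)
  next
    assume "\<exists>a A B p q. (a, A, B, p) \<in> V \<and> (\<forall>z\<in>U. X z = field_of a A B p q z)"
    then obtain a A B' p q where V: "(a, A, B', p) \<in> V" and X: "\<forall>z\<in>U. X z = field_of a A B' p q z" by blast
    obtain c0 Z where "Z \<in> T" "field_of a A B' p q = (\<lambda>z. c0 *\<^sub>R V0 z + Z z)"
      using assms(1)[OF V] by blast
    moreover from this(1) have "Z \<in> span_on U B" using assms(3) by blast
    ultimately show "\<exists>c0 W. W \<in> span_on U B \<and> (\<forall>z\<in>U. X z = c0 *\<^sub>R V0 z + W z)" using X by auto
  qed
qed

lemma span_basic_ops: "span_on U (basic_ops k) = fields U (sols k)"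
proof (cases k)
  case Case1
  show ?thesis unfolding Case1 basic_ops.simps
  proof (rule fields_span3)
    fix c1 c2 c3
    show "\<exists>a A B p q. (a, A, B, p) \<in> sols Case1 \<and> field_of a A B p q =
        (\<lambda>z. c1 *\<^sub>R op_Pt z + (c2 *\<^sub>R op_Px z + c3 *\<^sub>R op_D1 z))"
      by (rule exI[of _ "\<lambda>t. 4 * c3 * t + c1"], rule exI[of _ "\<lambda>_. 0"], rule exI[of _ "\<lambda>_. 0"], rule exI[of _ c3], rule exI[of _ c2])
        (rule conjI, (unfold sols.simps, blast), auto simp: field_of_def op_defs pd_t_zero_fun)
  next
    fix a A B p q assume "(a, A, B, p) \<in> sols Case1"
    then obtain k where e: "a = (\<lambda>t. 4 * p * t + k)" "A = (\<lambda>_. 0)" "B = (\<lambda>_. 0)" by auto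
    show "\<exists>c1 c2 c3. field_of a A B p q = (\<lambda>z. c1 *\<^sub>R op_Pt z + (c2 *\<^sub>R op_Px z + c3 *\<^sub>R op_D1 z))"
      unfolding e by (rule exI[of _ k], rule exI[of _ q], rule exI[of _ p]) (auto simp: field_of_def op_defs pd_t_zero_fun)
  qed
next
  case (Case2 \<gamma> \<mu> d l)
  show ?thesis unfolding Case2 basic_ops.simps
  proof (rule fields_span3)
    fix c1 c2 c3
    show "\<exists>a A B p q. (a, A, B, p) \<in> sols (Case2 \<gamma> \<mu> d l) \<and> field_of a A B p q =
        (\<lambda>z. c1 *\<^sub>R op_Pt z + (c2 *\<^sub>R op_Px z + c3 *\<^sub>R op_D2 \<gamma> \<mu> z))"
      by (rule exI[of _ "\<lambda>t. 2 * (\<gamma> - 2 * \<mu>) * c3 * t + c1"], rule exI[of _ "\<lambda>_. 0"], rule exI[of _ "\<lambda>_. 2 * c3"],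
          rule exI[of _ "(\<gamma> - \<mu>) * c3"], rule exI[of _ c2])
        (rule conjI, (unfold sols.simps, blast), auto simp: field_of_def op_defs pd_t_zero_fun algebra_simps)
  next
    fix a A B p q assume "(a, A, B, p) \<in> sols (Case2 \<gamma> \<mu> d l)"
    then obtain c k where e: "a = (\<lambda>t. 2 * (\<gamma> - 2 * \<mu>) * c * t + k)" "A = (\<lambda>_. 0)" "B = (\<lambda>_. 2 * c)" "p = (\<gamma> - \<mu>) * c" by auto
    show "\<exists>c1 c2 c3. field_of a A B p q = (\<lambda>z. c1 *\<^sub>R op_Pt z + (c2 *\<^sub>R op_Px z + c3 *\<^sub>R op_D2 \<gamma> \<mu> z))"
      unfolding e by (rule exI[of _ k], rule exI[of _ q], rule exI[of _ c]) (auto simp: field_of_def op_defs pd_t_zero_fun algebra_simps)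
  qed
next
  case (Case3 \<gamma> \<mu> d l)
  show ?thesis unfolding Case3 basic_ops.simps
  proof (rule fields_span3)
    fix c1 c2 c3
    show "\<exists>a A B p q. (a, A, B, p) \<in> sols (Case3 \<gamma> \<mu> d l) \<and> field_of a A B p q =
        (\<lambda>z. c1 *\<^sub>R op_Pt z + (c2 *\<^sub>R op_Px z + c3 *\<^sub>R op_D3 \<gamma> \<mu> z))"
      by (rule exI[of _ "\<lambda>t. 2 * (\<gamma> - 2 * \<mu>) * c3 * t + c1"], rule exI[of _ "\<lambda>_. 2 * c3"], rule exI[of _ "\<lambda>_. 0"],
          rule exI[of _ "(\<gamma> - \<mu>) * c3"], rule exI[of _ c2])
        (rule conjI, (unfold sols.simps, blast), auto simp: field_of_def op_defs pd_t_zero_fun algebra_simps)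
  next
    fix a A B p q assume "(a, A, B, p) \<in> sols (Case3 \<gamma> \<mu> d l)"
    then obtain c k where e: "a = (\<lambda>t. 2 * (\<gamma> - 2 * \<mu>) * c * t + k)" "A = (\<lambda>_. 2 * c)" "B = (\<lambda>_. 0)" "p = (\<gamma> - \<mu>) * c" by auto
    show "\<exists>c1 c2 c3. field_of a A B p q = (\<lambda>z. c1 *\<^sub>R op_Pt z + (c2 *\<^sub>R op_Px z + c3 *\<^sub>R op_D3 \<gamma> \<mu> z))"
      unfolding e by (rule exI[of _ k], rule exI[of _ q], rule exI[of _ c]) (auto simp: field_of_def op_defs pd_t_zero_fun algebra_simps)
  qed
next
  case (Case4 d l)
  show ?thesis unfolding Case4 basic_ops.simps
  proof (rule fields_span3)
    fix c1 c2 c3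
    show "\<exists>a A B p q. (a, A, B, p) \<in> sols (Case4 d l) \<and> field_of a A B p q =
        (\<lambda>z. c1 *\<^sub>R op_Pt z + (c2 *\<^sub>R op_Px z + c3 *\<^sub>R op_Q1 l z))"
      by (rule exI[of _ "\<lambda>t. c1"], rule exI[of _ "\<lambda>t. c3 * exp (l * t)"], rule exI[of _ "\<lambda>_. 0"],
          rule exI[of _ "0"], rule exI[of _ c2])
        (rule conjI, (unfold sols.simps, blast), auto simp: field_of_def op_defs pd_t_zero_fun algebra_simps)
  next
    fix a A B p q assume "(a, A, B, p) \<in> sols (Case4 d l)"
    then obtain c k where e: "a = (\<lambda>t. k)" "A = (\<lambda>t. c * exp (l * t))" "B = (\<lambda>_. 0)" "p = 0" by auto
    show "\<exists>c1 c2 c3. field_of a A B p q = (\<lambda>z. c1 *\<^sub>R op_Pt z + (c2 *\<^sub>R op_Px z + c3 *\<^sub>R op_Q1 l z))"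
      unfolding e by (rule exI[of _ k], rule exI[of _ q], rule exI[of _ c]) (auto simp: field_of_def op_defs pd_t_zero_fun algebra_simps)
  qed
next
  case (Case5 \<gamma>)
  show ?thesis unfolding Case5 basic_ops.simps
  proof (rule fields_span_rest)
    show "X \<in> span_on U {op_Px, op_D1, op_D2 \<gamma> \<gamma>} \<longleftrightarrow>
      (\<exists>Z\<in>{\<lambda>z. c1 *\<^sub>R op_Px z + (c2 *\<^sub>R op_D1 z + c3 *\<^sub>R op_D2 \<gamma> \<gamma> z) | c1 c2 c3. True}. \<forall>z\<in>U. X z = Z z)" for X
      unfolding span_on3 by auto
  next
    fix a A B p q assume "(a, A, B, p) \<in> sols (Case5 \<gamma>)"
    then obtain c k where e: "a = (\<lambda>t. (4 * p - 2 * \<gamma> * c) * t + k)" "A = (\<lambda>_. 0)" "B = (\<lambda>_. 2 * c)" by auto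
    have "field_of a A B p q = (\<lambda>z. k *\<^sub>R op_Pt z + (q *\<^sub>R op_Px z + (p *\<^sub>R op_D1 z + c *\<^sub>R op_D2 \<gamma> \<gamma> z)))"
      by (auto simp: e field_of_def op_defs pd_t_zero_fun algebra_simps)
    then show "\<exists>c0 X. X \<in> {\<lambda>z. c1 *\<^sub>R op_Px z + (c2 *\<^sub>R op_D1 z + c3 *\<^sub>R op_D2 \<gamma> \<gamma> z) | c1 c2 c3. True} \<and>
        field_of a A B p q = (\<lambda>z. c0 *\<^sub>R op_Pt z + X z)" by blast
  next
    fix c0 X assume "X \<in> {\<lambda>z. c1 *\<^sub>R op_Px z + (c2 *\<^sub>R op_D1 z + c3 *\<^sub>R op_D2 \<gamma> \<gamma> z) | c1 c2 c3. True}"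
    then obtain c1 c2 c3 where X: "X = (\<lambda>z. c1 *\<^sub>R op_Px z + (c2 *\<^sub>R op_D1 z + c3 *\<^sub>R op_D2 \<gamma> \<gamma> z))" by blast
    show "\<exists>a A B p q. (a, A, B, p) \<in> sols (Case5 \<gamma>) \<and> field_of a A B p q = (\<lambda>z. c0 *\<^sub>R op_Pt z + X z)"
      by (rule exI[of _ "\<lambda>t. (4 * c2 - 2 * \<gamma> * c3) * t + c0"], rule exI[of _ "\<lambda>_. 0"], rule exI[of _ "\<lambda>_. 2 * c3"],
          rule exI[of _ c2], rule exI[of _ c1])
        (rule conjI, (unfold sols.simps, blast), auto simp: X field_of_def op_defs pd_t_zero_fun algebra_simps)
  qed
next
  case (Case6 \<gamma>)
  show ?thesis unfolding Case6 basic_ops.simps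
  proof (rule fields_span_rest)
    show "X \<in> span_on U {op_Px, op_D1, op_D3 \<gamma> \<gamma>} \<longleftrightarrow>
      (\<exists>Z\<in>{\<lambda>z. c1 *\<^sub>R op_Px z + (c2 *\<^sub>R op_D1 z + c3 *\<^sub>R op_D3 \<gamma> \<gamma> z) | c1 c2 c3. True}. \<forall>z\<in>U. X z = Z z)" for X
      unfolding span_on3 by auto
  next
    fix a A B p q assume "(a, A, B, p) \<in> sols (Case6 \<gamma>)"
    then obtain c k where e: "a = (\<lambda>t. (4 * p - 2 * \<gamma> * c) * t + k)" "A = (\<lambda>_. 2 * c)" "B = (\<lambda>_. 0)" by auto
    have "field_of a A B p q = (\<lambda>z. k *\<^sub>R op_Pt z + (q *\<^sub>R op_Px z + (p *\<^sub>R op_D1 z + c *\<^sub>R op_D3 \<gamma> \<gamma> z)))"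
      by (auto simp: e field_of_def op_defs pd_t_zero_fun algebra_simps)
    then show "\<exists>c0 X. X \<in> {\<lambda>z. c1 *\<^sub>R op_Px z + (c2 *\<^sub>R op_D1 z + c3 *\<^sub>R op_D3 \<gamma> \<gamma> z) | c1 c2 c3. True} \<and>
        field_of a A B p q = (\<lambda>z. c0 *\<^sub>R op_Pt z + X z)" by blast
  next
    fix c0 X assume "X \<in> {\<lambda>z. c1 *\<^sub>R op_Px z + (c2 *\<^sub>R op_D1 z + c3 *\<^sub>R op_D3 \<gamma> \<gamma> z) | c1 c2 c3. True}"
    then obtain c1 c2 c3 where X: "X = (\<lambda>z. c1 *\<^sub>R op_Px z + (c2 *\<^sub>R op_D1 z + c3 *\<^sub>R op_D3 \<gamma> \<gamma> z))" by blast
    show "\<exists>a A B p q. (a, A, B, p) \<in> sols (Case6 \<gamma>) \<and> field_of a A B p q = (\<lambda>z. c0 *\<^sub>R op_Pt z + X z)"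
      by (rule exI[of _ "\<lambda>t. (4 * c2 - 2 * \<gamma> * c3) * t + c0"], rule exI[of _ "\<lambda>_. 2 * c3"], rule exI[of _ "\<lambda>_. 0"],
          rule exI[of _ c2], rule exI[of _ c1])
        (rule conjI, (unfold sols.simps, blast), auto simp: X field_of_def op_defs pd_t_zero_fun algebra_simps)
  qed
next
  case (Case7 d)
  let ?T = "{\<lambda>z. c1 *\<^sub>R op_Px z + (c2 *\<^sub>R op_I z + op_Xinf P z) | c1 c2 P. P \<in> linear_solutions d}"
  have "span_on U (insert op_Pt (insert op_Px (insert op_I (op_Xinf ` linear_solutions d)))) = fields U (sols k)"
    unfolding Case7
  proof (rule fields_span_rest)
    show "X \<in> span_on U (insert op_Px (insert op_I (op_Xinf ` linear_solutions d))) \<longleftrightarrow> (\<exists>Z\<in>?T. \<forall>z\<in>U. X z = Z z)" for X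
    proof
      assume "X \<in> span_on U (insert op_Px (insert op_I (op_Xinf ` linear_solutions d)))"
      then obtain c1 W c2 W2 P where "P \<in> linear_solutions d" "\<forall>z\<in>U. W2 z = op_Xinf P z" "\<forall>z\<in>U. W z = c2 *\<^sub>R op_I z + W2 z"
        "\<forall>z\<in>U. X z = c1 *\<^sub>R op_Px z + W z" unfolding span_on4 span_on_Xinf by blast
      then show "\<exists>Z\<in>?T. \<forall>z\<in>U. X z = Z z" by (intro bexI[of _ "\<lambda>z. c1 *\<^sub>R op_Px z + (c2 *\<^sub>R op_I z + op_Xinf P z)"]) auto
    next
      assume "\<exists>Z\<in>?T. \<forall>z\<in>U. X z = Z z"
      then obtain c1 c2 P where P: "P \<in> linear_solutions d" and X: "\<forall>z\<in>U. X z = c1 *\<^sub>R op_Px z + (c2 *\<^sub>R op_I z + op_Xinf P z)" by blast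
      have 1: "op_Xinf P \<in> span_on U (op_Xinf ` linear_solutions d)" unfolding span_on_Xinf using P by blast
      have 2: "(\<lambda>z. c2 *\<^sub>R op_I z + op_Xinf P z) \<in> span_on U (insert op_I (op_Xinf ` linear_solutions d))"
        unfolding span_on_insert by (intro exI[of _ c2] bexI[OF _ 1]) simp
      show "X \<in> span_on U (insert op_Px (insert op_I (op_Xinf ` linear_solutions d)))"
        unfolding span_on_insert[of X] by (intro exI[of _ c1] bexI[OF _ 2]) (rule X)
    qed
  next
    fix a A B p q assume "(a, A, B, p) \<in> sols (Case7 d)"
    then obtain c k where e: "a = (\<lambda>t. k)" "A = (\<lambda>_. c)" "p = 0" and B: "B \<in> linear_solutions d" by auto
    have "field_of a A B p q = (\<lambda>z. k *\<^sub>R op_Pt z + (q *\<^sub>R op_Px z + (c *\<^sub>R op_I z + op_Xinf B z)))"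
      by (auto simp: e field_of_def op_defs pd_t_zero_fun algebra_simps)
    then show "\<exists>c0 X. X \<in> ?T \<and> field_of a A B p q = (\<lambda>z. c0 *\<^sub>R op_Pt z + X z)" using B by blast
  next
    fix c0 X assume "X \<in> ?T"
    then obtain c1 c2 P where P: "P \<in> linear_solutions d" and X: "X = (\<lambda>z. c1 *\<^sub>R op_Px z + (c2 *\<^sub>R op_I z + op_Xinf P z))" by blast
    show "\<exists>a A B p q. (a, A, B, p) \<in> sols (Case7 d) \<and> field_of a A B p q = (\<lambda>z. c0 *\<^sub>R op_Pt z + X z)"
      by (rule exI[of _ "\<lambda>t. c0"], rule exI[of _ "\<lambda>_. c2"], rule exI[of _ P], rule exI[of _ 0], rule exI[of _ c1])
        (rule conjI, (unfold sols.simps, use P in blast), auto simp: X field_of_def op_defs pd_t_zero_fun algebra_simps)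
  qed
  then show ?thesis by (simp add: Case7)
next
  case Case8
  let ?T = "{\<lambda>z. c1 *\<^sub>R op_Px z + (c2 *\<^sub>R op_I z + (c3 *\<^sub>R op_D1 z + op_Xinf P z)) | c1 c2 c3 P. P \<in> linear_solutions 0}"
  have "span_on U (insert op_Pt (insert op_Px (insert op_I (insert op_D1 (op_Xinf ` linear_solutions 0))))) = fields U (sols k)"
    unfolding Case8
  proof (rule fields_span_rest)
    show "X \<in> span_on U (insert op_Px (insert op_I (insert op_D1 (op_Xinf ` linear_solutions 0)))) \<longleftrightarrow> (\<exists>Z\<in>?T. \<forall>z\<in>U. X z = Z z)" for X
    proof
      assume "X \<in> span_on U (insert op_Px (insert op_I (insert op_D1 (op_Xinf ` linear_solutions 0))))"
      then obtain c1 W c2 W2 c3 W3 P where "P \<in> linear_solutions 0" "\<forall>z\<in>U. W3 z = op_Xinf P z" "\<forall>z\<in>U. W2 z = c3 *\<^sub>R op_D1 z + W3 z"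
        "\<forall>z\<in>U. W z = c2 *\<^sub>R op_I z + W2 z" "\<forall>z\<in>U. X z = c1 *\<^sub>R op_Px z + W z" unfolding span_on4 span_on_Xinf by blast
      then show "\<exists>Z\<in>?T. \<forall>z\<in>U. X z = Z z"
        by (intro bexI[of _ "\<lambda>z. c1 *\<^sub>R op_Px z + (c2 *\<^sub>R op_I z + (c3 *\<^sub>R op_D1 z + op_Xinf P z))"]) auto
    next
      assume "\<exists>Z\<in>?T. \<forall>z\<in>U. X z = Z z"
      then obtain c1 c2 c3 P where P: "P \<in> linear_solutions 0"
        and X: "\<forall>z\<in>U. X z = c1 *\<^sub>R op_Px z + (c2 *\<^sub>R op_I z + (c3 *\<^sub>R op_D1 z + op_Xinf P z))" by blast
      have 1: "op_Xinf P \<in> span_on U (op_Xinf ` linear_solutions 0)" unfolding span_on_Xinf using P by blast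
      have 2: "(\<lambda>z. c3 *\<^sub>R op_D1 z + op_Xinf P z) \<in> span_on U (insert op_D1 (op_Xinf ` linear_solutions 0))"
        unfolding span_on_insert by (intro exI[of _ c3] bexI[OF _ 1]) simp
      have 3: "(\<lambda>z. c2 *\<^sub>R op_I z + (c3 *\<^sub>R op_D1 z + op_Xinf P z)) \<in> span_on U (insert op_I (insert op_D1 (op_Xinf ` linear_solutions 0)))"
        unfolding span_on_insert[of _ _ op_I] by (intro exI[of _ c2] bexI[OF _ 2]) simp
      show "X \<in> span_on U (insert op_Px (insert op_I (insert op_D1 (op_Xinf ` linear_solutions 0))))"
        unfolding span_on_insert[of X] by (intro exI[of _ c1] bexI[OF _ 3]) (rule X)
    qed
  next
    fix a A B p q assume "(a, A, B, p) \<in> sols Case8"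
    then obtain c k where e: "a = (\<lambda>t. 4 * p * t + k)" "A = (\<lambda>_. c)" and B: "B \<in> linear_solutions 0" by auto
    have "field_of a A B p q = (\<lambda>z. k *\<^sub>R op_Pt z + (q *\<^sub>R op_Px z + (c *\<^sub>R op_I z + (p *\<^sub>R op_D1 z + op_Xinf B z))))"
      by (auto simp: e field_of_def op_defs pd_t_zero_fun algebra_simps)
    then show "\<exists>c0 X. X \<in> ?T \<and> field_of a A B p q = (\<lambda>z. c0 *\<^sub>R op_Pt z + X z)" using B by blast
  next
    fix c0 X assume "X \<in> ?T"
    then obtain c1 c2 c3 P where P: "P \<in> linear_solutions 0" and X: "X = (\<lambda>z. c1 *\<^sub>R op_Px z + (c2 *\<^sub>R op_I z + (c3 *\<^sub>R op_D1 z + op_Xinf P z)))" by blast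
    show "\<exists>a A B p q. (a, A, B, p) \<in> sols Case8 \<and> field_of a A B p q = (\<lambda>z. c0 *\<^sub>R op_Pt z + X z)"
      by (rule exI[of _ "\<lambda>t. 4 * c3 * t + c0"], rule exI[of _ "\<lambda>_. c2"], rule exI[of _ P], rule exI[of _ c3], rule exI[of _ c1])
        (rule conjI, (unfold sols.simps, use P in blast), auto simp: X field_of_def op_defs pd_t_zero_fun algebra_simps)
  qed
  then show ?thesis by (simp add: Case8)
qed

section \<open>The listed systems as solutions of Euler equations\<close>

lemma deriv_on:
  fixes f :: "real \<Rightarrow> real"
  assumes "open J" "u \<in> J" "\<And>y. y \<in> J \<Longrightarrow> f y = g y" "(g has_real_derivative d) (at u)"
  shows "deriv f u = d"
  using DERIV_imp_deriv[OF has_field_derivative_transform_within_open[OF assms(4,1,2), of f]] assms(3) by simp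

lemma power_term_euler:
  assumes J: "open J" and f: "smooth_on J f" and p: "power_term J f c \<sigma>"
  shows "euler J 1 0 f \<sigma>" "c = 0 \<Longrightarrow> vanishes J f" "c \<noteq> 0 \<Longrightarrow> nowhere_zero J 1 0 f"
proof -
  consider (pos) "J \<subseteq> {0<..}" "\<forall>u\<in>J. f u = c * u powr \<sigma>"
    | (int) n where "\<sigma> = of_int n" "\<forall>u\<in>J. f u = c * u powi n" | (zero) "c = 0" "\<forall>u\<in>J. f u = 0"
    using p unfolding power_term_def by blast
  then have "euler J 1 0 f \<sigma> \<and> (c = 0 \<longrightarrow> vanishes J f) \<and> (c \<noteq> 0 \<longrightarrow> nowhere_zero J 1 0 f)"
  proof cases
    case pos
    have "deriv f u * u = \<sigma> * f u" if u: "u \<in> J" for u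
    proof -
      have u0: "u > 0" using pos u by auto
      have "((\<lambda>u. c * u powr \<sigma>) has_real_derivative c * (\<sigma> * u powr (\<sigma> - 1))) (at u)"
        using u0 by (auto intro!: derivative_eq_intros has_real_derivative_powr)
      then have "deriv f u = c * (\<sigma> * u powr (\<sigma> - 1))" by (rule deriv_on[OF J u, rotated]) (use pos in auto)
      moreover have "u powr (\<sigma> - 1) * u = u powr \<sigma>" using u0 by (simp add: powr_diff)
      ultimately show ?thesis using pos u by (simp add: algebra_simps)
    qed
    then show ?thesis using pos by (auto simp: euler_def vanishes_def nowhere_zero_def)
  next
    case int
    have e: "deriv f u * u = \<sigma> * f u" if u: "u \<in> J" "u \<noteq> 0" for u
    proof -
      have "((\<lambda>u. c * u powi n) has_real_derivative c * (of_int n * u powi (n - 1))) (at u)"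
        using u(2) by (auto intro!: derivative_eq_intros)
      then have "deriv f u = c * (of_int n * u powi (n - 1))" by (rule deriv_on[OF J u(1), rotated]) (use int in auto)
      moreover have "u powi (n - 1) * u = u powi n" using u(2) by (simp add: power_int_diff)
      ultimately show ?thesis using int u by (simp add: algebra_simps)
    qed
    have "deriv f u * u = \<sigma> * f u" if u: "u \<in> J" for u
    proof (cases "u = 0")
      \<comment> \<open>The derivative formula for integer powers was used only off 0; at 0 the
        equation follows from nearby points by continuity.\<close>
      case True
      have c1: "continuous_on J (\<lambda>u. deriv f u * u - \<sigma> * f u)"
        using smooth_on_continuous[OF f] smooth_on_continuous[OF smooth_on_deriv[OF J f]]
        by (intro continuous_intros)
      then have "isCont (\<lambda>u. deriv f u * u - \<sigma> * f u) u" using J u continuous_on_eq_continuous_at by blast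
      moreover have "eventually (\<lambda>w. w \<in> J - {u}) (at u)" using J u eventually_at_in_open by blast
      then have "eventually (\<lambda>w. deriv f w * w - \<sigma> * f w = 0) (at u)"
        by (rule eventually_mono) (use e True in auto)
      then have "((\<lambda>w. deriv f w * w - \<sigma> * f w) \<longlongrightarrow> 0) (at u)" by (rule tendsto_eventually)
      ultimately have "deriv f u * u - \<sigma> * f u = 0"
        unfolding isCont_def using LIM_unique by blast
      then show ?thesis by simp
    qed (use e u in auto)
    then show ?thesis using int by (auto simp: euler_def vanishes_def nowhere_zero_def)
  next
    case zero
    then have v: "vanishes J f" by (simp add: vanishes_def)
    then show ?thesis using zero deriv_vanishes[OF J v] by (auto simp: euler_def)
  qed
  then show "euler J 1 0 f \<sigma>" "c = 0 \<Longrightarrow> vanishes J f" "c \<noteq> 0 \<Longrightarrow> nowhere_zero J 1 0 f" by blast+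
qed

lemma exp_term_euler:
  assumes J: "open J" and f: "\<And>u. u \<in> J \<Longrightarrow> f u = c * exp (\<sigma> * u)"
  shows "euler J 0 1 f \<sigma>" "c = 0 \<Longrightarrow> vanishes J f" "c \<noteq> 0 \<Longrightarrow> nowhere_zero J 0 1 f"
proof -
  have "deriv f u = c * (\<sigma> * exp (\<sigma> * u))" if u: "u \<in> J" for u
    by (rule deriv_on[OF J u f]) (auto intro!: derivative_eq_intros)
  then show "euler J 0 1 f \<sigma>" using f by (simp add: euler_def)
  show "c = 0 \<Longrightarrow> vanishes J f" "c \<noteq> 0 \<Longrightarrow> nowhere_zero J 0 1 f" using f by (simp_all add: vanishes_def nowhere_zero_def)
qed

text \<open>Common form of cases 2, 3, 5 and 6. The weight e + 2 \<mu> - \<gamma> of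
  \<open>F\<close> is the one that lets all terms of the equation scale alike. Cases 5 and 6 are
  taken with \<mu> = \<gamma> and d = l = 0.\<close>

definition scaling_system :: "rd_system \<Rightarrow> real \<Rightarrow> real \<Rightarrow> real \<Rightarrow> real \<Rightarrow> real \<Rightarrow> real \<Rightarrow> bool" where
  "scaling_system S e b \<gamma> \<mu> d l \<longleftrightarrow>
    ((e = 0 \<and> b = 1) \<or> (e = 1 \<and> b = 0)) \<and>
    euler (uvals S) e b (coefK S) \<gamma> \<and> nowhere_zero (uvals S) e b (coefK S) \<and>
    euler (uvals S) e b (coefD S) \<mu> \<and> (if d = 0 then vanishes (uvals S) (coefD S) else nowhere_zero (uvals S) e b (coefD S)) \<and>
    euler (uvals S) e b (coefF S) (e + 2 * \<mu> - \<gamma>) \<and>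
    (if l = 0 then vanishes (uvals S) (coefF S) else nowhere_zero (uvals S) e b (coefF S))"

lemma vanishes_euler: "open J \<Longrightarrow> vanishes J f \<Longrightarrow> euler J e b f \<sigma>"
  using deriv_vanishes by (auto simp: euler_def vanishes_def)

lemma listed_scaling:
  assumes L: "listed k S"
  shows "k = Case2 \<gamma> \<mu> d l \<Longrightarrow> scaling_system S 0 1 \<gamma> \<mu> d l"
    "k = Case3 \<gamma> \<mu> d l \<Longrightarrow> scaling_system S 1 0 \<gamma> \<mu> d l"
    "k = Case5 \<gamma> \<Longrightarrow> scaling_system S 0 1 \<gamma> \<gamma> 0 0"
    "k = Case6 \<gamma> \<Longrightarrow> scaling_system S 1 0 \<gamma> \<gamma> 0 0"
proof -
  have J: "open (uvals S)" and sm: "smooth_on (uvals S) (coefK S)" "smooth_on (uvals S) (coefD S)" "smooth_on (uvals S) (coefF S)"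
    using L by (auto simp: listed_def valid_system_def)
  show "scaling_system S 0 1 \<gamma> \<mu> d l" if "k = Case2 \<gamma> \<mu> d l"
    using L that exp_term_euler[OF J, of "coefK S" 1 \<gamma>] exp_term_euler[OF J, of "coefD S" d \<mu>]
      exp_term_euler[OF J, of "coefF S" l "2 * \<mu> - \<gamma>"]
    by (simp add: listed_def scaling_system_def)
  show "scaling_system S 1 0 \<gamma> \<mu> d l" if "k = Case3 \<gamma> \<mu> d l"
  proof -
    have e: "2 * \<mu> - \<gamma> + 1 = 1 + 2 * \<mu> - \<gamma>" by simp
    have "power_term (uvals S) (coefK S) 1 \<gamma>" "power_term (uvals S) (coefD S) d \<mu>"
      "power_term (uvals S) (coefF S) l (1 + 2 * \<mu> - \<gamma>)"
      using L that e by (simp_all add: listed_def)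
    note pe = power_term_euler[OF J sm(1) this(1)] power_term_euler[OF J sm(2) this(2)] power_term_euler[OF J sm(3) this(3)]
    show ?thesis unfolding scaling_system_def using pe(1,4,7) pe(3)[OF one_neq_zero] pe(5,6,8,9) by presburger
  qed
  show "scaling_system S 0 1 \<gamma> \<gamma> 0 0" if "k = Case5 \<gamma>"
  proof -
    have v: "vanishes (uvals S) (coefD S)" "vanishes (uvals S) (coefF S)" using L that by (auto simp: listed_def vanishes_def)
    show ?thesis using L that exp_term_euler[OF J, of "coefK S" 1 \<gamma>] v vanishes_euler[OF J v(1)] vanishes_euler[OF J v(2)]
      by (simp add: listed_def scaling_system_def)
  qed
  show "scaling_system S 1 0 \<gamma> \<gamma> 0 0" if "k = Case6 \<gamma>"
  proof -
    have v: "vanishes (uvals S) (coefD S)" "vanishes (uvals S) (coefF S)" using L that by (auto simp: listed_def vanishes_def)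
    show ?thesis using L that power_term_euler[OF J sm(1), of 1 \<gamma>] v vanishes_euler[OF J v(1)] vanishes_euler[OF J v(2)]
      by (simp add: listed_def scaling_system_def)
  qed
qed

lemma smooth_affine: "smooth_on UNIV (\<lambda>t::real. m * t + k)"
  by (intro smooth_on_add smooth_on_mult smooth_on_const smooth_on_linear open_UNIV bounded_linear_ident)

lemma deriv_affine: "deriv (\<lambda>t::real. m * t + k) t = m"
  by (rule DERIV_imp_deriv) (auto intro!: derivative_eq_intros)

lemma determining_scaling:
  assumes "scaling_system S e b \<gamma> \<mu> d l"
  shows "determining S (\<lambda>t. 2 * (\<gamma> - 2 * \<mu>) * c * t + k) (\<lambda>_. e * (2 * c)) (\<lambda>_. b * (2 * c)) ((\<gamma> - \<mu>) * c)"
  unfolding determining_def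
proof (intro conjI allI ballI smooth_affine)
  show "smooth_on UNIV (\<lambda>_::real. e * (2 * c))" "smooth_on UNIV (\<lambda>_::real \<times> real. b * (2 * c))"
    by (auto intro: smooth_on_const)
  fix t x u assume u: "u \<in> uvals S"
  have E: "deriv (coefK S) u * (e * u + b) = \<gamma> * coefK S u" "deriv (coefD S) u * (e * u + b) = \<mu> * coefD S u"
    "deriv (coefF S) u * (e * u + b) = (e + 2 * \<mu> - \<gamma>) * coefF S u"
    using assms u by (auto simp: scaling_system_def euler_def)
  have w: "w * (e * (2 * c) * u + b * (2 * c)) = 2 * c * (w * (e * u + b))" for w by (simp add: algebra_simps)
  show "deriv (coefK S) u * (e * (2 * c) * u + b * (2 * c)) =
       coefK S u * (4 * ((\<gamma> - \<mu>) * c) - deriv (\<lambda>t. 2 * (\<gamma> - 2 * \<mu>) * c * t + k) t)"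
    unfolding w E deriv_affine by (simp add: algebra_simps)
  show "deriv (coefD S) u * (e * (2 * c) * u + b * (2 * c)) =
       coefD S u * (2 * ((\<gamma> - \<mu>) * c) - deriv (\<lambda>t. 2 * (\<gamma> - 2 * \<mu>) * c * t + k) t)"
    unfolding w E deriv_affine by (simp add: algebra_simps)
  show "deriv (coefF S) u * (e * (2 * c) * u + b * (2 * c)) =
       (e * (2 * c) - deriv (\<lambda>t. 2 * (\<gamma> - 2 * \<mu>) * c * t + k) t) * coefF S u +
       deriv (\<lambda>_. e * (2 * c)) t * u + pd_t (\<lambda>_. b * (2 * c)) (t, x) +
       coefK S u * pd_x (pd_x (pd_x (pd_x (\<lambda>_. b * (2 * c))))) (t, x) - coefD S u * pd_x (pd_x (\<lambda>_. b * (2 * c))) (t, x)"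
    unfolding w E deriv_affine by (simp add: pd_t_zero_fun algebra_simps)
qed

lemma determining_two_scalings:
  assumes "scaling_system S e b \<gamma> \<gamma> 0 0"
  shows "determining S (\<lambda>t. (4 * p - 2 * \<gamma> * c) * t + k) (\<lambda>_. e * (2 * c)) (\<lambda>_. b * (2 * c)) p"
  unfolding determining_def
proof (intro conjI allI ballI smooth_affine)
  show "smooth_on UNIV (\<lambda>_::real. e * (2 * c))" "smooth_on UNIV (\<lambda>_::real \<times> real. b * (2 * c))"
    by (auto intro: smooth_on_const)
  fix t x u assume u: "u \<in> uvals S"
  have E: "deriv (coefK S) u * (e * u + b) = \<gamma> * coefK S u" "coefD S u = 0" "coefF S u = 0"
    "deriv (coefD S) u * (e * u + b) = 0" "deriv (coefF S) u * (e * u + b) = 0"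
    using assms u by (auto simp: scaling_system_def euler_def vanishes_def)
  have w: "w * (e * (2 * c) * u + b * (2 * c)) = 2 * c * (w * (e * u + b))" for w by (simp add: algebra_simps)
  show "deriv (coefK S) u * (e * (2 * c) * u + b * (2 * c)) = coefK S u * (4 * p - deriv (\<lambda>t. (4 * p - 2 * \<gamma> * c) * t + k) t)"
    unfolding w E deriv_affine by (simp add: algebra_simps)
  show "deriv (coefD S) u * (e * (2 * c) * u + b * (2 * c)) = coefD S u * (2 * p - deriv (\<lambda>t. (4 * p - 2 * \<gamma> * c) * t + k) t)"
    unfolding w E by simp
  show "deriv (coefF S) u * (e * (2 * c) * u + b * (2 * c)) =
       (e * (2 * c) - deriv (\<lambda>t. (4 * p - 2 * \<gamma> * c) * t + k) t) * coefF S u +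
       deriv (\<lambda>_. e * (2 * c)) t * u + pd_t (\<lambda>_. b * (2 * c)) (t, x) +
       coefK S u * pd_x (pd_x (pd_x (pd_x (\<lambda>_. b * (2 * c))))) (t, x) - coefD S u * pd_x (pd_x (\<lambda>_. b * (2 * c))) (t, x)"
    unfolding w E by (simp add: pd_t_zero_fun)
qed

lemma listed_determining:
  assumes L: "listed k S" and s: "(a, A, B, p) \<in> sols k"
  shows "determining S a A B p"
proof (cases k)
  case Case1
  then obtain k' where e: "a = (\<lambda>t. 4 * p * t + k')" "A = (\<lambda>_. 0)" "B = (\<lambda>_. 0)" using s by auto
  have J: "open (uvals S)" using L by (auto simp: listed_def valid_system_def)
  have v: "vanishes (uvals S) (coefD S)" "vanishes (uvals S) (coefF S)" using L Case1 by (auto simp: listed_def vanishes_def)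
  show ?thesis unfolding determining_def e using v
    by (auto simp: deriv_affine pd_t_zero_fun vanishes_def smooth_affine intro: smooth_on_const)
next
  case (Case2 \<gamma> \<mu> d l)
  then obtain c k' where e: "a = (\<lambda>t. 2 * (\<gamma> - 2 * \<mu>) * c * t + k')" "A = (\<lambda>_. 0)" "B = (\<lambda>_. 2 * c)" "p = (\<gamma> - \<mu>) * c" using s by auto
  show ?thesis using determining_scaling[OF listed_scaling(1)[OF L Case2], of c k'] unfolding e by simp
next
  case (Case3 \<gamma> \<mu> d l)
  then obtain c k' where e: "a = (\<lambda>t. 2 * (\<gamma> - 2 * \<mu>) * c * t + k')" "A = (\<lambda>_. 2 * c)" "B = (\<lambda>_. 0)" "p = (\<gamma> - \<mu>) * c" using s by auto
  show ?thesis using determining_scaling[OF listed_scaling(2)[OF L Case3], of c k'] unfolding e by simp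
next
  case (Case5 \<gamma>)
  then obtain c k' where e: "a = (\<lambda>t. (4 * p - 2 * \<gamma> * c) * t + k')" "A = (\<lambda>_. 0)" "B = (\<lambda>_. 2 * c)" using s by auto
  show ?thesis using determining_two_scalings[OF listed_scaling(3)[OF L Case5], of p c k'] unfolding e by simp
next
  case (Case6 \<gamma>)
  then obtain c k' where e: "a = (\<lambda>t. (4 * p - 2 * \<gamma> * c) * t + k')" "A = (\<lambda>_. 2 * c)" "B = (\<lambda>_. 0)" using s by auto
  show ?thesis using determining_two_scalings[OF listed_scaling(4)[OF L Case6], of p c k'] unfolding e by simp
next
  case (Case4 d l)
  then obtain c k' where e: "a = (\<lambda>_. k')" "A = (\<lambda>t. c * exp (l * t))" "B = (\<lambda>_. 0)" "p = 0" using s by auto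
  have J: "open (uvals S)" using L by (auto simp: listed_def valid_system_def)
  have pos: "uvals S \<subseteq> {0<..}" and KDF: "\<And>u. u \<in> uvals S \<Longrightarrow> coefK S u = 1" "\<And>u. u \<in> uvals S \<Longrightarrow> coefD S u = d"
    "\<And>u. u \<in> uvals S \<Longrightarrow> coefF S u = l * u * ln u" using L Case4 by (auto simp: listed_def)
  have dA: "deriv (\<lambda>t. c * exp (l * t)) t = l * (c * exp (l * t))" for t
    by (rule DERIV_imp_deriv) (auto intro!: derivative_eq_intros)
  have dK: "deriv (coefK S) u = 0" "deriv (coefD S) u = 0" "deriv (coefF S) u = l * ln u + l" if u: "u \<in> uvals S" for u
  proof -
    show "deriv (coefK S) u = 0" "deriv (coefD S) u = 0"
      by (rule deriv_on[OF J u KDF(1)], assumption, simp, rule deriv_on[OF J u KDF(2)], assumption, simp)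
    show "deriv (coefF S) u = l * ln u + l"
      by (rule deriv_on[OF J u KDF(3)]) (use pos u in \<open>auto intro!: derivative_eq_intros\<close>)
  qed
  have sA: "smooth_on UNIV (\<lambda>t. c * exp (l * t))" by (intro smooth_on_mult smooth_on_const smooth_on_exp open_UNIV)
  show ?thesis unfolding determining_def e dA
    by (auto simp: dK KDF pd_t_zero_fun distrib_left distrib_right sA intro: smooth_on_const)
next
  case (Case7 d)
  then obtain c k' where e: "a = (\<lambda>_. k')" "A = (\<lambda>t. c)" "p = 0" and B: "B \<in> linear_solutions d" using s by auto
  have J: "open (uvals S)" using L by (auto simp: listed_def valid_system_def)
  have KDF: "\<And>u. u \<in> uvals S \<Longrightarrow> coefK S u = 1" "\<And>u. u \<in> uvals S \<Longrightarrow> coefD S u = d" "\<And>u. u \<in> uvals S \<Longrightarrow> coefF S u = 0"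
    using L Case7 by (auto simp: listed_def)
  have dK: "deriv (coefK S) u = 0" "deriv (coefD S) u = 0" "deriv (coefF S) u = 0" if u: "u \<in> uvals S" for u
    by (rule deriv_on[OF J u KDF(1)], assumption, simp, rule deriv_on[OF J u KDF(2)], assumption, simp,
        rule deriv_on[OF J u KDF(3)], assumption, simp)
  show ?thesis unfolding determining_def e using B
    by (auto simp: dK KDF linear_solutions_def intro: smooth_on_const)
next
  case Case8
  then obtain c k' where e: "a = (\<lambda>t. 4 * p * t + k')" "A = (\<lambda>t. c)" and B: "B \<in> linear_solutions 0" using s by auto
  have J: "open (uvals S)" using L by (auto simp: listed_def valid_system_def)
  have KDF: "\<And>u. u \<in> uvals S \<Longrightarrow> coefK S u = 1" "\<And>u. u \<in> uvals S \<Longrightarrow> coefD S u = 0" "\<And>u. u \<in> uvals S \<Longrightarrow> coefF S u = 0"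
    using L Case8 by (auto simp: listed_def)
  have dK: "deriv (coefK S) u = 0" "deriv (coefD S) u = 0" "deriv (coefF S) u = 0" if u: "u \<in> uvals S" for u
    by (rule deriv_on[OF J u KDF(1)], assumption, simp, rule deriv_on[OF J u KDF(2)], assumption, simp,
        rule deriv_on[OF J u KDF(3)], assumption, simp)
  show ?thesis unfolding determining_def e using B
    by (auto simp: dK KDF deriv_affine smooth_affine linear_solutions_def intro: smooth_on_const)
qed

text \<open>Left out are case 1, where \<open>K\<close> is arbitrary, and the members of cases 2 and
  3 with d = 0 whose source can be removed by a substitution: it is constant for 2 \<mu> = \<gamma>
  \<noteq> 0 in case 2 and for \<gamma> = 0, 2 \<mu> = -1 in case 3, and linear for 2 \<mu> =
  \<gamma> \<noteq> 0 in case 3.\<close>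

fun nondegenerate :: "listed_case \<Rightarrow> bool" where
  "nondegenerate Case1 \<longleftrightarrow> False"
| "nondegenerate (Case2 \<gamma> \<mu> d l) \<longleftrightarrow> \<gamma> = 0 \<or> d \<noteq> 0 \<or> 2 * \<mu> \<noteq> \<gamma>"
| "nondegenerate (Case3 \<gamma> \<mu> d l) \<longleftrightarrow> (if \<gamma> = 0 then d \<noteq> 0 \<or> 1 + 2 * \<mu> \<noteq> 0 else d \<noteq> 0 \<or> 2 * \<mu> \<noteq> \<gamma>)"
| "nondegenerate _ \<longleftrightarrow> True"

text \<open>In cases 7 and 8 the solutions \<open>P\<close> live on all new times, and one that is
  known on a half-line of times need not extend. Case 4 is solved for proportional time as
  well.\<close>

fun needs_linear_time :: "listed_case \<Rightarrow> bool" where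
  "needs_linear_time (Case4 d l) \<longleftrightarrow> True"
| "needs_linear_time (Case7 d) \<longleftrightarrow> True"
| "needs_linear_time Case8 \<longleftrightarrow> True"
| "needs_linear_time _ \<longleftrightarrow> False"

lemma (in solving) listed_solves:
  assumes L: "listed k S" and nd: "nondegenerate k"
    and lin: "needs_linear_time k \<Longrightarrow> \<exists>\<kappa>. (\<forall>t. \<tau> t = \<kappa> * t) \<and> (\<forall>t. \<theta> t = \<kappa>)"
  shows "solves S (sols k) \<tau> \<theta> Y"
  unfolding solves_def
proof (intro allI impI)
  fix a A B p assume H: "hat_eqs S \<theta> Y a A B p"
  let ?goal = "\<exists>a' A' B'. (a', A', B', p) \<in> sols k \<and> a = (\<lambda>t. a' (\<tau> t)) \<and> A = (\<lambda>t. A' (\<tau> t)) \<and> B = (\<lambda>q. B' (\<tau> (fst q), snd q))"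
  show ?goal
  proof (cases k)
    case Case1
    then show ?thesis using nd by simp
  next
    case (Case2 \<gamma> \<mu> d l)
    note sc = listed_scaling(1)[OF L Case2, unfolded scaling_system_def]
    have z: "\<gamma>\<^sup>2 + \<mu>\<^sup>2 \<noteq> 0" "d\<^sup>2 + l\<^sup>2 \<noteq> 0" using L Case2 by (auto simp: listed_def)
    have "\<exists>c k'. p = (\<gamma> - \<mu>) * c \<and> a = (\<lambda>t. 2 * (\<gamma> - 2 * \<mu>) * c * \<tau> t + k') \<and> A = (\<lambda>_. 0 * (2 * c)) \<and> B = (\<lambda>_. 1 * (2 * c))"
      by (rule solve_scaling[OF _ _ _ _ _ _ _ H]) (use sc nd z Case2 in \<open>auto split: if_splits\<close>)
    then obtain c k' where e: "p = (\<gamma> - \<mu>) * c" "a = (\<lambda>t. 2 * (\<gamma> - 2 * \<mu>) * c * \<tau> t + k')" "A = (\<lambda>_. 0)" "B = (\<lambda>_. 2 * c)" by auto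
    show ?thesis unfolding Case2 sols.simps e
      by (rule exI[of _ "\<lambda>t. 2 * (\<gamma> - 2 * \<mu>) * c * t + k'"], rule exI[of _ "\<lambda>_. 0"], rule exI[of _ "\<lambda>_. 2 * c"]) blast
  next
    case (Case3 \<gamma> \<mu> d l)
    note sc = listed_scaling(2)[OF L Case3, unfolded scaling_system_def]
    have z: "\<gamma>\<^sup>2 + \<mu>\<^sup>2 \<noteq> 0" "d\<^sup>2 + l\<^sup>2 \<noteq> 0" using L Case3 by (auto simp: listed_def)
    have "\<exists>c k'. p = (\<gamma> - \<mu>) * c \<and> a = (\<lambda>t. 2 * (\<gamma> - 2 * \<mu>) * c * \<tau> t + k') \<and> A = (\<lambda>_. 1 * (2 * c)) \<and> B = (\<lambda>_. 0 * (2 * c))"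
      by (rule solve_scaling[OF _ _ _ _ _ _ _ H]) (use sc nd z Case3 in \<open>auto split: if_splits\<close>)
    then obtain c k' where e: "p = (\<gamma> - \<mu>) * c" "a = (\<lambda>t. 2 * (\<gamma> - 2 * \<mu>) * c * \<tau> t + k')" "A = (\<lambda>_. 2 * c)" "B = (\<lambda>_. 0)" by auto
    show ?thesis unfolding Case3 sols.simps e
      by (rule exI[of _ "\<lambda>t. 2 * (\<gamma> - 2 * \<mu>) * c * t + k'"], rule exI[of _ "\<lambda>_. 2 * c"], rule exI[of _ "\<lambda>_. 0"]) blast
  next
    case (Case4 d l)
    obtain \<kappa> where \<kappa>: "\<And>t. \<tau> t = \<kappa> * t" "\<And>t. \<theta> t = \<kappa>" using lin Case4 by auto
    have l: "l \<noteq> 0" "uvals S \<subseteq> {0<..}" "\<And>u. u \<in> uvals S \<Longrightarrow> coefK S u = 1" "\<And>u. u \<in> uvals S \<Longrightarrow> coefD S u = d"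
      "\<And>u. u \<in> uvals S \<Longrightarrow> coefF S u = l * u * ln u" using L Case4 by (auto simp: listed_def)
    obtain c k' where e: "p = 0" "a = (\<lambda>_. k')" "A = (\<lambda>t. c * exp (l * \<tau> t))" "B = (\<lambda>_. 0)"
      using solve_log[OF l(3,4,5,2,1) \<kappa> H] by blast
    show ?thesis unfolding Case4 sols.simps e
      by (rule exI[of _ "\<lambda>_. k'"], rule exI[of _ "\<lambda>t. c * exp (l * t)"], rule exI[of _ "\<lambda>_. 0"]) blast
  next
    case (Case5 \<gamma>)
    note sc = listed_scaling(3)[OF L Case5, unfolded scaling_system_def]
    have z: "\<gamma> \<noteq> 0" using L Case5 by (auto simp: listed_def)
    have "\<exists>c k'. a = (\<lambda>t. (4 * p - 2 * \<gamma> * c) * \<tau> t + k') \<and> A = (\<lambda>_. 0 * (2 * c)) \<and> B = (\<lambda>_. 1 * (2 * c))"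
      by (rule solve_two_scalings[OF _ _ _ z _ H]) (use sc in auto)
    then obtain c k' where e: "a = (\<lambda>t. (4 * p - 2 * \<gamma> * c) * \<tau> t + k')" "A = (\<lambda>_. 0)" "B = (\<lambda>_. 2 * c)" by auto
    show ?thesis unfolding Case5 sols.simps e
      by (rule exI[of _ "\<lambda>t. (4 * p - 2 * \<gamma> * c) * t + k'"], rule exI[of _ "\<lambda>_. 0"], rule exI[of _ "\<lambda>_. 2 * c"]) blast
  next
    case (Case6 \<gamma>)
    note sc = listed_scaling(4)[OF L Case6, unfolded scaling_system_def]
    have z: "\<gamma> \<noteq> 0" using L Case6 by (auto simp: listed_def)
    have "\<exists>c k'. a = (\<lambda>t. (4 * p - 2 * \<gamma> * c) * \<tau> t + k') \<and> A = (\<lambda>_. 1 * (2 * c)) \<and> B = (\<lambda>_. 0 * (2 * c))"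
      by (rule solve_two_scalings[OF _ _ _ z _ H]) (use sc in auto)
    then obtain c k' where e: "a = (\<lambda>t. (4 * p - 2 * \<gamma> * c) * \<tau> t + k')" "A = (\<lambda>_. 2 * c)" "B = (\<lambda>_. 0)" by auto
    show ?thesis unfolding Case6 sols.simps e
      by (rule exI[of _ "\<lambda>t. (4 * p - 2 * \<gamma> * c) * t + k'"], rule exI[of _ "\<lambda>_. 2 * c"], rule exI[of _ "\<lambda>_. 0"]) blast
  next
    case (Case7 d)
    obtain \<kappa> where \<kappa>: "\<And>t. \<tau> t = \<kappa> * t" "\<And>t. \<theta> t = \<kappa>" using lin Case7 by auto
    have \<kappa>0: "\<kappa> \<noteq> 0" using \<theta>[of 0] \<kappa> by simp
    have l: "d \<noteq> 0" "\<And>u. u \<in> uvals S \<Longrightarrow> coefK S u = 1" "\<And>u. u \<in> uvals S \<Longrightarrow> coefD S u = d"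
      "\<And>u. u \<in> uvals S \<Longrightarrow> coefF S u = 0" using L Case7 by (auto simp: listed_def)
    obtain c k' where e: "d * p = 0" "a = (\<lambda>t. 4 * p * \<tau> t + k')" "A = (\<lambda>_. c)"
      and B: "(\<lambda>q. B (fst q / \<kappa>, snd q)) \<in> linear_solutions d"
      using solve_linear[OF l(2-4) \<kappa> H] by blast
    have p: "p = 0" using e(1) l(1) by simp
    have "B = (\<lambda>q. (\<lambda>q. B (fst q / \<kappa>, snd q)) (\<tau> (fst q), snd q))" using \<kappa>0 by (simp add: \<kappa>)
    moreover have "(\<lambda>_. k', \<lambda>_. c, \<lambda>q. B (fst q / \<kappa>, snd q), p) \<in> sols k" unfolding Case7 sols.simps p using B by blast
    moreover have "a = (\<lambda>t. (\<lambda>_. k') (\<tau> t))" "A = (\<lambda>t. (\<lambda>_. c) (\<tau> t))" using e p by simp_all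
    ultimately show ?thesis by blast
  next
    case Case8
    obtain \<kappa> where \<kappa>: "\<And>t. \<tau> t = \<kappa> * t" "\<And>t. \<theta> t = \<kappa>" using lin Case8 by auto
    have \<kappa>0: "\<kappa> \<noteq> 0" using \<theta>[of 0] \<kappa> by simp
    have l: "\<And>u. u \<in> uvals S \<Longrightarrow> coefK S u = 1" "\<And>u. u \<in> uvals S \<Longrightarrow> coefD S u = 0"
      "\<And>u. u \<in> uvals S \<Longrightarrow> coefF S u = 0" using L Case8 by (auto simp: listed_def)
    obtain c k' where e: "a = (\<lambda>t. 4 * p * \<tau> t + k')" "A = (\<lambda>_. c)"
      and B: "(\<lambda>q. B (fst q / \<kappa>, snd q)) \<in> linear_solutions 0"
      using solve_linear[OF l \<kappa> H] by blast
    have "B = (\<lambda>q. (\<lambda>q. B (fst q / \<kappa>, snd q)) (\<tau> (fst q), snd q))" using \<kappa>0 by (simp add: \<kappa>)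
    moreover have "(\<lambda>t. 4 * p * t + k', \<lambda>_. c, \<lambda>q. B (fst q / \<kappa>, snd q), p) \<in> sols k" unfolding Case8 sols.simps using B by blast
    moreover have "a = (\<lambda>t. (\<lambda>t. 4 * p * t + k') (\<tau> t))" "A = (\<lambda>t. (\<lambda>_. c) (\<tau> t))" using e by simp_all
    ultimately show ?thesis by blast
  qed
qed

lemma MAI_listed:
  assumes L: "listed k S" and nd: "nondegenerate k"
  shows "MAI S = span_on (base_dom S) (basic_ops k)"
proof -
  have S: "valid_system S" using L by (simp add: listed_def)
  interpret solving S "\<lambda>t. t" "\<lambda>_. 1" "\<lambda>_. uvals S"
    using S by unfold_locales (auto simp: valid_system_def)
  have "solves S (sols k) (\<lambda>t. t) (\<lambda>_. 1) (\<lambda>_. uvals S)"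
    by (rule listed_solves[OF L nd]) (auto intro!: exI[of _ 1])
  from MAI_eq_fields[OF S listed_determining[OF L] this] show ?thesis by (simp add: span_basic_ops)
qed

text \<open>The second assertion of the theorem for one given case and target.\<close>

definition reduces_to :: "rd_system \<Rightarrow> listed_case \<Rightarrow> rd_system \<Rightarrow> bool" where
  "reduces_to S k S' \<longleftrightarrow> listed k S' \<and> MAI S' = span_on (base_dom S') (basic_ops k) \<and>
     (\<exists>C du dv. reduces_by C du dv S S' \<and> MAI S = transported C du dv S (span_on (base_dom S') (basic_ops k)))"

text \<open>Each \<open>Y t\<close> is the preimage of the open set \<open>uvals S\<close> under an
  affine map, hence open, although \<open>uvals S'\<close> may be larger.\<close>

lemma (in reduction) solving_image: "solving S' \<tau> \<theta> Y"
proof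
  show "valid_system S'" by (rule S')
  show "(\<tau> has_real_derivative \<theta> t) (at t)" for t by (rule derivs(1))
  show "\<theta> t \<noteq> 0" for t by (rule theta_nz)
  have oS: "open (uvals S)" and nS: "uvals S \<noteq> {}" using S by (auto simp: valid_system_def)
  show "open (Y t)" for t
  proof -
    have "Y t = (\<lambda>y. \<alpha> t + r t * y) -` uvals S"
      using r_nz[of t] by (auto simp: Y_def image_iff field_simps intro!: bexI)
    moreover have "open ((\<lambda>y. \<alpha> t + r t * y) -` uvals S)"
      by (rule continuous_open_vimage[OF oS]) (intro continuous_intros)
    ultimately show ?thesis by simp
  qed
  show "Y t \<noteq> {}" for t using nS by (simp add: Y_def)
  show "Y t \<subseteq> uvals S'" for t using coefs(1)[OF _ refl] by (auto simp: Y_def)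
qed

lemma (in reduction) reduces_to_listed:
  assumes L: "listed k S'" and nd: "nondegenerate k" and lin: "needs_linear_time k \<Longrightarrow> c1 = 0"
  shows "reduces_to S k S'"
proof -
  have "solves S' (sols k) \<tau> \<theta> Y"
  proof (rule solving.listed_solves[OF solving_image L nd])
    assume "needs_linear_time k"
    then have "c1 = 0" by (rule lin)
    then show "\<exists>\<kappa>. (\<forall>t. \<tau> t = \<kappa> * t) \<and> (\<forall>t. \<theta> t = \<kappa>)"
      unfolding \<tau>_def \<theta>_def by (intro exI[of _ c0]) simp
  qed
  from transport[OF listed_determining[OF L] this]
  show ?thesis unfolding reduces_to_def using L MAI_listed[OF L nd] reduces by (auto simp: span_basic_ops)
qed

section \<open>Reductions to the listed cases\<close>

text \<open>The power with exponent \<sigma> in the two situations that occur: on the whole line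
  (\<open>wh\<close>) for a natural exponent, with 0 as a dummy value for other exponents, and on
  the positive half-line for a real exponent.\<close>

definition hom :: "bool \<Rightarrow> real \<Rightarrow> real \<Rightarrow> real" where
  "hom wh \<sigma> u = (if wh then (if \<sigma> = real (nat \<lfloor>\<sigma>\<rfloor>) then u ^ nat \<lfloor>\<sigma>\<rfloor> else 0) else u powr \<sigma>)"

definition homdom :: "bool \<Rightarrow> real set" where
  "homdom wh = (if wh then UNIV else {0<..})"

text \<open>Ensures that the dummy value of \<open>hom\<close> occurs only with coefficient
  0.\<close>

definition hom_coeff :: "bool \<Rightarrow> real \<Rightarrow> real \<Rightarrow> bool" where
  "hom_coeff wh \<sigma> c \<longleftrightarrow> (wh \<longrightarrow> c = 0 \<or> \<sigma> = real (nat \<lfloor>\<sigma>\<rfloor>))"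

lemma homdom: "open (homdom wh)" "is_interval (homdom wh)" "homdom wh \<noteq> {}" "1 \<in> homdom wh"
  by (auto simp: homdom_def is_interval_univ)

lemma hom_one: "hom wh \<sigma> 1 = 1 \<or> hom wh \<sigma> 1 = 0" "hom_coeff wh \<sigma> c \<Longrightarrow> c \<noteq> 0 \<Longrightarrow> hom wh \<sigma> 1 = 1"
  by (auto simp: hom_def hom_coeff_def)

lemma smooth_hom: "smooth_on (homdom wh) (hom wh \<sigma>)"
proof (cases wh)
  case True
  have "smooth_on UNIV (\<lambda>u::real. u ^ n)" for n
    by (rule smooth_on_power[OF open_UNIV smooth_on_linear[OF open_UNIV bounded_linear_ident]])
  then show ?thesis using True
    by (cases "\<sigma> = real (nat \<lfloor>\<sigma>\<rfloor>)") (simp_all add: hom_def[abs_def] homdom_def smooth_on_const)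
next
  case False
  then show ?thesis using smooth_on_powr by (simp add: hom_def[abs_def] homdom_def)
qed

text \<open>Exact homogeneity under positive factors, which the dummy value satisfies too. A
  dilation that is exponential in time thus multiplies each coefficient function by an exponential
  of time.\<close>

lemma hom_scale: "hom wh \<sigma> (exp l * y) = exp (\<sigma> * l) * hom wh \<sigma> y"
proof (cases wh)
  case True
  have "\<sigma> = real (nat \<lfloor>\<sigma>\<rfloor>) \<Longrightarrow> exp l ^ nat \<lfloor>\<sigma>\<rfloor> = exp (\<sigma> * l)"
    using exp_of_nat_mult[of "nat \<lfloor>\<sigma>\<rfloor>" l] by simp
  then show ?thesis using True by (auto simp: hom_def power_mult_distrib)
qed (simp add: hom_def powr_mult exp_powr_real mult.commute)

lemma hom_nonzero: "hom_coeff wh \<sigma> c \<Longrightarrow> c \<noteq> 0 \<Longrightarrow> u \<in> homdom wh \<Longrightarrow> u \<noteq> 0 \<Longrightarrow> hom wh \<sigma> u \<noteq> 0"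
  by (auto simp: hom_def hom_coeff_def homdom_def split: if_splits)

lemma power_term_hom:
  assumes "hom_coeff wh \<sigma> c" shows "power_term (homdom wh) (\<lambda>u. c * hom wh \<sigma> u) c \<sigma>"
proof (cases wh)
  case True
  show ?thesis
  proof (cases "c = 0")
    case False
    then obtain n where n: "\<sigma> = real n" using assms True by (auto simp: hom_coeff_def)
    have "hom wh \<sigma> u = u powi (int n)" for u using True by (simp add: hom_def n)
    then show ?thesis unfolding power_term_def n
      by (intro disjI2 disjI1 exI[of _ "int n"]) (simp add: n)
  qed (simp add: power_term_def)
qed (simp add: power_term_def hom_def homdom_def)

lemma hom_coeff_scale: "hom_coeff wh \<sigma> c \<Longrightarrow> hom_coeff wh \<sigma> (c / k)" "hom_coeff wh \<sigma> c \<Longrightarrow> hom_coeff wh \<sigma> (c * k)"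
  by (auto simp: hom_coeff_def)

subsection \<open>Solutions of the Euler equation\<close>

lemma euler_negative:
  fixes f :: "real \<Rightarrow> real"
  assumes J: "open J" "is_interval J" and b: "- b \<in> J" and f: "smooth_on J f"
    and e: "\<And>u. u \<in> J \<Longrightarrow> deriv f u * (u + b) = \<sigma> * f u" and \<sigma>: "\<sigma> < 0" and u: "u \<in> J"
  shows "f u = 0"
proof -
  \<comment> \<open>At the singular point the left side of the equation is zero, while \<sigma> is
    not.\<close>
  have f0: "f (- b) = 0" using e[OF b] \<sigma> by simp
  have d: "((\<lambda>x. (f x)\<^sup>2) has_real_derivative 2 * f x * deriv f x) (at x)" if "x \<in> J" for x
    using smooth_on_real_deriv[OF f that] by (auto intro!: derivative_eq_intros)
  have sgn: "2 * f x * deriv f x * (x + b) \<le> 0" if "x \<in> J" for x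
  proof -
    have "2 * f x * deriv f x * (x + b) = 2 * \<sigma> * (f x)\<^sup>2" using e[OF that] by (simp add: power2_eq_square mult.assoc)
    also have "\<dots> \<le> 0" using \<sigma> by (simp add: mult_le_0_iff)
    finally show ?thesis .
  qed
  have seg: "x \<in> J" if "min u (- b) \<le> x" "x \<le> max u (- b)" for x
    using J(2) u b that unfolding is_interval_1 by (metis linorder_linear max_def min_def)
  have "(f u)\<^sup>2 \<le> (f (- b))\<^sup>2"
  proof (cases "- b \<le> u")
    case True
    show ?thesis
    proof (rule DERIV_nonpos_imp_nonincreasing[OF True])
      fix x assume x: "- b \<le> x" "x \<le> u"
      then have xJ: "x \<in> J" using True by (intro seg) auto
      have "2 * f x * deriv f x \<le> 0"
      proof (cases "x = - b")
        case False
        then have "x + b > 0" using x by simp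
        then show ?thesis using sgn[OF xJ] by (simp add: mult_le_0_iff)
      qed (simp add: f0)
      then show "\<exists>y. ((\<lambda>x. (f x)\<^sup>2) has_real_derivative y) (at x) \<and> y \<le> 0" using d[OF xJ] by blast
    qed
  next
    case False
    then have le: "u \<le> - b" by simp
    show ?thesis
    proof (rule DERIV_nonneg_imp_nondecreasing[OF le])
      fix x assume x: "u \<le> x" "x \<le> - b"
      then have xJ: "x \<in> J" using False by (intro seg) auto
      have "2 * f x * deriv f x \<ge> 0"
      proof (cases "x = - b")
        case False
        then have "x + b < 0" using x by simp
        then show ?thesis using sgn[OF xJ] by (simp add: mult_le_0_iff)
      qed (simp add: f0)
      then show "\<exists>y. ((\<lambda>x. (f x)\<^sup>2) has_real_derivative y) (at x) \<and> 0 \<le> y" using d[OF xJ] by blast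
    qed
  qed
  then show ?thesis using f0 by simp
qed

text \<open>A smooth solution across the singular point is a monomial: differentiating lowers the degree
  by one, and in negative degree the square of a solution decreases away from the singular point.\<close>

lemma euler_through:
  fixes f :: "real \<Rightarrow> real"
  assumes J: "open J" "is_interval J" and b: "- b \<in> J"
  shows "smooth_on J f \<Longrightarrow> (\<And>u. u \<in> J \<Longrightarrow> deriv f u * (u + b) = \<sigma> * f u) \<Longrightarrow> \<sigma> < real n \<Longrightarrow>
    \<exists>c. (\<forall>u\<in>J. f u = c * (u + b) ^ nat \<lfloor>\<sigma>\<rfloor>) \<and> (c \<noteq> 0 \<longrightarrow> \<sigma> = real (nat \<lfloor>\<sigma>\<rfloor>))"
proof (induction n arbitrary: f \<sigma>)
  case 0
  have "f u = 0" if "u \<in> J" for u by (rule euler_negative[OF J b 0(1,2)]) (use 0 that in auto)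
  then show ?case by (intro exI[of _ 0]) simp
next
  case (Suc n)
  have "\<exists>c. (\<forall>u\<in>J. deriv f u = c * (u + b) ^ nat \<lfloor>\<sigma> - 1\<rfloor>) \<and> (c \<noteq> 0 \<longrightarrow> \<sigma> - 1 = real (nat \<lfloor>\<sigma> - 1\<rfloor>))"
  proof (rule Suc.IH[OF smooth_on_deriv[OF J(1) Suc.prems(1)]])
    show "deriv (deriv f) u * (u + b) = (\<sigma> - 1) * deriv f u" if "u \<in> J" for u
      using deriv_eq_on_open[OF J(1) that Suc.prems(1), of 1 b \<sigma>] Suc.prems(2) by (simp add: algebra_simps)
    show "\<sigma> - 1 < real n" using Suc.prems(3) by simp
  qed
  then obtain c' where c': "\<And>u. u \<in> J \<Longrightarrow> deriv f u = c' * (u + b) ^ nat \<lfloor>\<sigma> - 1\<rfloor>"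
    "c' \<noteq> 0 \<Longrightarrow> \<sigma> - 1 = real (nat \<lfloor>\<sigma> - 1\<rfloor>)" by blast
  show ?case
  proof (cases "c' = 0")
    case True
    then obtain c where c: "\<And>u. u \<in> J \<Longrightarrow> f u = c"
      using deriv_zero_const[OF J Suc.prems(1)] c'(1) by auto
    have "\<sigma> * c = 0" using Suc.prems(2)[OF b] c'(1)[OF b] True c[OF b] by simp
    then show ?thesis
    proof (cases "\<sigma> = 0")
      case True
      then show ?thesis using c by (intro exI[of _ c]) simp
    next
      case False
      then show ?thesis using c \<open>\<sigma> * c = 0\<close> by (intro exI[of _ 0]) simp
    qed
  next
    case False
    define k where "k = nat \<lfloor>\<sigma> - 1\<rfloor>"
    have "\<sigma> - 1 = real k" using c'(2)[OF False] unfolding k_def .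
    then have \<sigma>: "\<sigma> = real (Suc k)" by simp
    then have k: "nat \<lfloor>\<sigma>\<rfloor> = Suc k" by (metis floor_of_nat nat_int)
    have "f u = c' / \<sigma> * (u + b) ^ nat \<lfloor>\<sigma>\<rfloor>" if "u \<in> J" for u
    proof -
      have "\<sigma> * f u = c' * (u + b) ^ Suc k" using Suc.prems(2)[OF that] c'(1)[OF that] by (simp add: k_def mult_ac)
      moreover have "\<sigma> \<noteq> 0" using \<sigma> by simp
      ultimately show ?thesis unfolding k by (simp add: field_simps del: power_Suc)
    qed
    then show ?thesis using k \<sigma> by (intro exI[of _ "c' / \<sigma>"]) simp
  qed
qed

text \<open>The sign \<open>s\<close> makes the base positive on all of \<open>J\<close>; its power
  with exponent - \<sigma> is an integrating factor.\<close>

lemma euler_powr: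
  fixes f :: "real \<Rightarrow> real"
  assumes J: "open J" "is_interval J" and s: "s = 1 \<or> s = -1" and pos: "\<And>u. u \<in> J \<Longrightarrow> s * (u + b) > 0" and f: "smooth_on J f"
    and e: "\<And>u. u \<in> J \<Longrightarrow> deriv f u * (u + b) = \<sigma> * f u"
  shows "\<exists>c. \<forall>u\<in>J. f u = c * (s * (u + b)) powr \<sigma>"
proof -
  have D: "((\<lambda>u. f u * (s * (u + b)) powr (- \<sigma>)) has_real_derivative 0) (at u within J)" if u: "u \<in> J" for u
  proof -
    have w: "s * (u + b) > 0" using pos[OF u] .
    have "((\<lambda>u. f u * (s * (u + b)) powr (- \<sigma>)) has_real_derivative
       deriv f u * (s * (u + b)) powr (- \<sigma>) + ((- \<sigma>) * (s * (u + b)) powr (- \<sigma> - 1) * s) * f u) (at u)"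
      using smooth_on_real_deriv[OF f u] w
      by (auto intro!: derivative_eq_intros DERIV_chain2[OF has_real_derivative_powr])
    moreover have "deriv f u * (s * (u + b)) powr (- \<sigma>) + ((- \<sigma>) * (s * (u + b)) powr (- \<sigma> - 1) * s) * f u = 0"
    proof -
      have "(s * (u + b)) powr (- \<sigma>) = (s * (u + b)) powr (- \<sigma> - 1) * (s * (u + b))"
        using w by (simp add: powr_diff)
      then have "deriv f u * (s * (u + b)) powr (- \<sigma>) + ((- \<sigma>) * (s * (u + b)) powr (- \<sigma> - 1) * s) * f u =
         s * (s * (u + b)) powr (- \<sigma> - 1) * (deriv f u * (u + b) - \<sigma> * f u)" by (simp add: algebra_simps)
      then show ?thesis using e[OF u] by simp
    qed
    ultimately show ?thesis by (simp add: has_field_derivative_at_within)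
  qed
  have cv: "convex J" using J is_interval_convex by blast
  obtain c where c: "\<And>u. u \<in> J \<Longrightarrow> f u * (s * (u + b)) powr (- \<sigma>) = c"
    using has_field_derivative_zero_constant[OF cv D] by blast
  have "f u = c * (s * (u + b)) powr \<sigma>" if "u \<in> J" for u
    using c[OF that] pos[OF that] by (auto simp: powr_minus field_simps)
  then show ?thesis by blast
qed

lemma interval_sign:
  fixes J :: "real set"
  assumes J: "is_interval J" and b: "- b \<notin> J"
  obtains s where "s = 1 \<or> s = -1" "\<And>u. u \<in> J \<Longrightarrow> s * (u + b) > 0"
proof -
  have "(\<forall>u\<in>J. u + b > 0) \<or> (\<forall>u\<in>J. u + b < 0)"
  proof (rule ccontr)
    assume "\<not> ?thesis"
    then obtain u w where "u \<in> J" "u \<le> - b" "w \<in> J" "- b \<le> w" by (force simp: not_less)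
    then have "- b \<in> J" using J unfolding is_interval_1 by blast
    then show False using b by simp
  qed
  then show ?thesis using that[of 1] that[of "-1"] by force
qed

text \<open>The sign and the kind of domain depend only on \<open>J\<close> and \<open>b\<close>, so
  \<open>K\<close>, \<open>D\<close> and \<open>F\<close> become multiples of powers of one and the
  same new variable.\<close>

lemma euler_hom:
  fixes J :: "real set"
  assumes J: "open J" "is_interval J" "J \<noteq> {}"
  obtains wh s where "s = 1 \<or> s = -1" "\<And>u. u \<in> J \<Longrightarrow> s * (u + b) \<in> homdom wh"
    "\<And>f \<sigma>. smooth_on J f \<Longrightarrow> euler J 1 b f \<sigma> \<Longrightarrow> \<exists>c. (\<forall>u\<in>J. f u = c * hom wh \<sigma> (s * (u + b))) \<and> hom_coeff wh \<sigma> c"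
proof (cases "- b \<in> J")
  case True
  have "\<exists>c. (\<forall>u\<in>J. f u = c * hom True \<sigma> (1 * (u + b))) \<and> hom_coeff True \<sigma> c"
    if f: "smooth_on J f" and e: "euler J 1 b f \<sigma>" for f \<sigma>
  proof -
    obtain n where "\<sigma> < real n" using reals_Archimedean2 by blast
    then have "\<exists>c. (\<forall>u\<in>J. f u = c * (u + b) ^ nat \<lfloor>\<sigma>\<rfloor>) \<and> (c \<noteq> 0 \<longrightarrow> \<sigma> = real (nat \<lfloor>\<sigma>\<rfloor>))"
      by (intro euler_through[OF J(1,2) True f]) (use e in \<open>auto simp: euler_def\<close>)
    then obtain c where "\<forall>u\<in>J. f u = c * (u + b) ^ nat \<lfloor>\<sigma>\<rfloor>" "c \<noteq> 0 \<longrightarrow> \<sigma> = real (nat \<lfloor>\<sigma>\<rfloor>)" by blast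
    then show ?thesis by (cases "c = 0") (auto simp: hom_def hom_coeff_def)
  qed
  then show ?thesis using that[of 1 True] by (simp add: homdom_def)
next
  case False
  then obtain s where s: "s = 1 \<or> s = -1" "\<And>u. u \<in> J \<Longrightarrow> s * (u + b) > 0" using interval_sign[OF J(2)] by blast
  have "\<exists>c. (\<forall>u\<in>J. f u = c * hom False \<sigma> (s * (u + b))) \<and> hom_coeff False \<sigma> c"
    if f: "smooth_on J f" and e: "euler J 1 b f \<sigma>" for f \<sigma>
    using euler_powr[OF J(1,2) s(1) s(2) f, of \<sigma>] e by (simp add: euler_def hom_def hom_coeff_def)
  then show ?thesis using that[of s False] s by (simp add: homdom_def)
qed

lemma euler_exp:
  fixes f :: "real \<Rightarrow> real"
  assumes J: "open J" "is_interval J" and f: "smooth_on J f" and e: "euler J 0 1 f \<sigma>"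
  shows "\<exists>c. \<forall>u\<in>J. f u = c * exp (\<sigma> * u)"
proof -
  have D: "((\<lambda>u. f u * exp (- \<sigma> * u)) has_real_derivative 0) (at u within J)" if u: "u \<in> J" for u
  proof -
    have "((\<lambda>u. f u * exp (- \<sigma> * u)) has_real_derivative deriv f u * exp (- \<sigma> * u) + exp (- \<sigma> * u) * (- \<sigma>) * f u) (at u)"
      using smooth_on_real_deriv[OF f u] by (auto intro!: derivative_eq_intros)
    then show ?thesis using e u by (simp add: euler_def has_field_derivative_at_within)
  qed
  have cv: "convex J" using J is_interval_convex by blast
  obtain c where c: "\<And>u. u \<in> J \<Longrightarrow> f u * exp (- \<sigma> * u) = c"
    using has_field_derivative_zero_constant[OF cv D] by blast
  have "f u = c * exp (\<sigma> * u)" if "u \<in> J" for u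
    using c[OF that] by (auto simp: exp_minus field_simps)
  then show ?thesis by blast
qed

text \<open>A solution is a constant multiple of an exponential or a power, which has no zero off
  the singular point; the constant decides.\<close>

lemma euler_dichotomy:
  assumes J: "open J" "is_interval J" "J \<noteq> {}" and eb: "(e = 0 \<and> b = 1) \<or> e = 1"
    and f: "smooth_on J f" and e: "euler J e b f \<sigma>"
  shows "vanishes J f \<or> nowhere_zero J e b f"
proof (cases "e = 1")
  case True
  obtain wh s where s: "s = 1 \<or> s = -1" "\<And>u. u \<in> J \<Longrightarrow> s * (u + b) \<in> homdom wh"
    and h: "\<And>f \<sigma>. smooth_on J f \<Longrightarrow> euler J 1 b f \<sigma> \<Longrightarrow> \<exists>c. (\<forall>u\<in>J. f u = c * hom wh \<sigma> (s * (u + b))) \<and> hom_coeff wh \<sigma> c"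
    by (rule euler_hom[OF J, of b]) blast
  obtain c where c: "\<forall>u\<in>J. f u = c * hom wh \<sigma> (s * (u + b))" "hom_coeff wh \<sigma> c" using h[OF f] e True by blast
  show ?thesis
  proof (cases "c = 0")
    case False
    have "f u \<noteq> 0" if "u \<in> J" "u + b \<noteq> 0" for u
    proof -
      have "s * (u + b) \<noteq> 0" using s(1) that(2) by auto
      from hom_nonzero[OF c(2) False s(2)[OF that(1)] this] show ?thesis using c(1) that(1) False by simp
    qed
    then show ?thesis using True by (simp add: nowhere_zero_def)
  qed (use c in \<open>simp add: vanishes_def\<close>)
next
  case False
  then obtain c where "\<forall>u\<in>J. f u = c * exp (\<sigma> * u)" using euler_exp[OF J(1,2) f] e eb by auto
  then show ?thesis by (cases "c = 0") (auto simp: vanishes_def nowhere_zero_def)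
qed

subsection \<open>Reductions\<close>

lemma smooth_exp_UNIV: "smooth_on UNIV (\<lambda>u. c * exp (\<sigma> * u))" for c \<sigma> :: real
  by (intro smooth_on_mult smooth_on_const smooth_on_exp open_UNIV)

text \<open>A model target on the largest possible domain, since the image of \<open>uvals S\<close>
  under a shift moves with time; \<open>pow_system\<close> plays the same part for
  dilations.\<close>

definition exp_system :: "real \<Rightarrow> real \<Rightarrow> real \<Rightarrow> real \<Rightarrow> rd_system" where
  "exp_system \<gamma> \<mu> d l = \<lparr>uvals = UNIV, coefK = (\<lambda>u. exp (\<gamma> * u)), coefD = (\<lambda>u. d * exp (\<mu> * u)),
     coefF = (\<lambda>u. l * exp ((2 * \<mu> - \<gamma>) * u))\<rparr>"

definition pow_system :: "bool \<Rightarrow> real \<Rightarrow> real \<Rightarrow> real \<Rightarrow> real \<Rightarrow> rd_system" where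
  "pow_system wh \<gamma> \<mu> d l = \<lparr>uvals = homdom wh, coefK = (\<lambda>u. 1 * hom wh \<gamma> u), coefD = (\<lambda>u. d * hom wh \<mu> u),
     coefF = (\<lambda>u. l * hom wh (2 * \<mu> - \<gamma> + 1) u)\<rparr>"

lemma valid_exp_system: "valid_system (exp_system \<gamma> \<mu> d l)"
  using smooth_exp_UNIV[of 1 \<gamma>] smooth_exp_UNIV by (simp add: valid_system_def exp_system_def is_interval_univ)

lemma valid_pow_system:
  assumes "hom_coeff wh \<gamma> 1" shows "valid_system (pow_system wh \<gamma> \<mu> d l)"
proof -
  have s: "smooth_on (homdom wh) (\<lambda>u. c * hom wh \<sigma> u)" for c \<sigma>
    by (intro smooth_on_mult smooth_on_const homdom smooth_hom)
  have "hom wh \<gamma> 1 \<noteq> 0" using hom_one(2)[OF assms] by simp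
  then show ?thesis using s[of 1 \<gamma>] s homdom by (auto simp: valid_system_def pow_system_def)
qed

text \<open>The derivative of the new time has to be a given exponential: the new time is (k / m)
  exp (m t), or k t if m = 0. The instantiations of \<open>that\<close> list \<open>c1\<close>,
  \<open>c2\<close>, \<open>c0\<close> in this order.\<close>

lemma time_constants:
  fixes k m :: real assumes "k \<noteq> 0"
  obtains c0 c1 c2 where "c1 * c2 = 0 \<or> c0 = 0" "\<And>t. c0 + c1 * c2 * exp (c2 * t) = k * exp (m * t)"
proof (cases "m = 0")
  case True
  then show ?thesis using that[of 0 0 k] by simp
next
  case False
  then show ?thesis using that[of "k / m" m 0] by simp
qed

text \<open>The constant part \<open>l1\<close> of the source is the velocity of the shift u = y +
  l1 t. The shift multiplies the coefficients by exponentials of time with the rates \<gamma> l1,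
  \<mu> l1 and (2 \<mu> - \<gamma>) l1; for \<gamma> = \<mu> these agree and go into the new
  time.\<close>

lemma reduce_exp:
  assumes S: "valid_system S" and k: "k \<noteq> 0"
    and coefs: "\<And>u. u \<in> uvals S \<Longrightarrow> coefK S u = k * exp (\<gamma> * u)" "\<And>u. u \<in> uvals S \<Longrightarrow> coefD S u = d * exp (\<mu> * u)"
      "\<And>u. u \<in> uvals S \<Longrightarrow> coefF S u = l * exp ((2 * \<mu> - \<gamma>) * u) + l1"
    and l1: "l1 = 0 \<or> \<gamma> = \<mu>"
    and K: "listed K (exp_system \<gamma> \<mu> (d / k) (l / k))" "nondegenerate K" "\<not> needs_linear_time K"
  shows "reduces_to S K (exp_system \<gamma> \<mu> (d / k) (l / k))"
proof -
  obtain c0 c1 c2 where c: "c1 * c2 = 0 \<or> c0 = 0" "\<And>t. c0 + c1 * c2 * exp (c2 * t) = k * exp (\<gamma> * l1 * t)"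
    by (rule time_constants[OF k, of "\<gamma> * l1"]) (rule that)
  interpret reduction S "exp_system \<gamma> \<mu> (d / k) (l / k)" c0 c1 c2 0 l1 1 0
  proof
    show "c0 + c1 * c2 * exp (c2 * t) \<noteq> 0" for t unfolding c using k by simp
    fix t u y assume u: "u \<in> uvals S" and "y = (u - (0 + l1 * t)) / (1 * exp (0 * t))"
    then have y: "u = y + l1 * t" by simp
    have e: "exp (\<sigma> * u) = exp (\<sigma> * l1 * t) * exp (\<sigma> * y)" for \<sigma> unfolding y by (simp add: exp_add[symmetric] algebra_simps)
    have 1: "coefK S u = k * exp (\<gamma> * l1 * t) * exp (\<gamma> * y)" unfolding coefs(1)[OF u] e by simp
    have 2: "coefD S u = k * exp (\<gamma> * l1 * t) * (d / k * exp (\<mu> * y))"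
      unfolding coefs(2)[OF u] e using l1 k by auto
    have 3: "coefF S u = k * exp (\<gamma> * l1 * t) * (l / k * exp ((2 * \<mu> - \<gamma>) * y)) + l1"
      unfolding coefs(3)[OF u] e using l1 k by auto
    show "y \<in> uvals (exp_system \<gamma> \<mu> (d / k) (l / k)) \<and>
       coefK S u = (c0 + c1 * c2 * exp (c2 * t)) * coefK (exp_system \<gamma> \<mu> (d / k) (l / k)) y \<and>
       coefD S u = (c0 + c1 * c2 * exp (c2 * t)) * coefD (exp_system \<gamma> \<mu> (d / k) (l / k)) y \<and>
       coefF S u = (c0 + c1 * c2 * exp (c2 * t)) * (1 * exp (0 * t)) * coefF (exp_system \<gamma> \<mu> (d / k) (l / k)) y
         + l1 + 0 * (1 * exp (0 * t)) * y"
      unfolding c using 1 2 3 by (simp add: exp_system_def)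
  qed (use S c valid_exp_system in auto)
  show ?thesis by (rule reduces_to_listed[OF K(1,2)]) (use K(3) in simp)
qed

text \<open>The part l1 (u + b) of the source is the growth rate of the dilation u + b = s exp (l1
  t) y, and the common factor exp (\<gamma> l1 t) again goes into the new time. Dividing the
  equation by s exp (l1 t) gives the source coefficient l s / k, as s * s = 1.\<close>

lemma reduce_pow:
  assumes S: "valid_system S" and k: "k \<noteq> 0" and s: "s = 1 \<or> s = -1" "\<And>u. u \<in> uvals S \<Longrightarrow> s * (u + b) \<in> homdom wh"
    and coefs: "\<And>u. u \<in> uvals S \<Longrightarrow> coefK S u = k * hom wh \<gamma> (s * (u + b))"
      "\<And>u. u \<in> uvals S \<Longrightarrow> coefD S u = d * hom wh \<mu> (s * (u + b))"
      "\<And>u. u \<in> uvals S \<Longrightarrow> coefF S u = l * hom wh (2 * \<mu> - \<gamma> + 1) (s * (u + b)) + l1 * (u + b)"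
    and kc: "hom_coeff wh \<gamma> k"
    and l1: "l1 = 0 \<or> \<gamma> = \<mu>"
    and K: "listed K (pow_system wh \<gamma> \<mu> (d / k) (l * s / k))" "nondegenerate K" "\<not> needs_linear_time K"
  shows "reduces_to S K (pow_system wh \<gamma> \<mu> (d / k) (l * s / k))"
proof -
  obtain c0 c1 c2 where c: "c1 * c2 = 0 \<or> c0 = 0" "\<And>t. c0 + c1 * c2 * exp (c2 * t) = k * exp (\<gamma> * l1 * t)"
    by (rule time_constants[OF k, of "\<gamma> * l1"]) (rule that)
  have kc1: "hom_coeff wh \<gamma> 1" using hom_coeff_scale(1)[OF kc, of k] k by simp
  have ss: "s * s = 1" "s \<noteq> 0" using s by auto
  interpret reduction S "pow_system wh \<gamma> \<mu> (d / k) (l * s / k)" c0 c1 c2 "- b" 0 s l1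
  proof
    show "c0 + c1 * c2 * exp (c2 * t) \<noteq> 0" for t unfolding c using k by simp
    fix t u y assume u: "u \<in> uvals S" and y: "y = (u - (- b + 0 * t)) / (s * exp (l1 * t))"
    have w: "s * (u + b) = exp (l1 * t) * y"
      unfolding y using ss by (simp add: field_simps) (metis ss(1) mult.assoc mult_1)
    have ub: "u + b = s * exp (l1 * t) * y" unfolding y using ss by (simp add: field_simps)
    have yd: "y \<in> homdom wh"
    proof (cases wh)
      case False
      then have "exp (l1 * t) * y > 0" using s(2)[OF u] w by (simp add: homdom_def)
      then show ?thesis using False by (simp add: homdom_def zero_less_mult_iff)
    qed (simp add: homdom_def)
    have e: "hom wh \<sigma> (s * (u + b)) = exp (\<sigma> * l1 * t) * hom wh \<sigma> y" for \<sigma> unfolding w hom_scale by (simp add: mult.assoc)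
    have 1: "coefK S u = k * exp (\<gamma> * l1 * t) * hom wh \<gamma> y" unfolding coefs(1)[OF u] e by simp
    have 2: "coefD S u = k * exp (\<gamma> * l1 * t) * (d / k * hom wh \<mu> y)"
      unfolding coefs(2)[OF u] e using l1 k by auto
    have "l * (exp ((2 * \<mu> - \<gamma> + 1) * l1 * t) * hom wh (2 * \<mu> - \<gamma> + 1) y) =
       k * exp (\<gamma> * l1 * t) * (s * exp (l1 * t)) * (l * s / k * hom wh (2 * \<mu> - \<gamma> + 1) y)"
    proof -
      have "exp ((2 * \<mu> - \<gamma> + 1) * l1 * t) = exp (\<gamma> * l1 * t) * exp (l1 * t)"
        using l1 by (auto simp: exp_add[symmetric] algebra_simps)
      moreover have "k * exp (\<gamma> * l1 * t) * (s * exp (l1 * t)) * (l * s / k * hom wh (2 * \<mu> - \<gamma> + 1) y)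
        = (s * s) * (exp (\<gamma> * l1 * t) * exp (l1 * t) * (l * hom wh (2 * \<mu> - \<gamma> + 1) y))" using k by (simp add: field_simps)
      ultimately show ?thesis unfolding ss(1) by (simp add: mult_ac)
    qed
    then have 3: "coefF S u = k * exp (\<gamma> * l1 * t) * (s * exp (l1 * t)) * (l * s / k * hom wh (2 * \<mu> - \<gamma> + 1) y) + l1 * (s * exp (l1 * t)) * y"
      unfolding coefs(3)[OF u] e by (simp add: ub mult.assoc)
    show "y \<in> uvals (pow_system wh \<gamma> \<mu> (d / k) (l * s / k)) \<and>
       coefK S u = (c0 + c1 * c2 * exp (c2 * t)) * coefK (pow_system wh \<gamma> \<mu> (d / k) (l * s / k)) y \<and>
       coefD S u = (c0 + c1 * c2 * exp (c2 * t)) * coefD (pow_system wh \<gamma> \<mu> (d / k) (l * s / k)) y \<and>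
       coefF S u = (c0 + c1 * c2 * exp (c2 * t)) * (s * exp (l1 * t)) * coefF (pow_system wh \<gamma> \<mu> (d / k) (l * s / k)) y
         + 0 + l1 * (s * exp (l1 * t)) * y"
      unfolding c pow_system_def using yd 1 2 3 by simp
  qed (use S c ss valid_pow_system[OF kc1] in auto)
  show ?thesis by (rule reduces_to_listed[OF K(1,2)]) (use K(3) in simp)
qed

text \<open>A constant source is removed by a shift linear in time. Otherwise
  \<open>- f0 / f1\<close> is the zero of the source, and the factor exp (f1 t) carries off the
  growth around it.\<close>

lemma reduce_linear:
  assumes S: "valid_system S"
    and coefs: "\<And>u. u \<in> uvals S \<Longrightarrow> coefK S u = k" "\<And>u. u \<in> uvals S \<Longrightarrow> coefD S u = d"
      "\<And>u. u \<in> uvals S \<Longrightarrow> coefF S u = f0 + f1 * u"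
  shows "\<exists>S'. reduces_to S (if d = 0 then Case8 else Case7 (d / k)) S'"
proof -
  let ?K = "if d = 0 then Case8 else Case7 (d / k)"
  have k: "k \<noteq> 0" using S coefs(1) by (auto simp: valid_system_def)
  define S' where "S' = \<lparr>uvals = UNIV, coefK = (\<lambda>u. 1), coefD = (\<lambda>u. d / k), coefF = (\<lambda>u. 0)\<rparr>"
  have S': "valid_system S'" by (simp add: valid_system_def S'_def is_interval_univ smooth_on_const)
  have L: "listed ?K S'" using S' k by (auto simp: listed_def S'_def)
  have nd: "nondegenerate ?K" by simp
  show ?thesis
  proof (cases "f1 = 0")
    case True
    interpret reduction S S' k 0 0 0 f0 1 0
      by unfold_locales (use S S' k coefs True in \<open>auto simp: S'_def\<close>)
    show ?thesis using reduces_to_listed[OF L nd] by blast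
  next
    case False
    interpret reduction S S' k 0 0 "- f0 / f1" 0 1 f1
      by unfold_locales (use S S' k coefs False in \<open>auto simp: S'_def field_simps\<close>)
    show ?thesis using reduces_to_listed[OF L nd] by blast
  qed
qed

lemma reduce_log:
  assumes S: "valid_system S" and s: "s = 1 \<or> s = -1" "\<And>u. u \<in> uvals S \<Longrightarrow> s * (u + b) > 0"
    and coefs: "\<And>u. u \<in> uvals S \<Longrightarrow> coefK S u = k" "\<And>u. u \<in> uvals S \<Longrightarrow> coefD S u = d"
      "\<And>u. u \<in> uvals S \<Longrightarrow> coefF S u = l * (u + b) * ln (s * (u + b)) + m * (u + b)" and l: "l \<noteq> 0"
  shows "\<exists>S'. reduces_to S (Case4 (d / k) (l / k)) S'"
proof -
  have k: "k \<noteq> 0" using S coefs(1) by (auto simp: valid_system_def)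
  define S' where "S' = \<lparr>uvals = {0<..}, coefK = (\<lambda>u. 1), coefD = (\<lambda>u. d / k), coefF = (\<lambda>u. l / k * u * ln u)\<rparr>"
  have "smooth_on {0<..} (\<lambda>u. l / k * u * ln u)"
    by (intro smooth_on_mult smooth_on_const smooth_on_linear[OF _ bounded_linear_ident] smooth_on_ln open_greaterThan)
  then have S': "valid_system S'" by (auto simp: valid_system_def S'_def smooth_on_const is_interval_1 intro: exI[of _ 1])
  have L: "listed (Case4 (d / k) (l / k)) S'" using S' k l by (auto simp: listed_def S'_def)
  have ss: "s * s = 1" "s \<noteq> 0" using s by auto
  \<comment> \<open>Chosen so that ln (s (u + b)) = ln y - m / l, which cancels the term m (u +
    b).\<close>
  define r where "r = s * exp (- m / l)"
  have r0: "r \<noteq> 0" using ss by (simp add: r_def)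
  interpret reduction S S' k 0 0 "- b" 0 r 0
  proof
    fix t u y assume u: "u \<in> uvals S" and y: "y = (u - (- b + 0 * t)) / (r * exp (0 * t))"
    have ub: "u + b = r * y" using y r0 by simp
    have w: "s * (u + b) = exp (- m / l) * y" unfolding ub r_def using ss by (simp add: mult.assoc[symmetric])
    have y0: "y > 0" using s(2)[OF u] unfolding w by (simp add: zero_less_mult_iff)
    have "l * (u + b) * ln (s * (u + b)) + m * (u + b) = k * r * (l / k * y * ln y)"
    proof -
      have lnw: "ln (s * (u + b)) = ln y - m / l" unfolding w using y0 by (simp add: ln_mult)
      show ?thesis unfolding lnw unfolding ub using k l by (simp add: field_simps)
    qed
    then show "y \<in> uvals S' \<and> coefK S u = (k + 0 * 0 * exp (0 * t)) * coefK S' y \<and>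
       coefD S u = (k + 0 * 0 * exp (0 * t)) * coefD S' y \<and>
       coefF S u = (k + 0 * 0 * exp (0 * t)) * (r * exp (0 * t)) * coefF S' y + 0 + 0 * (r * exp (0 * t)) * y"
      using y0 k coefs[OF u] by (simp add: S'_def)
  qed (use S S' k r0 in auto)
  have "reduces_to S (Case4 (d / k) (l / k)) S'" by (rule reduces_to_listed[OF L]) simp_all
  then show ?thesis by blast
qed

text \<open>The identity substitution, with all solutions of the determining equations as the family
  \<open>V\<close>. It serves case 1, whose algebra is found from the absence of other symmetries
  and not from weights.\<close>

lemma reduces_to_self:
  assumes L: "listed k S" and M: "MAI S = span_on (base_dom S) (basic_ops k)"
  shows "reduces_to S k S"
proof -
  have S: "valid_system S" using L by (simp add: listed_def)
  interpret reduction S S 1 0 0 0 0 1 0 by unfold_locales (use S in auto)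
  have "transported C False False S (MAI S) = MAI S"
  proof -
    have sol: "solves S {(a, A, B, p). determining S a A B p} \<tau> \<theta> Y"
      unfolding solves_def
    proof (intro allI impI)
      fix a A B p assume "hat_eqs S \<theta> Y a A B p"
      moreover have "\<theta> = (\<lambda>_. 1)" "Y = (\<lambda>_. uvals S)" "\<tau> = (\<lambda>t. t)" by (auto simp: \<theta>_def Y_def \<alpha>_def r_def \<tau>_def fun_eq_iff)
      ultimately have "determining S a A B p" "\<tau> = (\<lambda>t. t)" by (simp_all add: determining_hat)
      then show "\<exists>a' A' B'. (a', A', B', p) \<in> {(a, A, B, p). determining S a A B p} \<and> a = (\<lambda>t. a' (\<tau> t)) \<and>
          A = (\<lambda>t. A' (\<tau> t)) \<and> B = (\<lambda>q. B' (\<tau> (fst q), snd q))"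
        by (intro exI[of _ a] exI[of _ A] exI[of _ B]) simp
    qed
    have "fields (base_dom S) {(a, A, B, p). determining S a A B p} = MAI S"
      unfolding fields_def by (rule set_eqI) (simp only: MAI_iff[OF S] mem_Collect_eq prod.case)
    then show ?thesis using transport[OF _ sol] by simp
  qed
  then show ?thesis unfolding reduces_to_def using L M reduces by metis
qed

section \<open>Classification\<close>

text \<open>The cases with at least four independent operators, against which genericity is
  tested.\<close>

fun large :: "listed_case \<Rightarrow> bool" where
  "large (Case5 \<gamma>) \<longleftrightarrow> True"
| "large (Case6 \<gamma>) \<longleftrightarrow> True"
| "large (Case7 d) \<longleftrightarrow> True"
| "large Case8 \<longleftrightarrow> True"
| "large _ \<longleftrightarrow> False"

lemma exists_regular:
  fixes J :: "real set"
  assumes "open J" "J \<noteq> {}" and eb: "(e = 0 \<and> b = 1) \<or> e = 1"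
  obtains u where "u \<in> J" "e * u + b \<noteq> 0"
proof -
  have "\<exists>u\<in>J. e * u + b \<noteq> 0"
    using affine_zero[OF assms(1,2) finite.emptyI, of e b] eb by force
  then show ?thesis using that by blast
qed

text \<open>The sources that a substitution can absorb are recognised by their weights 0 and
  \<open>e\<close>.\<close>

lemma euler_power_cases:
  fixes J :: "real set"
  assumes J: "open J" "is_interval J" "J \<noteq> {}" and eb: "(e = 0 \<and> b = 1) \<or> e = 1" and f: "smooth_on J f"
  shows "euler J e b f 0 \<Longrightarrow> \<exists>c. \<forall>u\<in>J. f u = c"
    and "euler J e b f e \<Longrightarrow> \<exists>c. \<forall>u\<in>J. f u = c * (e * u + b)"
proof -
  have "(euler J e b f 0 \<longrightarrow> (\<exists>c. \<forall>u\<in>J. f u = c)) \<and> (euler J e b f e \<longrightarrow> (\<exists>c. \<forall>u\<in>J. f u = c * (e * u + b)))"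
  proof (cases "e = 1")
    case True
    obtain wh s where s: "s = 1 \<or> s = -1" "\<And>u. u \<in> J \<Longrightarrow> s * (u + b) \<in> homdom wh"
      and h: "\<And>f \<sigma>. smooth_on J f \<Longrightarrow> euler J 1 b f \<sigma> \<Longrightarrow> \<exists>c. (\<forall>u\<in>J. f u = c * hom wh \<sigma> (s * (u + b))) \<and> hom_coeff wh \<sigma> c"
      by (rule euler_hom[OF J, of b]) blast
    have h0: "hom wh 0 (s * (u + b)) = 1" "hom wh 1 (s * (u + b)) = s * (u + b)" if "u \<in> J" for u
      using s(2)[OF that] by (auto simp: hom_def homdom_def split: if_splits)
    have "\<exists>c. \<forall>u\<in>J. f u = c" if "euler J e b f 0" using h[OF f, of 0] that True h0(1) by auto
    moreover have "\<exists>c. \<forall>u\<in>J. f u = c * (e * u + b)" if E: "euler J e b f e"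
    proof -
      obtain c where "\<forall>u\<in>J. f u = c * hom wh 1 (s * (u + b))" using h[OF f, of 1] E True by auto
      then have "\<forall>u\<in>J. f u = c * s * (e * u + b)" using h0(2) True by simp
      then show ?thesis by blast
    qed
    ultimately show ?thesis by blast
  next
    case False
    then show ?thesis using euler_exp[OF J(1,2) f, of 0] eb by auto
  qed
  then show "euler J e b f 0 \<Longrightarrow> \<exists>c. \<forall>u\<in>J. f u = c" "euler J e b f e \<Longrightarrow> \<exists>c. \<forall>u\<in>J. f u = c * (e * u + b)" by blast+
qed

text \<open>The substitution absorbs l1 (e u + b), and \<open>G\<close> is the source that remains
  in the target. Hence \<open>nd\<close> is the hypothesis of \<open>solve_scaling\<close> with
  \<open>G\<close> in place of the source.\<close>

lemma scaling_form_reduces: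
  assumes S: "valid_system S" and eb: "(e = 0 \<and> b = 1) \<or> e = 1"
    and K: "euler (uvals S) e b (coefK S) \<gamma>" and D: "euler (uvals S) e b (coefD S) \<mu>"
    and G: "smooth_on (uvals S) G" "euler (uvals S) e b G (e + 2 * \<mu> - \<gamma>)"
    and F: "\<And>u. u \<in> uvals S \<Longrightarrow> coefF S u = G u + l1 * (e * u + b)" and l1: "l1 = 0 \<or> \<gamma> = \<mu>"
    and nd: "(\<gamma> \<noteq> 0 \<and> (nowhere_zero (uvals S) e b (coefD S) \<or> (nowhere_zero (uvals S) e b G \<and> 2 * \<mu> \<noteq> \<gamma>))) \<or>
      (\<gamma> = 0 \<and> \<mu> \<noteq> 0 \<and> (nowhere_zero (uvals S) e b (coefD S) \<or> (nowhere_zero (uvals S) e b G \<and> e + 2 * \<mu> \<noteq> 0)))"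
  shows "\<exists>k S'. reduces_to S k S'"
proof -
  have J: "open (uvals S)" "is_interval (uvals S)" "uvals S \<noteq> {}" and sm: "smooth_on (uvals S) (coefK S)" "smooth_on (uvals S) (coefD S)"
    and Kn: "\<exists>u\<in>uvals S. coefK S u \<noteq> 0"
    using S by (auto simp: valid_system_def)
  obtain u0 where u0: "u0 \<in> uvals S" "e * u0 + b \<noteq> 0" by (rule exists_regular[OF J(1,3) eb])
  show ?thesis
  proof (cases "e = 1")
    case False
    then have e: "e = 0" "b = 1" using eb by auto
    obtain k d l where c: "\<forall>u\<in>uvals S. coefK S u = k * exp (\<gamma> * u)" "\<forall>u\<in>uvals S. coefD S u = d * exp (\<mu> * u)"
      "\<forall>u\<in>uvals S. G u = l * exp ((0 + 2 * \<mu> - \<gamma>) * u)"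
      using euler_exp[OF J(1,2) sm(1)] euler_exp[OF J(1,2) sm(2)] euler_exp[OF J(1,2) G(1)] K D G(2) unfolding e by blast
    have k: "k \<noteq> 0" using Kn c(1) by auto
    have nz: "nowhere_zero (uvals S) e b (coefD S) \<Longrightarrow> d \<noteq> 0" "nowhere_zero (uvals S) e b G \<Longrightarrow> l \<noteq> 0"
      using c u0 by (auto simp: nowhere_zero_def)
    have nd': "(\<gamma> \<noteq> 0 \<and> (d \<noteq> 0 \<or> l \<noteq> 0 \<and> 2 * \<mu> \<noteq> \<gamma>)) \<or> (\<gamma> = 0 \<and> \<mu> \<noteq> 0 \<and> (d \<noteq> 0 \<or> l \<noteq> 0))"
      using nd nz by blast
    have L: "listed (Case2 \<gamma> \<mu> (d / k) (l / k)) (exp_system \<gamma> \<mu> (d / k) (l / k))"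
      using nd' k by (auto simp: listed_def valid_exp_system) (auto simp: exp_system_def)
    have "reduces_to S (Case2 \<gamma> \<mu> (d / k) (l / k)) (exp_system \<gamma> \<mu> (d / k) (l / k))"
      by (rule reduce_exp[OF S k _ _ _ l1 L]) (use c F e nd' k in auto)
    then show ?thesis by blast
  next
    case e: True
    obtain wh s where s: "s = 1 \<or> s = -1" "\<And>u. u \<in> uvals S \<Longrightarrow> s * (u + b) \<in> homdom wh"
      and h: "\<And>f \<sigma>. smooth_on (uvals S) f \<Longrightarrow> euler (uvals S) 1 b f \<sigma> \<Longrightarrow> \<exists>c. (\<forall>u\<in>uvals S. f u = c * hom wh \<sigma> (s * (u + b))) \<and> hom_coeff wh \<sigma> c"
      by (rule euler_hom[OF J, of b]) blast
    have ex: "1 + 2 * \<mu> - \<gamma> = 2 * \<mu> - \<gamma> + 1" by simp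
    obtain k where ck: "\<forall>u\<in>uvals S. coefK S u = k * hom wh \<gamma> (s * (u + b))" "hom_coeff wh \<gamma> k"
      using h[OF sm(1)] K e by blast
    obtain d where cd: "\<forall>u\<in>uvals S. coefD S u = d * hom wh \<mu> (s * (u + b))" "hom_coeff wh \<mu> d"
      using h[OF sm(2)] D e by blast
    obtain l where cl: "\<forall>u\<in>uvals S. G u = l * hom wh (2 * \<mu> - \<gamma> + 1) (s * (u + b))" "hom_coeff wh (2 * \<mu> - \<gamma> + 1) l"
      using h[OF G(1), of "2 * \<mu> - \<gamma> + 1"] G(2) e ex by auto
    have k: "k \<noteq> 0" using Kn ck(1) by auto
    have s0: "s \<noteq> 0" using s by auto
    have nz: "nowhere_zero (uvals S) e b (coefD S) \<Longrightarrow> d \<noteq> 0" "nowhere_zero (uvals S) e b G \<Longrightarrow> l \<noteq> 0"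
      using cd cl u0 by (auto simp: nowhere_zero_def)
    have nd': "(\<gamma> \<noteq> 0 \<and> (d \<noteq> 0 \<or> l \<noteq> 0 \<and> 2 * \<mu> \<noteq> \<gamma>)) \<or> (\<gamma> = 0 \<and> \<mu> \<noteq> 0 \<and> (d \<noteq> 0 \<or> l \<noteq> 0 \<and> 1 + 2 * \<mu> \<noteq> 0))"
      using nd nz e by blast
    have kc1: "hom_coeff wh \<gamma> 1" using hom_coeff_scale(1)[OF ck(2), of k] k by simp
    have hl: "hom_coeff wh (2 * \<mu> - \<gamma> + 1) (l * s / k)" using hom_coeff_scale(1)[OF hom_coeff_scale(2)[OF cl(2)]] .
    have L: "listed (Case3 \<gamma> \<mu> (d / k) (l * s / k)) (pow_system wh \<gamma> \<mu> (d / k) (l * s / k))"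
      unfolding listed_def listed_form.simps
      by (intro conjI valid_pow_system[OF kc1])
        (use power_term_hom[OF kc1] power_term_hom[OF hom_coeff_scale(1)[OF cd(2), of k]]
          power_term_hom[OF hl] nd' k s0 in \<open>auto simp: pow_system_def\<close>)
    have "reduces_to S (Case3 \<gamma> \<mu> (d / k) (l * s / k)) (pow_system wh \<gamma> \<mu> (d / k) (l * s / k))"
      by (rule reduce_pow[OF S k s _ _ _ ck(2) l1 L]) (use ck cd cl F e nd' k s0 in auto)
    then show ?thesis by blast
  qed
qed

text \<open>For vanishing \<open>D\<close> the exponent \<mu> can be set equal to \<gamma>, which is
  what the absorption of an arbitrary multiple of e u + b requires.\<close>

lemma two_scalings_reduces:
  assumes S: "valid_system S" and eb: "(e = 0 \<and> b = 1) \<or> e = 1"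
    and K: "euler (uvals S) e b (coefK S) \<gamma>" and \<gamma>: "\<gamma> \<noteq> 0" and D: "vanishes (uvals S) (coefD S)"
    and F: "\<And>u. u \<in> uvals S \<Longrightarrow> coefF S u = l1 * (e * u + b)"
  shows "\<exists>k S'. large k \<and> reduces_to S k S'"
proof -
  have J: "open (uvals S)" "is_interval (uvals S)" "uvals S \<noteq> {}" and sm: "smooth_on (uvals S) (coefK S)"
    and Kn: "\<exists>u\<in>uvals S. coefK S u \<noteq> 0"
    using S by (auto simp: valid_system_def)
  show ?thesis
  proof (cases "e = 1")
    case False
    then have e: "e = 0" "b = 1" using eb by auto
    obtain k where c: "\<forall>u\<in>uvals S. coefK S u = k * exp (\<gamma> * u)"
      using euler_exp[OF J(1,2) sm(1)] K unfolding e by blast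
    have k: "k \<noteq> 0" using Kn c(1) by auto
    have L: "listed (Case5 \<gamma>) (exp_system \<gamma> \<gamma> (0 / k) (0 / k))"
      using \<gamma> by (auto simp: listed_def valid_exp_system) (auto simp: exp_system_def)
    have "reduces_to S (Case5 \<gamma>) (exp_system \<gamma> \<gamma> (0 / k) (0 / k))"
      by (rule reduce_exp[OF S k _ _ _ _ L, of l1]) (use c F e D in \<open>auto simp: vanishes_def\<close>)
    then show ?thesis by (intro exI[of _ "Case5 \<gamma>"]) auto
  next
    case e: True
    obtain wh s where s: "s = 1 \<or> s = -1" "\<And>u. u \<in> uvals S \<Longrightarrow> s * (u + b) \<in> homdom wh"
      and h: "\<And>f \<sigma>. smooth_on (uvals S) f \<Longrightarrow> euler (uvals S) 1 b f \<sigma> \<Longrightarrow> \<exists>c. (\<forall>u\<in>uvals S. f u = c * hom wh \<sigma> (s * (u + b))) \<and> hom_coeff wh \<sigma> c"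
      by (rule euler_hom[OF J, of b]) blast
    obtain k where ck: "\<forall>u\<in>uvals S. coefK S u = k * hom wh \<gamma> (s * (u + b))" "hom_coeff wh \<gamma> k"
      using h[OF sm(1)] K e by blast
    have k: "k \<noteq> 0" using Kn ck(1) by auto
    have kc1: "hom_coeff wh \<gamma> 1" using hom_coeff_scale(1)[OF ck(2), of k] k by simp
    have L: "listed (Case6 \<gamma>) (pow_system wh \<gamma> \<gamma> (0 / k) (0 * s / k))"
      unfolding listed_def listed_form.simps
      by (intro conjI valid_pow_system[OF kc1])
        (use power_term_hom[OF kc1] \<gamma> in \<open>auto simp: pow_system_def\<close>)
    have "reduces_to S (Case6 \<gamma>) (pow_system wh \<gamma> \<gamma> (0 / k) (0 * s / k))"
      by (rule reduce_pow[OF S k s _ _ _ ck(2) _ L, of l1]) (use ck F e D in \<open>auto simp: vanishes_def\<close>)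
    then show ?thesis by (intro exI[of _ "Case6 \<gamma>"]) auto
  qed
qed

lemma linear_reduces:
  assumes S: "valid_system S"
    and "\<And>u. u \<in> uvals S \<Longrightarrow> coefK S u = k" "\<And>u. u \<in> uvals S \<Longrightarrow> coefD S u = d"
      "\<And>u. u \<in> uvals S \<Longrightarrow> coefF S u = f0 + f1 * u"
  shows "\<exists>k S'. large k \<and> reduces_to S k S'"
proof -
  obtain S' where "reduces_to S (if d = 0 then Case8 else Case7 (d / k)) S'" using reduce_linear[OF assms] by blast
  moreover have "large (if d = 0 then Case8 else Case7 (d / k))" by simp
  ultimately show ?thesis by blast
qed

text \<open>A nonzero affine function is normalised to leading coefficient 1 if it depends on
  \<open>u\<close>, and to the constant 1 otherwise.\<close>

lemma proportional_direction:
  fixes \<alpha>0 \<beta>0 :: real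
  assumes "\<alpha>0 \<noteq> 0 \<or> \<beta>0 \<noteq> 0"
  obtains e b \<alpha> where "(e = 0 \<and> b = 1) \<or> e = 1" "\<alpha> \<noteq> 0" "\<alpha>0 = \<alpha> * e" "\<beta>0 = \<alpha> * b"
proof (cases "\<alpha>0 = 0")
  case True
  then show ?thesis using assms that[of 0 1 \<beta>0] by simp
next
  case False
  then show ?thesis using that[of 1 "\<beta>0 / \<alpha>0" \<alpha>0] by simp
qed

section \<open>Consequences of a given symmetry: \<open>K\<close> or \<open>D\<close> not
  constant\<close>

locale symmetric_system =
  fixes S :: rd_system and a A :: "real \<Rightarrow> real" and B :: "real \<times> real \<Rightarrow> real" and p :: real
  assumes S: "valid_system S" and det: "determining S a A B p"
begin

sublocale solving S "\<lambda>t. t" "\<lambda>_. 1" "\<lambda>_. uvals S"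
  using S by unfold_locales (auto simp: valid_system_def)

lemma H: "hat_eqs S (\<lambda>_. 1) (\<lambda>_. uvals S) a A B p" using det by (simp add: determining_hat)

lemma J: "open (uvals S)" "is_interval (uvals S)" "uvals S \<noteq> {}" and Kn: "\<exists>u\<in>uvals S. coefK S u \<noteq> 0"
  using S by (auto simp: valid_system_def)

lemma eqs:
  assumes "u \<in> uvals S"
  shows "deriv (coefK S) u * (A t * u + B (t, x)) = coefK S u * (4 * p - deriv a t)"
    "deriv (coefD S) u * (A t * u + B (t, x)) = coefD S u * (2 * p - deriv a t)"
    "deriv (coefF S) u * (A t * u + B (t, x)) = (A t - deriv a t) * coefF S u + deriv A t * u + pd_t B (t, x)
         + coefK S u * pd_x (pd_x (pd_x (pd_x B))) (t, x) - coefD S u * pd_x (pd_x B) (t, x)"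
  using det assms unfolding determining_def by blast+

text \<open>Division by \<alpha> at a single point (t0, x0); the weights of \<open>K\<close> and
  \<open>D\<close> can be read off there.\<close>

lemma direction_euler:
  assumes "A t0 = \<alpha> * e" "B (t0, x0) = \<alpha> * b" "\<alpha> \<noteq> 0"
  shows "euler (uvals S) e b (coefK S) ((4 * p - deriv a t0) / \<alpha>)"
    "euler (uvals S) e b (coefD S) ((2 * p - deriv a t0) / \<alpha>)"
proof -
  have "deriv (coefK S) u * (e * u + b) = (4 * p - deriv a t0) / \<alpha> * coefK S u"
    "deriv (coefD S) u * (e * u + b) = (2 * p - deriv a t0) / \<alpha> * coefD S u" if u: "u \<in> uvals S" for u
  proof -
    have e: "\<alpha> * e * u + \<alpha> * b = \<alpha> * (e * u + b)" by (simp add: algebra_simps)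
    show "deriv (coefK S) u * (e * u + b) = (4 * p - deriv a t0) / \<alpha> * coefK S u"
      "deriv (coefD S) u * (e * u + b) = (2 * p - deriv a t0) / \<alpha> * coefD S u"
      using eqs(1,2)[OF u, of t0 x0] assms(3) unfolding assms(1,2) e by (simp_all add: field_simps)
  qed
  then show "euler (uvals S) e b (coefK S) ((4 * p - deriv a t0) / \<alpha>)"
    "euler (uvals S) e b (coefD S) ((2 * p - deriv a t0) / \<alpha>)" by (auto simp: euler_def)
qed

lemma K_nowhere_zero:
  assumes "(e = 0 \<and> b = 1) \<or> e = 1" "euler (uvals S) e b (coefK S) g"
  shows "nowhere_zero (uvals S) e b (coefK S)"
  using euler_dichotomy[OF J assms(1) sm(1) assms(2)] Kn by (auto simp: vanishes_def)

text \<open>It excludes, for generic members of case 1, every symmetry that moves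
  \<open>u\<close>.\<close>

lemma pure_diffusion_large:
  assumes D: "vanishes (uvals S) (coefD S)" and F: "vanishes (uvals S) (coefF S)"
    and ne: "A t0 \<noteq> 0 \<or> B (t0, x0) \<noteq> 0"
  shows "\<exists>k S'. large k \<and> reduces_to S k S'"
proof -
  obtain e b \<alpha> where eb: "(e = 0 \<and> b = 1) \<or> e = 1" and \<alpha>: "\<alpha> \<noteq> 0" "A t0 = \<alpha> * e" "B (t0, x0) = \<alpha> * b"
    using proportional_direction[OF ne] by blast
  note K = direction_euler(1)[OF \<alpha>(2,3,1)]
  show ?thesis
  proof (cases "(4 * p - deriv a t0) / \<alpha> = 0")
    case True
    obtain k where "\<forall>u\<in>uvals S. coefK S u = k"
      using euler_power_cases(1)[OF J eb sm(1)] K unfolding True by blast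
    then show ?thesis using D F by (intro linear_reduces[OF S, of k 0 0 0]) (auto simp: vanishes_def)
  next
    case False
    show ?thesis by (rule two_scalings_reduces[OF S eb K False D, of 0]) (use F in \<open>simp add: vanishes_def\<close>)
  qed
qed

text \<open>The direction found at one point persists: A u + B = C(t) (e u + b) for all
  \<open>t\<close>. Either C'(t0) = 0 and \<open>F\<close> has a pure weight, or C is not constant;
  in the second case comparing different times fixes the weight of \<open>F\<close> up to a multiple
  of e u + b.\<close>

lemma nonconstant_reduces:
  assumes nc: "u1 \<in> uvals S" "deriv (coefK S) u1 \<noteq> 0 \<or> deriv (coefD S) u1 \<noteq> 0"
    and ne: "A t0 \<noteq> 0 \<or> B (t0, x0) \<noteq> 0"
  shows "\<exists>k S'. reduces_to S k S'"
proof -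
  obtain e b \<alpha> where eb: "(e = 0 \<and> b = 1) \<or> e = 1" and \<alpha>: "\<alpha> \<noteq> 0" "A t0 = \<alpha> * e" "B (t0, x0) = \<alpha> * b"
    using proportional_direction[OF ne] by blast
  define g where "g = (4 * p - deriv a t0) / \<alpha>"
  define m where "m = (2 * p - deriv a t0) / \<alpha>"
  define \<nu> where "\<nu> = e + 2 * m - g"
  have K: "euler (uvals S) e b (coefK S) g" and D: "euler (uvals S) e b (coefD S) m"
    unfolding g_def m_def by (rule direction_euler[OF \<alpha>(2,3,1)])+
  have nK: "nowhere_zero (uvals S) e b (coefK S)" by (rule K_nowhere_zero[OF eb K])
  have dD: "vanishes (uvals S) (coefD S) \<or> nowhere_zero (uvals S) e b (coefD S)" by (rule euler_dichotomy[OF J eb sm(2) D])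
  have const0: "deriv f u1 = 0" if f: "smooth_on (uvals S) f" "euler (uvals S) e b f 0" for f
  proof -
    obtain c where "\<forall>u\<in>uvals S. f u = c" using euler_power_cases(1)[OF J eb f] by blast
    then show ?thesis by (intro deriv_on[OF J(1) nc(1), of f "\<lambda>_. c"]) auto
  qed
  \<comment> \<open>If g = 0, then \<open>K\<close> is constant and it is \<open>D\<close> that
    varies, so \<open>D\<close> is nonzero and has nonzero weight.\<close>
  have g0: "nowhere_zero (uvals S) e b (coefD S) \<and> m \<noteq> 0" if "g = 0"
  proof -
    have "deriv (coefK S) u1 = 0" using const0[OF sm(1)] K that by simp
    then have d1: "deriv (coefD S) u1 \<noteq> 0" using nc by simp
    then have "\<not> vanishes (uvals S) (coefD S)" using deriv_vanishes[OF J(1) _ nc(1)] by blast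
    moreover have "m \<noteq> 0" using const0[OF sm(2)] D d1 by auto
    ultimately show ?thesis using dD by blast
  qed
  \<comment> \<open>The proportionality for all times comes from \<open>K\<close> if g is nonzero,
    and from \<open>D\<close> otherwise.\<close>
  have "\<exists>C. (\<forall>t. A t = e * C t) \<and> (\<forall>t x. B (t, x) = b * C t) \<and> (\<forall>t. g * C t = 4 * p - deriv a t) \<and> (g = 0 \<longrightarrow> (\<forall>t. deriv C t = 0))"
  proof (cases "g = 0")
    case False
    show ?thesis
      using hat_K_homothety[OF eb H K nK False] False by (intro exI[of _ "\<lambda>t. (4 * p - deriv a t) / g"]) auto
  next
    case True
    have a': "deriv a t = 4 * p" for t using hat_K_constant[OF eb H _ nK] K True by simp
    have "A t = e * (- 2 * p / m) \<and> B (t, x) = b * (- 2 * p / m)" for t x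
    proof -
      have "m * (A t * u + B (t, x)) = (e * u + b) * (- 2 * p)" if "u \<in> uvals S" "e * u + b \<noteq> 0" for u
        using hat_D_homothety[where t = t and x = x, OF H D _ that] g0[OF True] a'[of t] by simp
      from proportional[OF eb _ this] g0[OF True] show ?thesis by blast
    qed
    then show ?thesis using a' True by (intro exI[of _ "\<lambda>t. - 2 * p / m"]) auto
  qed
  then obtain C where A: "\<And>t. A t = e * C t" and B: "\<And>t x. B (t, x) = b * C t" and Cs: "\<And>t. g * C t = 4 * p - deriv a t"
    and C0: "g = 0 \<Longrightarrow> deriv C t = 0" for t by blast
  have Ct0: "C t0 = \<alpha>" using eb A[of t0] B[of t0 x0] \<alpha> by auto
  note h = homothety[OF eb A B hat_smooth(2,3)[OF H]]
  have FE: "C t * (deriv (coefF S) u * (e * u + b)) = (e * C t - deriv a t) * coefF S u + deriv C t * (e * u + b)"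
    if u: "u \<in> uvals S" for t u
  proof -
    have "C t * (deriv (coefF S) u * (e * u + b)) = deriv (coefF S) u * (A t * u + B (t, 0))"
      unfolding A B by (simp add: algebra_simps)
    also have "\<dots> = (A t - deriv a t) * coefF S u + deriv A t * u + pd_t B (t, 0)"
      using eqs(3)[OF u, of t 0] fun_cong[OF h(2), of "(t, 0)"] fun_cong[OF h(3), of "(t, 0)"] by simp
    also have "\<dots> = (e * C t - deriv a t) * coefF S u + deriv C t * (e * u + b)"
      unfolding h(4,5) unfolding A[of t] by (simp add: algebra_simps)
    finally show ?thesis .
  qed
  define a1 where "a1 = deriv C t0 / \<alpha>"
  have \<nu>: "\<nu> = e - deriv a t0 / \<alpha>" using \<alpha>(1) by (simp add: \<nu>_def g_def m_def field_simps)
  \<comment> \<open>The source equation at \<open>t0\<close>, divided by C(t0) = \<alpha>.\<close>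
  have F0: "deriv (coefF S) u * (e * u + b) = \<nu> * coefF S u + a1 * (e * u + b)" if u: "u \<in> uvals S" for u
  proof -
    have "\<alpha> * \<nu> = e * \<alpha> - deriv a t0" "\<alpha> * a1 = deriv C t0" using \<alpha>(1) unfolding \<nu> a1_def by (simp_all add: field_simps)
    then have "\<alpha> * (deriv (coefF S) u * (e * u + b)) = (\<alpha> * \<nu>) * coefF S u + (\<alpha> * a1) * (e * u + b)"
      using FE[OF u, of t0] unfolding Ct0 by (simp only:)
    also have "\<dots> = \<alpha> * (\<nu> * coefF S u + a1 * (e * u + b))" by (simp only: distrib_left mult.assoc)
    finally show ?thesis using \<alpha>(1) by simp
  qed
  have large: "\<exists>k S'. reduces_to S k S'" if "vanishes (uvals S) (coefD S)" "\<exists>c. \<forall>u\<in>uvals S. coefF S u = c * (e * u + b)"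
  proof -
    have "\<not> nowhere_zero (uvals S) e b (coefD S)"
      using that(1) exists_regular[OF J(1,3) eb] by (auto simp: vanishes_def nowhere_zero_def)
    then have "g \<noteq> 0" using g0 by blast
    then show ?thesis using two_scalings_reduces[OF S eb K _ that(1)] that(2) by blast
  qed
  show ?thesis
  proof (cases "deriv C t0 = 0")
    case True
    then have F: "euler (uvals S) e b (coefF S) \<nu>" using F0 by (simp add: euler_def a1_def)
    have dF: "vanishes (uvals S) (coefF S) \<or> nowhere_zero (uvals S) e b (coefF S)" by (rule euler_dichotomy[OF J eb sm(3) F])
    show ?thesis
    proof (cases "nowhere_zero (uvals S) e b (coefD S) \<or> (nowhere_zero (uvals S) e b (coefF S) \<and> 2 * m \<noteq> g)")
      case True
      show ?thesis
        by (rule scaling_form_reduces[OF S eb K D sm(3), of 0]) (use F True g0 in \<open>auto simp: \<nu>_def\<close>)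
    next
      case False
      have "\<exists>c. \<forall>u\<in>uvals S. coefF S u = c * (e * u + b)"
      proof (cases "vanishes (uvals S) (coefF S)")
        case True
        then show ?thesis by (intro exI[of _ 0]) (simp add: vanishes_def)
      next
        case nv: False
        then have "\<nu> = e" using False dF by (simp add: \<nu>_def)
        then show ?thesis using euler_power_cases(2)[OF J eb sm(3)] F by blast
      qed
      then show ?thesis using large False dD by blast
    qed
  next
    case C1: False
    then have g: "g \<noteq> 0" using C0 by blast
    have notconst: False if "\<And>t. C t = c" for c
    proof -
      have "C = (\<lambda>_. c)" using that by auto
      then show False using C1 by simp
    qed
    \<comment> \<open>For \<nu> = e + g, the multiple - a1 / g of e u + b is a particular solution
      of the inhomogeneous equation \<open>F0\<close>; subtracting it leaves a solution of the Euler
      equation.\<close>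
    define G where "G = (\<lambda>u. coefF S u - (- a1 / g) * (e * u + b))"
    have om: "smooth_on (uvals S) (\<lambda>u. e * u + b)"
      by (intro smooth_on_add smooth_on_mult smooth_on_const smooth_on_linear[OF _ bounded_linear_ident] J)
    have sG: "smooth_on (uvals S) G" unfolding G_def
      by (intro smooth_on_diff smooth_on_mult smooth_on_const J sm om)
    have eG: "euler (uvals S) e b G (e + g)" if "\<nu> = e + g"
    proof -
      have "deriv G u * (e * u + b) = (e + g) * G u" if u: "u \<in> uvals S" for u
      proof -
        have "(G has_real_derivative deriv (coefF S) u - (- a1 / g) * e) (at u)"
          unfolding G_def using smooth_on_real_deriv[OF sm(3) u] g by (auto intro!: derivative_eq_intros)
        then have "deriv G u * (e * u + b) = deriv (coefF S) u * (e * u + b) + a1 / g * e * (e * u + b)"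
          by (simp add: DERIV_imp_deriv algebra_simps)
        also have "\<dots> = (e + g) * coefF S u + a1 * (e * u + b) + a1 / g * e * (e * u + b)"
          unfolding F0[OF u] \<open>\<nu> = e + g\<close> ..
        also have "\<dots> = (e + g) * G u" unfolding G_def using g by (simp add: field_simps)
        finally show ?thesis .
      qed
      then show ?thesis by (simp add: euler_def)
    qed
    have FG: "coefF S u = G u + (- a1 / g) * (e * u + b)" for u by (simp add: G_def)
    show ?thesis
    proof (cases "nowhere_zero (uvals S) e b (coefD S)")
      case True
      have Ds: "m * C t = 2 * p - deriv a t" for t
      proof -
        obtain u where u: "u \<in> uvals S" "e * u + b \<noteq> 0" by (rule exists_regular[OF J(1,3) eb])
        have "(e * u + b) * (m * C t) = (e * u + b) * (2 * p - deriv a t)"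
          using hat_D_homothety[where t = t and x = 0, OF H D True u] unfolding A B by (simp add: algebra_simps)
        then show ?thesis using u(2) by simp
      qed
      \<comment> \<open>Different weights would let \<open>K\<close> and \<open>D\<close> together
        determine C(t) as a constant.\<close>
      have gm: "g = m"
      proof (rule ccontr)
        assume "g \<noteq> m"
        then have "C t = 2 * p / (g - m)" for t using Cs[of t] Ds[of t] by (simp add: field_simps)
        then show False by (rule notconst)
      qed
      then have \<nu>g: "\<nu> = e + g" by (simp add: \<nu>_def)
      show ?thesis
        by (rule scaling_form_reduces[OF S eb K D sG _ FG]) (use eG[OF \<nu>g] gm True g in \<open>auto simp: add.commute\<close>)
    next
      case False
      then have vD: "vanishes (uvals S) (coefD S)" using dD by blast
      show ?thesis
      proof (cases "\<exists>c. \<forall>u\<in>uvals S. coefF S u = c * (e * u + b)")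
        case True
        then show ?thesis using large vD by blast
      next
        case nl: False
        \<comment> \<open>The derivative of \<open>F\<close> is eliminated between the equations at
          \<open>t\<close> and at \<open>t0\<close>. Since \<open>F\<close> is no multiple of e u +
          b, its coefficient has to vanish.\<close>
        have rel: "(\<nu> * C t - e * C t + deriv a t) * coefF S u = (deriv C t - a1 * C t) * (e * u + b)" if u: "u \<in> uvals S" for t u
          using FE[OF u, of t] unfolding F0[OF u] by (simp add: algebra_simps)
        have z: "\<nu> * C t - e * C t + deriv a t = 0" for t
        proof (rule ccontr)
          assume ne: "\<nu> * C t - e * C t + deriv a t \<noteq> 0"
          have "coefF S u = (deriv C t - a1 * C t) / (\<nu> * C t - e * C t + deriv a t) * (e * u + b)" if "u \<in> uvals S" for u
            using rel[OF that, of t] ne by (simp add: nonzero_eq_divide_eq mult.commute)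
          then show False using nl by blast
        qed
        have \<nu>g: "\<nu> = e + g"
        proof (rule ccontr)
          assume ne: "\<nu> \<noteq> e + g"
          have "C t = 4 * p / (g + e - \<nu>)" for t
          proof -
            have "(g + e - \<nu>) * C t = 4 * p" using z[of t] Cs[of t] by (simp add: algebra_simps)
            then show ?thesis using ne by (simp add: nonzero_eq_divide_eq mult.commute)
          qed
          then show False by (rule notconst)
        qed
        have dG: "vanishes (uvals S) G \<or> nowhere_zero (uvals S) e b G" by (rule euler_dichotomy[OF J eb sG eG[OF \<nu>g]])
        moreover have "\<not> vanishes (uvals S) G"
        proof
          assume "vanishes (uvals S) G"
          then have "\<forall>u\<in>uvals S. coefF S u = (- a1 / g) * (e * u + b)" using FG by (simp add: vanishes_def)
          then show False using nl by blast
        qed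
        ultimately have nG: "nowhere_zero (uvals S) e b G" by blast
        \<comment> \<open>The vanishing \<open>D\<close> satisfies the Euler equation with any
          weight; weight g turns e + 2 \<mu> - \<gamma> into e + g.\<close>
        show ?thesis
          by (rule scaling_form_reduces[OF S eb K vanishes_euler[OF J(1) vD, of e b g] sG _ FG]) (use eG[OF \<nu>g] nG g in \<open>auto simp: add.commute\<close>)
      qed
    qed
  qed
qed

end


text \<open>Division by the square of u + b turns the equation into (f / (u + b))' = l / (u +
  b).\<close>

lemma log_form:
  fixes f :: "real \<Rightarrow> real"
  assumes J: "open J" "is_interval J" and pos: "\<And>u. u \<in> J \<Longrightarrow> s * (u + b) > 0" and f: "smooth_on J f"
    and eq: "\<And>u. u \<in> J \<Longrightarrow> deriv f u * (u + b) = f u + l * (u + b)"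
  shows "\<exists>m. \<forall>u\<in>J. f u = l * (u + b) * ln (s * (u + b)) + m * (u + b)"
proof -
  define g where "g = (\<lambda>u. f u / (u + b) - l * ln (s * (u + b)))"
  have nz: "u + b \<noteq> 0" if "u \<in> J" for u using pos[OF that] by force
  have g: "(g has_real_derivative 0) (at u)" if u: "u \<in> J" for u
  proof -
    have s: "s \<noteq> 0" using pos[OF u] by force
    have "(g has_real_derivative (deriv f u * (u + b) - f u) / (u + b)\<^sup>2 - l * (s / (s * (u + b)))) (at u)"
      unfolding g_def using smooth_on_real_deriv[OF f u] nz[OF u] pos[OF u]
      by (auto intro!: derivative_eq_intros simp: power2_eq_square)
    moreover have "(deriv f u * (u + b) - f u) / (u + b)\<^sup>2 - l * (s / (s * (u + b))) = 0"
      unfolding eq[OF u] using nz[OF u] s by (simp add: power2_eq_square)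
    ultimately show ?thesis by simp
  qed
  have "\<exists>m. \<forall>u\<in>J. g u = m"
  proof (rule has_field_derivative_zero_constant)
    show "convex J" using J(2) by (simp add: is_interval_convex)
    show "(g has_field_derivative 0) (at u within J)" if "u \<in> J" for u
      using g[OF that] by (rule has_field_derivative_at_within)
  qed
  then obtain m where m: "\<And>u. u \<in> J \<Longrightarrow> g u = m" by blast
  have "f u = l * (u + b) * ln (s * (u + b)) + m * (u + b)" if u: "u \<in> J" for u
    using m[OF u] nz[OF u] unfolding g_def by (simp add: field_simps)
  then show ?thesis by blast
qed

section \<open>Constant \<open>K\<close> and \<open>D\<close>\<close>

context symmetric_system
begin

text \<open>Only \<open>F\<close> restricts the u component here. One u-derivative of its equation
  loses the terms with derivatives of \<open>B\<close>, a second one also loses A'; since F'' is not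
  identically zero, these equations still determine A u + B. The outcome is an exponential or a
  power source, or a logarithmic one if p = 0.\<close>

lemma constant_coefficients_reduces:
  assumes K: "\<And>u. u \<in> uvals S \<Longrightarrow> coefK S u = k" and D: "\<And>u. u \<in> uvals S \<Longrightarrow> coefD S u = d"
    and u1: "u1 \<in> uvals S" "deriv (deriv (coefF S)) u1 \<noteq> 0"
    and ne: "A t0 \<noteq> 0 \<or> B (t0, x0) \<noteq> 0"
  shows "\<exists>k S'. reduces_to S k S'"
proof -
  define F where "F = coefF S"
  \<comment> \<open>The term \<open>H\<close> is F''; the locale fact of the same name is still the
    one meant in \<open>hat_smooth(2,3)[OF H]\<close>.\<close>
  define H where "H = deriv (deriv F)"
  have k: "k \<noteq> 0" using K Kn by auto
  have sF: "smooth_on (uvals S) F" "smooth_on (uvals S) (deriv F)" "smooth_on (uvals S) H"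
    unfolding H_def F_def by (intro smooth_on_deriv J sm)+
  note dF = smooth_on_real_deriv[OF sF(1)] and dF' = smooth_on_real_deriv[OF sF(2), folded H_def] and dH = smooth_on_real_deriv[OF sF(3)]
  have H1: "H u1 \<noteq> 0" using u1 by (simp add: H_def F_def)
  have dK: "deriv (coefK S) u = 0" and dD: "deriv (coefD S) u = 0" if "u \<in> uvals S" for u
    by (rule deriv_on[OF J(1) that, of _ "\<lambda>_. k"], auto simp: K) (rule deriv_on[OF J(1) that, of _ "\<lambda>_. d"], auto simp: D)
  have a': "deriv a t = 4 * p" for t using eqs(1)[OF u1(1), of t 0] dK[OF u1(1)] K[OF u1(1)] k by simp
  have dp: "d * p = 0" using eqs(2)[OF u1(1), of 0 0] dD[OF u1(1)] D[OF u1(1)] a' by simp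
  have eK: "euler (uvals S) e b (coefK S) 0" for e b by (simp add: euler_def dK)
  define \<beta> where "\<beta> t = B (t, 0)" for t
  have O1x: "H u * (A t * u + B (t, x)) + 4 * p * deriv F u = deriv A t" if u: "u \<in> uvals S" for u t x
  proof -
    define R where "R = pd_t B (t, x) + k * pd_x (pd_x (pd_x (pd_x B))) (t, x) - d * pd_x (pd_x B) (t, x)"
    have "H u * (A t * u + B (t, x)) + deriv F u * A t = (A t - 4 * p) * deriv F u + deriv A t"
    proof (rule deriv_eq_on[OF J(1) u])
      show "deriv F y * (A t * y + B (t, x)) = (A t - 4 * p) * F y + deriv A t * y + R" if "y \<in> uvals S" for y
        using eqs(3)[OF that, of t x] K[OF that] D[OF that] a' unfolding F_def R_def by simp
      show "((\<lambda>y. deriv F y * (A t * y + B (t, x))) has_real_derivative H u * (A t * u + B (t, x)) + deriv F u * A t) (at u)"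
        using dF'[OF u] by (auto intro!: derivative_eq_intros)
      show "((\<lambda>y. (A t - 4 * p) * F y + deriv A t * y + R) has_real_derivative (A t - 4 * p) * deriv F u + deriv A t) (at u)"
        using dF[OF u] by (auto intro!: derivative_eq_intros)
    qed
    then show ?thesis by (simp add: algebra_simps)
  qed
  \<comment> \<open>F'' is nonzero at \<open>u1\<close>, so \<open>O1x\<close> there determines
    \<open>B (t, x)\<close> by data free of x.\<close>
  have B: "B (t, x) = \<beta> t" for t x
  proof -
    have "H u1 * (A t * u1 + B (t, x)) = H u1 * (A t * u1 + B (t, 0))"
      using O1x[OF u1(1), of t x] O1x[OF u1(1), of t 0] by linarith
    then show ?thesis using H1 by (simp add: \<beta>_def)
  qed
  have O1: "H u * (A t * u + \<beta> t) + 4 * p * deriv F u = deriv A t" if "u \<in> uvals S" for u t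
    using O1x[OF that, of t 0] unfolding B .
  have O2: "deriv H u * (A t * u + \<beta> t) + (A t + 4 * p) * H u = 0" if u: "u \<in> uvals S" for u t
  proof -
    have "deriv H u * (A t * u + \<beta> t) + H u * A t + 4 * p * H u = 0"
    proof (rule deriv_eq_on[OF J(1) u])
      show "H y * (A t * y + \<beta> t) + 4 * p * deriv F y = deriv A t" if "y \<in> uvals S" for y by (rule O1[OF that])
      show "((\<lambda>y. H y * (A t * y + \<beta> t) + 4 * p * deriv F y) has_real_derivative
          deriv H u * (A t * u + \<beta> t) + H u * A t + 4 * p * H u) (at u)"
        using dF'[OF u] dH[OF u] by (auto intro!: derivative_eq_intros)
    qed simp
    then show ?thesis by (simp add: algebra_simps)
  qed
  have not_affine: False if "\<And>u. u \<in> uvals S \<Longrightarrow> deriv F u = c" for c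
  proof -
    have "H u1 = 0" unfolding H_def by (rule deriv_on[OF J(1) u1(1), of _ "\<lambda>_. c"]) (simp_all add: that)
    then show False using H1 by simp
  qed
  have not_vanishing: "nowhere_zero (uvals S) e b F" if "(e = 0 \<and> b = 1) \<or> e = 1" "euler (uvals S) e b F \<nu>" for e b \<nu>
    using euler_dichotomy[OF J that(1) sF(1) that(2)] not_affine[of 0] deriv_vanishes[OF J(1), of F] by blast
  have scaling: "\<exists>k S'. reduces_to S k S'"
    if eb: "(e = 0 \<and> b = 1) \<or> e = 1" and \<nu>: "\<nu> \<noteq> e" "\<nu> \<noteq> 0" and F: "euler (uvals S) e b F \<nu>" and p: "p \<noteq> 0" for e b \<nu>
  proof -
    have "vanishes (uvals S) (coefD S)" using dp p D by (auto simp: vanishes_def)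
    \<comment> \<open>As d p = 0 and p \<noteq> 0, \<open>D\<close> vanishes and its weight is free.
      This choice gives \<open>F\<close> the weight e + 2 \<mu> - 0 = \<nu> that the scaling form
      prescribes.\<close>
    define \<mu> where "\<mu> = (\<nu> - e) / 2"
    have \<mu>: "e + 2 * \<mu> - 0 = \<nu>" "e + 2 * \<mu> = \<nu>" by (simp_all add: \<mu>_def field_simps)
    have D': "euler (uvals S) e b (coefD S) \<mu>" by (rule vanishes_euler[OF J(1) \<open>vanishes (uvals S) (coefD S)\<close>])
    show ?thesis
      by (rule scaling_form_reduces[OF S eb eK D' sF(1), of 0, unfolded \<mu>])
        (use F not_vanishing[OF eb F] \<nu> \<mu>(2) in \<open>auto simp: F_def\<close>)
  qed
  show ?thesis
  proof (cases "\<forall>t. A t = 0")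
    case True
    then have A: "A = (\<lambda>_. 0)" by auto
    define \<alpha> where "\<alpha> = \<beta> t0"
    have \<alpha>: "\<alpha> \<noteq> 0" using ne unfolding B A \<alpha>_def by simp
    have E1: "H u * \<beta> t = - 4 * p * deriv F u" if "u \<in> uvals S" for u t using O1[OF that, of t] by (simp add: A)
    have "p \<noteq> 0" using E1[OF u1(1), of t0] H1 \<alpha> by (auto simp: \<alpha>_def)
    have \<beta>: "\<beta> t = \<alpha>" for t
    proof -
      have "H u1 * \<beta> t = H u1 * \<alpha>" using E1[OF u1(1), of t] E1[OF u1(1), of t0] by (simp add: \<alpha>_def)
      then show ?thesis using H1 by simp
    qed
    have B': "B = (\<lambda>_. \<alpha>)" using B \<beta> by (simp add: fun_eq_iff)
    have "euler (uvals S) 0 1 F (- 4 * p / \<alpha>)"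
    proof -
      have "\<alpha> * deriv F u = - 4 * p * F u" if "u \<in> uvals S" for u
        using eqs(3)[OF that, of 0 0] a'[of 0] by (simp add: A B' pd_t_zero_fun F_def mult.commute)
      then show ?thesis using \<alpha> by (auto simp: euler_def field_simps)
    qed
    then show ?thesis using scaling[of 0 1 "- 4 * p / \<alpha>"] \<open>p \<noteq> 0\<close> \<alpha> by simp
  next
    case False
    then obtain t1 where t1: "A t1 \<noteq> 0" by blast
    define \<alpha> where "\<alpha> = A t1"
    define b where "b = \<beta> t1 / \<alpha>"
    \<comment> \<open>The weight with respect to u + b that the source equation at \<open>t1\<close>
      prescribes for \<open>F\<close>; \<nu> = 1 means p = 0.\<close>
    define \<nu> where "\<nu> = 1 - 4 * p / \<alpha>"
    define a1 where "a1 = deriv A t1 / \<alpha>"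
    have \<alpha>: "\<alpha> \<noteq> 0" "A t1 = \<alpha>" "\<beta> t1 = \<alpha> * b" "4 * p = \<alpha> * (1 - \<nu>)" "deriv A t1 = \<alpha> * a1"
      using t1 by (simp_all add: \<alpha>_def b_def \<nu>_def a1_def)
    have eb: "((1::real) = 0 \<and> b = 1) \<or> (1::real) = 1" by simp
    have HF: "H u * (u + b) = (\<nu> - 1) * deriv F u + a1" if u: "u \<in> uvals S" for u
    proof -
      have "\<alpha> * (H u * (u + b)) = \<alpha> * ((\<nu> - 1) * deriv F u + a1)"
        using O1[OF u, of t1] unfolding \<alpha>(2-5) by (simp add: algebra_simps)
      then show ?thesis using \<alpha>(1) by simp
    qed
    have HE: "deriv H u * (u + b) = (\<nu> - 2) * H u" if u: "u \<in> uvals S" for u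
    proof -
      have "\<alpha> * (deriv H u * (u + b)) = \<alpha> * ((\<nu> - 2) * H u)"
        using O2[OF u, of t1] unfolding \<alpha>(2-5) by (simp add: algebra_simps)
      then show ?thesis using \<alpha>(1) by simp
    qed
    have eH: "euler (uvals S) 1 b H (\<nu> - 2)" using HE by (simp add: euler_def)
    have nH: "H u \<noteq> 0" if "u \<in> uvals S" "u + b \<noteq> 0" for u
      using euler_dichotomy[OF J eb sF(3) eH] H1 u1(1) that by (auto simp: vanishes_def nowhere_zero_def)
    \<comment> \<open>\<open>HE\<close> replaces F''' in \<open>O2\<close>; cancelling F'', which is
      nonzero off - b, leaves an affine function of \<open>u\<close>.\<close>
    have c: "(\<nu> - 1) * A t + 4 * p = 0" "(\<nu> - 2) * (\<beta> t - b * A t) = 0" for t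
    proof -
      have "((\<nu> - 1) * A t + 4 * p) * u + (((\<nu> - 1) * A t + 4 * p) * b + (\<nu> - 2) * (\<beta> t - b * A t)) = 0"
        if u: "u \<in> uvals S" "u \<notin> {- b}" for u
      proof -
        have "H u * (((\<nu> - 1) * A t + 4 * p) * u + (((\<nu> - 1) * A t + 4 * p) * b + (\<nu> - 2) * (\<beta> t - b * A t)))
          = ((\<nu> - 2) * H u) * (A t * u + \<beta> t) + (A t + 4 * p) * H u * (u + b)" by (simp add: algebra_simps)
        also have "\<dots> = (u + b) * (deriv H u * (A t * u + \<beta> t) + (A t + 4 * p) * H u)"
          unfolding HE[OF u(1), symmetric] by (simp add: algebra_simps)
        also have "\<dots> = 0" unfolding O2[OF u(1)] by simp
        finally show ?thesis using nH[OF u(1)] u(2) by force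
      qed
      note z = affine_zero[OF J(1,3), of "{- b}", OF _ this, simplified]
      show "(\<nu> - 1) * A t + 4 * p = 0" by (rule z(1))
      show "(\<nu> - 2) * (\<beta> t - b * A t) = 0" using z(2) unfolding z(1) by simp
    qed
    have A1: "A t * a1 + H u * (\<beta> t - b * A t) = deriv A t" if u: "u \<in> uvals S" for t u
    proof -
      have "A t * a1 + H u * (\<beta> t - b * A t) = A t * (a1 - H u * (u + b)) + H u * (A t * u + \<beta> t)" by (simp add: algebra_simps)
      also have "\<dots> = - ((\<nu> - 1) * A t) * deriv F u + H u * (A t * u + \<beta> t)" unfolding HF[OF u] by (simp add: algebra_simps)
      also have "(\<nu> - 1) * A t = - 4 * p" using c(1)[of t] by simp
      finally show ?thesis using O1[OF u, of t] by simp
    qed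
    obtain u2 where u2: "u2 \<in> uvals S" "u2 + b \<noteq> 0" using exists_regular[OF J(1,3) eb] by auto
    \<comment> \<open>For \<nu> = 1 the factor \<nu> - 2 in \<open>c\<close> is nonzero. Otherwise
      \<open>A\<close> is constant, so a1 = 0 and \<open>A1\<close> reduces to F'' times the
      difference in question.\<close>
    have AB: "\<beta> t = b * A t" for t
    proof (cases "\<nu> = 1")
      case True
      then show ?thesis using c(2)[of t] by simp
    next
      case False
      have "A t = - 4 * p / (\<nu> - 1)" for t using c(1)[of t] False by (simp add: field_simps)
      then have A: "A = (\<lambda>_. - 4 * p / (\<nu> - 1))" by auto
      have "deriv A t = 0" for t by (subst A) simp
      then have "H u2 * (\<beta> t - b * A t) = 0" using A1[OF u2(1), of t] \<alpha>(1,5) by simp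
      then show ?thesis using nH[OF u2] by simp
    qed
    have BA: "B (t, x) = b * A t" for t x unfolding B AB ..
    have one: "A t = 1 * A t" for t by simp
    note h = homothety[OF eb one BA hat_smooth(2,3)[OF H]]
    have FE: "deriv F u * (u + b) = \<nu> * F u + a1 * (u + b)" if u: "u \<in> uvals S" for u
    proof -
      have "deriv F u * (\<alpha> * u + b * \<alpha>) = (\<alpha> - 4 * p) * F u + \<alpha> * a1 * u + b * (\<alpha> * a1)"
        using eqs(3)[OF u, of t1 0] unfolding a' BA h(2,3,5) \<alpha>(2,5) F_def by (simp add: pd_t_zero_fun)
      then have "\<alpha> * (deriv F u * (u + b)) = \<alpha> * (\<nu> * F u + a1 * (u + b))"
        unfolding \<alpha>(4) by (simp add: algebra_simps)
      then show ?thesis using \<alpha>(1) by simp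
    qed
    show ?thesis
    proof (cases "\<nu> = 1")
      case False
      have "A t = - 4 * p / (\<nu> - 1)" for t using c(1)[of t] False by (simp add: field_simps)
      then have A: "A = (\<lambda>_. - 4 * p / (\<nu> - 1))" by auto
      have "deriv A t1 = 0" by (subst A) simp
      then have a1: "a1 = 0" using \<alpha>(1,5) by simp
      have eF: "euler (uvals S) 1 b F \<nu>" using FE by (simp add: euler_def a1)
      have "\<nu> \<noteq> 0"
      proof
        assume "\<nu> = 0"
        then obtain m where "\<forall>u\<in>uvals S. F u = m" using euler_power_cases(1)[OF J eb sF(1)] eF by auto
        then have "deriv F u = 0" if "u \<in> uvals S" for u
          by (intro deriv_on[OF J(1) that, of _ "\<lambda>_. m"]) auto
        then show False by (rule not_affine)
      qed
      moreover have "p \<noteq> 0" using \<alpha>(1,4) False by auto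
      ultimately show ?thesis using scaling[OF eb False _ eF] by blast
    next
      case True
      have a1: "a1 \<noteq> 0" using HF[OF u2(1)] nH[OF u2] u2(2) True by auto
      \<comment> \<open>At u = - b the identity \<open>HF\<close> with \<nu> = 1 would give a1 = 0.
        Hence u + b has a fixed sign, and the logarithm makes sense.\<close>
      have "- b \<notin> uvals S" using HF[of "- b"] a1 True by auto
      then obtain s where s: "s = 1 \<or> s = -1" "\<And>u. u \<in> uvals S \<Longrightarrow> s * (u + b) > 0"
        using interval_sign[OF J(2)] by blast
      obtain m where m: "\<And>u. u \<in> uvals S \<Longrightarrow> F u = a1 * (u + b) * ln (s * (u + b)) + m * (u + b)"
        using log_form[OF J(1,2) s(2) sF(1), of a1] FE True by auto
      show ?thesis using reduce_log[OF S s K D m[unfolded F_def] a1] by blast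
    qed
  qed
qed

end

section \<open>Reduction of all systems with non-trivial symmetry\<close>

context symmetric_system
begin

lemma direction_reduces:
  assumes ne: "A t0 \<noteq> 0 \<or> B (t0, x0) \<noteq> 0"
  shows "\<exists>k S'. reduces_to S k S'"
proof (cases "\<exists>u\<in>uvals S. deriv (coefK S) u \<noteq> 0 \<or> deriv (coefD S) u \<noteq> 0")
  case True
  then show ?thesis using nonconstant_reduces[OF _ _ ne] by blast
next
  case False
  obtain k where k: "\<And>u. u \<in> uvals S \<Longrightarrow> coefK S u = k" using deriv_zero_const[OF J(1,2) sm(1)] False by blast
  obtain d where d: "\<And>u. u \<in> uvals S \<Longrightarrow> coefD S u = d" using deriv_zero_const[OF J(1,2) sm(2)] False by blast
  show ?thesis
  proof (cases "\<exists>u\<in>uvals S. deriv (deriv (coefF S)) u \<noteq> 0")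
    case True
    then show ?thesis using constant_coefficients_reduces[OF k d _ _ ne] by blast
  next
    case False
    then obtain m where m: "\<And>u. u \<in> uvals S \<Longrightarrow> deriv (coefF S) u = m"
      using deriv_zero_const[OF J(1,2) smooth_on_deriv[OF J(1) sm(3)]] by blast
    have sG: "smooth_on (uvals S) (\<lambda>u. coefF S u - m * u)"
      by (intro smooth_on_diff smooth_on_mult smooth_on_const smooth_on_linear[OF _ bounded_linear_ident] J sm)
    have "deriv (\<lambda>u. coefF S u - m * u) u = 0" if u: "u \<in> uvals S" for u
      using smooth_on_real_deriv[OF sm(3) u] m[OF u] by (intro DERIV_imp_deriv) (auto intro!: derivative_eq_intros)
    then obtain f0 where "\<And>u. u \<in> uvals S \<Longrightarrow> coefF S u - m * u = f0"
      using deriv_zero_const[OF J(1,2) sG] by blast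
    then have "coefF S u = f0 + m * u" if "u \<in> uvals S" for u using that by (simp add: algebra_simps)
    then show ?thesis using linear_reduces[OF S k d] by blast
  qed
qed

text \<open>The first equation where \<open>K\<close> is nonzero gives a' = 4 p; the other two
  become - 2 p D = 0 and - 4 p F = 0.\<close>

lemma no_direction:
  assumes "\<And>t x. A t = 0 \<and> B (t, x) = 0"
  shows "A = (\<lambda>_. 0)" "B = (\<lambda>_. 0)" "\<exists>k. a = (\<lambda>t. 4 * p * t + k)"
    "p \<noteq> 0 \<Longrightarrow> vanishes (uvals S) (coefD S) \<and> vanishes (uvals S) (coefF S)"
proof -
  show A: "A = (\<lambda>_. 0)" and B: "B = (\<lambda>_. 0)" using assms by auto
  obtain u0 where "u0 \<in> uvals S" "coefK S u0 \<noteq> 0" using Kn by blast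
  then have a': "deriv a t = 4 * p" for t using eqs(1)[of u0 t 0] by (simp add: A B)
  then show "\<exists>k. a = (\<lambda>t. 4 * p * t + k)" using integrate_a[OF hat_smooth(1)[OF H], of "4 * p"] by simp
  show "vanishes (uvals S) (coefD S) \<and> vanishes (uvals S) (coefF S)" if "p \<noteq> 0"
    using eqs(2)[of _ 0 0] eqs(3)[of _ 0 0] that by (simp add: vanishes_def A B a' pd_t_zero_fun)
qed

end

text \<open>If no symmetry moves \<open>u\<close>, only the translations and the scaling with
  parameter \<open>p\<close> remain, and in case 1 the latter is \<open>op_D1\<close>.\<close>

lemma MAI_without_direction:
  assumes L: "listed Case1 S"
    and nd: "\<And>a A B p t x. determining S a A B p \<Longrightarrow> A t = 0 \<and> B (t, x) = 0"
  shows "MAI S = span_on (base_dom S) (basic_ops Case1)"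
proof -
  have S: "valid_system S" using L by (simp add: listed_def)
  have "solves S (sols Case1) (\<lambda>t. t) (\<lambda>_. 1) (\<lambda>_. uvals S)"
    unfolding solves_def determining_hat[symmetric]
  proof (intro allI impI)
    fix a A B p assume d: "determining S a A B p"
    interpret symmetric_system S a A B p by unfold_locales (rule S d)+
    obtain k where "a = (\<lambda>t. 4 * p * t + k)" using no_direction(3) nd[OF d] by blast
    moreover note no_direction(1,2)[OF nd[OF d]]
    ultimately show "\<exists>a' A' B'. (a', A', B', p) \<in> sols Case1 \<and> a = (\<lambda>t. a' t) \<and> A = (\<lambda>t. A' t) \<and> B = (\<lambda>q. B' (fst q, snd q))"
      by (intro exI[of _ a] exI[of _ A] exI[of _ B]) auto
  qed
  from MAI_eq_fields[OF S listed_determining[OF L] this] show ?thesis by (simp only: span_basic_ops)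
qed

lemma classification:
  assumes S: "valid_system S" and nt: "nontrivial_symmetry S"
  shows "\<exists>k S'. reduces_to S k S'"
proof (cases "\<exists>a A B p t x. determining S a A B p \<and> (A t \<noteq> 0 \<or> B (t, x) \<noteq> 0)")
  case True
  then obtain a A B p t x where d: "determining S a A B p" "A t \<noteq> 0 \<or> B (t, x) \<noteq> 0" by blast
  interpret symmetric_system S a A B p by unfold_locales (rule S d)+
  show ?thesis by (rule direction_reduces[OF d(2)])
next
  case False
  then have nd: "A t = 0 \<and> B (t, x) = 0" if "determining S a A B p" for a A B p t x using that by blast
  obtain X where X: "X \<in> MAI S" "X \<notin> span_on (base_dom S) {op_Pt, op_Px}"
    using nt unfolding nontrivial_symmetry_def by blast
  obtain a A B p q where d: "determining S a A B p" and Xz: "\<forall>z\<in>base_dom S. X z = field_of a A B p q z"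
    using X(1) unfolding MAI_iff[OF S] by blast
  interpret symmetric_system S a A B p by unfold_locales (rule S d)+
  note AB = no_direction(1,2)[OF nd[OF d]]
  obtain k where k: "a = (\<lambda>t. 4 * p * t + k)" using no_direction(3) nd[OF d] by blast
  \<comment> \<open>Otherwise \<open>X\<close> would be a combination of the two
    translations.\<close>
  have "p \<noteq> 0"
  proof
    assume p: "p = 0"
    have "(\<lambda>_. 0) \<in> span_on (base_dom S) {}" by (simp add: span_on_empty)
    then have "(\<lambda>z. q *\<^sub>R op_Px z) \<in> span_on (base_dom S) {op_Px}"
      unfolding span_on_insert by (intro exI[of _ q] bexI[of _ "\<lambda>_. 0"]) simp_all
    moreover have "\<forall>z\<in>base_dom S. X z = k *\<^sub>R op_Pt z + q *\<^sub>R op_Px z"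
      using Xz by (auto simp: AB k p field_of_def op_defs pd_t_zero_fun)
    ultimately have "X \<in> span_on (base_dom S) {op_Pt, op_Px}"
      unfolding span_on_insert[of X _ op_Pt] by (intro exI[of _ k] bexI[of _ "\<lambda>z. q *\<^sub>R op_Px z"]) simp_all
    then show False using X(2) by simp
  qed
  then have L: "listed Case1 S" using no_direction(4)[OF nd[OF d]] S by (simp add: listed_def vanishes_def)
  have "MAI S = span_on (base_dom S) (basic_ops Case1)" by (rule MAI_without_direction[OF L]) (rule nd)
  then show ?thesis using reduces_to_self[OF L] by blast
qed

section \<open>Dimensions and the generic members of the listed cases\<close>

lemma dim_on_le_3:
  assumes "\<not> large k" shows "dim_on U (basic_ops k) \<le> 3"
  unfolding dim_on_def
proof (rule SUP_least)
  fix A assume A: "A \<in> {A. finite A \<and> A \<subseteq> basic_ops k \<and> independent_on U A}"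
  obtain V1 V2 V3 where V: "basic_ops k = {V1, V2, V3}" using assms by (cases k) auto
  have "card A \<le> card {V1, V2, V3}" using A V by (intro card_mono) auto
  also have "\<dots> \<le> 3" by (simp add: card_insert_if)
  finally show "enat (card A) \<le> 3" by (simp add: numeral_eq_enat)
qed

lemma dim_on_ge_4:
  assumes B: "{V1, V2, V3, V4} \<subseteq> B"
    and ind: "\<And>c1 c2 c3 c4. (\<And>z. z \<in> U \<Longrightarrow> c1 *\<^sub>R V1 z + (c2 *\<^sub>R V2 z + (c3 *\<^sub>R V3 z + c4 *\<^sub>R V4 z)) = 0) \<Longrightarrow>
      c1 = 0 \<and> c2 = 0 \<and> c3 = 0 \<and> c4 = 0"
  shows "4 \<le> dim_on U B"
proof -
  have n: "V1 \<noteq> V2" "V1 \<noteq> V3" "V1 \<noteq> V4" "V2 \<noteq> V3" "V2 \<noteq> V4" "V3 \<noteq> V4"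
    using ind[of 1 "-1" 0 0] ind[of 1 0 "-1" 0] ind[of 1 0 0 "-1"] ind[of 0 1 "-1" 0] ind[of 0 1 0 "-1"] ind[of 0 0 1 "-1"]
    by auto
  have "independent_on U {V1, V2, V3, V4}"
    unfolding independent_on_def
  proof (intro allI impI)
    fix c assume "\<forall>z\<in>U. (\<Sum>Y\<in>{V1, V2, V3, V4}. c Y *\<^sub>R Y z) = 0"
    then have "c V1 *\<^sub>R V1 z + (c V2 *\<^sub>R V2 z + (c V3 *\<^sub>R V3 z + c V4 *\<^sub>R V4 z)) = 0" if "z \<in> U" for z
      using that n by simp
    from ind[OF this] show "\<forall>Y\<in>{V1, V2, V3, V4}. c Y = 0" by simp
  qed
  then have "enat (card {V1, V2, V3, V4}) \<le> dim_on U B"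
    unfolding dim_on_def using B by (intro SUP_upper) auto
  moreover have "card {V1, V2, V3, V4} = 4" using n by simp
  ultimately show ?thesis by (simp only: numeral_eq_enat)
qed

text \<open>The values at a few points over one and the same \<open>u\<close> separate the
  operators. In cases 7 and 8 the constant solution P = 1 supplies the fourth one.\<close>

lemma large_dim:
  assumes k: "large k" and S: "valid_system S"
  shows "4 \<le> dim_on (base_dom S) (basic_ops k)"
proof -
  obtain u where u: "u \<in> uvals S" using S by (auto simp: valid_system_def)
  have z: "(t, x, u, v) \<in> base_dom S" for t x v using u by (simp add: base_dom_def)
  show ?thesis
  proof (cases k)
    case (Case5 \<gamma>)
    show ?thesis
    proof (rule dim_on_ge_4[of op_Pt op_Px op_D1 "op_D2 \<gamma> \<gamma>"])
      fix c1 c2 c3 c4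
      assume "\<And>z. z \<in> base_dom S \<Longrightarrow> c1 *\<^sub>R op_Pt z + (c2 *\<^sub>R op_Px z + (c3 *\<^sub>R op_D1 z + c4 *\<^sub>R op_D2 \<gamma> \<gamma> z)) = 0"
      from this[OF z[of 0 0 0]] this[OF z[of 0 1 0]]
      show "c1 = 0 \<and> c2 = 0 \<and> c3 = 0 \<and> c4 = 0" by (auto simp: op_defs zero_prod_def)
    qed (simp add: Case5)
  next
    case (Case6 \<gamma>)
    show ?thesis
    proof (rule dim_on_ge_4[of op_Pt op_Px op_D1 "op_D3 \<gamma> \<gamma>"])
      fix c1 c2 c3 c4
      assume "\<And>z. z \<in> base_dom S \<Longrightarrow> c1 *\<^sub>R op_Pt z + (c2 *\<^sub>R op_Px z + (c3 *\<^sub>R op_D1 z + c4 *\<^sub>R op_D3 \<gamma> \<gamma> z)) = 0"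
      from this[OF z[of 0 0 0]] this[OF z[of 0 1 0]] this[OF z[of 0 0 1]]
      show "c1 = 0 \<and> c2 = 0 \<and> c3 = 0 \<and> c4 = 0" by (auto simp: op_defs zero_prod_def)
    qed (simp add: Case6)
  next
    case (Case7 d)
    show ?thesis
    proof (rule dim_on_ge_4[of op_Pt op_Px op_I "op_Xinf (\<lambda>_. 1)"])
      fix c1 c2 c3 c4
      assume "\<And>z. z \<in> base_dom S \<Longrightarrow> c1 *\<^sub>R op_Pt z + (c2 *\<^sub>R op_Px z + (c3 *\<^sub>R op_I z + c4 *\<^sub>R op_Xinf (\<lambda>_. 1) z)) = 0"
      from this[OF z[of 0 0 0]] this[OF z[of 0 0 1]]
      show "c1 = 0 \<and> c2 = 0 \<and> c3 = 0 \<and> c4 = 0" by (auto simp: op_defs zero_prod_def pd_t_zero_fun)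
    qed (simp add: Case7 linear_solutions_zero(2))
  next
    case Case8
    show ?thesis
    proof (rule dim_on_ge_4[of op_Pt op_Px op_I "op_Xinf (\<lambda>_. 1)"])
      fix c1 c2 c3 c4
      assume "\<And>z. z \<in> base_dom S \<Longrightarrow> c1 *\<^sub>R op_Pt z + (c2 *\<^sub>R op_Px z + (c3 *\<^sub>R op_I z + c4 *\<^sub>R op_Xinf (\<lambda>_. 1) z)) = 0"
      from this[OF z[of 0 0 0]] this[OF z[of 0 0 1]]
      show "c1 = 0 \<and> c2 = 0 \<and> c3 = 0 \<and> c4 = 0" by (auto simp: op_defs zero_prod_def pd_t_zero_fun)
    qed (simp add: Case8 linear_solutions_zero(2))
  qed (use k in auto)
qed

lemma not_generic:
  assumes "\<not> large k" "\<exists>k' S'. large k' \<and> reduces_to S k' S'"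
  shows "\<not> generic_in_case k S"
proof -
  obtain k' S' C du dv where r: "large k'" "listed k' S'" "reduces_by C du dv S S'"
    using assms(2) unfolding reduces_to_def by blast
  have "dim_on (base_dom S) (basic_ops k) \<le> 3" by (rule dim_on_le_3[OF assms(1)])
  also have "(3::enat) < 4" by simp
  also have "4 \<le> dim_on (base_dom S') (basic_ops k')" using large_dim[OF r(1)] r(2) by (simp add: listed_def)
  finally show ?thesis using r unfolding generic_in_case_def by blast
qed

lemma power_term_values:
  assumes "power_term J f c \<sigma>" "u \<in> J"
  shows "\<sigma> = 0 \<Longrightarrow> f u = c" "\<sigma> = 1 \<Longrightarrow> f u = c * u" "c = 0 \<Longrightarrow> f u = 0"
  using assms unfolding power_term_def by auto

text \<open>A degenerate member of case 2 or 3 reduces to a case of larger dimension, against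
  genericity. In case 1 any symmetry that moves \<open>u\<close> would do the same, so genericity
  leaves the translations and \<open>op_D1\<close>.\<close>

lemma listed_generic_MAI:
  assumes L: "listed k S" and g: "generic_in_case k S"
  shows "MAI S = span_on (base_dom S) (basic_ops k)"
proof (cases "nondegenerate k")
  case True
  then show ?thesis by (rule MAI_listed[OF L])
next
  case nd: False
  have S: "valid_system S" and J: "open (uvals S)" and sK: "smooth_on (uvals S) (coefK S)"
    using L by (auto simp: listed_def valid_system_def)
  have "\<not> large k" using nd by (cases k) auto
  then have small: False if "\<exists>k' S'. large k' \<and> reduces_to S k' S'" using not_generic that g by blast
  show ?thesis
  proof (cases k)
    case Case1
    have nd: "A t = 0 \<and> B (t, x) = 0" if d: "determining S a A B p" for a A B p t x
    proof (rule ccontr)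
      assume ne: "\<not> (A t = 0 \<and> B (t, x) = 0)"
      interpret symmetric_system S a A B p by unfold_locales (rule S d)+
      have "vanishes (uvals S) (coefD S)" "vanishes (uvals S) (coefF S)" using L Case1 by (auto simp: listed_def vanishes_def)
      from pure_diffusion_large[OF this, of t x] ne show False using small by blast
    qed
    show ?thesis unfolding Case1 by (rule MAI_without_direction[OF L[unfolded Case1]]) (rule nd)
  next
    case (Case2 \<gamma> \<mu> d l)
    have c: "\<gamma> \<noteq> 0" "d = 0" "2 * \<mu> = \<gamma>" using nd Case2 by auto
    have f: "\<And>u. u \<in> uvals S \<Longrightarrow> coefK S u = 1 * exp (\<gamma> * u)" "vanishes (uvals S) (coefD S)"
      "\<And>u. u \<in> uvals S \<Longrightarrow> coefF S u = l * (0 * u + 1)"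
      using L unfolding Case2 listed_def by (auto simp: c vanishes_def)
    have "\<exists>k S'. large k \<and> reduces_to S k S'"
      by (rule two_scalings_reduces[OF S _ exp_term_euler(1)[OF J f(1)] c(1) f(2,3)]) auto
    then show ?thesis using small by blast
  next
    case (Case3 \<gamma> \<mu> d l)
    have c: "d = 0" using nd Case3 by (auto split: if_splits)
    have f: "power_term (uvals S) (coefK S) 1 \<gamma>" "power_term (uvals S) (coefD S) 0 \<mu>"
      "power_term (uvals S) (coefF S) l (2 * \<mu> - \<gamma> + 1)"
      using L unfolding Case3 listed_def by (auto simp: c)
    have "\<exists>k S'. large k \<and> reduces_to S k S'"
    proof (cases "\<gamma> = 0")
      case True
      then have "2 * \<mu> - \<gamma> + 1 = 0" using nd Case3 by auto
      then show ?thesis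
        by (intro linear_reduces[OF S, of 1 0 l 0])
          (use power_term_values(1)[OF f(1)] power_term_values(3)[OF f(2)] power_term_values(1)[OF f(3)] True in auto)
    next
      case False
      then have "2 * \<mu> - \<gamma> + 1 = 1" using nd Case3 by auto
      then show ?thesis
        by (intro two_scalings_reduces[OF S _ power_term_euler(1)[OF J sK f(1)] False, of l])
          (use power_term_values(3)[OF f(2)] power_term_values(2)[OF f(3)] in \<open>auto simp: vanishes_def\<close>)
    qed
    then show ?thesis using small by blast
  qed (use nd in auto)
qed

section \<open>A constant that vanishes in every reducing substitution\<close>

lemma base_subst_inj:
  assumes C: "invertible_subst C" shows "inj (base_subst C)"
proof -
  have "inj (\<lambda>t. C 0 * t + C 1 * exp (C 2 * t))"
  proof (rule inj_of_deriv_nonzero)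
    show "((\<lambda>t. C 0 * t + C 1 * exp (C 2 * t)) has_real_derivative C 0 + C 1 * C 2 * exp (C 2 * t)) (at t)" for t
      by (auto intro!: derivative_eq_intros)
    show "C 0 + C 1 * C 2 * exp (C 2 * t) \<noteq> 0" for t using C by (simp add: invertible_subst_def)
  qed
  note time = injD[OF this]
  have C3: "C 3 \<noteq> 0" using C by (simp add: invertible_subst_def)
  show ?thesis
  proof (rule injI)
    fix p q assume e: "base_subst C p = base_subst C q"
    obtain t x s y where p: "p = (t, x)" "q = (s, y)" by (cases p; cases q)
    have "t = s" by (rule time) (use e in \<open>simp add: p base_subst_def\<close>)
    moreover have "x = y" using e C3 by (simp add: p base_subst_def)
    ultimately show "p = q" by (simp add: p)
  qed
qed

text \<open>At a solution with \<open>u\<close> a function of \<open>t\<close> alone and \<open>v = 0\<close>, the equation \<open>v' = u'\<^sub>x\<^sub>x\<close> of the target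
  system leaves no room for a shift of \<open>v\<close>.\<close>

lemma reduces_by_no_shift:
  assumes S: "valid_system S" and r: "reduces_by C du dv S S'"
  shows "C 8 = 0"
proof -
  have C: "invertible_subst C" using r by (simp add: reduces_by_def)
  obtain u0 where u0: "u0 \<in> uvals S" using S by (auto simp: valid_system_def)
  \<comment> \<open>With u = h(t) and v = 0 the system holds at time 0, where u_t equals F(u0). One
    point is enough because the equivalence of the two systems is pointwise.\<close>
  define h where "h = (\<lambda>t. coefF S u0 * t + u0)"
  define \<Omega> where "\<Omega> = {q :: real \<times> real. h (fst q) \<in> uvals S}"
  define u where "u = (\<lambda>q :: real \<times> real. h (fst q))"
  define v where "v = (\<lambda>q :: real \<times> real. 0 :: real)"
  define U where "U = (\<lambda>t. dep_subst du (C 4) (C 5) (C 6) (C 7) t (h t))"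
  \<comment> \<open>The transformed functions have to be given on the plane of the new variables,
    hence the inverse of the base substitution.\<close>
  define u' where "u' = (\<lambda>w. U (fst (inv (base_subst C) w)))"
  define v' where "v' = (\<lambda>w. dep_subst dv (C 8) 0 (C 9) (C 10) (fst (inv (base_subst C) w)) 0)"
  have inv: "inv (base_subst C) (base_subst C q) = q" for q by (rule inv_f_f[OF base_subst_inj[OF C]])
  have sh: "smooth_on UNIV h" unfolding h_def by (rule smooth_affine)
  have o: "open \<Omega>"
  proof -
    have "continuous_on UNIV u" unfolding u_def h_def by (intro continuous_intros)
    moreover have "\<Omega> = u -` uvals S" by (auto simp: \<Omega>_def u_def)
    ultimately show ?thesis using S by (simp add: valid_system_def open_vimage)
  qed
  have sU: "smooth_on UNIV U"
  proof (cases du)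
    case True
    have "smooth_on UNIV (\<lambda>t. (C 5 * t + C 4) + C 6 * exp (C 7 * t) * h t)"
      by (intro smooth_on_add smooth_on_mult smooth_exp_UNIV smooth_affine sh open_UNIV)
    then show ?thesis by (simp add: U_def dep_subst_def True add.commute)
  next
    case False
    have "smooth_on UNIV (\<lambda>t. (h t - (C 5 * t + C 4)) * (1 / C 6 * exp ((- C 7) * t)))"
      by (intro smooth_on_diff smooth_on_mult smooth_exp_UNIV smooth_affine sh open_UNIV)
    then show ?thesis by (simp add: U_def dep_subst_def False add.commute exp_minus field_simps)
  qed
  have p: "(0, 0) \<in> \<Omega>" using u0 by (simp add: \<Omega>_def h_def)
  have "deriv h 0 = coefF S u0" unfolding h_def by (rule deriv_affine)
  then have "system_holds_at S u v (0, 0)"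
    unfolding system_holds_at_def u_def v_def pd_time_fun[OF sh] by (simp add: pd_t_zero_fun h_def)
  moreover have "\<forall>q\<in>\<Omega>. graph_point u' v' (base_subst C q) = subst_map C du dv (graph_point u v q)"
  proof
    fix q assume "q \<in> \<Omega>"
    obtain t x where q: "q = (t, x)" by (cases q)
    have "u' (base_subst C q) = U t" "v' (base_subst C q) = dep_subst dv (C 8) 0 (C 9) (C 10) t 0"
      unfolding u'_def v'_def inv q by simp_all
    then show "graph_point u' v' (base_subst C q) = subst_map C du dv (graph_point u v q)"
      by (simp add: graph_point_def subst_map_def q base_subst_def U_def u_def v_def)
  qed
  moreover have "u ` \<Omega> \<subseteq> uvals S" by (auto simp: u_def \<Omega>_def)
  moreover have "smooth_on \<Omega> u" "smooth_on \<Omega> v"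
    unfolding u_def v_def
    by (rule smooth_on_comp[OF o open_UNIV sh smooth_on_linear[OF o bounded_linear_fst]]) (simp_all add: smooth_on_const o)
  ultimately have "system_holds_at S' u' v' (base_subst C (0, 0))"
    using r o p unfolding reduces_by_def by blast
  moreover have "pd_x (pd_x u') (base_subst C (0, 0)) = 0"
  proof -
    have "pd_x u' (base_subst C q) = 0" for q
    proof -
      have "pd_x u' (base_subst C q) = pd_x (\<lambda>q. U (fst q)) q / C 3"
        by (rule base_change(2)[OF C open_UNIV UNIV_I])
          (auto simp: u'_def inv intro: smooth_on_differentiable[OF smooth_on_fst_arg[OF sU]])
      then show ?thesis by (simp add: pd_time_fun(2)[OF sU])
    qed
    then have "pd_x (pd_x u') (base_subst C (0, 0)) = pd_x (\<lambda>_. 0) (0, 0) / C 3"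
      by (intro base_change(2)[OF C open_UNIV UNIV_I]) auto
    then show ?thesis by (simp add: pd_t_zero_fun)
  qed
  ultimately have "v' (base_subst C (0, 0)) = 0" by (simp add: system_holds_at_def)
  then show ?thesis using C unfolding v'_def inv by (auto simp: dep_subst_def invertible_subst_def split: if_splits)
qed

text \<open>The third assertion makes the remark on vanishing constants precise; it is settled
  uniformly by the shift of \<open>v\<close>, the constant \<open>C 8\<close>.\<close>

theorem theorem1:
  shows "(\<forall>k S. listed k S \<and> generic_in_case k S \<longrightarrow>
            MAI S = span_on (base_dom S) (basic_ops k)) \<and>
         (\<forall>S. valid_system S \<and> nontrivial_symmetry S \<longrightarrow>
            (\<exists>k S' C du dv. listed k S' \<and> MAI S' = span_on (base_dom S') (basic_ops k) \<and>
               reduces_by C du dv S S' \<and>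
               MAI S = transported C du dv S (span_on (base_dom S') (basic_ops k)))) \<and>
         (\<forall>S k S' C du dv. valid_system S \<and> nontrivial_symmetry S \<and>
            listed k S' \<and> reduces_by C du dv S S' \<longrightarrow> (\<exists>i\<le>10. C i = 0))"
proof (intro conjI allI impI)
  show "MAI S = span_on (base_dom S) (basic_ops k)" if "listed k S \<and> generic_in_case k S" for k S
    using listed_generic_MAI that by blast
  show "\<exists>k S' C du dv. listed k S' \<and> MAI S' = span_on (base_dom S') (basic_ops k) \<and>
      reduces_by C du dv S S' \<and> MAI S = transported C du dv S (span_on (base_dom S') (basic_ops k))"
    if "valid_system S \<and> nontrivial_symmetry S" for S
    using classification[of S] that unfolding reduces_to_def by blast
  show "\<exists>i\<le>10. C i = 0"
    if "valid_system S \<and> nontrivial_symmetry S \<and> listed k S' \<and> reduces_by C du dv S S'" for S k S' C du dv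
    by (rule exI[of _ 8]) (use reduces_by_no_shift that in auto)
qed

end
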